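(* Let $n\in\mathbb{N}$, $\beta\in(0,\infty)$, and let $\varrho$ be an $m_{n,\beta}$-a.e. positive function on $E=[0,\infty)^n$ such that $\varrho\in C^1(E)$ and $\sqrt{\varrho|_{E_+(B)}}\in H^{1,2}(E_+(B))$ for all $\varnothing\neq B\subset I$. Let $A_i$, $i\in\mathcal{I}$, be the connected components of $E\setminus\{\varrho=0\}$, and suppose that $\mathcal{I}$ is finite, that each $A_i$ is convex, and that there is a constant $C<\infty$ with $\mu\big(B_r(\{\varrho=0\})\big)\le C r^2$ as $r\to0$. Let $\mathbf{M}=\big(\mathbf{\Omega},\mathbf{F},(\mathbf{F}_t)_{t\ge0},(\mathbf{X}_t)_{t\ge0},(\mathbf{\Theta}_t)_{t\ge0},(\mathbf{P}_x)_{x\in E}\big)$ be the conservative diffusion process with state space $E$ associated with $(\mathcal{E},D(\mathcal{E}))$. Then for all measurable $\Gamma\subset\partial E=\bigcup_{B\subsetneq I}E_+(B)$ and all $i\in\mathcal{I}$, $$\lim_{t\to\infty}\frac1t\int_0^t\mathbf 1_\Gamma(\mathbf{X}_s)\,ds=\frac{\mu(\Gamma\cap A_i)}{\mu(A_i)}$$ $\mathbf{P}_x$-a.s. for quasi every $x\in A_i$. In particular, if $\mu(\Gamma\cap A_i)>0$, then for quasi every $x\in A_i$ and $\mathbf{P}_x$-a.a. $\omega\in\mathbf{\Omega}$ there exist $T(\omega,x)\in[0,\infty)$ and $c(\omega,x)\in(0,\infty)$ such that $$\int_0^t\mathbf 1_\Gamma(\mathbf{X}_s(\omega))\,ds\ge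 t\,c(\omega,x)\quad\text{for all }t\ge T(\omega,x).$$
   Context: Notation: $I=\{1,\dots,n\}$ and $E=[0,\infty)^n$. For $B\subset I$, $E_+(B)=\{x\in E: x_i>0 \text{ for } i\in B,\ x_i=0\text{ for } i\in I\setminus B\}$ (identified, for $B\neq\varnothing$, with an open subset of $\mathbb{R}^{\#B}$). $\lambda_B^{(n)}$ is the product measure on $E$ given by Lebesgue measure on $[0,\infty)$ in each coordinate $i\in B$ and the Dirac measure at $0$ in each coordinate $j\in I\setminus B$. Put $\lambda_B^{n,\beta}=\beta^{n-\#B}\lambda_B^{(n)}$, $m_{n,\beta}=\sum_{B\subset I}\lambda_B^{n,\beta}$, $\mu=\varrho\,m_{n,\beta}$, $\mu_B=\varrho\,\lambda_B^{n,\beta}$. $H^{1,2}(E_+(B))$ is the Sobolev space of weakly differentiable functions on $E_+(B)$ that are square integrable together with their derivative; $C^1(E)$ is the space of continuously differentiable functions on $E$. $B_r(S)$ is the $r$-neighborhood of $S$ in $E$ (empty if $S=\varnothing$). $C_c^2(E)$ is the set of functions $f:E\to\mathbb{R}$ with compact support in $E$ that are twice continuously differentiable on $(0,\infty)^n$ and whose partial derivatives of order $\le 2$ extend continuously to $E$. $\nabla^Bf=\sum_{i\in B}\partial_if\,e_i$. $(\mathcal{E},D(\mathcal{E}))$ is the closure on $L^2(E;\mu)$ of the (closable) form $\mathcal{E}(f,g)=\sum_{\varnothing\neq B\subset I}\int_{E_+(B)}(\nabla^Bf,\nabla^Bg)\,d\mu_B$, $f,g\in C_c^2(E)$; it is a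 regular, strongly local, conservative symmetric Dirichlet form with $L^2$-semigroup $(T_t)_{t>0}$. A conservative diffusion process (strong Markov, continuous paths, infinite life time) is associated with $(\mathcal{E},D(\mathcal{E}))$ if $x\mapsto\mathbb{E}_x(f(\mathbf{X}_t))$ is a quasi-continuous version of $T_tf$ for all $f\in L^2(E;\mu)$, $t>0$. "Quasi every" means outside a set of zero capacity with respect to $(\mathcal{E},D(\mathcal{E}))$. *)

theory Defs
  imports "HOL-Probability.Probability"
begin

section \<open>The orthant, its faces and the reference measures\<close>

text \<open>The dimension \<open>n\<close> is \<open>CARD('n)\<close>, the index set \<open>I\<close> is \<open>UNIV :: 'n set\<close>. A function on the
  orthant \<open>E\<close> is represented by a function on the whole space; none of the notions below depends on
  its values off \<open>E\<close>.\<close>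

definition orthant :: "(real^'n) set" where
  "orthant = {x. \<forall>i. 0 \<le> x $ i}"

definition face :: "'n set \<Rightarrow> (real^'n) set" where
  "face B = {x. (\<forall>i\<in>B. 0 < x $ i) \<and> (\<forall>i\<in>- B. x $ i = 0)}"

definition orthant_boundary :: "(real^'n) set" where
  "orthant_boundary = (\<Union>B\<in>{B. B \<subset> UNIV}. face B)"

definition nbhd :: "real \<Rightarrow> (real^'n) set \<Rightarrow> (real^'n) set" where
  "nbhd r S = {x \<in> orthant. \<exists>y\<in>S. dist x y < r}"

definition face_lebesgue :: "'n set \<Rightarrow> (real^'n) measure" where
  "face_lebesgue B =
    distr (PiM UNIV (\<lambda>i. if i \<in> B then restrict_space lborel {0..}
                         else return (restrict_space borel {0..}) 0))
          (restrict_space borel orthant) (\<lambda>x. \<chi> i. x i)"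

definition face_measure :: "real \<Rightarrow> 'n::finite set \<Rightarrow> (real^'n) measure" where
  "face_measure \<beta> B = scale_measure (ennreal (\<beta> ^ (CARD('n) - card B))) (face_lebesgue B)"

definition ref_measure :: "real \<Rightarrow> (real^'n::finite) measure" where
  "ref_measure \<beta> = measure_of orthant (sets (restrict_space borel orthant))
     (\<lambda>A. \<Sum>B\<in>UNIV. emeasure (face_measure \<beta> B) A)"

definition weighted_measure :: "real \<Rightarrow> (real^'n::finite \<Rightarrow> real) \<Rightarrow> (real^'n) measure" where
  "weighted_measure \<beta> \<rho> = density (ref_measure \<beta>) (\<lambda>x. ennreal (\<rho> x))"

definition weighted_face_measure ::
    "real \<Rightarrow> (real^'n::finite \<Rightarrow> real) \<Rightarrow> 'n set \<Rightarrow> (real^'n) measure" where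
  "weighted_face_measure \<beta> \<rho> B = density (face_measure \<beta> B) (\<lambda>x. ennreal (\<rho> x))"

lemma face_subset_orthant: "face B \<subseteq> orthant"
proof
  fix x assume x: "x \<in> face B"
  have "0 \<le> x $ i" for i
    using x by (cases "i \<in> B") (auto simp: face_def less_imp_le)
  then show "x \<in> orthant"
    by (simp add: orthant_def)
qed

lemma sets_face_lebesgue [simp]: "sets (face_lebesgue B) = sets (restrict_space borel orthant)"
  by (simp add: face_lebesgue_def)

lemma sets_face_measure [simp]: "sets (face_measure \<beta> B) = sets (restrict_space borel orthant)"
  by (simp add: face_measure_def)

lemma space_ref_measure [simp]: "space (ref_measure \<beta>) = orthant"
  by (simp add: ref_measure_def space_measure_of_conv)

lemma sets_ref_measure [simp]:
  "sets (ref_measure \<beta> :: (real^'n::finite) measure) = sets (restrict_space borel orthant)"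
  using sets.sigma_sets_eq[of "restrict_space borel (orthant :: (real^'n) set)"]
    sets.space_closed[of "restrict_space borel (orthant :: (real^'n) set)"]
  by (simp add: ref_measure_def space_restrict_space sets_measure_of)

lemma emeasure_ref_measure:
  assumes "A \<in> sets (restrict_space borel orthant)"
  shows "emeasure (ref_measure \<beta>) A = (\<Sum>B\<in>UNIV. emeasure (face_measure \<beta> B) A)"
proof (rule emeasure_measure_of[OF ref_measure_def])
  show "sets (restrict_space borel orthant) \<subseteq> Pow (orthant :: (real^'a) set)"
    using sets.space_closed[of "restrict_space borel (orthant :: (real^'a) set)"]
    by (simp add: space_restrict_space)
  show "countably_additive (sets (ref_measure \<beta>))
          (\<lambda>A. \<Sum>B\<in>UNIV. emeasure (face_measure \<beta> B) (A :: (real^'a) set))"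
  proof (rule countably_additiveI)
    fix F :: "nat \<Rightarrow> (real^'a) set"
    assume F: "range F \<subseteq> sets (ref_measure \<beta>)" "disjoint_family F"
    have "(\<Sum>i. \<Sum>B\<in>UNIV. emeasure (face_measure \<beta> B) (F i))
        = (\<Sum>B\<in>UNIV. \<Sum>i. emeasure (face_measure \<beta> B) (F i))"
      by (rule suminf_sum) simp
    also have "\<dots> = (\<Sum>B\<in>UNIV. emeasure (face_measure \<beta> B) (\<Union>i. F i))"
      using F by (intro sum.cong refl suminf_emeasure) auto
    finally show "(\<Sum>i. \<Sum>B\<in>UNIV. emeasure (face_measure \<beta> B) (F i))
        = (\<Sum>B\<in>UNIV. emeasure (face_measure \<beta> B) (\<Union>i. F i))" .
  qed
qed (use assms in \<open>auto simp: positive_def\<close>)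

lemma space_weighted_measure [simp]: "space (weighted_measure \<beta> \<rho>) = orthant"
  by (simp add: weighted_measure_def)

lemma sets_weighted_measure [simp]:
  "sets (weighted_measure \<beta> \<rho>) = sets (restrict_space borel orthant)"
  by (simp add: weighted_measure_def)


section \<open>Function spaces\<close>

definition partial_deriv :: "'n::finite \<Rightarrow> (real^'n \<Rightarrow> real) \<Rightarrow> real^'n \<Rightarrow> real" where
  "partial_deriv i f x = deriv (\<lambda>t. f (x + t *\<^sub>R axis i 1)) 0"

definition iter_partial :: "'n::finite list \<Rightarrow> (real^'n \<Rightarrow> real) \<Rightarrow> real^'n \<Rightarrow> real" where
  "iter_partial is f = foldr partial_deriv is f"

text \<open>\<open>C\<^sup>k\<close> in the coordinate directions \<open>B\<close>. For \<open>U = face B\<close> this is \<open>C\<^sup>k\<close> on the open subset of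
  \<open>\<real>\<^sup>B\<close> with which the face is identified, since moving a little in a direction \<open>i \<in> B\<close> stays in
  the face.\<close>

definition Ck_dirs :: "nat \<Rightarrow> 'n::finite set \<Rightarrow> (real^'n) set \<Rightarrow> (real^'n \<Rightarrow> real) \<Rightarrow> bool" where
  "Ck_dirs k B U f \<longleftrightarrow>
    (\<forall>is. set is \<subseteq> B \<and> length is \<le> k \<longrightarrow>
       continuous_on U (iter_partial is f) \<and>
       (length is < k \<longrightarrow>
         (\<forall>i\<in>B. \<forall>x\<in>U. (\<lambda>t. iter_partial is f (x + t *\<^sub>R axis i 1)) differentiable (at 0))))"

definition extends_continuously :: "(real^'n \<Rightarrow> real) \<Rightarrow> bool" where
  "extends_continuously g \<longleftrightarrow>
    (\<exists>h. continuous_on orthant h \<and> (\<forall>x\<in>face UNIV. h x = g x))"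

definition Ck_orthant :: "nat \<Rightarrow> (real^'n::finite \<Rightarrow> real) set" where
  "Ck_orthant k = {f. continuous_on orthant f \<and> Ck_dirs k UNIV (face UNIV) f \<and>
     (\<forall>is. length is \<le> k \<longrightarrow> extends_continuously (iter_partial is f))}"

definition Cc2_orthant :: "(real^'n::finite \<Rightarrow> real) set" where
  "Cc2_orthant = {f \<in> Ck_orthant 2. compact (closure {x \<in> orthant. f x \<noteq> 0})}"

definition face_test_functions :: "'n::finite set \<Rightarrow> (real^'n \<Rightarrow> real) set" where
  "face_test_functions B = {\<phi>. (\<forall>k. Ck_dirs k B (face B) \<phi>) \<and>
     compact (closure {x \<in> face B. \<phi> x \<noteq> 0}) \<and> closure {x \<in> face B. \<phi> x \<noteq> 0} \<subseteq> face B}"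

text \<open>Square-integrable functions, not identified when equal almost everywhere.\<close>

definition L2 :: "'a measure \<Rightarrow> ('a \<Rightarrow> real) set" where
  "L2 M = {f \<in> borel_measurable M. integrable M (\<lambda>x. (f x)\<^sup>2)}"

definition L2_inner :: "'a measure \<Rightarrow> ('a \<Rightarrow> real) \<Rightarrow> ('a \<Rightarrow> real) \<Rightarrow> real" where
  "L2_inner M f g = (\<integral>x. f x * g x \<partial>M)"

definition L2_norm :: "'a measure \<Rightarrow> ('a \<Rightarrow> real) \<Rightarrow> real" where
  "L2_norm M f = sqrt (L2_inner M f f)"

definition sobolev_H12 :: "'n::finite set \<Rightarrow> (real^'n \<Rightarrow> real) set" where
  "sobolev_H12 B =
    {u \<in> L2 (restrict_space (face_lebesgue B) (face B)).
       \<forall>i\<in>B. \<exists>g \<in> L2 (restrict_space (face_lebesgue B) (face B)).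
         \<forall>\<phi>\<in>face_test_functions B.
           (LINT x|restrict_space (face_lebesgue B) (face B). u x * partial_deriv i \<phi> x)
             = - (LINT x|restrict_space (face_lebesgue B) (face B). g x * \<phi> x)}"


section \<open>The Dirichlet form\<close>

text \<open>\<open>partial_deriv i f\<close> for \<open>i \<in> B\<close> is the derivative along the face; on \<open>face B\<close> it agrees with the
  continuous extension of the partial derivative from the interior.\<close>

definition pre_form ::
    "real \<Rightarrow> (real^'n::finite \<Rightarrow> real) \<Rightarrow> (real^'n \<Rightarrow> real) \<Rightarrow> (real^'n \<Rightarrow> real) \<Rightarrow> real" where
  "pre_form \<beta> \<rho> f g =
    (\<Sum>B\<in>{B. B \<noteq> {}}. LINT x:face B|weighted_face_measure \<beta> \<rho> B.
       (\<Sum>i\<in>B. partial_deriv i f x * partial_deriv i g x))"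

definition form_approx ::
    "real \<Rightarrow> (real^'n::finite \<Rightarrow> real) \<Rightarrow> (nat \<Rightarrow> real^'n \<Rightarrow> real) \<Rightarrow> (real^'n \<Rightarrow> real) \<Rightarrow> bool" where
  "form_approx \<beta> \<rho> f u \<longleftrightarrow>
    (\<forall>k. f k \<in> Cc2_orthant) \<and>
    (\<forall>\<epsilon>>0. \<exists>K. \<forall>j\<ge>K. \<forall>k\<ge>K.
       pre_form \<beta> \<rho> (\<lambda>x. f j x - f k x) (\<lambda>x. f j x - f k x) < \<epsilon>) \<and>
    (\<lambda>k. L2_norm (weighted_measure \<beta> \<rho>) (\<lambda>x. f k x - u x)) \<longlonglongrightarrow> 0"

definition form_domain :: "real \<Rightarrow> (real^'n::finite \<Rightarrow> real) \<Rightarrow> (real^'n \<Rightarrow> real) set" where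
  "form_domain \<beta> \<rho> = {u \<in> L2 (weighted_measure \<beta> \<rho>). \<exists>f. form_approx \<beta> \<rho> f u}"

text \<open>The limit exists and does not depend on the approximating sequences because the pre-form is
  closable.\<close>

definition form ::
    "real \<Rightarrow> (real^'n::finite \<Rightarrow> real) \<Rightarrow> (real^'n \<Rightarrow> real) \<Rightarrow> (real^'n \<Rightarrow> real) \<Rightarrow> real" where
  "form \<beta> \<rho> u v =
    (THE c. \<forall>f g. form_approx \<beta> \<rho> f u \<longrightarrow> form_approx \<beta> \<rho> g v \<longrightarrow>
       (\<lambda>k. pre_form \<beta> \<rho> (f k) (g k)) \<longlonglongrightarrow> c)"


section \<open>Semigroup and capacity of a closed form\<close>

text \<open>In this section the form has domain \<open>D \<subseteq> L2 M\<close> and values \<open>Q u v\<close>, and the topology of the state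
  space \<open>space M\<close> is the subspace topology.\<close>

text \<open>The strongly continuous contraction semigroup whose generator is the operator \<open>L\<close> of the form:
  \<open>u \<in> D(L)\<close> and \<open>L u = w\<close> iff \<open>u \<in> D\<close> and \<open>Q u v = - (w, v)\<close> for all \<open>v \<in> D\<close>. Operators act on
  functions modulo equality almost everywhere.\<close>

definition is_L2_semigroup ::
    "'a measure \<Rightarrow> ('a \<Rightarrow> real) set \<Rightarrow> (('a \<Rightarrow> real) \<Rightarrow> ('a \<Rightarrow> real) \<Rightarrow> real) \<Rightarrow>
     (real \<Rightarrow> ('a \<Rightarrow> real) \<Rightarrow> 'a \<Rightarrow> real) \<Rightarrow> bool" where
  "is_L2_semigroup M D Q T \<longleftrightarrow>
    (\<forall>t>0. \<forall>f\<in>L2 M. T t f \<in> L2 M \<and> L2_norm M (T t f) \<le> L2_norm M f) \<and>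
    (\<forall>t>0. \<forall>f\<in>L2 M. \<forall>g\<in>L2 M. (AE x in M. f x = g x) \<longrightarrow> (AE x in M. T t f x = T t g x)) \<and>
    (\<forall>t>0. \<forall>f\<in>L2 M. \<forall>g\<in>L2 M. \<forall>a b.
       AE x in M. T t (\<lambda>y. a * f y + b * g y) x = a * T t f x + b * T t g x) \<and>
    (\<forall>s>0. \<forall>t>0. \<forall>f\<in>L2 M. AE x in M. T (s + t) f x = T s (T t f) x) \<and>
    (\<forall>f\<in>L2 M. ((\<lambda>t. L2_norm M (\<lambda>x. T t f x - f x)) \<longlongrightarrow> 0) (at_right 0)) \<and>
    (\<forall>u\<in>L2 M. \<forall>w\<in>L2 M.
       ((\<lambda>t. L2_norm M (\<lambda>x. (T t u x - u x) / t - w x)) \<longlongrightarrow> 0) (at_right 0) \<longleftrightarrow>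
       u \<in> D \<and> (\<forall>v\<in>D. Q u v = - L2_inner M w v))"

definition capacity_open ::
    "'a measure \<Rightarrow> ('a \<Rightarrow> real) set \<Rightarrow> (('a \<Rightarrow> real) \<Rightarrow> ('a \<Rightarrow> real) \<Rightarrow> real) \<Rightarrow> 'a set \<Rightarrow> ennreal" where
  "capacity_open M D Q U =
    (INF u\<in>{u\<in>D. AE x in M. x \<in> U \<longrightarrow> 1 \<le> u x}. ennreal (Q u u + L2_inner M u u))"

definition capacity ::
    "'a::topological_space measure \<Rightarrow> ('a \<Rightarrow> real) set \<Rightarrow> (('a \<Rightarrow> real) \<Rightarrow> ('a \<Rightarrow> real) \<Rightarrow> real) \<Rightarrow>
     'a set \<Rightarrow> ennreal" where
  "capacity M D Q A =
    (INF U\<in>{U. openin (top_of_set (space M)) U \<and> A \<subseteq> U}. capacity_open M D Q U)"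

definition quasi_every ::
    "'a::topological_space measure \<Rightarrow> ('a \<Rightarrow> real) set \<Rightarrow> (('a \<Rightarrow> real) \<Rightarrow> ('a \<Rightarrow> real) \<Rightarrow> real) \<Rightarrow>
     'a set \<Rightarrow> ('a \<Rightarrow> bool) \<Rightarrow> bool" where
  "quasi_every M D Q A R \<longleftrightarrow> (\<exists>N\<subseteq>space M. capacity M D Q N = 0 \<and> (\<forall>x\<in>A - N. R x))"

definition quasi_continuous ::
    "'a::topological_space measure \<Rightarrow> ('a \<Rightarrow> real) set \<Rightarrow> (('a \<Rightarrow> real) \<Rightarrow> ('a \<Rightarrow> real) \<Rightarrow> real) \<Rightarrow>
     ('a \<Rightarrow> real) \<Rightarrow> bool" where
  "quasi_continuous M D Q f \<longleftrightarrow>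
    (\<forall>\<epsilon>>0. \<exists>U. openin (top_of_set (space M)) U \<and> capacity M D Q U < \<epsilon> \<and>
       continuous_on (space M - U) f)"


section \<open>Diffusion processes\<close>

text \<open>Only the \<open>\<sigma>\<close>-algebras of \<open>\<F>\<close> and \<open>\<F>t t\<close> matter. Times are reals \<open>t \<ge> 0\<close>; the family \<open>P x\<close> is
  constrained for \<open>x \<in> S\<close> only. Infinite life time means that \<open>X t\<close> takes values in \<open>S\<close> for
  all \<open>t\<close>, without a cemetery point.\<close>

locale conservative_diffusion =
  fixes S :: "'a::topological_space set"
    and \<F> :: "'w measure"
    and \<F>t :: "real \<Rightarrow> 'w measure"
    and X :: "real \<Rightarrow> 'w \<Rightarrow> 'a"
    and \<Theta> :: "real \<Rightarrow> 'w \<Rightarrow> 'w"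
    and P :: "'a \<Rightarrow> 'w measure"
  assumes filtration_sub: "0 \<le> t \<Longrightarrow> subalgebra \<F> (\<F>t t)"
    and filtration_mono: "0 \<le> s \<Longrightarrow> s \<le> t \<Longrightarrow> subalgebra (\<F>t t) (\<F>t s)"
    and adapted: "0 \<le> t \<Longrightarrow> X t \<in> measurable (\<F>t t) (restrict_space borel S)"
    and continuous_paths: "\<omega> \<in> space \<F> \<Longrightarrow> continuous_on {0..} (\<lambda>t. X t \<omega>)"
    and shift_into: "0 \<le> t \<Longrightarrow> \<omega> \<in> space \<F> \<Longrightarrow> \<Theta> t \<omega> \<in> space \<F>"
    and shift: "0 \<le> s \<Longrightarrow> 0 \<le> t \<Longrightarrow> \<omega> \<in> space \<F> \<Longrightarrow> X s (\<Theta> t \<omega>) = X (s + t) \<omega>"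
    and prob: "x \<in> S \<Longrightarrow> prob_space (P x)"
    and sets_P: "x \<in> S \<Longrightarrow> sets (P x) = sets \<F>"
    and kernel: "0 \<le> t \<Longrightarrow> \<Gamma> \<in> sets (restrict_space borel S) \<Longrightarrow>
      (\<lambda>x. measure (P x) {\<omega> \<in> space \<F>. X t \<omega> \<in> \<Gamma>}) \<in> borel_measurable (restrict_space borel S)"
    and start: "x \<in> S \<Longrightarrow> AE \<omega> in P x. X 0 \<omega> = x"
    and strong_markov:
      "\<lbrakk>x \<in> S;
        \<And>t. 0 \<le> t \<Longrightarrow> {\<omega> \<in> space \<F>. \<tau> \<omega> \<le> ennreal t} \<in> sets (\<F>t t);
        A \<in> sets \<F>; \<And>t. 0 \<le> t \<Longrightarrow> {\<omega> \<in> A. \<tau> \<omega> \<le> ennreal t} \<in> sets (\<F>t t);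
        0 \<le> s; \<Gamma> \<in> sets (restrict_space borel S)\<rbrakk> \<Longrightarrow>
       emeasure (P x) {\<omega> \<in> A. \<tau> \<omega> < \<infinity> \<and> X (enn2real (\<tau> \<omega>) + s) \<omega> \<in> \<Gamma>} =
         (\<integral>\<^sup>+\<omega>. indicator {\<omega> \<in> A. \<tau> \<omega> < \<infinity>} \<omega> *
            emeasure (P (X (enn2real (\<tau> \<omega>)) \<omega>)) {\<omega>' \<in> space \<F>. X s \<omega>' \<in> \<Gamma>} \<partial>P x)"

definition associated ::
    "'a::topological_space measure \<Rightarrow> ('a \<Rightarrow> real) set \<Rightarrow> (('a \<Rightarrow> real) \<Rightarrow> ('a \<Rightarrow> real) \<Rightarrow> real) \<Rightarrow>
     (real \<Rightarrow> ('a \<Rightarrow> real) \<Rightarrow> 'a \<Rightarrow> real) \<Rightarrow> (real \<Rightarrow> 'w \<Rightarrow> 'a) \<Rightarrow> ('a \<Rightarrow> 'w measure) \<Rightarrow> bool" where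
  "associated M D Q T X P \<longleftrightarrow>
    (\<forall>f\<in>L2 M. \<forall>t>0.
       quasi_continuous M D Q (\<lambda>x. \<integral>\<omega>. f (X t \<omega>) \<partial>P x) \<and>
       (AE x in M. (\<integral>\<omega>. f (X t \<omega>) \<partial>P x) = T t f x))"

end

theory Submission
  imports Defs
begin

text \<open>
  The \<open>O(r\<^sup>2)\<close> bound for the measure of the neighbourhoods of the zero set of \<open>\<rho>\<close> lets one approximate the
  indicator of a component \<open>A\<close> by averages of cut-off functions at well separated scales, with
  energies tending to zero. Hence \<open>1\<^sub>A\<close> lies in the form domain and has zero energy, it is fixed by the
  semigroup, and \<open>1\<^sub>A \<mu>\<close> is an invariant measure of the process. Conversely, a function of zero energy
  is constant on \<open>A\<close>: locally \<open>\<rho>\<close> is bounded below, and along every coordinate the reference measure is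
  \<open>\<beta> \<delta>\<^sub>0\<close> plus Lebesgue measure, whose atom is glued to the interior by continuity of the
  approximating functions. So \<open>1\<^sub>A \<mu>\<close> is ergodic.

  Birkhoff's theorem (through Garsia's maximal inequality, applied to the occupation time of unit
  intervals) gives the convergence of the time averages outside a shift-invariant path event \<open>N\<close>
  with \<open>P\<^sub>x N = 0\<close> for almost every \<open>x \<in> A\<close>. By invariance \<open>P\<^sub>x N = E\<^sub>x[P\<^bsub>X 1\<^esub> N]\<close>, which is quasi-continuous
  in \<open>x\<close>, and a quasi-continuous function vanishing almost everywhere on the relatively open set \<open>A\<close>
  vanishes quasi everywhere on it.
\<close>

section \<open>The reference measure as a product of sticky half-lines\<close>

text \<open>The form is a sum over faces of different dimensions without a term that couples them,
  so irreducibility on a component is not visible in it. The coupling sits in the domain: a test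
  function is continuous up to the boundary, and the sum of the face measures is a product of
  one-dimensional measures, each of them Lebesgue plus an atom at 0. All estimates are therefore
  made along one coordinate at a time, in the single measure \<open>ref_measure \<beta>\<close>. The
  exponent 2 is critical. A ramp of slope 1/r on a shell of measure O(r^2) has energy O(1), not
  o(1); only averaging over many disjoint shells brings the energy to zero. \<open>form\<close> is a
  definite description, so every use of it rests on closability, which is proved with difference
  quotients in place of an integration by parts. Association provides quasi-continuity only for
  functions E_x f(X_t) with t > 0. This is why the exceptional path event has to be invariant
  exactly, not just up to null sets.\<close>

lemma nn_integral_sum_measure:
  assumes "sets N1 = sets M" "sets N2 = sets M"
    and "\<And>A. A \<in> sets M \<Longrightarrow> emeasure M A = emeasure N1 A + emeasure N2 A"
    and "f \<in> borel_measurable M"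
  shows "(\<integral>\<^sup>+x. f x \<partial>M) = (\<integral>\<^sup>+x. f x \<partial>N1) + (\<integral>\<^sup>+x. f x \<partial>N2)"
  using assms(4)
proof (induction rule: borel_measurable_induct)
  case (cong f g)
  have sp: "space N1 = space M" "space N2 = space M" using assms(1,2) by (auto dest: sets_eq_imp_space_eq)
  show ?case using cong nn_integral_cong[of M f g] nn_integral_cong[of N1 f g] nn_integral_cong[of N2 f g]
    by (simp add: sp)
next
  case (set A)
  then show ?case by (simp add: assms)
next
  case (mult u c)
  have "u \<in> borel_measurable N1" "u \<in> borel_measurable N2"
    using mult assms(1,2) measurable_cong_sets by blast+
  then show ?case using mult by (simp add: nn_integral_cmult distrib_left)
next
  case (add u v)
  have "u \<in> borel_measurable N1" "u \<in> borel_measurable N2" "v \<in> borel_measurable N1" "v \<in> borel_measurable N2"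
    using add assms(1,2) measurable_cong_sets by blast+
  then show ?case using add by (simp add: nn_integral_add ac_simps)
next
  case (seq U)
  have [measurable]: "U i \<in> borel_measurable N1" "U i \<in> borel_measurable N2" for i
    using seq assms(1,2) measurable_cong_sets by blast+
  have inc: "incseq (\<lambda>i. \<integral>\<^sup>+x. U i x \<partial>N)" for N
    using seq by (auto simp: incseq_def le_fun_def intro!: nn_integral_mono)
  have "(\<integral>\<^sup>+x. (SUP i. U i x) \<partial>M) = (SUP i. \<integral>\<^sup>+x. U i x \<partial>M)"
    using seq by (intro nn_integral_monotone_convergence_SUP) auto
  also have "\<dots> = (SUP i. (\<integral>\<^sup>+x. U i x \<partial>N1) + (\<integral>\<^sup>+x. U i x \<partial>N2))"
    using seq by simp
  also have "\<dots> = (SUP i. \<integral>\<^sup>+x. U i x \<partial>N1) + (SUP i. \<integral>\<^sup>+x. U i x \<partial>N2)"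
    by (rule ennreal_SUP_add[OF inc inc])
  also have "\<dots> = (\<integral>\<^sup>+x. (SUP i. U i x) \<partial>N1) + (\<integral>\<^sup>+x. (SUP i. U i x) \<partial>N2)"
    using seq by (simp add: nn_integral_monotone_convergence_SUP)
  finally show ?case by (simp add: SUP_apply[abs_def])
qed

text \<open>The speed measure of sticky reflected Brownian motion on the half-line. Its n-fold
  product, expanded over the set of coordinates that take the Lebesgue part, is
  \<open>ref_measure \<beta>\<close>.\<close>

definition sticky_line :: "real \<Rightarrow> real measure" where
  "sticky_line \<beta> = measure_of {0..} (sets (restrict_space borel {0..}))
     (\<lambda>A. emeasure (restrict_space lborel {0..}) A + ennreal \<beta> * indicator A 0)"

lemma space_sticky_line [simp]: "space (sticky_line \<beta>) = {0..}"
  by (simp add: sticky_line_def space_measure_of_conv)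

lemma sets_sticky_line [measurable_cong, simp]:
  "sets (sticky_line \<beta>) = sets (restrict_space borel {0..})"
  using sets.sigma_sets_eq[of "restrict_space borel {0::real..}"]
    sets.space_closed[of "restrict_space borel {0::real..}"]
  by (simp add: sticky_line_def space_restrict_space sets_measure_of)

lemma emeasure_sticky_line:
  assumes "A \<in> sets (restrict_space borel {0..})"
  shows "emeasure (sticky_line \<beta>) A = emeasure (restrict_space lborel {0..}) A + ennreal \<beta> * indicator A 0"
proof (rule emeasure_measure_of[OF sticky_line_def])
  show "sets (restrict_space borel {0::real..}) \<subseteq> Pow {0..}"
    using sets.space_closed[of "restrict_space borel {0::real..}"] by (simp add: space_restrict_space)
  \<comment> \<open>Written as a scaled Dirac measure, the atom brings its own countable
    additivity.\<close>
  let ?N = "scale_measure (ennreal \<beta>) (return (restrict_space borel {0::real..}) 0)"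
  have eq: "ennreal \<beta> * indicator B 0 = emeasure ?N B"
    if "B \<in> sets (restrict_space borel {0..})" for B :: "real set"
    using that by simp
  show "countably_additive (sets (sticky_line \<beta>))
      (\<lambda>A. emeasure (restrict_space lborel {0..}) A + ennreal \<beta> * indicator A 0)"
  proof (rule countably_additiveI)
    fix F :: "nat \<Rightarrow> real set"
    assume F: "range F \<subseteq> sets (sticky_line \<beta>)" "disjoint_family F"
    have s: "sets (restrict_space lborel {0::real..}) = sets (restrict_space borel {0..})"
      by (simp add: sets_restrict_space)
    have mF: "F i \<in> sets (restrict_space borel {0..})" for i using F by auto
    have mU: "(\<Union>i. F i) \<in> sets (restrict_space borel {0..})" using mF by auto
    have "(\<Sum>i. emeasure (restrict_space lborel {0..}) (F i) + ennreal \<beta> * indicator (F i) 0)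
      = (\<Sum>i. emeasure (restrict_space lborel {0..}) (F i)) + (\<Sum>i. emeasure ?N (F i))"
      by (subst suminf_add) (use mF in \<open>auto simp del: emeasure_scale_measure emeasure_return simp: eq\<close>)
    also have "(\<Sum>i. emeasure (restrict_space lborel {0..}) (F i)) = emeasure (restrict_space lborel {0..}) (\<Union>i. F i)"
      using F mF by (intro suminf_emeasure) (auto simp: s)
    also have "(\<Sum>i. emeasure ?N (F i)) = emeasure ?N (\<Union>i. F i)"
      using F mF by (intro suminf_emeasure) auto
    also have "\<dots> = ennreal \<beta> * indicator (\<Union>i. F i) 0" by (rule eq[OF mU, symmetric])
    finally show "(\<Sum>i. emeasure (restrict_space lborel {0..}) (F i) + ennreal \<beta> * indicator (F i) 0)
      = emeasure (restrict_space lborel {0..}) (\<Union>i. F i) + ennreal \<beta> * indicator (\<Union>i. F i) 0" .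
  qed
qed (use assms in \<open>auto simp: positive_def\<close>)

lemma nn_integral_sticky_line:
  assumes "f \<in> borel_measurable (restrict_space borel {0..})"
  shows "(\<integral>\<^sup>+s. f s \<partial>sticky_line \<beta>) = (\<integral>\<^sup>+s. f s * indicator {0..} s \<partial>lborel) + ennreal \<beta> * f 0"
proof -
  let ?N = "scale_measure (ennreal \<beta>) (return (restrict_space borel {0::real..}) 0)"
  have "(\<integral>\<^sup>+s. f s \<partial>sticky_line \<beta>) = (\<integral>\<^sup>+s. f s \<partial>restrict_space lborel {0..}) + (\<integral>\<^sup>+s. f s \<partial>?N)"
  proof (rule nn_integral_sum_measure)
    show "f \<in> borel_measurable (sticky_line \<beta>)" using assms by (simp cong: measurable_cong_sets)
  qed (auto simp: emeasure_sticky_line sets_restrict_space)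
  also have "(\<integral>\<^sup>+s. f s \<partial>?N) = ennreal \<beta> * f 0"
    using assms by (simp add: nn_integral_scale_measure nn_integral_return)
  also have "(\<integral>\<^sup>+s. f s \<partial>restrict_space lborel {0..}) = (\<integral>\<^sup>+s. f s * indicator {0..} s \<partial>lborel)"
    by (rule nn_integral_restrict_space) auto
  finally show ?thesis .
qed

lemma emeasure_sticky_line_atLeastAtMost:
  assumes "0 \<le> a"
  shows "emeasure (sticky_line \<beta>) {0..a} = ennreal a + ennreal \<beta>"
proof -
  have "emeasure (restrict_space lborel {0..}) {0..a} = ennreal a"
    using assms by (subst emeasure_restrict_space) auto
  then show ?thesis
    using assms by (subst emeasure_sticky_line) (auto simp: sets_restrict_space image_iff intro!: exI[of _ "{0..a}"])
qed

lemma sigma_finite_sticky_line: "sigma_finite_measure (sticky_line \<beta>)"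
proof
  show "\<exists>A. countable A \<and> A \<subseteq> sets (sticky_line \<beta>) \<and> \<Union> A = space (sticky_line \<beta>) \<and> (\<forall>a\<in>A. emeasure (sticky_line \<beta>) a \<noteq> \<infinity>)"
  proof (intro exI[of _ "range (\<lambda>n. {0..real n})"] conjI)
    show "range (\<lambda>n. {0..real n}) \<subseteq> sets (sticky_line \<beta>)"
      by (auto simp: sets_restrict_space image_iff intro!: bexI[of _ "{0..real _}"])
    show "(\<Union>n. {0..real n}) = space (sticky_line \<beta>)"
      by (auto intro: real_arch_simple)
  qed (auto simp: emeasure_sticky_line_atLeastAtMost)
qed

lemma product_sigma_finite_sticky_line: "product_sigma_finite (\<lambda>_. sticky_line \<beta>)"
  by (simp add: product_sigma_finite_def sigma_finite_sticky_line)

section \<open>Measurability in the orthant\<close>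

lemma orthant_borel [measurable]: "orthant \<in> sets (borel :: (real^'n) measure)"
proof -
  have "closed (orthant :: (real^'n) set)"
    unfolding orthant_def by (intro closed_Collect_all closed_Collect_le continuous_intros)
  then show ?thesis by simp
qed

lemma vec_lambda_measurable:
  fixes f :: "'a \<Rightarrow> 'n::finite \<Rightarrow> real"
  assumes "\<And>i. (\<lambda>x. f x i) \<in> borel_measurable M"
  shows "(\<lambda>x. \<chi> i. f x i) \<in> borel_measurable M"
proof (rule borel_measurable_euclidean_space[THEN iffD2], intro ballI)
  fix b :: "real^'n" assume "b \<in> Basis"
  then obtain i where b: "b = axis i 1" by (auto simp: Basis_vec_def)
  have "(\<lambda>x. (\<chi> i. f x i) \<bullet> b) = (\<lambda>x. f x i)"
    by (simp add: b inner_axis)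
  then show "(\<lambda>x. (\<chi> i. f x i) \<bullet> b) \<in> borel_measurable M" using assms by simp
qed

abbreviation orthant_algebra :: "(real^'n) measure" where
  "orthant_algebra \<equiv> restrict_space borel orthant"

lemma vec_lambda_orthant_measurable:
  fixes f :: "'a \<Rightarrow> 'n::finite \<Rightarrow> real"
  assumes "\<And>i. (\<lambda>x. f x i) \<in> M \<rightarrow>\<^sub>M restrict_space borel {0..}"
  shows "(\<lambda>x. \<chi> i. f x i) \<in> M \<rightarrow>\<^sub>M (orthant_algebra :: (real^'n) measure)"
proof (rule measurable_restrict_space2)
  show "(\<lambda>x. \<chi> i. f x i) \<in> space M \<rightarrow> (orthant :: (real^'n) set)"
    using measurable_space[OF assms] by (auto simp: orthant_def)
  show "(\<lambda>x. \<chi> i. f x i) \<in> borel_measurable M"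
    by (rule vec_lambda_measurable) (use assms in \<open>auto simp: measurable_restrict_space2_iff\<close>)
qed

lemma vec_nth_orthant_measurable [measurable]:
  "(\<lambda>x. x $ i) \<in> orthant_algebra \<rightarrow>\<^sub>M restrict_space borel {0::real..}"
  by (rule measurable_restrict_space2) (auto simp: orthant_def space_restrict_space intro!: measurable_restrict_space1)

lemma vec_nth_borel_measurable_orthant [measurable]:
  "(\<lambda>x. x $ i) \<in> borel_measurable (orthant_algebra :: (real^'n) measure)"
  by (rule measurable_restrict_space1) simp

section \<open>Boxes and the product formula\<close>

definition box_in :: "('n \<Rightarrow> real set) \<Rightarrow> (real^'n) set" where
  "box_in A = {x \<in> orthant. \<forall>i. x $ i \<in> A i}"

lemma box_in_measurable:
  assumes "\<And>i. A i \<in> sets (restrict_space borel {0..})"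
  shows "box_in A \<in> sets (orthant_algebra :: (real^'n::finite) measure)"
proof -
  have "box_in A = (\<Inter>i. (\<lambda>x. x $ i) -` A i \<inter> space (orthant_algebra :: (real^'n) measure))"
    by (auto simp: box_in_def space_restrict_space)
  also have "\<dots> \<in> sets orthant_algebra"
    by (intro sets.finite_INT measurable_sets[OF vec_nth_orthant_measurable] assms) auto
  finally show ?thesis .
qed

lemma sigma_finite_halfline: "sigma_finite_measure (restrict_space lborel {0::real..})"
  by (rule sigma_finite_measure_restrict_space) (auto intro: lborel.sigma_finite_measure_axioms)

lemma emeasure_face_lebesgue_box:
  fixes A :: "'n::finite \<Rightarrow> real set"
  assumes A: "\<And>i. A i \<in> sets (restrict_space borel {0..})"
  shows "emeasure (face_lebesgue B) (box_in A) =
    (\<Prod>i\<in>UNIV. if i \<in> B then emeasure (restrict_space lborel {0..}) (A i) else indicator (A i) 0)"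
proof -
  let ?M = "\<lambda>i. if i \<in> B then restrict_space lborel {0..} else return (restrict_space borel {0::real..}) 0"
  have sM: "sets (?M i) = sets (restrict_space borel {0..})" for i
    by (auto simp: sets_restrict_space)
  have spM: "space (?M i) = {0..}" for i
    by (auto simp: space_restrict_space)
  have "prob_space (return (restrict_space borel {0::real..}) 0)"
    by (rule prob_space_return) (simp add: space_restrict_space)
  then interpret product_sigma_finite ?M
    by (auto simp: product_sigma_finite_def sigma_finite_halfline prob_space_imp_sigma_finite)
  have meas: "(\<lambda>x. \<chi> i. x i) \<in> PiM UNIV ?M \<rightarrow>\<^sub>M (orthant_algebra :: (real^'n) measure)"
  proof (rule vec_lambda_orthant_measurable)
    fix i :: 'n
    have "(\<lambda>x. x i) \<in> PiM UNIV ?M \<rightarrow>\<^sub>M ?M i" by measurable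
    then show "(\<lambda>x. x i) \<in> PiM UNIV ?M \<rightarrow>\<^sub>M restrict_space borel {0..}"
      by (subst (asm) measurable_cong_sets[OF refl sM])
  qed
  have Asub: "A i \<subseteq> {0..}" for i
    using sets.sets_into_space[OF A[of i]] by (simp add: space_restrict_space)
  have "emeasure (face_lebesgue B) (box_in A)
      = emeasure (PiM UNIV ?M) ((\<lambda>x. \<chi> i. x i) -` box_in A \<inter> space (PiM UNIV ?M))"
    unfolding face_lebesgue_def by (rule emeasure_distr[OF meas box_in_measurable[OF A]])
  also have "(\<lambda>x. \<chi> i. x i) -` box_in A \<inter> space (PiM UNIV ?M) = Pi\<^sub>E UNIV A"
    using Asub by (auto simp: box_in_def space_PiM spM orthant_def PiE_iff subset_eq)
  also have "emeasure (PiM UNIV ?M) (Pi\<^sub>E UNIV A) = (\<Prod>i\<in>UNIV. emeasure (?M i) (A i))"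
    using A by (intro emeasure_PiM) (auto simp: sets_restrict_space)
  also have "\<dots> = (\<Prod>i\<in>UNIV. if i \<in> B then emeasure (restrict_space lborel {0..}) (A i) else indicator (A i) 0)"
    using A by (intro prod.cong) auto
  finally show ?thesis .
qed

text \<open>Multiplying out the factors Lebesgue + \<beta> * Dirac gives one summand for each set B
  of coordinates that take the Lebesgue part; the remaining factors supply the weight \<beta>^(n -
  card B).\<close>

lemma emeasure_ref_measure_box:
  fixes A :: "'n::finite \<Rightarrow> real set"
  assumes A: "\<And>i. A i \<in> sets (restrict_space borel {0..})" and "0 \<le> \<beta>"
  shows "emeasure (ref_measure \<beta>) (box_in A) = (\<Prod>i\<in>UNIV. emeasure (sticky_line \<beta>) (A i))"
proof -
  let ?a = "\<lambda>i. emeasure (restrict_space lborel {0..}) (A i)"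
  let ?b = "\<lambda>i. ennreal \<beta> * indicator (A i) 0"
  have "(\<Prod>i\<in>UNIV. emeasure (sticky_line \<beta>) (A i)) = (\<Prod>i\<in>UNIV. ?a i + ?b i)"
    using A by (simp add: emeasure_sticky_line)
  also have "\<dots> = (\<Sum>B\<in>Pow UNIV. (\<Prod>i\<in>B. ?a i) * (\<Prod>i\<in>UNIV - B. ?b i))"
    by (rule prod_add) simp
  also have "\<dots> = (\<Sum>B\<in>UNIV. emeasure (face_measure \<beta> B) (box_in A))"
  proof (rule sum.cong)
    fix B :: "'n set"
    have 1: "(\<Prod>i\<in>UNIV - B. ?b i) = ennreal (\<beta> ^ (CARD('n) - card B)) * (\<Prod>i\<in>UNIV - B. indicator (A i) 0)"
      using assms(2) by (simp add: prod.distrib card_Diff_subset ennreal_power)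
    have 2: "(\<Prod>i\<in>UNIV. if i \<in> B then ?a i else indicator (A i) 0)
        = (\<Prod>i\<in>B. ?a i) * (\<Prod>i\<in>UNIV - B. indicator (A i) (0::real))"
    proof (subst prod.If_cases)
      have "UNIV \<inter> {i. i \<in> B} = B" "UNIV \<inter> - {i. i \<in> B} = UNIV - B" by auto
      then show "prod ?a (UNIV \<inter> {i. i \<in> B}) * (\<Prod>i\<in>UNIV \<inter> - {i. i \<in> B}. indicator (A i) 0)
        = prod ?a B * (\<Prod>i\<in>UNIV - B. indicator (A i) (0::real))" by simp
    qed simp
    show "(\<Prod>i\<in>B. ?a i) * (\<Prod>i\<in>UNIV - B. ?b i) = emeasure (face_measure \<beta> B) (box_in A)"
      unfolding face_measure_def emeasure_scale_measure emeasure_face_lebesgue_box[OF A] 1 2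
      by (simp add: ac_simps)
  qed auto
  also have "\<dots> = emeasure (ref_measure \<beta>) (box_in A)"
    by (rule emeasure_ref_measure[symmetric]) (rule box_in_measurable[OF A])
  finally show ?thesis by simp
qed

text \<open>The comparison is made on functions \<open>'n \<Rightarrow> real\<close>, where boxes
  determine a product measure, and is then carried back along the inverse bijection.\<close>

lemma ref_measure_eq_distr_PiM:
  assumes "0 \<le> \<beta>"
  shows "ref_measure \<beta> = distr (PiM (UNIV::'n::finite set) (\<lambda>_. sticky_line \<beta>)) orthant_algebra (\<lambda>x. \<chi> i. x i)"
proof -
  let ?P = "PiM (UNIV::'n set) (\<lambda>_. sticky_line \<beta>)"
  interpret product_sigma_finite "\<lambda>_::'n. sticky_line \<beta>" by (rule product_sigma_finite_sticky_line)
  have m1: "(\<lambda>x i. x $ i) \<in> ref_measure \<beta> \<rightarrow>\<^sub>M ?P"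
  proof (rule measurable_PiM_single')
    fix i :: 'n
    have "(\<lambda>x. x $ i) \<in> orthant_algebra \<rightarrow>\<^sub>M restrict_space borel {0::real..}" by (rule vec_nth_orthant_measurable)
    then show "(\<lambda>x. x $ i) \<in> ref_measure \<beta> \<rightarrow>\<^sub>M sticky_line \<beta>"
      by (subst measurable_cong_sets[OF sets_ref_measure sets_sticky_line])
  qed (auto simp: orthant_def)
  have m2: "(\<lambda>x. \<chi> i. x i) \<in> ?P \<rightarrow>\<^sub>M (orthant_algebra :: (real^'n) measure)"
  proof (rule vec_lambda_orthant_measurable)
    fix i :: 'n
    have "(\<lambda>x. x i) \<in> ?P \<rightarrow>\<^sub>M sticky_line \<beta>" by measurable
    then show "(\<lambda>x. x i) \<in> ?P \<rightarrow>\<^sub>M restrict_space borel {0..}"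
      by (subst (asm) measurable_cong_sets[OF refl sets_sticky_line])
  qed
  have P: "distr (ref_measure \<beta>) ?P (\<lambda>x i. x $ i) = ?P"
  proof (rule PiM_eqI)
    fix A assume A: "\<And>i. i \<in> (UNIV::'n set) \<Longrightarrow> A i \<in> sets (sticky_line \<beta>)"
    have A': "A i \<in> sets (restrict_space borel {0..})" for i using A[of i] by simp
    have "(\<lambda>x i. x $ i) -` Pi\<^sub>E UNIV A \<inter> space (ref_measure \<beta>) = box_in A"
      by (auto simp: box_in_def PiE_iff)
    then show "emeasure (distr (ref_measure \<beta>) ?P (\<lambda>x i. x $ i)) (Pi\<^sub>E UNIV A) = (\<Prod>i\<in>UNIV. emeasure (sticky_line \<beta>) (A i))"
      using A' assms by (subst emeasure_distr[OF m1]) (auto simp: emeasure_ref_measure_box intro!: sets_PiM_I_finite)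
  qed auto
  have "distr ?P orthant_algebra (\<lambda>x. \<chi> i. x i) = distr (distr (ref_measure \<beta>) ?P (\<lambda>x i. x $ i)) (orthant_algebra :: (real^'n) measure) (\<lambda>x. \<chi> i. x i)"
    by (simp add: P)
  also have "\<dots> = distr (ref_measure \<beta>) orthant_algebra (\<lambda>x. x)"
    by (subst distr_distr[OF m2 m1]) (simp add: comp_def)
  also have "\<dots> = ref_measure \<beta>"
    by (rule distr_id2) simp
  finally show ?thesis by simp
qed

section \<open>Changing one coordinate\<close>

definition upd_coord :: "real^'n \<Rightarrow> 'n \<Rightarrow> real \<Rightarrow> real^'n" where
  "upd_coord x i s = (\<chi> j. if j = i then s else x $ j)"

lemma upd_coord_nth [simp]: "upd_coord x i s $ j = (if j = i then s else x $ j)"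
  by (simp add: upd_coord_def)

lemma upd_coord_upd_coord [simp]: "upd_coord (upd_coord x i s) i t = upd_coord x i t"
  by (simp add: vec_eq_iff)

lemma upd_coord_add_axis: "x + t *\<^sub>R axis i 1 = upd_coord x i (x $ i + t)"
  by (simp add: vec_eq_iff axis_def)

lemma upd_coord_orthant [simp]: "x \<in> orthant \<Longrightarrow> 0 \<le> s \<Longrightarrow> upd_coord x i s \<in> orthant"
  by (auto simp: orthant_def)

lemma measurable_upd_coord [measurable (raw)]:
  fixes f :: "'a \<Rightarrow> real^'n::finite"
  assumes f: "f \<in> M \<rightarrow>\<^sub>M orthant_algebra"
    and g: "g \<in> M \<rightarrow>\<^sub>M restrict_space borel {0::real..}"
  shows "(\<lambda>x. upd_coord (f x) i (g x)) \<in> M \<rightarrow>\<^sub>M orthant_algebra"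
  unfolding upd_coord_def
proof (rule vec_lambda_orthant_measurable)
  fix j
  show "(\<lambda>x. if j = i then g x else f x $ j) \<in> M \<rightarrow>\<^sub>M restrict_space borel {0..}"
    using g measurable_compose[OF f vec_nth_orthant_measurable, of j] by (cases "j = i") auto
qed

text \<open>The coordinate \<open>i\<close> of the reference measure, integrated against an arbitrary window \<open>J\<close> of
  that coordinate so that no projection to the remaining coordinates is needed.\<close>

lemma nn_integral_ref_measure_coord:
  fixes \<phi> :: "real^'n::finite \<Rightarrow> ennreal"
  assumes \<phi> [measurable]: "\<phi> \<in> borel_measurable orthant_algebra" and J: "J \<in> sets (restrict_space borel {0..})" and "0 \<le> \<beta>"
  shows "emeasure (sticky_line \<beta>) J * (\<integral>\<^sup>+x. \<phi> x \<partial>ref_measure \<beta>) =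
    (\<integral>\<^sup>+x. indicator J (x $ i) * (\<integral>\<^sup>+s. \<phi> (upd_coord x i s) \<partial>sticky_line \<beta>) \<partial>ref_measure \<beta>)"
proof -
  let ?m = "sticky_line \<beta>"
  let ?P = "PiM (UNIV::'n set) (\<lambda>_. ?m)" and ?P' = "PiM (UNIV - {i}) (\<lambda>_. ?m)"
  interpret product_sigma_finite "\<lambda>_::'n. ?m" by (rule product_sigma_finite_sticky_line)
  interpret m: sigma_finite_measure ?m by (rule sigma_finite_sticky_line)
  have UN: "insert i (UNIV - {i}) = UNIV" by auto
  have V [measurable]: "(\<lambda>x. \<chi> i. x i) \<in> ?P \<rightarrow>\<^sub>M (orthant_algebra :: (real^'n) measure)"
  proof (rule vec_lambda_orthant_measurable)
    fix i :: 'n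
    have "(\<lambda>x. x i) \<in> ?P \<rightarrow>\<^sub>M sticky_line \<beta>" by measurable
    then show "(\<lambda>x. x i) \<in> ?P \<rightarrow>\<^sub>M restrict_space borel {0..}"
      by (subst (asm) measurable_cong_sets[OF refl sets_sticky_line])
  qed
  have J' [measurable]: "J \<in> sets ?m" using J by simp
  have [measurable]: "\<phi> \<in> borel_measurable (ref_measure \<beta>)"
    using \<phi> by (subst measurable_cong_sets[OF sets_ref_measure refl])
  let ?R = "\<lambda>x. \<integral>\<^sup>+s. \<phi> (upd_coord x i s) \<partial>?m"
  have idm: "(\<lambda>s. s) \<in> ?m \<rightarrow>\<^sub>M restrict_space borel {0..}"
    using measurable_cong_sets[OF sets_sticky_line refl] measurable_ident_sets by blast
  have [measurable]: "(\<lambda>(x, s). \<phi> (upd_coord x i s)) \<in> borel_measurable (orthant_algebra \<Otimes>\<^sub>M ?m)"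
  proof -
    have "(\<lambda>p. upd_coord (fst p) i (snd p)) \<in> orthant_algebra \<Otimes>\<^sub>M ?m \<rightarrow>\<^sub>M (orthant_algebra :: (real^'n) measure)"
      by (rule measurable_upd_coord) (use measurable_compose[OF measurable_snd idm] in auto)
    then show ?thesis by (auto simp: case_prod_beta intro: measurable_compose[OF _ \<phi>])
  qed
  have R [measurable]: "?R \<in> borel_measurable orthant_algebra" by measurable
  have Ji [measurable]: "(\<lambda>x. indicator J (x $ i) :: ennreal) \<in> borel_measurable (orthant_algebra :: (real^'n) measure)"
  proof -
    have "(indicator J :: _ \<Rightarrow> ennreal) \<in> borel_measurable (restrict_space borel {0..})" using J by simp
    from measurable_compose[OF vec_nth_orthant_measurable this] show ?thesis .
  qed
  \<comment> \<open>The point is completed by the dummy value 0 in coordinate i, which every later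
    update overwrites.\<close>
  have sp: "x \<in> space ?P' \<Longrightarrow> s \<in> space ?m \<Longrightarrow> (\<chi> j. (x(i := s)) j) = upd_coord (\<chi> j. (x(i := 0)) j) i s" for x s
    by (simp add: vec_eq_iff)
  have L: "(\<integral>\<^sup>+x. \<phi> x \<partial>ref_measure \<beta>) = (\<integral>\<^sup>+x. ?R (\<chi> j. (x(i := 0)) j) \<partial>?P')"
  proof -
    have "(\<integral>\<^sup>+x. \<phi> x \<partial>ref_measure \<beta>) = (\<integral>\<^sup>+x. \<phi> (\<chi> i. x i) \<partial>?P)"
      by (subst ref_measure_eq_distr_PiM[OF \<open>0 \<le> \<beta>\<close>], subst nn_integral_distr) auto
    also have "\<dots> = (\<integral>\<^sup>+x. (\<integral>\<^sup>+s. \<phi> (\<chi> j. (x(i := s)) j) \<partial>?m) \<partial>?P')"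
      by (subst UN[symmetric], subst product_nn_integral_insert) (auto simp: UN)
    also have "\<dots> = (\<integral>\<^sup>+x. ?R (\<chi> j. (x(i := 0)) j) \<partial>?P')"
      by (intro nn_integral_cong arg_cong[of _ _ \<phi>] sp)
    finally show ?thesis .
  qed
  have "(\<integral>\<^sup>+x. indicator J (x $ i) * ?R x \<partial>ref_measure \<beta>) = (\<integral>\<^sup>+x. indicator J (x i) * ?R (\<chi> i. x i) \<partial>?P)"
    by (subst ref_measure_eq_distr_PiM[OF \<open>0 \<le> \<beta>\<close>], subst nn_integral_distr) auto
  also have "\<dots> = (\<integral>\<^sup>+x. (\<integral>\<^sup>+s. indicator J s * ?R (\<chi> j. (x(i := s)) j) \<partial>?m) \<partial>?P')"
  proof -
    have "(\<lambda>x. indicator J (x i) * ?R (\<chi> i. x i)) \<in> borel_measurable (PiM (insert i (UNIV - {i})) (\<lambda>_. ?m))"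
      unfolding UN by measurable
    from product_nn_integral_insert[OF _ _ this] show ?thesis
      unfolding UN by simp
  qed
  also have "\<dots> = (\<integral>\<^sup>+x. emeasure ?m J * ?R (\<chi> j. (x(i := 0)) j) \<partial>?P')"
  proof (rule nn_integral_cong)
    fix x assume "x \<in> space ?P'"
    have "(\<integral>\<^sup>+s. indicator J s * ?R (\<chi> j. (x(i := s)) j) \<partial>?m) = (\<integral>\<^sup>+s. indicator J s * ?R (\<chi> j. (x(i := 0)) j) \<partial>?m)"
      by (intro nn_integral_cong arg_cong2[of _ _ _ _ "(*)"] refl arg_cong[of _ _ \<phi>]) (simp add: vec_eq_iff)
    also have "\<dots> = emeasure ?m J * ?R (\<chi> j. (x(i := 0)) j)"
      by (subst nn_integral_multc) (use J in \<open>auto simp: nn_integral_indicator\<close>)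
    finally show "(\<integral>\<^sup>+s. indicator J s * ?R (\<chi> j. (x(i := s)) j) \<partial>?m) = emeasure ?m J * ?R (\<chi> j. (x(i := 0)) j)" .
  qed
  also have "\<dots> = emeasure ?m J * (\<integral>\<^sup>+x. ?R (\<chi> j. (x(i := 0)) j) \<partial>?P')"
  proof (rule nn_integral_cmult)
    have "(\<lambda>x. \<chi> j. (x(i := 0)) j) \<in> ?P' \<rightarrow>\<^sub>M (orthant_algebra :: (real^'n) measure)"
    proof (rule vec_lambda_orthant_measurable)
      fix j :: 'n
      have "(\<lambda>x. x j) \<in> ?P' \<rightarrow>\<^sub>M ?m" if "j \<noteq> i" using that by (intro measurable_component_singleton) auto
      then have "(\<lambda>x. x j) \<in> ?P' \<rightarrow>\<^sub>M restrict_space borel {0..}" if "j \<noteq> i"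
        using that by (subst (asm) measurable_cong_sets[OF refl sets_sticky_line])
      then show "(\<lambda>x. (x(i := 0)) j) \<in> ?P' \<rightarrow>\<^sub>M restrict_space borel {0..}"
        by (cases "j = i") (auto intro!: measurable_const simp: space_restrict_space)
    qed
    from measurable_compose[OF this R] show "(\<lambda>x. ?R (\<chi> j. (x(i := 0)) j)) \<in> borel_measurable ?P'" .
  qed
  finally show ?thesis by (simp add: L)
qed

lemma measurable_ref_measure_eq [simp]:
  "f \<in> ref_measure \<beta> \<rightarrow>\<^sub>M N \<longleftrightarrow> f \<in> orthant_algebra \<rightarrow>\<^sub>M N"
  "f \<in> weighted_measure \<beta> \<rho> \<rightarrow>\<^sub>M N \<longleftrightarrow> f \<in> orthant_algebra \<rightarrow>\<^sub>M N"
  "f \<in> face_measure \<beta> B \<rightarrow>\<^sub>M N \<longleftrightarrow> f \<in> orthant_algebra \<rightarrow>\<^sub>M N"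
  using measurable_cong_sets[OF sets_ref_measure refl] measurable_cong_sets[OF sets_weighted_measure refl]
    measurable_cong_sets[OF sets_face_measure refl] by blast+

lemma interval_halfline_sets:
  assumes "I \<in> sets borel" "I \<subseteq> {0::real..}"
  shows "I \<in> sets (restrict_space borel {0..})"
  using assms by (subst sets_restrict_space_iff) auto

lemma emeasure_sticky_line_zero: "emeasure (sticky_line \<beta>) {0} = ennreal \<beta>"
proof -
  have "emeasure (restrict_space lborel {0::real..}) {0} = 0"
    by (subst emeasure_restrict_space) auto
  then show ?thesis
    by (subst emeasure_sticky_line) (auto intro: interval_halfline_sets)
qed

lemma sigma_finite_ref_measure:
  assumes "0 \<le> \<beta>"
  shows "sigma_finite_measure (ref_measure \<beta> :: (real^'n::finite) measure)"
proof
  let ?Q = "\<lambda>k::nat. box_in (\<lambda>_::'n. {0..real k})"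
  have s: "{0..real k} \<in> sets (restrict_space borel {0..})" for k by (rule interval_halfline_sets) auto
  have "x \<in> (\<Union>k. ?Q k)" if "x \<in> orthant" for x :: "real^'n"
  proof -
    obtain k where k: "norm x \<le> real k" using real_arch_simple by blast
    have "x \<in> ?Q k" using that k component_le_norm_cart[of x] by (auto simp: box_in_def orthant_def intro: order_trans abs_le_D1)
    then show ?thesis by blast
  qed
  then have U: "(\<Union>k. ?Q k) = orthant" by (auto simp: box_in_def)
  show "\<exists>A. countable A \<and> A \<subseteq> sets (ref_measure \<beta>) \<and> \<Union> A = space (ref_measure \<beta> :: (real^'n) measure) \<and> (\<forall>a\<in>A. emeasure (ref_measure \<beta>) a \<noteq> \<infinity>)"
  proof (intro exI[of _ "range ?Q"] conjI)
    show "\<forall>a\<in>range ?Q. emeasure (ref_measure \<beta>) a \<noteq> \<infinity>"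
    proof safe
      fix k assume "emeasure (ref_measure \<beta>) (?Q k) = \<infinity>"
      then show False using assms
        by (subst (asm) emeasure_ref_measure_box[OF s])
          (auto simp: emeasure_sticky_line_atLeastAtMost ennreal_prod_eq_top power_eq_top_ennreal)
    qed
  qed (use box_in_measurable[OF s] U in auto)
qed

section \<open>Box neighbourhoods and full support\<close>

lemma box_in_nbhd:
  fixes z :: "real^'n::finite"
  assumes U: "openin (top_of_set orthant) U" and z: "z \<in> U"
  shows "\<exists>\<delta>>0. box_in (\<lambda>i. {s. 0 \<le> s \<and> \<bar>s - z $ i\<bar> < \<delta>}) \<subseteq> U"
proof -
  obtain e where e: "e > 0" "ball z e \<inter> orthant \<subseteq> U"
    using U z openin_contains_ball by metis
  \<comment> \<open>The l1 norm dominates the Euclidean one, so each of the CARD('n) coordinates may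
    use an equal share of e.\<close>
  let ?d = "e / real CARD('n)"
  have "box_in (\<lambda>i. {s. 0 \<le> s \<and> \<bar>s - z $ i\<bar> < ?d}) \<subseteq> U"
  proof
    fix x assume x: "x \<in> box_in (\<lambda>i. {s. 0 \<le> s \<and> \<bar>s - z $ i\<bar> < ?d})"
    have "norm (x - z) \<le> (\<Sum>i\<in>UNIV. \<bar>(x - z) $ i\<bar>)" by (rule norm_le_l1_cart)
    also have "\<dots> < (\<Sum>i\<in>(UNIV::'n set). ?d)"
    proof (rule sum_strict_mono)
      fix i :: 'n
      have "\<bar>x $ i - z $ i\<bar> < ?d" using x unfolding box_in_def by blast
      then show "\<bar>(x - z) $ i\<bar> < ?d" by simp
    qed auto
    also have "\<dots> = e" by simp
    finally have "x \<in> ball z e" by (simp add: dist_norm norm_minus_commute)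
    then show "x \<in> U" using e x by (auto simp: box_in_def)
  qed
  moreover have "?d > 0" using e by simp
  ultimately show ?thesis by blast
qed

lemma sticky_line_interval:
  assumes "0 \<le> z" "0 < \<delta>"
  shows "{s. 0 \<le> s \<and> \<bar>s - z\<bar> < \<delta>} \<in> sets (restrict_space borel {0..})"
    and "emeasure (sticky_line \<beta>) {s. 0 \<le> s \<and> \<bar>s - z\<bar> < \<delta>} > 0"
    and "emeasure (sticky_line \<beta>) {s. 0 \<le> s \<and> \<bar>s - z\<bar> < \<delta>} < \<infinity>"
proof -
  let ?I = "{s. 0 \<le> s \<and> \<bar>s - z\<bar> < \<delta>}"
  have "?I = {0..} \<inter> {z - \<delta> <..< z + \<delta>}" by auto
  then have "?I \<in> sets borel" by simp
  then show I: "?I \<in> sets (restrict_space borel {0..})" by (intro interval_halfline_sets) auto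
  \<comment> \<open>Only the part to the right of z is certain to lie in the half-line.\<close>
  have "0 < ennreal \<delta>" using assms by simp
  also have "\<dots> = emeasure (restrict_space lborel {0..}) {z ..< z + \<delta>}"
    using assms by (subst emeasure_restrict_space) auto
  also have "\<dots> \<le> emeasure (restrict_space lborel {0..}) ?I"
  proof (rule emeasure_mono)
    show "{z ..< z + \<delta>} \<subseteq> ?I" using assms by auto
    show "?I \<in> sets (restrict_space lborel {0..})" using I by (simp only: sets_restrict_space sets_lborel)
  qed
  also have "\<dots> \<le> emeasure (sticky_line \<beta>) ?I" by (simp add: emeasure_sticky_line[OF I])
  finally show "emeasure (sticky_line \<beta>) ?I > 0" .
  have "emeasure (sticky_line \<beta>) ?I \<le> emeasure (sticky_line \<beta>) {0..z + \<delta>}"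
    by (rule emeasure_mono) (auto intro: interval_halfline_sets)
  also have "\<dots> < \<infinity>" using assms by (subst emeasure_sticky_line_atLeastAtMost) auto
  finally show "emeasure (sticky_line \<beta>) ?I < \<infinity>" .
qed

text \<open>Each factor of a small box has positive mass. Full support is used to exclude negative
  values of \<rho>, to match local constants on overlaps, and to give every component positive
  mass.\<close>

lemma ref_measure_open_pos:
  fixes U :: "(real^'n::finite) set"
  assumes "openin (top_of_set orthant) U" "U \<noteq> {}" "0 \<le> \<beta>"
  shows "emeasure (ref_measure \<beta>) U > 0"
proof -
  obtain z where z: "z \<in> U" using assms by blast
  then have "z \<in> orthant" using assms openin_imp_subset by blast
  obtain \<delta> where d: "\<delta> > 0" "box_in (\<lambda>i. {s. 0 \<le> s \<and> \<bar>s - z $ i\<bar> < \<delta>}) \<subseteq> U" (is "?Q \<subseteq> _")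
    using box_in_nbhd[OF assms(1) z] by blast
  have z0: "0 \<le> z $ i" for i using \<open>z \<in> orthant\<close> by (auto simp: orthant_def)
  note I = sticky_line_interval[OF z0 d(1)]
  have "0 < emeasure (ref_measure \<beta>) ?Q"
    using I(2)[of \<beta>] by (subst emeasure_ref_measure_box[OF I(1) assms(3)]) (auto simp: zero_less_iff_neq_zero)
  also have "\<dots> \<le> emeasure (ref_measure \<beta>) U"
  proof (rule emeasure_mono[OF d(2)])
    obtain W where "open W" "U = orthant \<inter> W" using assms(1) by (auto simp: openin_open)
    then show "U \<in> sets (ref_measure \<beta>)" by (auto simp: sets_restrict_space_iff)
  qed
  finally show ?thesis .
qed

section \<open>Translation along a coordinate\<close>

lemma orthant_shift [simp]: "x \<in> orthant \<Longrightarrow> 0 \<le> t \<Longrightarrow> x + t *\<^sub>R axis i 1 \<in> orthant"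
  by (simp add: upd_coord_add_axis) (metis add_nonneg_nonneg mem_Collect_eq orthant_def upd_coord_orthant)

lemma measurable_shift [measurable]:
  "0 \<le> t \<Longrightarrow> (\<lambda>x. x + t *\<^sub>R axis i 1) \<in> orthant_algebra \<rightarrow>\<^sub>M (orthant_algebra :: (real^'n::finite) measure)"
  by (rule measurable_restrict_space2) (auto simp: space_restrict_space intro!: measurable_restrict_space1)

text \<open>Lebesgue measure on the open half-line shrinks under a shift away from 0. The
  restriction to x_i > 0 keeps the atom out: a shifted atom would land on a Lebesgue null set and
  break the inequality.\<close>

lemma nn_integral_ref_measure_shift:
  fixes \<phi> :: "real^'n::finite \<Rightarrow> ennreal"
  assumes \<phi> [measurable]: "\<phi> \<in> borel_measurable orthant_algebra" and \<tau>: "0 \<le> \<tau>" and "0 < \<beta>"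
  shows "(\<integral>\<^sup>+x. indicator {0<..} (x $ i) * \<phi> (x + \<tau> *\<^sub>R axis i 1) \<partial>ref_measure \<beta>)
    \<le> (\<integral>\<^sup>+x. indicator {0<..} (x $ i) * \<phi> x \<partial>ref_measure \<beta>)"
proof -
  \<comment> \<open>The window {0} has mass \<beta>, which is positive and finite and can be
    cancelled at the end.\<close>
  have J: "{0} \<in> sets (restrict_space borel {0::real..})" by (rule interval_halfline_sets) auto
  have b: "0 \<le> \<beta>" using assms by simp
  let ?f = "\<lambda>x. indicator {0<..} (x $ i) * \<phi> x"
  let ?g = "\<lambda>x. indicator {0<..} (x $ i) * \<phi> (x + \<tau> *\<^sub>R axis i 1)"
  have [measurable]: "(\<lambda>x. \<phi> (x + \<tau> *\<^sub>R axis i 1)) \<in> borel_measurable orthant_algebra"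
    using measurable_compose[OF measurable_shift[OF \<tau>] \<phi>] .
  have mf: "?f \<in> borel_measurable orthant_algebra" by measurable
  have mg: "?g \<in> borel_measurable orthant_algebra" by measurable
  have inner: "(\<integral>\<^sup>+s. ?g (upd_coord x i s) \<partial>sticky_line \<beta>) \<le> (\<integral>\<^sup>+s. ?f (upd_coord x i s) \<partial>sticky_line \<beta>)"
    if x: "x \<in> orthant" for x
  proof -
    \<comment> \<open>Extended by \<open>max 0\<close> to all reals, so that the affine substitution
      in \<open>lborel\<close> applies.\<close>
    define \<zeta> where "\<zeta> s = \<phi> (upd_coord x i (max 0 s))" for s
    have u: "(\<lambda>s. upd_coord x i s) \<in> restrict_space borel {0..} \<rightarrow>\<^sub>M (orthant_algebra :: (real^'n) measure)"
      by (rule measurable_upd_coord) (use x in \<open>auto simp: space_restrict_space\<close>)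
    have "(\<lambda>s. max 0 s) \<in> borel \<rightarrow>\<^sub>M restrict_space borel {0::real..}"
      by (rule measurable_restrict_space2) auto
    from measurable_compose[OF measurable_compose[OF this u] \<phi>]
    have [measurable]: "\<zeta> \<in> borel_measurable borel" by (simp add: \<zeta>_def[abs_def])
    have mfu: "(\<lambda>s. ?f (upd_coord x i s)) \<in> borel_measurable (restrict_space borel {0..})"
      using measurable_compose[OF u mf] by simp
    have mgu: "(\<lambda>s. ?g (upd_coord x i s)) \<in> borel_measurable (restrict_space borel {0..})"
      using measurable_compose[OF u mg] by simp
    have "(\<integral>\<^sup>+s. ?g (upd_coord x i s) \<partial>sticky_line \<beta>) = (\<integral>\<^sup>+s. indicator {0<..} s * \<zeta> (s + \<tau>) \<partial>lborel)"
      by (subst nn_integral_sticky_line[OF mgu])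
        (auto simp: \<zeta>_def upd_coord_add_axis max_absorb2 \<tau> indicator_def intro!: nn_integral_cong)
    also have "\<dots> \<le> (\<integral>\<^sup>+s. indicator {0<..} (\<tau> + 1 * s) * \<zeta> (\<tau> + 1 * s) \<partial>lborel)"
      using \<tau> by (intro nn_integral_mono) (auto simp: indicator_def ac_simps)
    also have "\<dots> = (\<integral>\<^sup>+s. indicator {0<..} s * \<zeta> s \<partial>lborel)"
      by (subst nn_integral_real_affine[of _ 1 \<tau>, where f = "\<lambda>s. indicator {0<..} s * \<zeta> s"]) auto
    also have "\<dots> = (\<integral>\<^sup>+s. ?f (upd_coord x i s) \<partial>sticky_line \<beta>)"
      by (subst nn_integral_sticky_line[OF mfu])
        (auto simp: \<zeta>_def max_absorb2 indicator_def intro!: nn_integral_cong)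
    finally show ?thesis .
  qed
  have "(\<integral>\<^sup>+x. indicator {0} (x $ i) * (\<integral>\<^sup>+s. ?g (upd_coord x i s) \<partial>sticky_line \<beta>) \<partial>ref_measure \<beta>)
      \<le> (\<integral>\<^sup>+x. indicator {0} (x $ i) * (\<integral>\<^sup>+s. ?f (upd_coord x i s) \<partial>sticky_line \<beta>) \<partial>ref_measure \<beta>)"
    by (intro nn_integral_mono mult_left_mono inner) auto
  then have "ennreal \<beta> * (\<integral>\<^sup>+x. ?g x \<partial>ref_measure \<beta>) \<le> ennreal \<beta> * (\<integral>\<^sup>+x. ?f x \<partial>ref_measure \<beta>)"
    unfolding nn_integral_ref_measure_coord[OF mf J b, of i, symmetric]
      nn_integral_ref_measure_coord[OF mg J b, of i, symmetric] emeasure_sticky_line_zero .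
  then show ?thesis
    using assms by (simp add: ennreal_mult_le_mult_iff)
qed

section \<open>The faces inside the reference measure\<close>

lemma face_eq_box: "face B = box_in (\<lambda>i. if i \<in> B then {0<..} else {0})"
proof (rule set_eqI)
  fix x
  have "(\<forall>i. x $ i \<in> (if i \<in> B then {0<..} else {0})) \<longleftrightarrow> x \<in> face B"
    by (auto simp: face_def)
  then show "x \<in> face B \<longleftrightarrow> x \<in> box_in (\<lambda>i. if i \<in> B then {0<..} else {0})"
    using face_subset_orthant[of B] by (auto simp: box_in_def)
qed

lemma face_measurable [measurable]: "face B \<in> sets (orthant_algebra :: (real^'n::finite) measure)"
  unfolding face_eq_box by (rule box_in_measurable) (auto intro!: interval_halfline_sets)

text \<open>At a coordinate where B and B' differ, one factor is the Lebesgue measure of a point or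
  the Dirac measure of the open half-line.\<close>

lemma emeasure_face_measure_other:
  fixes B B' :: "'n::finite set"
  assumes "B \<noteq> B'"
  shows "emeasure (face_measure \<beta> B') (face B) = 0"
proof -
  let ?A = "\<lambda>i. if i \<in> B then {0<..} else {0::real}"
  have A: "?A i \<in> sets (restrict_space borel {0..})" for i by (auto intro!: interval_halfline_sets)
  obtain i where i: "i \<in> B \<and> i \<notin> B' \<or> i \<in> B' \<and> i \<notin> B" using assms by blast
  have "emeasure (restrict_space lborel {0::real..}) {0} = 0"
    by (subst emeasure_restrict_space) auto
  then have "(if i \<in> B' then emeasure (restrict_space lborel {0..}) (?A i) else indicator (?A i) 0) = 0"
    using i by auto
  then have "emeasure (face_lebesgue B') (box_in ?A) = 0"
    unfolding emeasure_face_lebesgue_box[OF A] by (intro prod_zero bexI[of _ i]) auto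
  then show ?thesis by (simp add: face_measure_def face_eq_box)
qed

lemma emeasure_ref_measure_face:
  fixes B :: "'n::finite set"
  assumes A: "A \<in> sets orthant_algebra" "A \<subseteq> face B"
  shows "emeasure (ref_measure \<beta>) A = emeasure (face_measure \<beta> B) A"
proof -
  have "emeasure (face_measure \<beta> B') A = (if B' = B then emeasure (face_measure \<beta> B) A else 0)" for B'
  proof (cases "B' = B")
    case False
    then show ?thesis
      using emeasure_mono[of A "face B" "face_measure \<beta> B'"] A emeasure_face_measure_other[of B B' \<beta>] by simp
  qed simp
  then have "(\<Sum>B'\<in>UNIV. emeasure (face_measure \<beta> B') A) = (\<Sum>B'\<in>UNIV. if B' = B then emeasure (face_measure \<beta> B) A else 0)"
    by (rule sum.cong[OF refl])
  also have "\<dots> = emeasure (face_measure \<beta> B) A" by simp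
  finally show ?thesis
    unfolding emeasure_ref_measure[OF A(1)] .
qed

lemma emeasure_density_indicator:
  assumes "A \<in> sets N" "B \<in> sets N"
  shows "emeasure (density N (indicator B)) A = emeasure N (B \<inter> A)"
proof -
  have "emeasure (density N (indicator B)) A = (\<integral>\<^sup>+x. indicator B x * indicator A x \<partial>N)"
    by (rule emeasure_density) (use assms in auto)
  also have "\<dots> = (\<integral>\<^sup>+x. indicator (B \<inter> A) x \<partial>N)"
    by (simp only: indicator_inter_arith)
  also have "\<dots> = emeasure N (B \<inter> A)"
    by (rule nn_integral_indicator) (use assms in auto)
  finally show ?thesis .
qed

lemma density_face_measure:
  fixes B :: "'n::finite set"
  shows "density (face_measure \<beta> B) (indicator (face B)) = density (ref_measure \<beta>) (indicator (face B))"
proof (rule measure_eqI)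
  fix A assume "A \<in> sets (density (face_measure \<beta> B) (indicator (face B)))"
  then have A: "A \<in> sets orthant_algebra" by simp
  show "emeasure (density (face_measure \<beta> B) (indicator (face B))) A = emeasure (density (ref_measure \<beta>) (indicator (face B))) A"
    using A emeasure_ref_measure_face[of "face B \<inter> A" B \<beta>] by (simp add: emeasure_density_indicator)
qed simp

text \<open>This replaces the integrals over separate faces in \<open>pre_form\<close> by integrals
  against the one measure \<open>weighted_measure \<beta> \<rho>\<close>.\<close>

lemma density_weighted_face_measure:
  fixes B :: "'n::finite set"
  assumes [measurable]: "\<rho> \<in> borel_measurable orthant_algebra"
  shows "density (weighted_face_measure \<beta> \<rho> B) (indicator (face B)) = density (weighted_measure \<beta> \<rho>) (indicator (face B))"
proof -
  have "density (density N (\<lambda>x. ennreal (\<rho> x))) (indicator (face B)) = density (density N (indicator (face B))) (\<lambda>x. ennreal (\<rho> x))"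
    if s: "sets N = sets orthant_algebra" for N
  proof -
    have [measurable]: "\<rho> \<in> borel_measurable N" "face B \<in> sets N"
      using measurable_cong_sets[OF s refl, of borel] s by auto
    show ?thesis by (subst (1 2) density_density_eq) (auto simp: mult.commute)
  qed
  from this[of "face_measure \<beta> B"] this[of "ref_measure \<beta>"] show ?thesis
    unfolding weighted_face_measure_def weighted_measure_def by (simp add: density_face_measure)
qed

lemma face_disjoint: "x \<in> face B \<Longrightarrow> x \<in> face B' \<Longrightarrow> B = B'"
  by (auto simp: face_def) (metis ComplI less_irrefl)+

lemma face_cover: "x \<in> orthant \<Longrightarrow> x \<in> face {i. 0 < x $ i}"
  by (auto simp: face_def orthant_def intro: antisym)

lemma orthant_eq_faces: "orthant = (\<Union>B. face B)"
  using face_cover face_subset_orthant by blast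

text \<open>The square of sqrt \<rho> is |\<rho>|, so the Sobolev hypothesis contains the
  integrability of \<rho> on every face other than the origin, and the origin is a single atom of
  finite mass.\<close>

lemma finite_weighted_measure:
  fixes \<rho> :: "real^'n::finite \<Rightarrow> real"
  assumes \<rho> [measurable]: "\<rho> \<in> borel_measurable orthant_algebra"
    and H: "\<And>B. B \<noteq> {} \<Longrightarrow> (\<lambda>x. sqrt (\<rho> x)) \<in> sobolev_H12 B"
  shows "finite_measure (weighted_measure \<beta> \<rho>)"
proof
  have fin: "emeasure (weighted_measure \<beta> \<rho>) (face B) < \<infinity>" for B :: "'n set"
  proof -
    have "emeasure (weighted_measure \<beta> \<rho>) (face B) = emeasure (density (weighted_face_measure \<beta> \<rho> B) (indicator (face B))) (face B)"
      unfolding density_weighted_face_measure[OF \<rho>]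
      by (subst emeasure_density_indicator) auto
    also have "\<dots> = emeasure (weighted_face_measure \<beta> \<rho> B) (face B)"
    proof -
      have "face B \<in> sets (weighted_face_measure \<beta> \<rho> B)" by (simp add: weighted_face_measure_def)
      then show ?thesis
        by (subst emeasure_density_indicator) auto
    qed
    also have "\<dots> = (\<integral>\<^sup>+x. ennreal (\<rho> x) * indicator (face B) x \<partial>face_measure \<beta> B)"
      unfolding weighted_face_measure_def by (subst emeasure_density) auto
    also have "\<dots> = ennreal (\<beta> ^ (CARD('n) - card B)) * (\<integral>\<^sup>+x. ennreal (\<rho> x) * indicator (face B) x \<partial>face_lebesgue B)"
      unfolding face_measure_def by (subst nn_integral_scale_measure) (auto simp: measurable_cong_sets[OF sets_face_lebesgue refl])
    also have "\<dots> < \<infinity>"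
    proof -
      have "(\<integral>\<^sup>+x. ennreal (\<rho> x) * indicator (face B) x \<partial>face_lebesgue B) < \<infinity>"
      proof (cases "B = {}")
        case True
        have f: "face {} = {0 :: real^'n}" by (auto simp: face_def vec_eq_iff)
        have z: "emeasure (face_lebesgue {}) (face {} :: (real^'n) set) < \<infinity>"
          unfolding face_eq_box by (subst emeasure_face_lebesgue_box) (auto intro!: interval_halfline_sets)
        have "(\<integral>\<^sup>+x. ennreal (\<rho> x) * indicator (face {}) x \<partial>face_lebesgue {})
          = (\<integral>\<^sup>+x. ennreal (\<rho> 0) * indicator (face {}) x \<partial>(face_lebesgue {} :: (real^'n) measure))"
          by (intro nn_integral_cong) (auto simp: f indicator_def)
        also have "\<dots> = ennreal (\<rho> 0) * emeasure (face_lebesgue {}) (face {} :: (real^'n) set)"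
          by (subst nn_integral_cmult_indicator) auto
        also have "\<dots> < \<infinity>" using z by (auto simp: ennreal_mult_less_top)
        finally show ?thesis using True by simp
      next
        case False
        let ?F = "restrict_space (face_lebesgue B) (face B)"
        have sp: "space (face_lebesgue B) = orthant"
          using sets_eq_imp_space_eq[OF sets_face_lebesgue] by (simp add: space_restrict_space)
        \<comment> \<open>No sign of \<rho> is available here; \<open>sqrt\<close> is an odd
          function, so the square is the absolute value.\<close>
        have "integrable ?F (\<lambda>x. (sqrt (\<rho> x))\<^sup>2)"
          using H[OF False] by (auto simp: sobolev_H12_def L2_def)
        then have "(\<integral>\<^sup>+x. ennreal (norm ((sqrt (\<rho> x))\<^sup>2)) \<partial>?F) < \<infinity>"
          by (simp add: integrable_iff_bounded)
        also have "(\<integral>\<^sup>+x. ennreal (norm ((sqrt (\<rho> x))\<^sup>2)) \<partial>?F) = (\<integral>\<^sup>+x. ennreal \<bar>\<rho> x\<bar> * indicator (face B) x \<partial>face_lebesgue B)"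
          by (subst nn_integral_restrict_space) (auto simp: sp Int_absorb2[OF face_subset_orthant] real_sqrt_abs2 power2_eq_square abs_mult)
        finally have "(\<integral>\<^sup>+x. ennreal \<bar>\<rho> x\<bar> * indicator (face B) x \<partial>face_lebesgue B) < \<infinity>" .
        then show ?thesis
          by (rule order.strict_trans1[rotated]) (auto intro!: nn_integral_mono mult_right_mono ennreal_leI)
      qed
      then show ?thesis by (simp add: ennreal_mult_less_top)
    qed
    finally show ?thesis .
  qed
  have "emeasure (weighted_measure \<beta> \<rho>) (space (weighted_measure \<beta> \<rho>)) \<le> (\<Sum>B\<in>UNIV. emeasure (weighted_measure \<beta> \<rho>) (face B))"
    unfolding space_weighted_measure orthant_eq_faces
    by (rule emeasure_subadditive_finite) auto
  also have "\<dots> < \<infinity>" using fin by (auto simp: less_top)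
  finally show "emeasure (weighted_measure \<beta> \<rho>) (space (weighted_measure \<beta> \<rho>)) \<noteq> \<infinity>" by simp
qed

section \<open>The form on continuously differentiable functions\<close>

definition bounded_meas :: "'a measure \<Rightarrow> ('a \<Rightarrow> real) \<Rightarrow> bool" where
  "bounded_meas M f \<longleftrightarrow> f \<in> borel_measurable M \<and> (\<exists>c. \<forall>x\<in>space M. \<bar>f x\<bar> \<le> c)"

lemma bounded_measI: "f \<in> borel_measurable M \<Longrightarrow> (\<And>x. x \<in> space M \<Longrightarrow> \<bar>f x\<bar> \<le> c) \<Longrightarrow> bounded_meas M f"
  by (auto simp: bounded_meas_def)

lemma bounded_meas_measurable [measurable_dest]: "bounded_meas M f \<Longrightarrow> f \<in> borel_measurable M"
  by (simp add: bounded_meas_def)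

lemma bounded_meas_bound:
  assumes "bounded_meas M f"
  obtains c where "0 \<le> c" "\<And>x. x \<in> space M \<Longrightarrow> \<bar>f x\<bar> \<le> c"
proof -
  obtain c where c: "\<And>x. x \<in> space M \<Longrightarrow> \<bar>f x\<bar> \<le> c" using assms by (auto simp: bounded_meas_def)
  show thesis
  proof (rule that[of "\<bar>c\<bar>"])
    fix x assume "x \<in> space M"
    from c[OF this] show "\<bar>f x\<bar> \<le> \<bar>c\<bar>" by linarith
  qed simp
qed

lemma bounded_meas_const [simp]: "bounded_meas M (\<lambda>_. c)"
  by (auto simp: bounded_meas_def)

lemma bounded_meas_mult:
  assumes "bounded_meas M f" "bounded_meas M g" shows "bounded_meas M (\<lambda>x. f x * g x)"
proof -
  obtain a where a: "0 \<le> a" "\<And>x. x \<in> space M \<Longrightarrow> \<bar>f x\<bar> \<le> a" using bounded_meas_bound[OF assms(1)] by blast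
  obtain b where b: "0 \<le> b" "\<And>x. x \<in> space M \<Longrightarrow> \<bar>g x\<bar> \<le> b" using bounded_meas_bound[OF assms(2)] by blast
  note [measurable] = assms
  show ?thesis
    by (rule bounded_measI[where c = "a * b"]) (auto simp: abs_mult intro!: mult_mono a b)
qed

lemma bounded_meas_add:
  assumes "bounded_meas M f" "bounded_meas M g" shows "bounded_meas M (\<lambda>x. f x + g x)"
proof -
  obtain a where a: "\<And>x. x \<in> space M \<Longrightarrow> \<bar>f x\<bar> \<le> a" using bounded_meas_bound[OF assms(1)] by blast
  obtain b where b: "\<And>x. x \<in> space M \<Longrightarrow> \<bar>g x\<bar> \<le> b" using bounded_meas_bound[OF assms(2)] by blast
  note [measurable] = assms
  show ?thesis
    by (rule bounded_measI[where c = "a + b"]) (auto intro!: order_trans[OF abs_triangle_ineq] add_mono a b)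
qed

lemma bounded_meas_diff:
  assumes "bounded_meas M f" "bounded_meas M g" shows "bounded_meas M (\<lambda>x. f x - g x)"
  using bounded_meas_add[OF assms(1) bounded_meas_mult[OF bounded_meas_const assms(2)], of "-1"] by simp

lemma bounded_meas_sum:
  assumes "\<And>i. i \<in> I \<Longrightarrow> bounded_meas M (f i)" shows "bounded_meas M (\<lambda>x. \<Sum>i\<in>I. f i x)"
  using assms by (induction I rule: infinite_finite_induct) (auto intro: bounded_meas_add)

lemma bounded_meas_indicator: "A \<in> sets M \<Longrightarrow> bounded_meas M (indicator A)"
  by (rule bounded_measI[where c = 1]) (auto simp: indicator_def)

lemma (in finite_measure) integrable_bounded_meas:
  assumes "bounded_meas M f" shows "integrable M f"
proof -
  obtain c where "\<And>x. x \<in> space M \<Longrightarrow> \<bar>f x\<bar> \<le> c" using bounded_meas_bound[OF assms] by blast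
  with assms show ?thesis by (intro integrable_const_bound[where B = c]) (auto simp: bounded_meas_def)
qed

text \<open>The discriminant criterion, which serves as an abstract Cauchy-Schwarz inequality for
  the form, for integrals over segments and for the L2 norm.\<close>

lemma quadratic_nonneg_imp:
  fixes p q r :: real
  assumes "\<And>t. 0 \<le> p + 2 * t * q + t\<^sup>2 * r" and "0 \<le> r"
  shows "q\<^sup>2 \<le> p * r"
proof (cases "r = 0")
  case True
  have "q = 0"
  proof (rule ccontr)
    assume "q \<noteq> 0"
    \<comment> \<open>This t gives p + 2 * t * q = -1.\<close>
    then show False using assms(1)[of "- (p + 1) / (2 * q)"] True by (simp add: field_simps)
  qed
  then show ?thesis using True by simp
next
  case False
  then have r: "0 < r" using assms by simp
  \<comment> \<open>The minimiser of the quadratic.\<close>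
  have "0 \<le> p + 2 * (- q / r) * q + (- q / r)\<^sup>2 * r" by (rule assms)
  also have "\<dots> = p - q\<^sup>2 / r" using r by (simp add: field_simps power2_eq_square)
  finally show ?thesis using r by (simp add: field_simps)
qed

text \<open>The function h must be continuous on the whole orthant, but it has to be the derivative
  only where x_i > 0: at x_i = 0 a two-sided difference quotient would see values of f outside E.
  Boundary faces are included, each in its own directions.\<close>

definition C1_bounded :: "(real^'n::finite \<Rightarrow> real) \<Rightarrow> bool" where
  "C1_bounded f \<longleftrightarrow> continuous_on orthant f \<and> bounded (f ` orthant) \<and>
    (\<forall>i. \<exists>h. continuous_on orthant h \<and> bounded (h ` orthant) \<and>
       (\<forall>x\<in>orthant. 0 < x $ i \<longrightarrow> ((\<lambda>t. f (x + t *\<^sub>R axis i 1)) has_real_derivative h x) (at 0)))"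

text \<open>On a face B the factor removes exactly the directions outside B, so the sum over all i
  sees just the gradient along the face.\<close>

definition grad :: "'n::finite \<Rightarrow> (real^'n \<Rightarrow> real) \<Rightarrow> real^'n \<Rightarrow> real" where
  "grad i f x = indicator {0<..} (x $ i) * partial_deriv i f x"

lemma continuous_on_orthant_measurable:
  "continuous_on orthant f \<Longrightarrow> f \<in> borel_measurable (orthant_algebra :: (real^'n::finite) measure)" for f :: "_ \<Rightarrow> real"
  by (rule borel_measurable_continuous_on_restrict)

lemma C1_boundedE:
  assumes "C1_bounded f"
  obtains h where "continuous_on orthant h" "bounded (h ` orthant)"
    "\<And>x. x \<in> orthant \<Longrightarrow> grad i f x = indicator {0<..} (x $ i) * h x"
    "\<And>x. x \<in> orthant \<Longrightarrow> 0 < x $ i \<Longrightarrow> ((\<lambda>t. f (x + t *\<^sub>R axis i 1)) has_real_derivative h x) (at 0)"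
proof -
  obtain h where h: "continuous_on orthant h" "bounded (h ` orthant)"
    "\<And>x. x \<in> orthant \<Longrightarrow> 0 < x $ i \<Longrightarrow> ((\<lambda>t. f (x + t *\<^sub>R axis i 1)) has_real_derivative h x) (at 0)"
    using assms unfolding C1_bounded_def by meson
  have "grad i f x = indicator {0<..} (x $ i) * h x" if "x \<in> orthant" for x
    using DERIV_imp_deriv[OF h(3)[OF that]] by (auto simp: grad_def partial_deriv_def indicator_def)
  with h show thesis using that by blast
qed

lemma C1_bounded_bounded_meas:
  assumes "C1_bounded f" shows "bounded_meas orthant_algebra f"
proof -
  obtain c where "\<forall>x\<in>orthant. \<bar>f x\<bar> \<le> c" using assms by (auto simp: C1_bounded_def bounded_iff)
  with assms show ?thesis
    by (intro bounded_measI[where c = c]) (auto simp: C1_bounded_def space_restrict_space continuous_on_orthant_measurable)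
qed

lemma C1_bounded_grad:
  assumes "C1_bounded f" shows "bounded_meas orthant_algebra (grad i f)"
proof -
  obtain h where h: "continuous_on orthant h" "bounded (h ` orthant)"
    "\<And>x. x \<in> orthant \<Longrightarrow> grad i f x = indicator {0<..} (x $ i) * h x"
    using C1_boundedE[OF assms] by metis
  obtain c where c: "\<forall>x\<in>orthant. \<bar>h x\<bar> \<le> c" using h(2) by (auto simp: bounded_iff)
  have "bounded_meas orthant_algebra (\<lambda>x. indicator {0<..} (x $ i) * h x)"
  proof (rule bounded_meas_mult)
    show "bounded_meas orthant_algebra h"
      using c h(1) by (intro bounded_measI[where c = c]) (auto simp: space_restrict_space continuous_on_orthant_measurable)
    show "bounded_meas orthant_algebra (\<lambda>x. indicator {0<..} (x $ i) :: real)"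
      using measurable_compose[OF vec_nth_borel_measurable_orthant borel_measurable_indicator[of "{0<..}" borel]]
      by (intro bounded_measI[where c = 1]) (auto simp: indicator_def)
  qed
  moreover have "grad i f \<in> borel_measurable orthant_algebra \<longleftrightarrow> (\<lambda>x. indicator {0<..} (x $ i) * h x) \<in> borel_measurable orthant_algebra"
    by (intro measurable_cong h(3)) (simp add: space_restrict_space)
  ultimately show ?thesis using h(3) by (auto simp: bounded_meas_def space_restrict_space)
qed

lemma C1_bounded_diff:
  assumes "C1_bounded f" "C1_bounded g" shows "C1_bounded (\<lambda>x. f x - g x)"
  unfolding C1_bounded_def
proof (intro conjI allI)
  show "continuous_on orthant (\<lambda>x. f x - g x)" using assms by (auto simp: C1_bounded_def intro: continuous_intros)
  show "bounded ((\<lambda>x. f x - g x) ` orthant)" using assms by (auto simp: C1_bounded_def intro: bounded_minus_comp)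
  fix i
  obtain h where h: "continuous_on orthant h" "bounded (h ` orthant)"
    "\<And>x. x \<in> orthant \<Longrightarrow> 0 < x $ i \<Longrightarrow> ((\<lambda>t. f (x + t *\<^sub>R axis i 1)) has_real_derivative h x) (at 0)"
    using assms(1) unfolding C1_bounded_def by meson
  obtain k where k: "continuous_on orthant k" "bounded (k ` orthant)"
    "\<And>x. x \<in> orthant \<Longrightarrow> 0 < x $ i \<Longrightarrow> ((\<lambda>t. g (x + t *\<^sub>R axis i 1)) has_real_derivative k x) (at 0)"
    using assms(2) unfolding C1_bounded_def by meson
  show "\<exists>l. continuous_on orthant l \<and> bounded (l ` orthant) \<and>
       (\<forall>x\<in>orthant. 0 < x $ i \<longrightarrow> ((\<lambda>t. f (x + t *\<^sub>R axis i 1) - g (x + t *\<^sub>R axis i 1)) has_real_derivative l x) (at 0))"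
    using h k by (intro exI[of _ "\<lambda>x. h x - k x"]) (auto intro!: continuous_intros bounded_minus_comp derivative_intros)
qed

lemma grad_diff:
  assumes "C1_bounded f" "C1_bounded g" "x \<in> orthant"
  shows "grad i (\<lambda>x. f x - g x) x = grad i f x - grad i g x"
proof (cases "0 < x $ i")
  case True
  obtain h where h: "((\<lambda>t. f (x + t *\<^sub>R axis i 1)) has_real_derivative h x) (at 0)"
    using assms True unfolding C1_bounded_def by meson
  obtain k where k: "((\<lambda>t. g (x + t *\<^sub>R axis i 1)) has_real_derivative k x) (at 0)"
    using assms True unfolding C1_bounded_def by meson
  from DERIV_imp_deriv[OF h] DERIV_imp_deriv[OF k] DERIV_imp_deriv[OF DERIV_diff[OF h k]] True
  show ?thesis by (simp add: grad_def partial_deriv_def)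
qed (simp add: grad_def)

text \<open>The fundamental theorem in this form needs the derivative only inside the interval, so a
  = 0 is allowed. This is what ties the boundary values of f to the interior.\<close>

lemma grad_has_integral:
  assumes f: "C1_bounded f" and x: "x \<in> orthant" and ab: "0 \<le> a" "a \<le> b"
  shows "((\<lambda>s. grad i f (upd_coord x i s)) has_integral f (upd_coord x i b) - f (upd_coord x i a)) {a..b}"
proof (rule fundamental_theorem_of_calculus_interior[OF ab(2)])
  have "continuous_on {a..b} (\<lambda>s. upd_coord x i s)"
  proof -
    have "continuous_on {a..b} (\<lambda>s. upd_coord x i 0 + s *\<^sub>R axis i 1)" by (intro continuous_intros)
    then show ?thesis by (simp add: upd_coord_add_axis)
  qed
  moreover have "(\<lambda>s. upd_coord x i s) ` {a..b} \<subseteq> orthant"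
    using upd_coord_orthant[OF x] ab by force
  moreover have "continuous_on orthant f" using f unfolding C1_bounded_def by blast
  ultimately show "continuous_on {a..b} (\<lambda>s. f (upd_coord x i s))"
    by (metis continuous_on_compose2)
  fix s assume s: "s \<in> {a<..<b}"
  obtain h where h: "\<And>x. x \<in> orthant \<Longrightarrow> grad i f x = indicator {0<..} (x $ i) * h x"
    "\<And>x. x \<in> orthant \<Longrightarrow> 0 < x $ i \<Longrightarrow> ((\<lambda>t. f (x + t *\<^sub>R axis i 1)) has_real_derivative h x) (at 0)"
    using C1_boundedE[OF f] by metis
  let ?y = "upd_coord x i s"
  have y: "?y \<in> orthant" "0 < ?y $ i" using x s ab by auto
  have "((\<lambda>t. f (upd_coord x i (s + t))) has_real_derivative grad i f ?y) (at 0)"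
    using h(2)[OF y] h(1)[OF y(1)] y(2) by (simp add: upd_coord_add_axis)
  then have "((\<lambda>t. f (upd_coord x i t)) has_real_derivative grad i f ?y) (at s)"
    using DERIV_shift[of "\<lambda>t. f (upd_coord x i t)" "grad i f ?y" 0 s] by (simp add: add.commute)
  then show "((\<lambda>s. f (upd_coord x i s)) has_vector_derivative grad i f ?y) (at s)"
    by (simp add: has_real_derivative_iff_has_vector_derivative)
qed

section \<open>The form as one weighted energy\<close>

locale weighted_orthant =
  fixes \<beta> :: real and \<rho> :: "real^'n::finite \<Rightarrow> real"
  assumes beta_pos: "0 < \<beta>"
    and rho_AE_pos: "AE x in ref_measure \<beta>. 0 < \<rho> x"
    and rho_continuous: "continuous_on orthant \<rho>"
    and finite_mu: "finite_measure (weighted_measure \<beta> \<rho>)"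
begin

abbreviation "\<mu> \<equiv> weighted_measure \<beta> \<rho>"
abbreviation "m \<equiv> ref_measure \<beta> :: (real^'n) measure"

sublocale finite_measure \<mu> by (rule finite_mu)
sublocale m: sigma_finite_measure m using beta_pos by (intro sigma_finite_ref_measure) simp

lemma rho_measurable [measurable]: "\<rho> \<in> borel_measurable orthant_algebra"
  by (rule continuous_on_orthant_measurable[OF rho_continuous])

text \<open>By continuity a negative value persists on a relatively open set, and such a set is not
  null.\<close>

lemma rho_nonneg:
  assumes "x \<in> orthant" shows "0 \<le> \<rho> x"
proof (rule ccontr)
  let ?U = "orthant \<inter> \<rho> -` {..<0}"
  assume "\<not> 0 \<le> \<rho> x"
  then have "?U \<noteq> {}" using assms by auto
  moreover have o: "openin (top_of_set orthant) ?U"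
    using continuous_openin_preimage_gen[OF rho_continuous, of "{..<0}"] by simp
  ultimately have pos: "emeasure m ?U > 0" using beta_pos by (intro ref_measure_open_pos) auto
  moreover have "?U \<in> sets m"
    using measurable_sets[OF rho_measurable, of "{..<0}"] by (simp add: space_restrict_space Int_commute)
  moreover have "AE x in m. x \<notin> ?U" using rho_AE_pos by eventually_elim auto
  ultimately have "emeasure m ?U = 0"
    by (subst (asm) AE_iff_measurable[where N = ?U]) auto
  with pos show False by simp
qed

lemma nn_integral_mu:
  "f \<in> borel_measurable orthant_algebra \<Longrightarrow> (\<integral>\<^sup>+x. f x \<partial>\<mu>) = (\<integral>\<^sup>+x. ennreal (\<rho> x) * f x \<partial>m)"
  unfolding weighted_measure_def by (subst nn_integral_density) auto

lemma AE_mu_iff: "(AE x in \<mu>. Q x) \<longleftrightarrow> (AE x in m. Q x)"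
proof -
  have "(AE x in \<mu>. Q x) \<longleftrightarrow> (AE x in m. 0 < \<rho> x \<longrightarrow> Q x)"
    unfolding weighted_measure_def by (subst AE_density) auto
  also have "\<dots> \<longleftrightarrow> (AE x in m. Q x)"
    using rho_AE_pos by (auto elim: AE_mp)
  finally show ?thesis .
qed

lemma bounded_meas_mu [simp]: "bounded_meas \<mu> f \<longleftrightarrow> bounded_meas orthant_algebra f"
  by (simp add: bounded_meas_def space_restrict_space)

definition G :: "(real^'n \<Rightarrow> real) \<Rightarrow> (real^'n \<Rightarrow> real) \<Rightarrow> real" where
  "G f g = (\<Sum>i\<in>UNIV. \<integral>x. grad i f x * grad i g x \<partial>\<mu>)"

text \<open>The faces partition E, and on each of them the components of \<open>grad\<close> in
  foreign directions vanish.\<close>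

lemma pre_form_eq:
  assumes f: "C1_bounded f" and g: "C1_bounded g"
  shows "pre_form \<beta> \<rho> f g = G f g"
proof -
  define F where "F x = (\<Sum>i\<in>UNIV. grad i f x * grad i g x)" for x
  have bF: "bounded_meas orthant_algebra F"
    unfolding F_def by (intro bounded_meas_sum bounded_meas_mult C1_bounded_grad f g)
  then have [measurable]: "F \<in> borel_measurable orthant_algebra" by (rule bounded_meas_measurable)
  have face: "(LINT x:face B|weighted_face_measure \<beta> \<rho> B. (\<Sum>i\<in>B. partial_deriv i f x * partial_deriv i g x))
      = (\<integral>x. indicator (face B) x * F x \<partial>\<mu>)" for B :: "'n set"
  proof -
    let ?N = "weighted_face_measure \<beta> \<rho> B"
    have sN: "sets ?N = sets orthant_algebra" by (simp add: weighted_face_measure_def)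
    have "indicator (face B) x * (\<Sum>i\<in>B. partial_deriv i f x * partial_deriv i g x) = indicator (face B) x * F x" for x
    proof (cases "x \<in> face B")
      case True
      have "F x = (\<Sum>i\<in>B. grad i f x * grad i g x)"
        unfolding F_def by (rule sum.mono_neutral_right) (use True in \<open>auto simp: face_def grad_def\<close>)
      also have "\<dots> = (\<Sum>i\<in>B. partial_deriv i f x * partial_deriv i g x)"
        by (rule sum.cong) (use True in \<open>auto simp: face_def grad_def\<close>)
      finally show ?thesis by simp
    qed simp
    note eq = this
    have "(LINT x:face B|?N. (\<Sum>i\<in>B. partial_deriv i f x * partial_deriv i g x)) = (\<integral>x. indicator (face B) x *\<^sub>R F x \<partial>?N)"
      by (simp only: set_lebesgue_integral_def real_scaleR_def eq)
    also have "\<dots> = (\<integral>x. F x \<partial>density ?N (\<lambda>x. ennreal (indicator (face B) x)))"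
      by (rule integral_density[symmetric]) (auto simp: sN measurable_cong_sets[OF sN refl])
    also have "\<dots> = (\<integral>x. F x \<partial>density \<mu> (\<lambda>x. ennreal (indicator (face B) x)))"
      by (simp add: ennreal_indicator density_weighted_face_measure[OF rho_measurable])
    also have "\<dots> = (\<integral>x. indicator (face B) x *\<^sub>R F x \<partial>\<mu>)"
      by (rule integral_density) auto
    finally show ?thesis by simp
  qed
  \<comment> \<open>The origin may be added to the sum over faces, since every \<open>grad\<close>
    vanishes there.\<close>
  have F0: "indicator (face {}) x * F x = 0" for x
    by (cases "x \<in> face {}") (simp_all add: F_def face_def grad_def)
  have "pre_form \<beta> \<rho> f g = (\<Sum>B\<in>{B. B \<noteq> {}}. \<integral>x. indicator (face B) x * F x \<partial>\<mu>)"
    unfolding pre_form_def by (intro sum.cong refl face)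
  also have "\<dots> = (\<Sum>B\<in>UNIV. \<integral>x. indicator (face B) x * F x \<partial>\<mu>)"
    by (rule sum.mono_neutral_left) (auto simp: F0)
  also have "\<dots> = (\<integral>x. (\<Sum>B\<in>UNIV. indicator (face B) x * F x) \<partial>\<mu>)"
    by (rule Bochner_Integration.integral_sum[symmetric]) (auto intro!: integrable_bounded_meas bounded_meas_mult bounded_meas_indicator bF)
  also have "\<dots> = (\<integral>x. F x \<partial>\<mu>)"
  proof (rule Bochner_Integration.integral_cong[OF refl])
    fix x assume "x \<in> space \<mu>"
    then have x: "x \<in> face {i. 0 < x $ i}" by (intro face_cover) simp
    have "(\<Sum>B\<in>UNIV. indicator (face B) x * F x) = (\<Sum>B\<in>UNIV. if B = {i. 0 < x $ i} then F x else 0)"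
      by (rule sum.cong) (use x face_disjoint in \<open>auto simp: indicator_def\<close>)
    then show "(\<Sum>B\<in>UNIV. indicator (face B) x * F x) = F x" by simp
  qed
  also have "\<dots> = G f g"
    unfolding F_def G_def by (rule Bochner_Integration.integral_sum) (auto intro!: integrable_bounded_meas bounded_meas_mult C1_bounded_grad f g)
  finally show ?thesis .
qed

lemma G_commute: "G f g = G g f"
  by (simp add: G_def mult.commute)

lemma G_integrable: "C1_bounded f \<Longrightarrow> C1_bounded g \<Longrightarrow> integrable \<mu> (\<lambda>x. grad i f x * grad i g x)"
  by (auto intro!: integrable_bounded_meas bounded_meas_mult C1_bounded_grad)

lemma G_diff_left:
  assumes "C1_bounded f" "C1_bounded g" "C1_bounded h"
  shows "G (\<lambda>x. f x - g x) h = G f h - G g h"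
proof -
  have "(\<integral>x. grad i (\<lambda>x. f x - g x) x * grad i h x \<partial>\<mu>) = (\<integral>x. grad i f x * grad i h x \<partial>\<mu>) - (\<integral>x. grad i g x * grad i h x \<partial>\<mu>)" for i
    by (subst Bochner_Integration.integral_diff[symmetric])
      (auto intro!: G_integrable assms Bochner_Integration.integral_cong simp: grad_diff assms left_diff_distrib)
  then show ?thesis by (simp add: G_def sum_subtractf)
qed

lemma G_diff_right:
  assumes "C1_bounded f" "C1_bounded g" "C1_bounded h"
  shows "G h (\<lambda>x. f x - g x) = G h f - G h g"
  using G_diff_left[OF assms] by (simp add: G_commute[of h])

lemma G_nonneg: "0 \<le> G f f"
  by (auto simp: G_def intro!: sum_nonneg integral_nonneg_AE)

lemma G_Cauchy_Schwarz:
  assumes "C1_bounded f" "C1_bounded g"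
  shows "(G f g)\<^sup>2 \<le> G f f * G g g"
proof (rule quadratic_nonneg_imp[OF _ G_nonneg])
  fix t
  have "0 \<le> (\<Sum>i\<in>UNIV. \<integral>x. (grad i f x + t * grad i g x)\<^sup>2 \<partial>\<mu>)"
    by (intro sum_nonneg integral_nonneg_AE) auto
  also have "\<dots> = (\<Sum>i\<in>UNIV. (\<integral>x. grad i f x * grad i f x \<partial>\<mu>) + 2 * t * (\<integral>x. grad i f x * grad i g x \<partial>\<mu>)
        + t\<^sup>2 * (\<integral>x. grad i g x * grad i g x \<partial>\<mu>))"
  proof (rule sum.cong[OF refl])
    fix i
    show "(\<integral>x. (grad i f x + t * grad i g x)\<^sup>2 \<partial>\<mu>) =
      (\<integral>x. grad i f x * grad i f x \<partial>\<mu>) + 2 * t * (\<integral>x. grad i f x * grad i g x \<partial>\<mu>)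
        + t\<^sup>2 * (\<integral>x. grad i g x * grad i g x \<partial>\<mu>)"
  proof -
    have "(\<lambda>x. (grad i f x + t * grad i g x)\<^sup>2) = (\<lambda>x. grad i f x * grad i f x + 2 * t * (grad i f x * grad i g x) + t\<^sup>2 * (grad i g x * grad i g x))"
      by (auto simp: power2_eq_square algebra_simps)
    then show ?thesis using G_integrable assms by (simp add: integral_mult_right)
  qed
  qed
  also have "(\<Sum>i\<in>UNIV. (\<integral>x. grad i f x * grad i f x \<partial>\<mu>) + 2 * t * (\<integral>x. grad i f x * grad i g x \<partial>\<mu>)
        + t\<^sup>2 * (\<integral>x. grad i g x * grad i g x \<partial>\<mu>)) = G f f + 2 * t * G f g + t\<^sup>2 * G g g"
    by (simp add: G_def sum.distrib sum_distrib_left)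
  finally show "0 \<le> G f f + 2 * t * G f g + t\<^sup>2 * G g g" .
qed

end

section \<open>Test functions are continuously differentiable up to the boundary\<close>

lemma closed_orthant: "closed (orthant :: (real^'n) set)"
  unfolding orthant_def by (intro closed_Collect_all closed_Collect_le continuous_intros)

lemma open_face_UNIV: "open (face UNIV :: (real^'n::finite) set)"
proof -
  have "face UNIV = (\<Inter>i. {x :: real^'n. 0 < x $ i})" by (auto simp: face_def)
  then show ?thesis by (auto intro!: open_INT open_Collect_less continuous_intros)
qed

lemma closure_face_UNIV: "closure (face UNIV) = (orthant :: (real^'n::finite) set)"
proof
  show "closure (face UNIV) \<subseteq> (orthant :: (real^'n) set)"
    by (rule closure_minimal[OF face_subset_orthant closed_orthant])
  show "(orthant :: (real^'n) set) \<subseteq> closure (face UNIV)"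
  proof
    fix x :: "real^'n" assume x: "x \<in> orthant"
    have "(\<lambda>k. x + (1 / real (Suc k)) *\<^sub>R (\<chi> i. 1)) \<longlonglongrightarrow> x + 0 *\<^sub>R (\<chi> i. 1)"
      using LIMSEQ_inverse_real_of_nat by (intro tendsto_intros) (simp add: inverse_eq_divide)
    moreover have "x + (1 / real (Suc k)) *\<^sub>R (\<chi> i. 1) \<in> face UNIV" for k
      using x by (auto simp: face_def orthant_def intro!: add_nonneg_pos)
    ultimately show "x \<in> closure (face UNIV)"
      unfolding closure_sequential by (intro exI[of _ "\<lambda>k. x + (1 / real (Suc k)) *\<^sub>R (\<chi> i. 1)"]) auto
  qed
qed

text \<open>Partial derivatives are only known to vanish off K in the interior; density of the
  interior carries the bound to the boundary.\<close>

lemma bounded_on_orthant: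
  fixes h :: "real^'n::finite \<Rightarrow> real"
  assumes h: "continuous_on orthant h" and K: "compact K"
    and z: "\<And>x. x \<in> face UNIV \<Longrightarrow> x \<notin> K \<Longrightarrow> h x = 0"
  shows "bounded (h ` orthant)"
proof -
  have "compact (h ` (orthant \<inter> K))"
    using closed_Int_compact[OF closed_orthant K] h by (intro compact_continuous_image) (auto intro: continuous_on_subset)
  then obtain c where c: "\<And>x. x \<in> orthant \<inter> K \<Longrightarrow> \<bar>h x\<bar> \<le> c"
    using compact_imp_bounded[of "h ` (orthant \<inter> K)"] by (auto simp: bounded_iff)
  have c': "\<bar>h x\<bar> \<le> \<bar>c\<bar>" if "x \<in> face UNIV" for x
    using c[of x] z[OF that] that face_subset_orthant by (cases "x \<in> K") force+
  have "h ` closure (face UNIV) \<subseteq> {- \<bar>c\<bar>..\<bar>c\<bar>}"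
  proof (rule image_closure_subset)
    show "continuous_on (closure (face UNIV)) h" using h unfolding closure_face_UNIV .
    show "h ` face UNIV \<subseteq> {- \<bar>c\<bar>..\<bar>c\<bar>}" using c' by (force simp: abs_le_iff)
  qed simp
  then show ?thesis using bounded_subset[OF bounded_closed_interval] by (auto simp: closure_face_UNIV)
qed

text \<open>The definition gives derivatives in the interior and a continuous extension h, but says
  nothing about derivatives along the boundary faces. Integrating h along coordinate lines gives an
  identity that passes to the closure, and differentiating it there shows that h is the derivative
  on the faces as well.\<close>

lemma Cc2_C1_bounded:
  fixes f :: "real^'n::finite \<Rightarrow> real"
  assumes f: "f \<in> Cc2_orthant" shows "C1_bounded f"
proof -
  let ?e = "\<lambda>i. axis i 1 :: real^'n"
  have cont: "continuous_on orthant f" using f by (auto simp: Cc2_orthant_def Ck_orthant_def)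
  define K where "K = closure {x \<in> orthant. f x \<noteq> 0}"
  have K: "compact K" using f by (auto simp: Cc2_orthant_def K_def)
  have fK: "f x = 0" if "x \<in> orthant" "x \<notin> K" for x
    using that closure_subset[of "{x \<in> orthant. f x \<noteq> 0}"] by (auto simp: K_def)
  have bf: "bounded (f ` orthant)"
    by (rule bounded_on_orthant[OF cont K]) (use fK face_subset_orthant in blast)
  have dirs: "Ck_dirs 2 UNIV (face UNIV) f" using f by (auto simp: Cc2_orthant_def Ck_orthant_def)
  have diff: "(\<lambda>t. f (x + t *\<^sub>R ?e i)) differentiable (at 0)" if "x \<in> face UNIV" for x i
    using dirs[unfolded Ck_dirs_def, rule_format, of "[]"] that by (auto simp: iter_partial_def)
  have ex: "\<exists>h. continuous_on orthant h \<and> (\<forall>x\<in>face UNIV. h x = partial_deriv i f x)" for i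
  proof -
    have "\<forall>is. length is \<le> 2 \<longrightarrow> extends_continuously (iter_partial is f)"
      using f by (simp add: Cc2_orthant_def Ck_orthant_def)
    then have "extends_continuously (iter_partial [i] f)" by simp
    then show ?thesis by (simp add: extends_continuously_def iter_partial_def)
  qed
  show ?thesis
    unfolding C1_bounded_def
  proof (intro conjI allI cont bf)
    fix i
    obtain h where h: "continuous_on orthant h" "\<And>x. x \<in> face UNIV \<Longrightarrow> h x = partial_deriv i f x"
      using ex by blast
    have der: "((\<lambda>t. f (x + t *\<^sub>R ?e i)) has_real_derivative h x) (at 0)" if "x \<in> face UNIV" for x
      using diff[OF that, of i] DERIV_deriv_iff_real_differentiable h(2)[OF that] by (simp add: partial_deriv_def)
    have h0: "h x = 0" if x: "x \<in> face UNIV" "x \<notin> K" for x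
    proof -
      \<comment> \<open>Near x the function is identically 0, hence its derivative is 0 too.\<close>
      have "open (face UNIV - K)" by (intro open_Diff open_face_UNIV compact_imp_closed K)
      moreover have "((\<lambda>t. x + t *\<^sub>R ?e i) \<longlongrightarrow> x + 0 *\<^sub>R ?e i) (at 0)" by (intro tendsto_intros)
      ultimately have "\<forall>\<^sub>F t in at 0. x + t *\<^sub>R ?e i \<in> face UNIV - K"
        using x by (intro topological_tendstoD) auto
      then have ev: "\<forall>\<^sub>F t in at 0. f (x + t *\<^sub>R ?e i) = 0"
        by eventually_elim (use fK face_subset_orthant in blast)
      have "((\<lambda>t. f (x + t *\<^sub>R ?e i)) has_real_derivative 0) (at 0)"
      proof (rule DERIV_cong_ev[THEN iffD2, OF refl _ refl DERIV_const[of 0]])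
        show "\<forall>\<^sub>F t in nhds 0. f (x + t *\<^sub>R ?e i) = 0"
          using ev fK[of x] x face_subset_orthant[of UNIV] by (auto simp: eventually_nhds_conv_at)
      qed
      with der[OF x(1)] show ?thesis by (rule DERIV_unique)
    qed
    have bh: "bounded (h ` orthant)" by (rule bounded_on_orthant[OF h(1) K h0])
    have line: "continuous_on S (\<lambda>\<tau>. h (x + \<tau> *\<^sub>R ?e i))" if "x \<in> orthant" "S \<subseteq> {0..}" for x S
      by (rule continuous_on_compose2[OF h(1)]) (use that in \<open>auto intro!: continuous_intros\<close>)
    have ftc: "f (x + t *\<^sub>R ?e i) - f x = integral {0..t} (\<lambda>\<tau>. h (x + \<tau> *\<^sub>R ?e i))"
      if x: "x \<in> face UNIV" and t: "0 \<le> t" for x t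
    proof -
      have "((\<lambda>\<tau>. h (x + \<tau> *\<^sub>R ?e i)) has_integral f (x + t *\<^sub>R ?e i) - f (x + 0 *\<^sub>R ?e i)) {0..t}"
      proof (rule fundamental_theorem_of_calculus[OF t])
        fix s assume s: "s \<in> {0..t}"
        have "x + s *\<^sub>R ?e i \<in> face UNIV"
          using x s by (auto simp: face_def axis_def add_pos_nonneg)
        from der[OF this] have "((\<lambda>u. f (x + (u + s) *\<^sub>R ?e i)) has_real_derivative h (x + s *\<^sub>R ?e i)) (at 0)"
          by (simp add: algebra_simps)
        then have "((\<lambda>u. f (x + u *\<^sub>R ?e i)) has_real_derivative h (x + s *\<^sub>R ?e i)) (at s)"
          using DERIV_shift[of "\<lambda>u. f (x + u *\<^sub>R ?e i)" "h (x + s *\<^sub>R ?e i)" 0 s] by simp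
        then show "((\<lambda>u. f (x + u *\<^sub>R ?e i)) has_vector_derivative h (x + s *\<^sub>R ?e i)) (at s within {0..t})"
          by (simp add: has_real_derivative_iff_has_vector_derivative has_vector_derivative_at_within)
      qed
      then show ?thesis by (simp add: integral_unique)
    qed
    have ftc': "f (x + t *\<^sub>R ?e i) - f x = integral {0..t} (\<lambda>\<tau>. h (x + \<tau> *\<^sub>R ?e i))"
      if x: "x \<in> orthant" and t: "0 \<le> t" for x t
    proof -
      \<comment> \<open>Both sides of the identity are continuous in x, so it extends from the
        interior to the orthant.\<close>
      let ?H = "\<lambda>x. f (x + t *\<^sub>R ?e i) - f x - integral (cbox 0 t) (\<lambda>\<tau>. h (x + \<tau> *\<^sub>R ?e i))"
      have "continuous_on (closure (face UNIV)) ?H"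
        unfolding closure_face_UNIV
      proof (intro continuous_on_diff cont integral_continuous_on_param)
        show "continuous_on orthant (\<lambda>x. f (x + t *\<^sub>R ?e i))"
          by (rule continuous_on_compose2[OF cont]) (use t in \<open>auto intro!: continuous_intros\<close>)
        show "continuous_on (orthant \<times> cbox 0 t) (\<lambda>(x, \<tau>). h (x + \<tau> *\<^sub>R ?e i))"
          unfolding case_prod_beta
          by (rule continuous_on_compose2[OF h(1)]) (auto intro!: continuous_intros)
      qed
      moreover have "?H x = 0" if "x \<in> face UNIV" for x using ftc[OF that t] by simp
      ultimately have "?H x = 0"
        by (rule continuous_constant_on_closure) (use x closure_face_UNIV in auto)
      then show ?thesis by simp
    qed
    show "\<exists>h. continuous_on orthant h \<and> bounded (h ` orthant) \<and>
        (\<forall>x\<in>orthant. 0 < x $ i \<longrightarrow> ((\<lambda>t. f (x + t *\<^sub>R ?e i)) has_real_derivative h x) (at 0))"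
    proof (intro exI[of _ h] conjI h(1) bh ballI impI)
      fix x :: "real^'n" assume x: "x \<in> orthant" "0 < x $ i"
      define y where "y = upd_coord x i 0"
      have y: "y \<in> orthant" using x by (simp add: y_def)
      have yx: "y + t *\<^sub>R ?e i = upd_coord x i t" for t by (simp add: y_def upd_coord_add_axis)
      have xx: "upd_coord x i (x $ i) = x" by (simp add: vec_eq_iff)
      \<comment> \<open>One unit of room makes x_i an interior point of the interval, so that the
        derivative is two-sided.\<close>
      let ?b = "x $ i + 1"
      have "((\<lambda>u. integral {0..u} (\<lambda>\<tau>. h (y + \<tau> *\<^sub>R ?e i))) has_real_derivative h (y + (x $ i) *\<^sub>R ?e i)) (at (x $ i) within {0..?b})"
        by (rule integral_has_real_derivative) (use x line[OF y] in auto)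
      moreover have "at (x $ i) within {0..?b} = at (x $ i)"
        by (rule at_within_interior) (use x in auto)
      ultimately have "((\<lambda>u. f y + integral {0..u} (\<lambda>\<tau>. h (y + \<tau> *\<^sub>R ?e i))) has_real_derivative h x) (at (x $ i))"
        by (auto simp: yx xx intro!: derivative_eq_intros)
      moreover have "\<forall>\<^sub>F u in at (x $ i). f y + integral {0..u} (\<lambda>\<tau>. h (y + \<tau> *\<^sub>R ?e i)) = f (y + u *\<^sub>R ?e i)"
      proof -
        have "\<forall>\<^sub>F u in at (x $ i). 0 < u"
          by (rule order_tendstoD(1)[OF tendsto_ident_at x(2)])
        then show ?thesis by eventually_elim (use ftc'[OF y] in \<open>simp add: algebra_simps\<close>)
      qed
      ultimately have "((\<lambda>u. f (y + u *\<^sub>R ?e i)) has_real_derivative h x) (at (x $ i))"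
        using ftc'[OF y, of "x $ i"] x
        by (subst DERIV_cong_ev[OF refl _ refl, symmetric]) (auto simp: eventually_nhds_conv_at)
      then have "((\<lambda>u. f (y + (u + x $ i) *\<^sub>R ?e i)) has_real_derivative h x) (at 0)"
        using DERIV_shift[of "\<lambda>u. f (y + u *\<^sub>R ?e i)" "h x" 0 "x $ i"] by simp
      moreover have "y + (u + x $ i) *\<^sub>R ?e i = x + u *\<^sub>R ?e i" for u
        unfolding yx by (simp add: upd_coord_add_axis add.commute)
      ultimately show "((\<lambda>t. f (x + t *\<^sub>R ?e i)) has_real_derivative h x) (at 0)" by simp
    qed
  qed
qed

section \<open>Closability\<close>

text \<open>Cauchy-Schwarz against the constant 1. The increment comes as a gauge integral from the
  fundamental theorem, while the bound is needed as a Lebesgue integral for Tonelli.\<close>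

lemma has_integral_power2_le:
  fixes w :: "real \<Rightarrow> real"
  assumes [measurable]: "w \<in> borel_measurable borel" and c: "\<And>s. \<bar>w s\<bar> \<le> c"
    and I: "(w has_integral I) {a..b}" and ab: "a \<le> b"
  shows "ennreal (I\<^sup>2) \<le> ennreal (b - a) * (\<integral>\<^sup>+s. indicator {a..b} s * ennreal ((w s)\<^sup>2) \<partial>lborel)"
proof -
  let ?i = "\<lambda>s. indicator {a..b} s :: real"
  have fin: "emeasure lborel {a..b} < \<infinity>" using ab by simp
  have int: "integrable lborel (\<lambda>s. ?i s * g s)" if [measurable]: "g \<in> borel_measurable borel" and "\<And>s. \<bar>g s\<bar> \<le> d" for g d
  proof (rule Bochner_Integration.integrable_bound)
    show "integrable lborel (\<lambda>s. ?i s * d)"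
      using fin by (intro integrable_mult_left integrable_real_indicator) auto
    have "\<bar>g s\<bar> \<le> \<bar>d\<bar>" for s using that(2)[of s] by linarith
    then show "AE s in lborel. norm (?i s * g s) \<le> norm (?i s * d)"
      by (auto simp: abs_mult indicator_def)
  qed measurable
  have w2: "\<bar>(w s)\<^sup>2\<bar> \<le> c\<^sup>2" for s using power_mono[OF c[of s], of 2] by simp
  have i1: "integrable lborel (\<lambda>s. ?i s * w s)" by (rule int[OF _ c]) simp
  have i2: "integrable lborel (\<lambda>s. ?i s * (w s)\<^sup>2)" by (rule int[OF _ w2]) simp
  define p where "p = (\<integral>s. ?i s * (w s)\<^sup>2 \<partial>lborel)"
  have "set_integrable lborel {a..b} w" using i1 by (simp add: set_integrable_def)
  from set_borel_integral_eq_integral(2)[OF this] I have q: "(\<integral>s. ?i s * w s \<partial>lborel) = I"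
    by (simp add: set_lebesgue_integral_def integral_unique)
  have "I\<^sup>2 \<le> p * (b - a)"
  proof (rule quadratic_nonneg_imp)
    fix t
    have "0 \<le> (\<integral>s. ?i s * (w s + t)\<^sup>2 \<partial>lborel)" by (intro integral_nonneg_AE) auto
    also have "\<dots> = (\<integral>s. ?i s * (w s)\<^sup>2 + 2 * t * (?i s * w s) + t\<^sup>2 * ?i s \<partial>lborel)"
      by (intro Bochner_Integration.integral_cong refl) (simp add: power2_eq_square algebra_simps)
    also have "\<dots> = p + 2 * t * I + t\<^sup>2 * (b - a)"
      using i1 i2 ab integrable_real_indicator[OF _ fin] by (simp add: p_def q)
    finally show "0 \<le> p + 2 * t * I + t\<^sup>2 * (b - a)" .
  qed (use ab in simp)
  then have "ennreal (I\<^sup>2) \<le> ennreal (b - a) * ennreal p"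
    using ab by (subst ennreal_mult'[symmetric]) (auto intro!: ennreal_leI simp: mult.commute p_def integral_nonneg_AE)
  also have "ennreal p = (\<integral>\<^sup>+s. ennreal (?i s * (w s)\<^sup>2) \<partial>lborel)"
    unfolding p_def by (rule nn_integral_eq_integral[symmetric]) (use i2 in auto)
  also have "\<dots> = (\<integral>\<^sup>+s. indicator {a..b} s * ennreal ((w s)\<^sup>2) \<partial>lborel)"
    by (intro nn_integral_cong) (auto simp: indicator_def)
  finally show ?thesis .
qed

text \<open>The \<open>max 0\<close> keeps the integrand Borel on the whole line; on {a..b} it
  changes nothing.\<close>

lemma grad_line_power2_le:
  assumes f: "C1_bounded f" and x: "x \<in> orthant" and ab: "0 \<le> a" "a \<le> b"
  shows "ennreal ((f (upd_coord x i b) - f (upd_coord x i a))\<^sup>2) \<le>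
    ennreal (b - a) * (\<integral>\<^sup>+s. indicator {a..b} s * ennreal ((grad i f (upd_coord x i (max 0 s)))\<^sup>2) \<partial>lborel)"
proof -
  obtain c where c: "\<And>x. x \<in> orthant \<Longrightarrow> \<bar>grad i f x\<bar> \<le> c"
    using bounded_meas_bound[OF C1_bounded_grad[OF f, of i]] by (auto simp: space_restrict_space)
  have m: "(\<lambda>s. upd_coord x i (max 0 s)) \<in> borel \<rightarrow>\<^sub>M orthant_algebra"
    by (rule measurable_upd_coord) (use x in \<open>auto simp: space_restrict_space intro!: measurable_restrict_space2\<close>)
  show ?thesis
  proof (rule has_integral_power2_le[OF _ _ _ ab(2)])
    show "(\<lambda>s. grad i f (upd_coord x i (max 0 s))) \<in> borel_measurable borel"
      by (rule measurable_compose[OF m bounded_meas_measurable[OF C1_bounded_grad[OF f]]])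
    show "\<bar>grad i f (upd_coord x i (max 0 s))\<bar> \<le> c" for s by (rule c) (use x in auto)
    show "((\<lambda>s. grad i f (upd_coord x i (max 0 s))) has_integral f (upd_coord x i b) - f (upd_coord x i a)) {a..b}"
      using grad_has_integral[OF f x ab, of i] by (rule has_integral_eq[rotated]) (use ab in \<open>simp add: max_absorb2\<close>)
  qed
qed

context weighted_orthant
begin

text \<open>On a window \<open>\<rho>\<close> is bounded away from zero along a whole segment in direction \<open>i\<close>, so the
  form controls difference quotients in \<open>L\<^sup>2(m)\<close>; the windows exhaust the set of positive \<open>\<rho>\<close>.\<close>

definition window :: "'n \<Rightarrow> nat \<Rightarrow> (real^'n) set" where
  "window i N = {x \<in> orthant. 0 < x $ i \<and> \<rho> x \<le> real N \<and>
     (\<forall>\<tau>\<in>{0..1 / real N}. 1 / real N \<le> \<rho> (x + \<tau> *\<^sub>R axis i 1))}"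

text \<open>The uncountable intersection over \<tau> is harmless because each of its members is
  closed.\<close>

lemma window_measurable [measurable]: "window i N \<in> sets orthant_algebra"
proof -
  define S where "S = (\<Inter>\<tau>\<in>{0..1 / real N}. orthant \<inter> (\<lambda>x. \<rho> (x + \<tau> *\<^sub>R axis i 1)) -` {1 / real N..})"
  have "closed S"
    unfolding S_def
  proof (intro closed_INT ballI)
    fix \<tau> assume "\<tau> \<in> {0..1 / real N}"
    then have "continuous_on orthant (\<lambda>x. \<rho> (x + \<tau> *\<^sub>R axis i 1))"
      by (intro continuous_on_compose2[OF rho_continuous]) (auto intro!: continuous_intros)
    then show "closed (orthant \<inter> (\<lambda>x. \<rho> (x + \<tau> *\<^sub>R axis i 1)) -` {1 / real N..})"
      by (rule continuous_closed_preimage) (auto simp: closed_orthant)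
  qed
  then have "S \<in> sets borel" by simp
  moreover have "S \<subseteq> orthant" by (auto simp: S_def)
  ultimately have S: "S \<in> sets orthant_algebra" by (auto simp: sets_restrict_space_iff)
  have "window i N = S \<inter> ({x \<in> space orthant_algebra. 0 < x $ i} \<inter> {x \<in> space orthant_algebra. \<rho> x \<le> real N})"
    by (auto simp: window_def S_def space_restrict_space)
  also have "\<dots> \<in> sets orthant_algebra"
    by (intro sets.Int S) measurable
  finally show ?thesis .
qed

lemma windowD:
  assumes "x \<in> window i N"
  shows "x \<in> orthant" "0 < x $ i" "\<rho> x \<le> real N" "0 \<le> \<tau> \<Longrightarrow> \<tau> \<le> 1 / real N \<Longrightarrow> 1 / real N \<le> \<rho> (x + \<tau> *\<^sub>R axis i 1)"
  using assms by (auto simp: window_def)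

lemma window_exhausts:
  assumes x: "x \<in> orthant" "0 < x $ i" "0 < \<rho> x"
  shows "\<forall>\<^sub>F N in sequentially. x \<in> window i N"
proof -
  have "continuous_on {0..} (\<lambda>\<tau>. \<rho> (x + \<tau> *\<^sub>R axis i 1))"
    by (rule continuous_on_compose2[OF rho_continuous]) (use x in \<open>auto intro!: continuous_intros\<close>)
  then have "((\<lambda>\<tau>. \<rho> (x + \<tau> *\<^sub>R axis i 1)) \<longlongrightarrow> \<rho> (x + 0 *\<^sub>R axis i 1)) (at 0 within {0..})"
    unfolding continuous_on by (metis atLeast_iff order_refl)
  then have "\<forall>\<^sub>F \<tau> in at 0 within {0..}. \<rho> x / 2 < \<rho> (x + \<tau> *\<^sub>R axis i 1)"
    by (rule order_tendstoD) (use x in simp)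
  then obtain d where d: "0 < d" and d': "\<And>\<tau>. \<tau> \<in> {0..} \<Longrightarrow> \<tau> \<noteq> 0 \<and> dist \<tau> 0 < d \<Longrightarrow> \<rho> x / 2 < \<rho> (x + \<tau> *\<^sub>R axis i 1)"
    unfolding eventually_at by blast
  have dd: "\<rho> x / 2 \<le> \<rho> (x + \<tau> *\<^sub>R axis i 1)" if "0 \<le> \<tau>" "\<tau> < d" for \<tau>
    using d'[of \<tau>] that x(3) by (cases "\<tau> = 0") (auto simp: dist_real_def)
  \<comment> \<open>2 / d keeps the segment inside the neighbourhood, 2 / \<rho> x gives the lower
    bound, \<rho> x the upper one, and 1 keeps N positive.\<close>
  obtain N0 where N0: "max (2 / d) (max (2 / \<rho> x) (max (\<rho> x) 1)) < real N0" using reals_Archimedean2 by blast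
  show ?thesis
  proof (rule eventually_sequentiallyI[of N0])
    fix N assume "N0 \<le> N"
    then have N: "2 / d < real N" "2 / \<rho> x < real N" "\<rho> x < real N" "1 < real N" using N0 by linarith+
    have 1: "1 / real N < d" using N d by (simp add: field_simps)
    have 2: "1 / real N \<le> \<rho> x / 2" using N x by (simp add: field_simps)
    show "x \<in> window i N"
      unfolding window_def
    proof (intro CollectI conjI ballI)
      fix \<tau> assume "\<tau> \<in> {0..1 / real N}"
      then have "\<rho> x / 2 \<le> \<rho> (x + \<tau> *\<^sub>R axis i 1)" using 1 by (intro dd) auto
      with 2 show "1 / real N \<le> \<rho> (x + \<tau> *\<^sub>R axis i 1)" by linarith
    qed (use x N in auto)
  qed
qed

text \<open>On the window 1 \<le> N * \<rho> at the shifted point, which inserts the weight exactly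
  where \<phi> is evaluated; shifting back costs nothing by
  \<open>nn_integral_ref_measure_shift\<close>.\<close>

lemma window_shift_le:
  assumes [measurable]: "\<phi> \<in> borel_measurable orthant_algebra" and \<tau>: "0 \<le> \<tau>" "\<tau> \<le> 1 / real N" and N: "0 < N"
  shows "(\<integral>\<^sup>+x. indicator (window i N) x * \<phi> (x + \<tau> *\<^sub>R axis i 1) \<partial>m) \<le> ennreal (real N) * (\<integral>\<^sup>+x. \<phi> x \<partial>\<mu>)"
proof -
  have "(\<integral>\<^sup>+x. indicator (window i N) x * \<phi> (x + \<tau> *\<^sub>R axis i 1) \<partial>m)
    \<le> (\<integral>\<^sup>+x. ennreal (real N) * (indicator {0<..} (x $ i) * (ennreal (\<rho> (x + \<tau> *\<^sub>R axis i 1)) * \<phi> (x + \<tau> *\<^sub>R axis i 1))) \<partial>m)"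
  proof (rule nn_integral_mono)
    fix x
    show "indicator (window i N) x * \<phi> (x + \<tau> *\<^sub>R axis i 1) \<le>
      ennreal (real N) * (indicator {0<..} (x $ i) * (ennreal (\<rho> (x + \<tau> *\<^sub>R axis i 1)) * \<phi> (x + \<tau> *\<^sub>R axis i 1)))"
    proof (cases "x \<in> window i N")
      case True
      have "1 \<le> ennreal (real N * \<rho> (x + \<tau> *\<^sub>R axis i 1))"
        using windowD(4)[OF True \<tau>] N by (simp add: field_simps)
      then have "1 * \<phi> (x + \<tau> *\<^sub>R axis i 1) \<le> ennreal (real N * \<rho> (x + \<tau> *\<^sub>R axis i 1)) * \<phi> (x + \<tau> *\<^sub>R axis i 1)"
        by (rule mult_right_mono) simp
      then show ?thesis
        using True windowD(2)[OF True] by (simp add: ennreal_mult' mult.assoc)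
    qed simp
  qed
  also have "\<dots> = ennreal (real N) * (\<integral>\<^sup>+x. indicator {0<..} (x $ i) * (ennreal (\<rho> (x + \<tau> *\<^sub>R axis i 1)) * \<phi> (x + \<tau> *\<^sub>R axis i 1)) \<partial>m)"
  proof (rule nn_integral_cmult)
    have "(\<lambda>x. ennreal (\<rho> (x + \<tau> *\<^sub>R axis i 1)) * \<phi> (x + \<tau> *\<^sub>R axis i 1)) \<in> borel_measurable orthant_algebra"
      by (rule measurable_compose[OF measurable_shift[OF \<tau>(1)], of "\<lambda>x. ennreal (\<rho> x) * \<phi> x"]) measurable
    then show "(\<lambda>x. indicator {0<..} (x $ i) * (ennreal (\<rho> (x + \<tau> *\<^sub>R axis i 1)) * \<phi> (x + \<tau> *\<^sub>R axis i 1))) \<in> borel_measurable m"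
      by simp
  qed
  also have "\<dots> \<le> ennreal (real N) * (\<integral>\<^sup>+x. indicator {0<..} (x $ i) * (ennreal (\<rho> x) * \<phi> x) \<partial>m)"
    by (intro mult_left_mono nn_integral_ref_measure_shift[of "\<lambda>x. ennreal (\<rho> x) * \<phi> x"] \<tau> beta_pos) auto
  also have "\<dots> \<le> ennreal (real N) * (\<integral>\<^sup>+x. ennreal (\<rho> x) * \<phi> x \<partial>m)"
    by (intro mult_left_mono nn_integral_mono) (auto simp: indicator_def)
  also have "\<dots> = ennreal (real N) * (\<integral>\<^sup>+x. \<phi> x \<partial>\<mu>)"
    by (simp add: nn_integral_mu)
  finally show ?thesis .
qed

lemma nn_integral_square:
  assumes "bounded_meas orthant_algebra f"
  shows "(\<integral>\<^sup>+x. ennreal ((f x)\<^sup>2) \<partial>\<mu>) = ennreal (\<integral>x. (f x)\<^sup>2 \<partial>\<mu>)"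
  using integrable_bounded_meas[of "\<lambda>x. f x * f x"] bounded_meas_mult[OF assms assms]
  by (intro nn_integral_eq_integral) (auto simp: power2_eq_square)

text \<open>Each increment is bounded by the energy on a segment; Tonelli exchanges the segment with
  the window, and \<open>window_shift_le\<close> treats every \<tau>. One factor s is the length of
  the segment in Cauchy-Schwarz, the other the length of the \<tau>-interval.\<close>

lemma window_diff_quotient:
  assumes u: "C1_bounded u" and s: "0 \<le> s" "s \<le> 1 / real N" and N: "0 < N"
  shows "(\<integral>\<^sup>+x. indicator (window i N) x * ennreal ((u (x + s *\<^sub>R axis i 1) - u x)\<^sup>2) \<partial>m)
     \<le> ennreal (s\<^sup>2 * real N * (\<integral>x. (grad i u x)\<^sup>2 \<partial>\<mu>))"
proof -
  define W where "W x = ennreal ((grad i u x)\<^sup>2)" for x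
  have gm: "grad i u \<in> borel_measurable orthant_algebra" by (rule bounded_meas_measurable[OF C1_bounded_grad[OF u]])
  then have W [measurable]: "W \<in> borel_measurable orthant_algebra" unfolding W_def[abs_def] by measurable
  define w where "w x \<tau> = W (upd_coord x i (x $ i + max 0 \<tau>))" for x \<tau>
  have "(\<lambda>p. upd_coord (fst p) i (fst p $ i + max 0 (snd p))) \<in> m \<Otimes>\<^sub>M lborel \<rightarrow>\<^sub>M orthant_algebra"
  proof (rule measurable_upd_coord)
    have "(\<lambda>x. x) \<in> m \<rightarrow>\<^sub>M orthant_algebra" by simp
    from measurable_compose[OF measurable_fst[of m "lborel :: real measure"] this] show f: "fst \<in> m \<Otimes>\<^sub>M (lborel :: real measure) \<rightarrow>\<^sub>M orthant_algebra" by simp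
    have [measurable]: "(\<lambda>p. fst p $ i) \<in> borel_measurable (m \<Otimes>\<^sub>M (lborel :: real measure))"
      by (rule measurable_compose[OF f vec_nth_borel_measurable_orthant])
    show "(\<lambda>p. fst p $ i + max 0 (snd p)) \<in> m \<Otimes>\<^sub>M lborel \<rightarrow>\<^sub>M restrict_space borel {0..}"
      by (rule measurable_restrict_space2) (auto simp: space_pair_measure orthant_def)
  qed
  from measurable_compose[OF this W]
  have "(\<lambda>p. w (fst p) (snd p)) \<in> borel_measurable (m \<Otimes>\<^sub>M lborel)"
    by (simp add: w_def)
  moreover have "(\<lambda>p. indicator (window i N) (fst p) :: ennreal) \<in> borel_measurable (m \<Otimes>\<^sub>M (lborel :: real measure))"
    by (rule measurable_compose[OF measurable_fst borel_measurable_indicator]) simp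
  moreover have "(\<lambda>p. indicator {0..s} (snd p) :: ennreal) \<in> borel_measurable (m \<Otimes>\<^sub>M (lborel :: real measure))"
    by (rule measurable_compose[OF measurable_snd borel_measurable_indicator]) simp
  ultimately have F: "(\<lambda>(x, \<tau>). indicator {0..s} \<tau> * (indicator (window i N) x * w x \<tau>)) \<in> borel_measurable (m \<Otimes>\<^sub>M lborel)"
    unfolding case_prod_beta by (intro borel_measurable_times_ennreal)
  interpret P: pair_sigma_finite m lborel
    by (intro pair_sigma_finite.intro m.sigma_finite_measure_axioms sigma_finite_lborel)
  have "(\<integral>\<^sup>+x. indicator (window i N) x * ennreal ((u (x + s *\<^sub>R axis i 1) - u x)\<^sup>2) \<partial>m)
    \<le> (\<integral>\<^sup>+x. ennreal s * (\<integral>\<^sup>+\<tau>. indicator {0..s} \<tau> * (indicator (window i N) x * w x \<tau>) \<partial>lborel) \<partial>m)"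
  proof (rule nn_integral_mono)
    fix x assume "x \<in> space m"
    then have x: "x \<in> orthant" by simp
    have x0: "0 \<le> x $ i" using x by (simp add: orthant_def)
    have xx: "upd_coord x i (x $ i) = x" by (simp add: vec_eq_iff)
    have "(\<lambda>s. upd_coord x i (max 0 s)) \<in> borel \<rightarrow>\<^sub>M orthant_algebra"
      by (rule measurable_upd_coord) (use x in \<open>auto simp: space_restrict_space intro!: measurable_restrict_space2\<close>)
    from measurable_compose[OF this W] have [measurable]: "(\<lambda>r. W (upd_coord x i (max 0 r))) \<in> borel_measurable borel" .
    have "ennreal ((u (x + s *\<^sub>R axis i 1) - u x)\<^sup>2) = ennreal ((u (upd_coord x i (x $ i + s)) - u (upd_coord x i (x $ i)))\<^sup>2)"
      by (simp add: upd_coord_add_axis xx)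
    also have "\<dots> \<le> ennreal (x $ i + s - x $ i) * (\<integral>\<^sup>+r. indicator {x $ i..x $ i + s} r * W (upd_coord x i (max 0 r)) \<partial>lborel)"
      unfolding W_def by (rule grad_line_power2_le[OF u x x0]) (use s in simp)
    also have "(\<integral>\<^sup>+r. indicator {x $ i..x $ i + s} r * W (upd_coord x i (max 0 r)) \<partial>lborel)
      = (\<integral>\<^sup>+\<tau>. indicator {x $ i..x $ i + s} (x $ i + 1 * \<tau>) * W (upd_coord x i (max 0 (x $ i + 1 * \<tau>))) \<partial>lborel)"
      by (subst nn_integral_real_affine[where c = 1 and t = "x $ i"]) auto
    also have "\<dots> = (\<integral>\<^sup>+\<tau>. indicator {0..s} \<tau> * w x \<tau> \<partial>lborel)"
      using x0 by (intro nn_integral_cong) (auto simp: indicator_def w_def max_absorb2)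
    finally show "indicator (window i N) x * ennreal ((u (x + s *\<^sub>R axis i 1) - u x)\<^sup>2)
      \<le> ennreal s * (\<integral>\<^sup>+\<tau>. indicator {0..s} \<tau> * (indicator (window i N) x * w x \<tau>) \<partial>lborel)"
      by (cases "x \<in> window i N") auto
  qed
  also have "\<dots> = ennreal s * (\<integral>\<^sup>+x. (\<integral>\<^sup>+\<tau>. indicator {0..s} \<tau> * (indicator (window i N) x * w x \<tau>) \<partial>lborel) \<partial>m)"
    by (rule nn_integral_cmult) (rule lborel.borel_measurable_nn_integral[OF F])
  also have "(\<integral>\<^sup>+x. (\<integral>\<^sup>+\<tau>. indicator {0..s} \<tau> * (indicator (window i N) x * w x \<tau>) \<partial>lborel) \<partial>m)
    = (\<integral>\<^sup>+\<tau>. (\<integral>\<^sup>+x. indicator {0..s} \<tau> * (indicator (window i N) x * w x \<tau>) \<partial>m) \<partial>lborel)"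
    by (rule P.Fubini'[OF F, symmetric])
  also have "\<dots> \<le> (\<integral>\<^sup>+\<tau>. ennreal (real N * (\<integral>x. (grad i u x)\<^sup>2 \<partial>\<mu>)) * indicator {0..s} \<tau> \<partial>lborel)"
  proof (rule nn_integral_mono)
    fix \<tau> :: real
    show "(\<integral>\<^sup>+x. indicator {0..s} \<tau> * (indicator (window i N) x * w x \<tau>) \<partial>m)
      \<le> ennreal (real N * (\<integral>x. (grad i u x)\<^sup>2 \<partial>\<mu>)) * indicator {0..s} \<tau>"
    proof (cases "\<tau> \<in> {0..s}")
      case True
      then have "(\<integral>\<^sup>+x. indicator {0..s} \<tau> * (indicator (window i N) x * w x \<tau>) \<partial>m)
        = (\<integral>\<^sup>+x. indicator (window i N) x * W (x + \<tau> *\<^sub>R axis i 1) \<partial>m)"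
        by (intro nn_integral_cong) (auto simp: w_def upd_coord_add_axis max_absorb2)
      also have "\<dots> \<le> ennreal (real N) * (\<integral>\<^sup>+x. W x \<partial>\<mu>)"
        by (rule window_shift_le) (use True s N in auto)
      also have "\<dots> = ennreal (real N * (\<integral>x. (grad i u x)\<^sup>2 \<partial>\<mu>))"
        unfolding W_def by (simp add: nn_integral_square[OF C1_bounded_grad[OF u]] ennreal_mult')
      finally show ?thesis using True by simp
    qed simp
  qed
  also have "\<dots> = ennreal (real N * (\<integral>x. (grad i u x)\<^sup>2 \<partial>\<mu>)) * ennreal s"
    using s by (subst nn_integral_cmult_indicator) auto
  finally have "(\<integral>\<^sup>+x. indicator (window i N) x * ennreal ((u (x + s *\<^sub>R axis i 1) - u x)\<^sup>2) \<partial>m)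
     \<le> ennreal s * (ennreal (real N * (\<integral>x. (grad i u x)\<^sup>2 \<partial>\<mu>)) * ennreal s)"
    by (simp add: mult_left_mono)
  also have "\<dots> = ennreal (s\<^sup>2 * real N * (\<integral>x. (grad i u x)\<^sup>2 \<partial>\<mu>))"
    using s by (simp add: ennreal_mult'[symmetric] power2_eq_square ac_simps integral_nonneg_AE)
  finally show ?thesis .
qed

text \<open>The same transfer without a derivative. The case s = 0 is included and bounds the
  function itself on the window.\<close>

lemma window_square:
  assumes u: "bounded_meas orthant_algebra u" and s: "0 \<le> s" "s \<le> 1 / real N" and N: "0 < N"
  shows "(\<integral>\<^sup>+x. indicator (window i N) x * ennreal ((u (x + s *\<^sub>R axis i 1))\<^sup>2) \<partial>m)
     \<le> ennreal (real N * (\<integral>x. (u x)\<^sup>2 \<partial>\<mu>))"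
proof -
  have [measurable]: "u \<in> borel_measurable orthant_algebra" using u by (rule bounded_meas_measurable)
  have "(\<integral>\<^sup>+x. indicator (window i N) x * ennreal ((u (x + s *\<^sub>R axis i 1))\<^sup>2) \<partial>m)
    \<le> ennreal (real N) * (\<integral>\<^sup>+x. ennreal ((u x)\<^sup>2) \<partial>\<mu>)"
    by (rule window_shift_le[OF _ s N, of "\<lambda>x. ennreal ((u x)\<^sup>2)"]) measurable
  then show ?thesis by (simp add: nn_integral_square[OF u] ennreal_mult')
qed

text \<open>Split f j into f j - f k, whose energy is at most \<epsilon>, and f k, whose L2 norm
  tends to 0. With difference quotients of fixed step s one can let k tend to infinity, since no
  derivative of f k is involved; afterwards s tends to 0.\<close>

lemma window_energy:
  assumes f: "\<And>k. C1_bounded (f k)" and N: "0 < N"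
    and d: "\<And>k. J \<le> k \<Longrightarrow> (\<integral>x. (grad i (f j) x - grad i (f k) x)\<^sup>2 \<partial>\<mu>) \<le> \<epsilon>"
    and L2: "(\<lambda>k. \<integral>x. (f k x)\<^sup>2 \<partial>\<mu>) \<longlonglongrightarrow> 0"
  shows "(\<integral>x. indicator (window i N) x * (grad i (f j) x)\<^sup>2 \<partial>\<mu>) \<le> 2 * (real N)\<^sup>2 * \<epsilon>"
proof -
  let ?K = "window i N"
  have fm [measurable]: "f k \<in> borel_measurable orthant_algebra" for k
    by (rule bounded_meas_measurable[OF C1_bounded_bounded_meas[OF f]])
  have gm [measurable]: "grad i (f k) \<in> borel_measurable orthant_algebra" for k
    by (rule bounded_meas_measurable[OF C1_bounded_grad[OF f]])
  have e0: "0 \<le> \<epsilon>" using d[OF order_refl] by (rule order_trans[rotated]) (simp add: integral_nonneg_AE)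
  have fs [measurable]: "(\<lambda>x. f k (x + s *\<^sub>R axis i 1)) \<in> borel_measurable orthant_algebra" if "0 \<le> s" for k s
    by (rule measurable_compose[OF measurable_shift[OF that] fm])
  have step1: "(\<integral>\<^sup>+x. indicator ?K x * ennreal ((f j (x + s *\<^sub>R axis i 1) - f j x)\<^sup>2) \<partial>m) \<le> ennreal (2 * s\<^sup>2 * real N * \<epsilon>)"
    if s: "0 \<le> s" "s \<le> 1 / real N" for s
  proof -
    let ?A = "\<integral>\<^sup>+x. indicator ?K x * ennreal ((f j (x + s *\<^sub>R axis i 1) - f j x)\<^sup>2) \<partial>m"
    define b where "b k = (\<integral>x. (f k x)\<^sup>2 \<partial>\<mu>)" for k
    have b0: "0 \<le> b k" for k by (simp add: b_def integral_nonneg_AE)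
    have le: "?A \<le> ennreal (2 * s\<^sup>2 * real N * \<epsilon> + 8 * real N * b k)" if k: "J \<le> k" for k
    proof -
      let ?g = "\<lambda>x. f j x - f k x"
      let ?g2 = "\<lambda>x. indicator ?K x * ennreal ((?g (x + s *\<^sub>R axis i 1) - ?g x)\<^sup>2)"
      let ?c2 = "\<lambda>x. indicator ?K x * ennreal ((f k (x + s *\<^sub>R axis i 1))\<^sup>2)"
      let ?d2 = "\<lambda>x. indicator ?K x * ennreal ((f k (x + 0 *\<^sub>R axis i 1))\<^sup>2)"
      note [measurable] = fs[OF s(1)]
      have "?A \<le> (\<integral>\<^sup>+x. 2 * ?g2 x + (4 * ?c2 x + 4 * ?d2 x) \<partial>m)"
      proof (rule nn_integral_mono)
        fix x
        let ?a = "f j (x + s *\<^sub>R axis i 1) - f j x" and ?b = "?g (x + s *\<^sub>R axis i 1) - ?g x"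
        let ?c = "f k (x + s *\<^sub>R axis i 1)" and ?d = "f k x"
        have "?a = ?b + (?c - ?d)" by simp
        moreover have "(?b + (?c - ?d))\<^sup>2 \<le> 2 * ?b\<^sup>2 + (4 * ?c\<^sup>2 + 4 * ?d\<^sup>2)"
        proof -
          have "0 \<le> (?b - (?c - ?d))\<^sup>2 + 2 * (?c + ?d)\<^sup>2" by simp
          then show ?thesis by (simp add: power2_eq_square algebra_simps)
        qed
        ultimately have "ennreal (?a\<^sup>2) \<le> ennreal (2 * ?b\<^sup>2 + (4 * ?c\<^sup>2 + 4 * ?d\<^sup>2))"
          by (metis ennreal_leI)
        also have "\<dots> = 2 * ennreal (?b\<^sup>2) + (4 * ennreal (?c\<^sup>2) + 4 * ennreal (?d\<^sup>2))"
          by (simp add: ennreal_plus ennreal_mult)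
        finally show "indicator ?K x * ennreal (?a\<^sup>2) \<le> 2 * ?g2 x + (4 * ?c2 x + 4 * ?d2 x)"
          by (cases "x \<in> ?K") auto
      qed
      also have "\<dots> = 2 * (\<integral>\<^sup>+x. ?g2 x \<partial>m) + (4 * (\<integral>\<^sup>+x. ?c2 x \<partial>m) + 4 * (\<integral>\<^sup>+x. ?d2 x \<partial>m))"
        by (simp add: nn_integral_add nn_integral_cmult)
      also have "\<dots> \<le> 2 * ennreal (s\<^sup>2 * real N * \<epsilon>) + (4 * ennreal (real N * b k) + 4 * ennreal (real N * b k))"
      proof (intro add_mono mult_left_mono)
        have "(\<integral>\<^sup>+x. ?g2 x \<partial>m) \<le> ennreal (s\<^sup>2 * real N * (\<integral>x. (grad i ?g x)\<^sup>2 \<partial>\<mu>))"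
          by (rule window_diff_quotient[OF C1_bounded_diff[OF f f] s N])
        also have "(\<integral>x. (grad i ?g x)\<^sup>2 \<partial>\<mu>) = (\<integral>x. (grad i (f j) x - grad i (f k) x)\<^sup>2 \<partial>\<mu>)"
          by (intro Bochner_Integration.integral_cong refl) (simp add: grad_diff[OF f f])
        also have "ennreal (s\<^sup>2 * real N * \<dots>) \<le> ennreal (s\<^sup>2 * real N * \<epsilon>)"
          by (intro ennreal_leI mult_left_mono d k) auto
        finally show "(\<integral>\<^sup>+x. ?g2 x \<partial>m) \<le> ennreal (s\<^sup>2 * real N * \<epsilon>)" .
        show "(\<integral>\<^sup>+x. ?c2 x \<partial>m) \<le> ennreal (real N * b k)"
          unfolding b_def by (rule window_square[OF C1_bounded_bounded_meas[OF f] s N])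
        show "(\<integral>\<^sup>+x. ?d2 x \<partial>m) \<le> ennreal (real N * b k)"
          unfolding b_def by (rule window_square[OF C1_bounded_bounded_meas[OF f] _ _ N]) auto
      qed auto
      also have "\<dots> = ennreal (2 * s\<^sup>2 * real N * \<epsilon> + 8 * real N * b k)"
      proof -
        have "2 * ennreal p + (4 * ennreal q + 4 * ennreal q) = ennreal (2 * p + 8 * q)" if "0 \<le> p" "0 \<le> q" for p q
        proof -
          have "2 * ennreal p + (4 * ennreal q + 4 * ennreal q) = ennreal 2 * ennreal p + (ennreal 4 * ennreal q + ennreal 4 * ennreal q)"
            by (simp only: ennreal_numeral)
          also have "\<dots> = ennreal (2 * p) + (ennreal (4 * q) + ennreal (4 * q))"
            using that by (simp only: ennreal_mult zero_le_numeral)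
          also have "\<dots> = ennreal (2 * p + (4 * q + 4 * q))"
            using that by (simp only: ennreal_plus mult_nonneg_nonneg add_nonneg_nonneg zero_le_numeral)
          finally show ?thesis by simp
        qed
        from this[of "s\<^sup>2 * real N * \<epsilon>" "real N * b k"] show ?thesis using e0 b0 by (simp add: ac_simps)
      qed
      finally show ?thesis .
    qed
    have "(\<lambda>k. ennreal (2 * s\<^sup>2 * real N * \<epsilon> + 8 * real N * b k)) \<longlonglongrightarrow> ennreal (2 * s\<^sup>2 * real N * \<epsilon> + 8 * real N * 0)"
      using L2 unfolding b_def by (intro tendsto_intros)
    then have "?A \<le> ennreal (2 * s\<^sup>2 * real N * \<epsilon> + 8 * real N * 0)"
      by (rule LIMSEQ_le_const) (use le in blast)
    then show ?thesis by simp
  qed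
  \<comment> \<open>Admissible steps: positive, at most 1 / N, and tending to 0.\<close>
  define s where "s n = 1 / (real N + real n)" for n :: nat
  have s: "0 < s n" "s n \<le> 1 / real N" for n using N by (auto simp: s_def frac_le)
  have s_lim: "s \<longlonglongrightarrow> 0"
    unfolding s_def by (rule real_tendsto_divide_at_top[OF tendsto_const])
      (rule filterlim_tendsto_add_at_top[OF tendsto_const filterlim_real_sequentially])
  let ?D = "\<lambda>n x. indicator ?K x * ennreal (((f j (x + s n *\<^sub>R axis i 1) - f j x) / s n)\<^sup>2)"
  have mD: "?D n \<in> borel_measurable m" for n
    using fs[of "s n" j] s(1)[of n] by (simp add: less_imp_le)
  have D: "(\<integral>\<^sup>+x. ?D n x \<partial>m) \<le> ennreal (2 * real N * \<epsilon>)" for n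
  proof -
    note [measurable] = fs[OF less_imp_le[OF s(1)[of n]]]
    have "(\<integral>\<^sup>+x. ?D n x \<partial>m) = (\<integral>\<^sup>+x. ennreal (1 / (s n)\<^sup>2) * (indicator ?K x * ennreal ((f j (x + s n *\<^sub>R axis i 1) - f j x)\<^sup>2)) \<partial>m)"
      by (intro nn_integral_cong) (simp add: power_divide ennreal_mult'[symmetric] mult.left_commute[of _ "indicator _ _"])
    also have "\<dots> = ennreal (1 / (s n)\<^sup>2) * (\<integral>\<^sup>+x. indicator ?K x * ennreal ((f j (x + s n *\<^sub>R axis i 1) - f j x)\<^sup>2) \<partial>m)"
      by (rule nn_integral_cmult) simp
    also have "\<dots> \<le> ennreal (1 / (s n)\<^sup>2) * ennreal (2 * (s n)\<^sup>2 * real N * \<epsilon>)"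
      by (rule mult_left_mono[OF step1]) (use s[of n] in auto)
    also have "\<dots> = ennreal (2 * real N * \<epsilon>)"
      using s(1)[of n] e0 by (subst ennreal_mult'[symmetric]) (auto simp: field_simps)
    finally show ?thesis .
  qed
  have conv: "(\<lambda>n. ?D n x) \<longlonglongrightarrow> indicator ?K x * ennreal ((grad i (f j) x)\<^sup>2)" for x
  proof (cases "x \<in> ?K")
    case True
    note x = windowD(1,2)[OF True]
    obtain h where h: "\<And>x. x \<in> orthant \<Longrightarrow> grad i (f j) x = indicator {0<..} (x $ i) * h x"
      "\<And>x. x \<in> orthant \<Longrightarrow> 0 < x $ i \<Longrightarrow> ((\<lambda>t. f j (x + t *\<^sub>R axis i 1)) has_real_derivative h x) (at 0)"
      using C1_boundedE[OF f] by metis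
    have "((\<lambda>t. (f j (x + t *\<^sub>R axis i 1) - f j x) / t) \<longlongrightarrow> grad i (f j) x) (at 0)"
      using h(2)[OF x] h(1)[OF x(1)] x(2) by (simp add: DERIV_def)
    moreover have "filterlim s (at 0) sequentially"
      using s_lim s(1) by (auto simp: filterlim_at intro!: always_eventually) (metis less_irrefl)
    ultimately have "(\<lambda>n. (f j (x + s n *\<^sub>R axis i 1) - f j x) / s n) \<longlonglongrightarrow> grad i (f j) x"
      by (rule filterlim_compose)
    then have "(\<lambda>n. ennreal (((f j (x + s n *\<^sub>R axis i 1) - f j x) / s n)\<^sup>2)) \<longlonglongrightarrow> ennreal ((grad i (f j) x)\<^sup>2)"
      by (intro tendsto_ennrealI tendsto_power)
    then show ?thesis using True by simp
  qed simp
  \<comment> \<open>Fatou, as the difference quotients are only known to converge pointwise.\<close>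
  have "(\<integral>\<^sup>+x. indicator ?K x * ennreal ((grad i (f j) x)\<^sup>2) \<partial>m) = (\<integral>\<^sup>+x. liminf (\<lambda>n. ?D n x) \<partial>m)"
    by (intro nn_integral_cong lim_imp_Liminf[symmetric] conv) simp
  also have "\<dots> \<le> liminf (\<lambda>n. \<integral>\<^sup>+x. ?D n x \<partial>m)"
    by (rule nn_integral_liminf[OF mD])
  also have "\<dots> \<le> liminf (\<lambda>n. ennreal (2 * real N * \<epsilon>))"
    by (rule Liminf_mono) (simp add: D)
  also have "\<dots> = ennreal (2 * real N * \<epsilon>)" by (rule Liminf_const) simp
  finally have fatou: "(\<integral>\<^sup>+x. indicator ?K x * ennreal ((grad i (f j) x)\<^sup>2) \<partial>m) \<le> ennreal (2 * real N * \<epsilon>)" .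
  have bm: "bounded_meas orthant_algebra (\<lambda>x. indicator ?K x * (grad i (f j) x)\<^sup>2)"
    unfolding power2_eq_square by (intro bounded_meas_mult bounded_meas_indicator C1_bounded_grad f) simp
  have "ennreal (\<integral>x. indicator ?K x * (grad i (f j) x)\<^sup>2 \<partial>\<mu>) = (\<integral>\<^sup>+x. ennreal (indicator ?K x * (grad i (f j) x)\<^sup>2) \<partial>\<mu>)"
    by (rule nn_integral_eq_integral[symmetric]) (use bm in \<open>auto intro!: integrable_bounded_meas\<close>)
  also have "\<dots> = (\<integral>\<^sup>+x. ennreal (\<rho> x) * (indicator ?K x * ennreal ((grad i (f j) x)\<^sup>2)) \<partial>m)"
  proof -
    have "(\<lambda>x. ennreal (indicator ?K x * (grad i (f j) x)\<^sup>2)) = (\<lambda>x. indicator ?K x * ennreal ((grad i (f j) x)\<^sup>2))"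
      by (auto simp: indicator_def)
    then show ?thesis by (simp add: nn_integral_mu)
  qed
  \<comment> \<open>On the window \<rho> \<le> N, which returns to \<mu> and produces the second
    factor N.\<close>
  also have "\<dots> \<le> (\<integral>\<^sup>+x. ennreal (real N) * (indicator ?K x * ennreal ((grad i (f j) x)\<^sup>2)) \<partial>m)"
    by (intro nn_integral_mono) (auto simp: indicator_def intro!: mult_right_mono ennreal_leI windowD(3))
  also have "\<dots> = ennreal (real N) * (\<integral>\<^sup>+x. indicator ?K x * ennreal ((grad i (f j) x)\<^sup>2) \<partial>m)"
    by (rule nn_integral_cmult) simp
  also have "\<dots> \<le> ennreal (real N) * ennreal (2 * real N * \<epsilon>)"
    by (intro mult_left_mono fatou) simp
  also have "\<dots> = ennreal (2 * (real N)\<^sup>2 * \<epsilon>)"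
    using e0 by (subst ennreal_mult'[symmetric]) (auto simp: power2_eq_square ac_simps)
  finally show ?thesis using e0 by (subst (asm) ennreal_le_iff) auto
qed

lemma G_self: "G f f = (\<Sum>i\<in>UNIV. \<integral>x. (grad i f x)\<^sup>2 \<partial>\<mu>)"
  by (simp add: G_def power2_eq_square)

section \<open>Closability\<close>

definition G_Cauchy :: "(nat \<Rightarrow> real^'n \<Rightarrow> real) \<Rightarrow> bool" where
  "G_Cauchy f \<longleftrightarrow> (\<forall>\<epsilon>>0. \<exists>K. \<forall>j\<ge>K. \<forall>k\<ge>K. G (\<lambda>x. f j x - f k x) (\<lambda>x. f j x - f k x) < \<epsilon>)"

text \<open>On a window the energy of f j is small by \<open>window_energy\<close>; off the window f
  j is compared with a fixed f J, whose energy there vanishes as the windows grow. Hence the order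
  of choices: J, then N, then J'.\<close>

lemma closable_coord:
  assumes f: "\<And>k. C1_bounded (f k)" and C: "G_Cauchy f"
    and L2: "(\<lambda>k. \<integral>x. (f k x)\<^sup>2 \<partial>\<mu>) \<longlonglongrightarrow> 0"
  shows "(\<lambda>k. \<integral>x. (grad i (f k) x)\<^sup>2 \<partial>\<mu>) \<longlonglongrightarrow> 0"
proof -
  define w where "w k = (\<integral>x. (grad i (f k) x)\<^sup>2 \<partial>\<mu>)" for k
  have w0: "0 \<le> w k" for k by (simp add: w_def integral_nonneg_AE)
  have Cauchy: "\<exists>K. \<forall>j\<ge>K. \<forall>k\<ge>K. (\<integral>x. (grad i (f j) x - grad i (f k) x)\<^sup>2 \<partial>\<mu>) \<le> \<epsilon>" if e: "0 < \<epsilon>" for \<epsilon>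
  proof -
    obtain K where K: "\<And>j k. j \<ge> K \<Longrightarrow> k \<ge> K \<Longrightarrow> G (\<lambda>x. f j x - f k x) (\<lambda>x. f j x - f k x) < \<epsilon>"
      using C e unfolding G_Cauchy_def by blast
    have "(\<integral>x. (grad i (f j) x - grad i (f k) x)\<^sup>2 \<partial>\<mu>) \<le> \<epsilon>" if "j \<ge> K" "k \<ge> K" for j k
    proof -
      have "(\<integral>x. (grad i (f j) x - grad i (f k) x)\<^sup>2 \<partial>\<mu>) = (\<integral>x. (grad i (\<lambda>x. f j x - f k x) x)\<^sup>2 \<partial>\<mu>)"
        by (intro Bochner_Integration.integral_cong refl) (simp add: grad_diff[OF f f])
      also have "\<dots> \<le> G (\<lambda>x. f j x - f k x) (\<lambda>x. f j x - f k x)"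
        unfolding G_self by (rule member_le_sum) (auto simp: integral_nonneg_AE)
      finally show ?thesis using K[OF that] by simp
    qed
    then show ?thesis by blast
  qed
  have "\<exists>K. \<forall>j\<ge>K. w j \<le> \<epsilon>" if e: "0 < \<epsilon>" for \<epsilon>
  proof -
    \<comment> \<open>The three contributions will add up to \<delta> + 2 \<delta> + 2
      \<delta>.\<close>
    define \<delta> where "\<delta> = \<epsilon> / 5"
    have d: "0 < \<delta>" using e by (simp add: \<delta>_def)
    obtain J where J: "\<And>j k. j \<ge> J \<Longrightarrow> k \<ge> J \<Longrightarrow> (\<integral>x. (grad i (f j) x - grad i (f k) x)\<^sup>2 \<partial>\<mu>) \<le> \<delta>"
      using Cauchy[OF d] by blast
    have gb: "bounded_meas orthant_algebra (grad i (f k))" for k by (rule C1_bounded_grad[OF f])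
    have gm [measurable]: "grad i (f k) \<in> borel_measurable orthant_algebra" for k by (rule bounded_meas_measurable[OF gb])
    \<comment> \<open>Dominated convergence over the windows. They only exhaust the points with x_i
      > 0, but elsewhere the component i of the gradient is 0.\<close>
    have "(\<lambda>N. \<integral>x. (1 - indicator (window i N) x) * (grad i (f J) x)\<^sup>2 \<partial>\<mu>) \<longlonglongrightarrow> (\<integral>x. 0 \<partial>\<mu>)"
    proof (rule integral_dominated_convergence[where w = "\<lambda>x. (grad i (f J) x)\<^sup>2"])
      show "integrable \<mu> (\<lambda>x. (grad i (f J) x)\<^sup>2)"
        unfolding power2_eq_square by (intro integrable_bounded_meas) (simp add: bounded_meas_mult gb)
      have "AE x in \<mu>. 0 < \<rho> x" using rho_AE_pos by (simp add: AE_mu_iff)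
      then show "AE x in \<mu>. (\<lambda>N. (1 - indicator (window i N) x) * (grad i (f J) x)\<^sup>2) \<longlonglongrightarrow> 0"
      proof (rule AE_mp, intro AE_I2 impI)
        fix x assume "x \<in> space \<mu>" and r: "0 < \<rho> x"
        then have x: "x \<in> orthant" by simp
        show "(\<lambda>N. (1 - indicator (window i N) x) * (grad i (f J) x)\<^sup>2) \<longlonglongrightarrow> 0"
        proof (cases "0 < x $ i")
          case True
          have "\<forall>\<^sub>F N in sequentially. (1 - indicator (window i N) x) * (grad i (f J) x)\<^sup>2 = 0"
            using window_exhausts[OF x True r] by eventually_elim simp
          then show ?thesis by (rule tendsto_eventually)
        next
          case False
          then have "grad i (f J) x = 0" by (simp add: grad_def)
          then show ?thesis by simp
        qed
      qed
    qed (auto simp: indicator_def)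
    then have "\<forall>\<^sub>F N in sequentially. (\<integral>x. (1 - indicator (window i N) x) * (grad i (f J) x)\<^sup>2 \<partial>\<mu>) < \<delta>"
      using d by (intro order_tendstoD) auto
    then obtain N where N: "0 < N" "(\<integral>x. (1 - indicator (window i N) x) * (grad i (f J) x)\<^sup>2 \<partial>\<mu>) < \<delta>"
      using eventually_gt_at_top[of "0::nat"] eventually_happens[OF eventually_conj] by (metis (no_types, lifting) sequentially_bot)
    \<comment> \<open>Makes the bound 2 N^2 \<eta> of \<open>window_energy\<close> equal to
      \<delta>.\<close>
    define \<eta> where "\<eta> = \<delta> / (2 * (real N)\<^sup>2)"
    have eta: "0 < \<eta>" using d N by (simp add: \<eta>_def)
    obtain J' where J': "\<And>j k. j \<ge> J' \<Longrightarrow> k \<ge> J' \<Longrightarrow> (\<integral>x. (grad i (f j) x - grad i (f k) x)\<^sup>2 \<partial>\<mu>) \<le> \<eta>"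
      using Cauchy[OF eta] by blast
    have "w j \<le> \<epsilon>" if j: "j \<ge> max J J'" for j
    proof -
      let ?I = "\<lambda>x. indicator (window i N) x :: real"
      have i1: "integrable \<mu> (\<lambda>x. ?I x * (grad i (f j) x)\<^sup>2)"
        unfolding power2_eq_square by (intro integrable_bounded_meas) (simp add: bounded_meas_mult bounded_meas_indicator gb)
      have i2: "integrable \<mu> (\<lambda>x. (1 - ?I x) * (grad i (f J) x)\<^sup>2)"
        unfolding power2_eq_square by (intro integrable_bounded_meas) (simp add: bounded_meas_mult bounded_meas_diff bounded_meas_indicator gb)
      have i3: "integrable \<mu> (\<lambda>x. (grad i (f j) x - grad i (f J) x)\<^sup>2)"
        unfolding power2_eq_square by (intro integrable_bounded_meas) (simp add: bounded_meas_mult bounded_meas_diff gb)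
      have i4: "integrable \<mu> (\<lambda>x. (grad i (f j) x)\<^sup>2)"
        unfolding power2_eq_square by (intro integrable_bounded_meas) (simp add: bounded_meas_mult gb)
      have "w j \<le> (\<integral>x. ?I x * (grad i (f j) x)\<^sup>2 + (2 * ((1 - ?I x) * (grad i (f J) x)\<^sup>2) + 2 * (grad i (f j) x - grad i (f J) x)\<^sup>2) \<partial>\<mu>)"
        unfolding w_def
      proof (rule integral_mono[OF i4])
        fix x
        let ?a = "grad i (f j) x" and ?b = "grad i (f J) x"
        have "?a\<^sup>2 \<le> 2 * ?b\<^sup>2 + 2 * (?a - ?b)\<^sup>2"
        proof -
          have "0 \<le> (2 * ?b - ?a)\<^sup>2" by simp
          then show ?thesis by (simp add: power2_eq_square algebra_simps)
        qed
        then show "?a\<^sup>2 \<le> ?I x * ?a\<^sup>2 + (2 * ((1 - ?I x) * ?b\<^sup>2) + 2 * (?a - ?b)\<^sup>2)"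
          by (cases "x \<in> window i N") auto
      qed (intro Bochner_Integration.integrable_add integrable_mult_right i1 i2 i3)
      also have "\<dots> = (\<integral>x. ?I x * (grad i (f j) x)\<^sup>2 \<partial>\<mu>) + (2 * (\<integral>x. (1 - ?I x) * (grad i (f J) x)\<^sup>2 \<partial>\<mu>) + 2 * (\<integral>x. (grad i (f j) x - grad i (f J) x)\<^sup>2 \<partial>\<mu>))"
        using i1 i2 i3 by simp
      also have "\<dots> \<le> \<delta> + (2 * \<delta> + 2 * \<delta>)"
      proof (intro add_mono mult_left_mono)
        have "(\<integral>x. ?I x * (grad i (f j) x)\<^sup>2 \<partial>\<mu>) \<le> 2 * (real N)\<^sup>2 * \<eta>"
          by (rule window_energy[OF f N(1) _ L2, of J']) (use J' j in auto)
        also have "\<dots> = \<delta>" using N by (simp add: \<eta>_def)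
        finally show "(\<integral>x. ?I x * (grad i (f j) x)\<^sup>2 \<partial>\<mu>) \<le> \<delta>" .
      qed (use N J j in auto)
      also have "\<dots> = \<epsilon>" by (simp add: \<delta>_def)
      finally show ?thesis .
    qed
    then show ?thesis by blast
  qed
  then have "w \<longlonglongrightarrow> 0"
    unfolding lim_sequentially dist_real_def using w0
    by (metis abs_of_nonneg diff_zero dense le_less_trans)
  then show ?thesis unfolding w_def .
qed

lemma closable:
  assumes "\<And>k. C1_bounded (f k)" "G_Cauchy f" "(\<lambda>k. \<integral>x. (f k x)\<^sup>2 \<partial>\<mu>) \<longlonglongrightarrow> 0"
  shows "(\<lambda>k. G (f k) (f k)) \<longlonglongrightarrow> 0"
  using tendsto_sum[of UNIV "\<lambda>i k. \<integral>x. (grad i (f k) x)\<^sup>2 \<partial>\<mu>" "\<lambda>_. 0", OF closable_coord[OF assms]]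
  by (simp add: G_self)

text \<open>From the nonnegativity of the energy of f + g.\<close>

lemma G_diff_le:
  assumes "C1_bounded f" "C1_bounded g"
  shows "G (\<lambda>x. f x - g x) (\<lambda>x. f x - g x) \<le> 2 * G f f + 2 * G g g"
proof -
  have "G (\<lambda>x. f x - g x) (\<lambda>x. f x - g x) = G f f - 2 * G f g + G g g"
    using assms by (simp add: G_diff_left G_diff_right C1_bounded_diff G_commute[of g f])
  moreover have "0 \<le> G f f + 2 * G f g + G g g"
  proof -
    \<comment> \<open>Only differences of functions are handled, so f + g is written as f - (0 -
      g).\<close>
    have n: "C1_bounded (\<lambda>x. 0)" by (auto simp: C1_bounded_def bounded_iff intro!: exI[of _ "\<lambda>_. 0"])
    have n2: "C1_bounded (\<lambda>x. 0 - g x)" by (rule C1_bounded_diff[OF n assms(2)])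
    have z: "G (\<lambda>x. 0) h = 0" for h by (simp add: G_def grad_def partial_deriv_def)
    have "0 \<le> G (\<lambda>x. f x - (0 - g x)) (\<lambda>x. f x - (0 - g x))" by (rule G_nonneg)
    also have "\<dots> = G f f + 2 * G f g + G g g"
      using G_diff_left[OF assms(1) n2 C1_bounded_diff[OF assms(1) n2]]
        G_diff_right[OF assms(1) n2 assms(1)] G_diff_right[OF assms(1) n2 n2]
        G_diff_left[OF n assms(2) assms(1)] G_diff_right[OF n assms(2) assms(1)]
        G_diff_left[OF n assms(2) n2] G_diff_right[OF n assms(2) assms(2)] z G_commute
      by (smt (verit))
    finally show ?thesis .
  qed
  ultimately show ?thesis by simp
qed

end

lemma L2_norm_tendsto_0_iff:
  "(\<lambda>k. L2_norm M (F k)) \<longlonglongrightarrow> 0 \<longleftrightarrow> (\<lambda>k. \<integral>x. (F k x)\<^sup>2 \<partial>M) \<longlonglongrightarrow> 0"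
proof -
  have sq: "(L2_norm M (F k))\<^sup>2 = (\<integral>x. (F k x)\<^sup>2 \<partial>M)" for k
    unfolding L2_norm_def L2_inner_def by (subst real_sqrt_pow2) (auto simp: power2_eq_square integral_nonneg_AE)
  have n: "L2_norm M (F k) = sqrt (\<integral>x. (F k x)\<^sup>2 \<partial>M)" for k
    by (simp add: L2_norm_def L2_inner_def power2_eq_square)
  show ?thesis
  proof
    assume "(\<lambda>k. L2_norm M (F k)) \<longlonglongrightarrow> 0"
    from tendsto_power[OF this, of 2] show "(\<lambda>k. \<integral>x. (F k x)\<^sup>2 \<partial>M) \<longlonglongrightarrow> 0" by (simp add: sq)
  next
    assume "(\<lambda>k. \<integral>x. (F k x)\<^sup>2 \<partial>M) \<longlonglongrightarrow> 0"
    from tendsto_real_sqrt[OF this] show "(\<lambda>k. L2_norm M (F k)) \<longlonglongrightarrow> 0" by (simp add: n)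
  qed
qed

lemma (in finite_measure) integrable_diff_square:
  assumes f: "bounded_meas M f" and u: "u \<in> L2 M"
  shows "integrable M (\<lambda>x. (f x - u x)\<^sup>2)"
proof -
  have [measurable]: "f \<in> borel_measurable M" "u \<in> borel_measurable M"
    using f u by (auto simp: bounded_meas_def L2_def)
  have "integrable M (\<lambda>x. 2 * (f x * f x) + 2 * (u x)\<^sup>2)"
    using integrable_bounded_meas[OF bounded_meas_mult[OF f f]] u by (auto simp: L2_def)
  then show ?thesis
  proof (rule Bochner_Integration.integrable_bound)
    have "(f x - u x)\<^sup>2 \<le> 2 * (f x * f x) + 2 * (u x)\<^sup>2" for x
    proof -
      have "0 \<le> (f x + u x)\<^sup>2" by simp
      then show ?thesis by (simp add: power2_eq_square algebra_simps)
    qed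
    then show "AE x in M. norm ((f x - u x)\<^sup>2) \<le> norm (2 * (f x * f x) + 2 * (u x)\<^sup>2)"
      by (auto intro: order_trans[OF _ abs_ge_self])
  qed measurable
qed

section \<open>The value of the closed form\<close>

context weighted_orthant
begin

lemma form_approxD:
  assumes "form_approx \<beta> \<rho> f u"
  shows "C1_bounded (f k)" "G_Cauchy f" "(\<lambda>k. \<integral>x. (f k x - u x)\<^sup>2 \<partial>\<mu>) \<longlonglongrightarrow> 0"
proof -
  have c: "C1_bounded (f k)" for k using assms by (auto simp: form_approx_def intro: Cc2_C1_bounded)
  show "C1_bounded (f k)" by (rule c)
  show "G_Cauchy f"
    using assms unfolding form_approx_def G_Cauchy_def by (simp add: pre_form_eq[OF C1_bounded_diff[OF c c] C1_bounded_diff[OF c c]])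
  show "(\<lambda>k. \<integral>x. (f k x - u x)\<^sup>2 \<partial>\<mu>) \<longlonglongrightarrow> 0"
    using assms by (simp add: form_approx_def L2_norm_tendsto_0_iff)
qed

text \<open>The difference of the two sequences approximates 0, so this is closability.\<close>

lemma form_approx_diff_tendsto:
  assumes f: "form_approx \<beta> \<rho> f u" and g: "form_approx \<beta> \<rho> g u" and u: "u \<in> L2 \<mu>"
  shows "(\<lambda>k. G (\<lambda>x. f k x - g k x) (\<lambda>x. f k x - g k x)) \<longlonglongrightarrow> 0"
proof (rule closable)
  note F = form_approxD[OF f] and H = form_approxD[OF g]
  show "C1_bounded (\<lambda>x. f k x - g k x)" for k by (rule C1_bounded_diff[OF F(1) H(1)])
  show "G_Cauchy (\<lambda>k x. f k x - g k x)"
    unfolding G_Cauchy_def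
  proof (intro allI impI)
    fix \<epsilon> :: real assume e: "0 < \<epsilon>"
    obtain K where K: "\<And>j k. j \<ge> K \<Longrightarrow> k \<ge> K \<Longrightarrow> G (\<lambda>x. f j x - f k x) (\<lambda>x. f j x - f k x) < \<epsilon> / 4"
      using F(2) e unfolding G_Cauchy_def by (meson zero_less_divide_iff zero_less_numeral)
    obtain L where L: "\<And>j k. j \<ge> L \<Longrightarrow> k \<ge> L \<Longrightarrow> G (\<lambda>x. g j x - g k x) (\<lambda>x. g j x - g k x) < \<epsilon> / 4"
      using H(2) e unfolding G_Cauchy_def by (meson zero_less_divide_iff zero_less_numeral)
    have "G (\<lambda>x. f j x - g j x - (f k x - g k x)) (\<lambda>x. f j x - g j x - (f k x - g k x)) < \<epsilon>"
      if "j \<ge> max K L" "k \<ge> max K L" for j k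
    proof -
      have "(\<lambda>x. f j x - g j x - (f k x - g k x)) = (\<lambda>x. (f j x - f k x) - (g j x - g k x))" by auto
      then have "G (\<lambda>x. f j x - g j x - (f k x - g k x)) (\<lambda>x. f j x - g j x - (f k x - g k x))
        \<le> 2 * G (\<lambda>x. f j x - f k x) (\<lambda>x. f j x - f k x) + 2 * G (\<lambda>x. g j x - g k x) (\<lambda>x. g j x - g k x)"
        using G_diff_le[OF C1_bounded_diff[OF F(1) F(1)] C1_bounded_diff[OF H(1) H(1)]] by simp
      also have "\<dots> < \<epsilon>" using K[of j k] L[of j k] that by simp
      finally show ?thesis .
    qed
    then show "\<exists>K. \<forall>j\<ge>K. \<forall>k\<ge>K. G (\<lambda>x. f j x - g j x - (f k x - g k x)) (\<lambda>x. f j x - g j x - (f k x - g k x)) < \<epsilon>"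
      by blast
  qed
  have bf: "bounded_meas \<mu> (f k)" and bg: "bounded_meas \<mu> (g k)" for k
    using C1_bounded_bounded_meas[OF F(1)] C1_bounded_bounded_meas[OF H(1)] by auto
  have le: "(\<integral>x. (f k x - g k x)\<^sup>2 \<partial>\<mu>) \<le> 2 * (\<integral>x. (f k x - u x)\<^sup>2 \<partial>\<mu>) + 2 * (\<integral>x. (g k x - u x)\<^sup>2 \<partial>\<mu>)" for k
  proof -
    have "(\<integral>x. (f k x - g k x)\<^sup>2 \<partial>\<mu>) \<le> (\<integral>x. 2 * (f k x - u x)\<^sup>2 + 2 * (g k x - u x)\<^sup>2 \<partial>\<mu>)"
    proof (rule integral_mono)
      show "integrable \<mu> (\<lambda>x. (f k x - g k x)\<^sup>2)"
        unfolding power2_eq_square by (intro integrable_bounded_meas bounded_meas_mult bounded_meas_diff bf bg)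
      show "integrable \<mu> (\<lambda>x. 2 * (f k x - u x)\<^sup>2 + 2 * (g k x - u x)\<^sup>2)"
        by (intro Bochner_Integration.integrable_add integrable_mult_right integrable_diff_square bf bg u)
      fix x
      have "0 \<le> (f k x - u x + (g k x - u x))\<^sup>2" by simp
      then show "(f k x - g k x)\<^sup>2 \<le> 2 * (f k x - u x)\<^sup>2 + 2 * (g k x - u x)\<^sup>2"
        by (simp add: power2_eq_square algebra_simps)
    qed
    also have "\<dots> = 2 * (\<integral>x. (f k x - u x)\<^sup>2 \<partial>\<mu>) + 2 * (\<integral>x. (g k x - u x)\<^sup>2 \<partial>\<mu>)"
      using integrable_diff_square[OF bf u] integrable_diff_square[OF bg u] by simp
    finally show ?thesis .
  qed
  have "(\<lambda>k. 2 * (\<integral>x. (f k x - u x)\<^sup>2 \<partial>\<mu>) + 2 * (\<integral>x. (g k x - u x)\<^sup>2 \<partial>\<mu>)) \<longlonglongrightarrow> 2 * 0 + 2 * 0"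
    by (intro tendsto_intros F(3) H(3))
  then have lim: "(\<lambda>k. 2 * (\<integral>x. (f k x - u x)\<^sup>2 \<partial>\<mu>) + 2 * (\<integral>x. (g k x - u x)\<^sup>2 \<partial>\<mu>)) \<longlonglongrightarrow> 0" by simp
  show "(\<lambda>k. \<integral>x. (f k x - g k x)\<^sup>2 \<partial>\<mu>) \<longlonglongrightarrow> 0"
    by (rule real_tendsto_sandwich[OF _ _ tendsto_const lim]) (simp_all add: le integral_nonneg_AE)
qed

text \<open>Every f k with k \<ge> K lies within energy 1 of the fixed f K.\<close>

lemma G_Cauchy_bounded:
  assumes "\<And>k. C1_bounded (f k)" "G_Cauchy f"
  obtains c K where "0 \<le> c" "\<And>k. k \<ge> K \<Longrightarrow> G (f k) (f k) \<le> c"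
proof -
  obtain K where K: "\<And>j k. j \<ge> K \<Longrightarrow> k \<ge> K \<Longrightarrow> G (\<lambda>x. f j x - f k x) (\<lambda>x. f j x - f k x) < 1"
    using assms(2) unfolding G_Cauchy_def by (meson zero_less_one)
  show thesis
  proof (rule that[of "2 * 1 + 2 * G (f K) (f K)" K])
    fix k assume k: "k \<ge> K"
    have e: "f k = (\<lambda>x. (f k x - f K x) - (0 - f K x))" by auto
    have z: "C1_bounded (\<lambda>x. 0)" by (auto simp: C1_bounded_def bounded_iff intro!: exI[of _ "\<lambda>_. 0"])
    have "G (\<lambda>x. (f k x - f K x) - (0 - f K x)) (\<lambda>x. (f k x - f K x) - (0 - f K x))
      \<le> 2 * G (\<lambda>x. f k x - f K x) (\<lambda>x. f k x - f K x) + 2 * G (\<lambda>x. 0 - f K x) (\<lambda>x. 0 - f K x)"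
      by (intro G_diff_le C1_bounded_diff assms z)
    also have "G (\<lambda>x. 0 - f K x) (\<lambda>x. 0 - f K x) = G (f K) (f K)"
    proof -
      have "G (\<lambda>x. 0) h = 0" "G h (\<lambda>x. 0) = 0" for h by (simp_all add: G_def grad_def partial_deriv_def)
      then show ?thesis
        using G_diff_left[OF z assms(1) C1_bounded_diff[OF z assms(1)], of K K] G_diff_right[OF z assms(1) assms(1), of K K] by simp
    qed
    finally show "G (f k) (f k) \<le> 2 * 1 + 2 * G (f K) (f K)" using K[OF k order_refl] e by simp
  qed (simp add: G_nonneg)
qed

lemma G_tendsto_0:
  assumes f: "\<And>k. C1_bounded (f k)" and g: "\<And>k. C1_bounded (g k)"
    and 0: "(\<lambda>k. G (f k) (f k)) \<longlonglongrightarrow> 0" and b: "\<And>k. k \<ge> K \<Longrightarrow> G (g k) (g k) \<le> c"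
  shows "(\<lambda>k. G (f k) (g k)) \<longlonglongrightarrow> 0"
proof -
  have "(\<lambda>k. G (f k) (f k) * c) \<longlonglongrightarrow> 0 * c" by (intro tendsto_intros 0)
  then have lim: "(\<lambda>k. G (f k) (f k) * c) \<longlonglongrightarrow> 0" by simp
  have "(\<lambda>k. (G (f k) (g k))\<^sup>2) \<longlonglongrightarrow> 0"
  proof (rule real_tendsto_sandwich[OF _ _ tendsto_const lim])
    show "\<forall>\<^sub>F k in sequentially. (G (f k) (g k))\<^sup>2 \<le> G (f k) (f k) * c"
    proof (rule eventually_sequentiallyI[of K])
      fix k assume "k \<ge> K"
      then have "G (f k) (f k) * G (g k) (g k) \<le> G (f k) (f k) * c"
        by (intro mult_left_mono b G_nonneg)
      with G_Cauchy_Schwarz[OF f g] show "(G (f k) (g k))\<^sup>2 \<le> G (f k) (f k) * c" by (rule order_trans)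
    qed
  qed auto
  from tendsto_real_sqrt[OF this] show ?thesis by (simp add: tendsto_rabs_zero_iff)
qed

text \<open>A definite description has a value only after uniqueness is known. Replacing the
  sequences f, g by f', g' changes the form by G (f' - f) g' + G (g' - g) f, and both terms tend to
  0 by Cauchy-Schwarz.\<close>

lemma form_eqI:
  assumes f: "form_approx \<beta> \<rho> f u" and g: "form_approx \<beta> \<rho> g v"
    and u: "u \<in> L2 \<mu>" and v: "v \<in> L2 \<mu>" and c: "(\<lambda>k. G (f k) (g k)) \<longlonglongrightarrow> c"
  shows "form \<beta> \<rho> u v = c"
  unfolding form_def
proof (rule the_equality)
  show all: "\<forall>f g. form_approx \<beta> \<rho> f u \<longrightarrow> form_approx \<beta> \<rho> g v \<longrightarrow> (\<lambda>k. pre_form \<beta> \<rho> (f k) (g k)) \<longlonglongrightarrow> c"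
  proof (intro allI impI)
    fix f' g' assume f': "form_approx \<beta> \<rho> f' u" and g': "form_approx \<beta> \<rho> g' v"
    note F = form_approxD[OF f] and H = form_approxD[OF g] and F' = form_approxD[OF f'] and H' = form_approxD[OF g']
    obtain a K where a: "\<And>k. k \<ge> K \<Longrightarrow> G (f k) (f k) \<le> a" using G_Cauchy_bounded[OF F(1,2)] by metis
    obtain b L where b: "\<And>k. k \<ge> L \<Longrightarrow> G (g' k) (g' k) \<le> b" using G_Cauchy_bounded[OF H'(1,2)] by metis
    have "(\<lambda>k. G (\<lambda>x. f' k x - f k x) (g' k)) \<longlonglongrightarrow> 0"
      by (rule G_tendsto_0[OF C1_bounded_diff[OF F'(1) F(1)] H'(1) form_approx_diff_tendsto[OF f' f u] b])
    moreover have "(\<lambda>k. G (\<lambda>x. g' k x - g k x) (f k)) \<longlonglongrightarrow> 0"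
      by (rule G_tendsto_0[OF C1_bounded_diff[OF H'(1) H(1)] F(1) form_approx_diff_tendsto[OF g' g v] a])
    ultimately have "(\<lambda>k. G (\<lambda>x. f' k x - f k x) (g' k) + G (\<lambda>x. g' k x - g k x) (f k) + G (f k) (g k)) \<longlonglongrightarrow> 0 + 0 + c"
      by (intro tendsto_add c)
    moreover have "G (\<lambda>x. f' k x - f k x) (g' k) + G (\<lambda>x. g' k x - g k x) (f k) + G (f k) (g k) = pre_form \<beta> \<rho> (f' k) (g' k)" for k
      by (simp add: G_diff_left F F' H H' pre_form_eq G_commute[of "f k"])
    ultimately show "(\<lambda>k. pre_form \<beta> \<rho> (f' k) (g' k)) \<longlonglongrightarrow> c" by simp
  qed
  fix c' assume "\<forall>f g. form_approx \<beta> \<rho> f u \<longrightarrow> form_approx \<beta> \<rho> g v \<longrightarrow> (\<lambda>k. pre_form \<beta> \<rho> (f k) (g k)) \<longlonglongrightarrow> c'"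
  with f g all show "c' = c" by (metis LIMSEQ_unique)
qed

text \<open>Vanishing energies make the sequence Cauchy by \<open>G_diff_le\<close>, and
  Cauchy-Schwarz against the bounded energies of any other approximating sequence makes the mixed
  form vanish.\<close>

lemma zero_energy_approx:
  assumes u: "u \<in> L2 \<mu>" and f: "\<And>k. f k \<in> Cc2_orthant"
    and L2: "(\<lambda>k. \<integral>x. (f k x - u x)\<^sup>2 \<partial>\<mu>) \<longlonglongrightarrow> 0" and G: "(\<lambda>k. G (f k) (f k)) \<longlonglongrightarrow> 0"
  shows "u \<in> form_domain \<beta> \<rho>" "\<And>v. v \<in> form_domain \<beta> \<rho> \<Longrightarrow> form \<beta> \<rho> u v = 0"
proof -
  have c: "C1_bounded (f k)" for k by (rule Cc2_C1_bounded[OF f])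
  have a: "form_approx \<beta> \<rho> f u"
    unfolding form_approx_def
  proof (intro conjI allI impI f)
    fix \<epsilon> :: real assume e: "0 < \<epsilon>"
    have "\<forall>\<^sub>F k in sequentially. G (f k) (f k) < \<epsilon> / 4" using e by (intro order_tendstoD[OF G]) simp
    then obtain K where K: "\<And>k. k \<ge> K \<Longrightarrow> G (f k) (f k) < \<epsilon> / 4" by (auto simp: eventually_sequentially)
    have "pre_form \<beta> \<rho> (\<lambda>x. f j x - f k x) (\<lambda>x. f j x - f k x) < \<epsilon>" if "j \<ge> K" "k \<ge> K" for j k
      using G_diff_le[OF c[of j] c[of k]] K[OF that(1)] K[OF that(2)]
      by (simp add: pre_form_eq[OF C1_bounded_diff[OF c c] C1_bounded_diff[OF c c]])
    then show "\<exists>K. \<forall>j\<ge>K. \<forall>k\<ge>K. pre_form \<beta> \<rho> (\<lambda>x. f j x - f k x) (\<lambda>x. f j x - f k x) < \<epsilon>" by blast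
  next
    show "(\<lambda>k. L2_norm \<mu> (\<lambda>x. f k x - u x)) \<longlonglongrightarrow> 0" using L2 by (simp add: L2_norm_tendsto_0_iff)
  qed
  show "u \<in> form_domain \<beta> \<rho>" using u a by (auto simp: form_domain_def)
  fix v assume "v \<in> form_domain \<beta> \<rho>"
  then obtain g where v: "v \<in> L2 \<mu>" and g: "form_approx \<beta> \<rho> g v" by (auto simp: form_domain_def)
  obtain b L where b: "\<And>k. k \<ge> L \<Longrightarrow> G (g k) (g k) \<le> b" using G_Cauchy_bounded[OF form_approxD(1,2)[OF g]] by metis
  show "form \<beta> \<rho> u v = 0"
    by (rule form_eqI[OF a g u v G_tendsto_0[OF c form_approxD(1)[OF g] G b]])
qed

text \<open>The energies of an approximating sequence are eventually bounded, hence converge along a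
  subsequence; by \<open>form_eqI\<close> their limit must be the value of the form.\<close>

lemma zero_form_approx:
  assumes u: "u \<in> form_domain \<beta> \<rho>" and z: "form \<beta> \<rho> u u = 0"
  obtains f where "\<And>k. C1_bounded (f k)" "(\<lambda>k. \<integral>x. (f k x - u x)\<^sup>2 \<partial>\<mu>) \<longlonglongrightarrow> 0" "(\<lambda>k. G (f k) (f k)) \<longlonglongrightarrow> 0"
proof -
  obtain f where u2: "u \<in> L2 \<mu>" and f: "form_approx \<beta> \<rho> f u" using u by (auto simp: form_domain_def)
  note F = form_approxD[OF f]
  obtain c K where c: "0 \<le> c" "\<And>k. k \<ge> K \<Longrightarrow> G (f k) (f k) \<le> c" using G_Cauchy_bounded[OF F(1,2)] by metis
  have "bounded (range (\<lambda>k. G (f (k + K)) (f (k + K))))"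
    using c G_nonneg by (auto simp: bounded_iff intro!: exI[of _ c])
  then obtain l and r :: "nat \<Rightarrow> nat" where r: "strict_mono r" "((\<lambda>k. G (f (k + K)) (f (k + K))) \<circ> r) \<longlonglongrightarrow> l"
    using bounded_imp_convergent_subsequence by blast
  \<comment> \<open>Skips the first K terms, to which the energy bound does not apply.\<close>
  define q where "q k = r k + K" for k
  have q: "strict_mono q" using r(1) by (simp add: q_def strict_mono_def)
  have qk: "k \<le> q k" for k using seq_suble[OF q] .
  have fq: "form_approx \<beta> \<rho> (\<lambda>k. f (q k)) u"
    unfolding form_approx_def
  proof (intro conjI allI impI)
    show "f (q k) \<in> Cc2_orthant" for k using f by (auto simp: form_approx_def)
    fix \<epsilon> :: real assume "0 < \<epsilon>"
    then obtain N where "\<forall>j\<ge>N. \<forall>k\<ge>N. pre_form \<beta> \<rho> (\<lambda>x. f j x - f k x) (\<lambda>x. f j x - f k x) < \<epsilon>"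
      using f unfolding form_approx_def by blast
    then show "\<exists>N. \<forall>j\<ge>N. \<forall>k\<ge>N. pre_form \<beta> \<rho> (\<lambda>x. f (q j) x - f (q k) x) (\<lambda>x. f (q j) x - f (q k) x) < \<epsilon>"
      using qk by (meson order_trans)
  next
    show "(\<lambda>k. L2_norm \<mu> (\<lambda>x. f (q k) x - u x)) \<longlonglongrightarrow> 0"
      using LIMSEQ_subseq_LIMSEQ[OF _ q, of "\<lambda>k. L2_norm \<mu> (\<lambda>x. f k x - u x)" 0] f by (simp add: form_approx_def comp_def)
  qed
  have lim: "(\<lambda>k. G (f (q k)) (f (q k))) \<longlonglongrightarrow> l" using r(2) by (simp add: q_def comp_def)
  have "l = 0" using form_eqI[OF fq fq u2 u2 lim] z by simp
  with lim show thesis using that[of "\<lambda>k. f (q k)"] form_approxD[OF fq] by blast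
qed

end

section \<open>Functions of zero energy\<close>

lemma measurable_coord:
  fixes \<phi> :: "real^'n::finite \<Rightarrow> 'b"
  assumes "\<phi> \<in> orthant_algebra \<rightarrow>\<^sub>M N"
  shows "(\<lambda>p. \<phi> (upd_coord (fst p) i (snd p))) \<in> ref_measure \<beta> \<Otimes>\<^sub>M sticky_line \<beta>' \<rightarrow>\<^sub>M N"
proof -
  have "(\<lambda>x. x) \<in> ref_measure \<beta> \<rightarrow>\<^sub>M (orthant_algebra :: (real^'n) measure)" by simp
  note f = measurable_compose[OF measurable_fst this, of "sticky_line \<beta>'"]
  have "(\<lambda>s. s) \<in> sticky_line \<beta>' \<rightarrow>\<^sub>M restrict_space borel {0..}"
    using measurable_cong_sets[OF sets_sticky_line refl] measurable_ident_sets by blast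
  note g = measurable_compose[OF measurable_snd this, of "ref_measure \<beta> :: (real^'n) measure"]
  show ?thesis by (rule measurable_compose[OF measurable_upd_coord[OF f g] assms])
qed

lemma measurable_upd_line:
  assumes "x \<in> orthant"
  shows "(\<lambda>s. upd_coord x i s) \<in> sticky_line \<beta> \<rightarrow>\<^sub>M (orthant_algebra :: (real^'n::finite) measure)"
proof -
  have "(\<lambda>s. s) \<in> sticky_line \<beta> \<rightarrow>\<^sub>M restrict_space borel {0..}"
    using measurable_cong_sets[OF sets_sticky_line refl] measurable_ident_sets by blast
  then show ?thesis using assms by (intro measurable_upd_coord) (auto simp: space_restrict_space)
qed

text \<open>Moving coordinate i within its side exchanges the roles of x_i and s.\<close>

lemma indicator_box_upd:
  assumes "x \<in> orthant" "0 \<le> s"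
  shows "indicator (I i) (x $ i) * indicator (box_in I) (upd_coord x i s) = (indicator (box_in I) x * indicator (I i) s :: ennreal)"
proof -
  have "x $ i \<in> I i \<and> upd_coord x i s \<in> box_in I \<longleftrightarrow> x \<in> box_in I \<and> s \<in> I i"
    using assms by (auto simp: box_in_def)
  then show ?thesis by (auto simp: indicator_def)
qed

text \<open>\<open>nn_integral_ref_measure_coord\<close> with the side of the box as window:
  integrating along i inside a box only multiplies by the mass of that side.\<close>

lemma nn_integral_box_coord:
  fixes \<phi> :: "real^'n::finite \<Rightarrow> ennreal"
  assumes \<phi> [measurable]: "\<phi> \<in> borel_measurable orthant_algebra"
    and I: "\<And>j. I j \<in> sets (restrict_space borel {0..})" and "0 \<le> \<beta>"
  shows "(\<integral>\<^sup>+x. indicator (box_in I) x * (\<integral>\<^sup>+s. indicator (I i) s * \<phi> (upd_coord x i s) \<partial>sticky_line \<beta>) \<partial>ref_measure \<beta>)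
    = emeasure (sticky_line \<beta>) (I i) * (\<integral>\<^sup>+x. indicator (box_in I) x * \<phi> x \<partial>ref_measure \<beta>)"
proof -
  have [measurable]: "box_in I \<in> sets orthant_algebra" by (rule box_in_measurable[OF I])
  have m: "(\<lambda>x. indicator (box_in I) x * \<phi> x) \<in> borel_measurable orthant_algebra" by measurable
  have e: "emeasure (sticky_line \<beta>) (I i) * (\<integral>\<^sup>+x. indicator (box_in I) x * \<phi> x \<partial>ref_measure \<beta>)
    = (\<integral>\<^sup>+x. indicator (I i) (x $ i) * (\<integral>\<^sup>+s. indicator (box_in I) (upd_coord x i s) * \<phi> (upd_coord x i s) \<partial>sticky_line \<beta>) \<partial>ref_measure \<beta>)"
    by (rule nn_integral_ref_measure_coord[OF m I assms(3)])
  show ?thesis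
    unfolding e
  proof (rule nn_integral_cong)
    fix x :: "real^'n" assume "x \<in> space (ref_measure \<beta>)"
    then have x: "x \<in> orthant" by simp
    note [measurable] = measurable_upd_line[OF x]
    have [measurable]: "I i \<in> sets (sticky_line \<beta>)" using I by simp
    have "indicator (box_in I) x * (\<integral>\<^sup>+s. indicator (I i) s * \<phi> (upd_coord x i s) \<partial>sticky_line \<beta>)
      = (\<integral>\<^sup>+s. indicator (box_in I) x * (indicator (I i) s * \<phi> (upd_coord x i s)) \<partial>sticky_line \<beta>)"
      by (rule nn_integral_cmult[symmetric]) measurable
    also have "\<dots> = (\<integral>\<^sup>+s. indicator (I i) (x $ i) * (indicator (box_in I) (upd_coord x i s) * \<phi> (upd_coord x i s)) \<partial>sticky_line \<beta>)"
      by (intro nn_integral_cong) (simp add: mult.assoc[symmetric] indicator_box_upd x)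
    also have "\<dots> = indicator (I i) (x $ i) * (\<integral>\<^sup>+s. indicator (box_in I) (upd_coord x i s) * \<phi> (upd_coord x i s) \<partial>sticky_line \<beta>)"
      by (rule nn_integral_cmult) measurable
    finally show "indicator (box_in I) x * (\<integral>\<^sup>+s. indicator (I i) s * \<phi> (upd_coord x i s) \<partial>sticky_line \<beta>)
      = indicator (I i) (x $ i) * (\<integral>\<^sup>+s. indicator (box_in I) (upd_coord x i s) * \<phi> (upd_coord x i s) \<partial>sticky_line \<beta>)" .
  qed
qed

text \<open>Tonelli for null sets: the exceptional set is integrated along the lines of direction i
  by \<open>nn_integral_box_coord\<close>.\<close>

lemma AE_coord:
  fixes P :: "real^'n::finite \<Rightarrow> bool"
  assumes P: "{x \<in> orthant. P x} \<in> sets orthant_algebra"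
    and I: "\<And>j. I j \<in> sets (restrict_space borel {0..})" and "0 \<le> \<beta>"
    and AE: "AE x in ref_measure \<beta>. x \<in> box_in I \<longrightarrow> P x"
  shows "AE x in ref_measure \<beta>. x \<in> box_in I \<longrightarrow> (AE s in sticky_line \<beta>. s \<in> I i \<longrightarrow> P (upd_coord x i s))"
proof -
  let ?N = "orthant - {x \<in> orthant. P x}"
  let ?T = "\<lambda>x. \<integral>\<^sup>+s. indicator (I i) s * indicator ?N (upd_coord x i s) \<partial>sticky_line \<beta>"
  interpret s: sigma_finite_measure "sticky_line \<beta>" by (rule sigma_finite_sticky_line)
  have [measurable]: "box_in I \<in> sets orthant_algebra" by (rule box_in_measurable[OF I])
  have "orthant \<in> sets (orthant_algebra :: (real^'n) measure)" by (simp add: sets_restrict_space_iff)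
  then have N [measurable]: "?N \<in> sets orthant_algebra" using P by (intro sets.Diff)
  have Ii [measurable]: "I i \<in> sets (sticky_line \<beta>)" using I by simp
  have "AE x in ref_measure \<beta>. indicator (box_in I) x * indicator ?N x = (0 :: ennreal)"
    using AE by eventually_elim (auto simp: indicator_def)
  then have "(\<integral>\<^sup>+x. indicator (box_in I) x * indicator ?N x \<partial>ref_measure \<beta>) = 0"
    by (subst nn_integral_0_iff_AE) auto
  moreover have "(\<lambda>x. indicator ?N x :: ennreal) \<in> borel_measurable orthant_algebra" by measurable
  ultimately have 0: "(\<integral>\<^sup>+x. indicator (box_in I) x * ?T x \<partial>ref_measure \<beta>) = 0"
    by (subst nn_integral_box_coord[OF _ I assms(3)]) auto
  have "(\<lambda>p. indicator (I i) (snd p) :: ennreal) \<in> borel_measurable (ref_measure \<beta> \<Otimes>\<^sub>M sticky_line \<beta>)"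
    by (rule measurable_compose[OF measurable_snd]) simp
  moreover have "(\<lambda>p. indicator ?N (upd_coord (fst p) i (snd p)) :: ennreal) \<in> borel_measurable (ref_measure \<beta> \<Otimes>\<^sub>M sticky_line \<beta>)"
    by (rule measurable_coord) measurable
  ultimately have "(\<lambda>(x, s). indicator (I i) s * indicator ?N (upd_coord x i s) :: ennreal) \<in> borel_measurable (ref_measure \<beta> \<Otimes>\<^sub>M sticky_line \<beta>)"
    unfolding case_prod_beta by (rule borel_measurable_times_ennreal)
  from s.borel_measurable_nn_integral[OF this]
  have "(\<lambda>x. indicator (box_in I) x * ?T x) \<in> borel_measurable (ref_measure \<beta>)" by simp
  with 0 have "AE x in ref_measure \<beta>. indicator (box_in I) x * ?T x = 0"
    by (subst (asm) nn_integral_0_iff_AE) auto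
  then show ?thesis
  proof (eventually_elim, intro impI)
    fix x assume "indicator (box_in I) x * ?T x = 0" "x \<in> box_in I"
    moreover from this have "x \<in> orthant" by (simp add: box_in_def)
    ultimately have x: "x \<in> orthant" and T: "?T x = 0" by auto
    note [measurable] = measurable_upd_line[OF x]
    have "(\<lambda>s. indicator (I i) s * indicator ?N (upd_coord x i s) :: ennreal) \<in> borel_measurable (sticky_line \<beta>)"
      by measurable
    from T nn_integral_0_iff_AE[OF this]
    have "AE s in sticky_line \<beta>. indicator (I i) s * indicator ?N (upd_coord x i s) = (0::ennreal)" by simp
    then show "AE s in sticky_line \<beta>. s \<in> I i \<longrightarrow> P (upd_coord x i s)"
      using AE_space by eventually_elim (use x in \<open>auto simp: indicator_def split: if_splits\<close>)
  qed
qed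

text \<open>Averaging over the coordinates one after the other changes nothing almost everywhere, and
  the result no longer depends on any coordinate.\<close>

lemma AE_const_box:
  fixes \<phi> :: "real^'n::finite \<Rightarrow> ennreal"
  assumes \<phi>: "\<phi> \<in> borel_measurable orthant_algebra"
    and I: "\<And>j. I j \<in> sets (restrict_space borel {0..})" and "0 \<le> \<beta>"
    and p: "\<And>j. 0 < emeasure (sticky_line \<beta>) (I j)" "\<And>j. emeasure (sticky_line \<beta>) (I j) < \<infinity>"
    and inv: "\<And>i. AE x in ref_measure \<beta>. x \<in> box_in I \<longrightarrow> (AE s in sticky_line \<beta>. s \<in> I i \<longrightarrow> \<phi> (upd_coord x i s) = \<phi> x)"
  shows "\<exists>c. AE x in ref_measure \<beta>. x \<in> box_in I \<longrightarrow> \<phi> x = c"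
proof -
  interpret s: sigma_finite_measure "sticky_line \<beta>" by (rule sigma_finite_sticky_line)
  \<comment> \<open>The mean over side i. Values in \<open>ennreal\<close> spare any integrability
    condition.\<close>
  define R where "R i \<psi> x = (\<integral>\<^sup>+s. indicator (I i) s * \<psi> (upd_coord x i s) \<partial>sticky_line \<beta>) / emeasure (sticky_line \<beta>) (I i)"
    for i and \<psi> :: "real^'n \<Rightarrow> ennreal" and x
  have Rm: "R i \<psi> \<in> borel_measurable orthant_algebra" if "\<psi> \<in> borel_measurable orthant_algebra" for i \<psi>
  proof -
    have "(\<lambda>p. indicator (I i) (snd p) :: ennreal) \<in> borel_measurable (ref_measure \<beta> \<Otimes>\<^sub>M sticky_line \<beta>)"
      by (rule measurable_compose[OF measurable_snd]) (use I in simp)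
    moreover have "(\<lambda>p. \<psi> (upd_coord (fst p) i (snd p))) \<in> borel_measurable (ref_measure \<beta> \<Otimes>\<^sub>M sticky_line \<beta>)"
      by (rule measurable_coord[OF that])
    ultimately have "(\<lambda>(x, s). indicator (I i) s * \<psi> (upd_coord x i s)) \<in> borel_measurable (ref_measure \<beta> \<Otimes>\<^sub>M sticky_line \<beta>)"
      unfolding case_prod_beta by (rule borel_measurable_times_ennreal)
    from s.borel_measurable_nn_integral[OF this] show ?thesis unfolding R_def by simp
  qed
  have "foldr R is \<phi> \<in> borel_measurable orthant_algebra \<and>
      (AE x in ref_measure \<beta>. x \<in> box_in I \<longrightarrow> foldr R is \<phi> x = \<phi> x) \<and>
      (\<forall>x y. (\<forall>j. j \<notin> set is \<longrightarrow> x $ j = y $ j) \<longrightarrow> foldr R is \<phi> x = foldr R is \<phi> y)" for "is"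
  \<comment> \<open>The last conjunct is the purpose: averaging over the coordinates in the list
    removes the dependence on them.\<close>
  proof (induction "is")
    case Nil
    show ?case using \<phi> by (auto simp: vec_eq_iff[symmetric])
  next
    case (Cons i "is")
    let ?\<psi> = "foldr R is \<phi>"
    note \<psi> = Cons.IH[THEN conjunct1]
    have "{x \<in> orthant. ?\<psi> x = \<phi> x} = {x \<in> space orthant_algebra. ?\<psi> x = \<phi> x}" by (simp add: space_restrict_space)
    also have "\<dots> \<in> sets orthant_algebra" using \<phi> \<psi> by measurable
    finally have "AE x in ref_measure \<beta>. x \<in> box_in I \<longrightarrow> (AE s in sticky_line \<beta>. s \<in> I i \<longrightarrow> ?\<psi> (upd_coord x i s) = \<phi> (upd_coord x i s))"
      by (rule AE_coord[OF _ I \<open>0 \<le> \<beta>\<close>]) (use Cons.IH in blast)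
    with inv[of i] have "AE x in ref_measure \<beta>. x \<in> box_in I \<longrightarrow> R i ?\<psi> x = \<phi> x"
    proof eventually_elim
      fix x
      assume 1: "x \<in> box_in I \<longrightarrow> (AE s in sticky_line \<beta>. s \<in> I i \<longrightarrow> \<phi> (upd_coord x i s) = \<phi> x)"
        and 2: "x \<in> box_in I \<longrightarrow> (AE s in sticky_line \<beta>. s \<in> I i \<longrightarrow> ?\<psi> (upd_coord x i s) = \<phi> (upd_coord x i s))"
      show "x \<in> box_in I \<longrightarrow> R i ?\<psi> x = \<phi> x"
      proof
        assume x: "x \<in> box_in I"
        have "AE s in sticky_line \<beta>. indicator (I i) s * ?\<psi> (upd_coord x i s) = \<phi> x * indicator (I i) s"
          using 1[rule_format, OF x] 2[rule_format, OF x] by eventually_elim (auto simp: indicator_def)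
        then have "R i ?\<psi> x = (\<integral>\<^sup>+s. \<phi> x * indicator (I i) s \<partial>sticky_line \<beta>) / emeasure (sticky_line \<beta>) (I i)"
          unfolding R_def by (intro arg_cong2[of _ _ _ _ "(/)"] nn_integral_cong_AE) auto
        also have "\<dots> = \<phi> x * emeasure (sticky_line \<beta>) (I i) / emeasure (sticky_line \<beta>) (I i)"
          by (subst nn_integral_cmult_indicator) (use I in auto)
        also have "\<dots> = \<phi> x"
          using p[of i] by (intro ennreal_mult_divide_eq) auto
        finally show "R i ?\<psi> x = \<phi> x" .
      qed
    qed
    moreover have "R i ?\<psi> x = R i ?\<psi> y" if xy: "\<forall>j. j \<notin> set (i # is) \<longrightarrow> x $ j = y $ j" for x y
    proof -
      have "?\<psi> (upd_coord x i s) = ?\<psi> (upd_coord y i s)" for s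
        using Cons.IH xy by auto
      then show ?thesis unfolding R_def by simp
    qed
    ultimately show ?case using Rm[OF \<psi>] by auto
  qed
  moreover obtain xs where "set xs = (UNIV :: 'n set)" using finite_list[of "UNIV :: 'n set"] by auto
  ultimately have *: "AE x in ref_measure \<beta>. x \<in> box_in I \<longrightarrow> foldr R xs \<phi> x = \<phi> x"
    and **: "\<And>x y. foldr R xs \<phi> x = foldr R xs \<phi> y" by blast+
  \<comment> \<open>After averaging over all coordinates nothing depends on x, so any point, here 0,
    gives the constant.\<close>
  have "AE x in ref_measure \<beta>. x \<in> box_in I \<longrightarrow> \<phi> x = foldr R xs \<phi> 0"
    using * by eventually_elim (metis **)
  then show ?thesis ..
qed

text \<open>Two local constants agree where their neighbourhoods meet, because a nonempty open set
  is not null; connectedness then leaves one constant. Lindelof reduces the cover to a countable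
  one, as almost everywhere statements demand.\<close>

lemma AE_const_connected:
  fixes \<phi> :: "real^'n::finite \<Rightarrow> 'b"
  assumes A: "openin (top_of_set orthant) A" "connected A" and "0 \<le> \<beta>"
    and loc: "\<And>z. z \<in> A \<Longrightarrow> \<exists>U. openin (top_of_set orthant) U \<and> z \<in> U \<and> (\<exists>c. AE x in ref_measure \<beta>. x \<in> U \<longrightarrow> \<phi> x = c)"
  shows "\<exists>c. AE x in ref_measure \<beta>. x \<in> A \<longrightarrow> \<phi> x = c"
proof -
  have "\<exists>U. \<forall>z\<in>A. openin (top_of_set orthant) (U z) \<and> z \<in> U z \<and> (\<exists>c. AE x in ref_measure \<beta>. x \<in> U z \<longrightarrow> \<phi> x = c)"
    by (rule bchoice) (use loc in blast)
  then obtain U where U: "\<And>z. z \<in> A \<Longrightarrow> openin (top_of_set orthant) (U z)" "\<And>z. z \<in> A \<Longrightarrow> z \<in> U z"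
    and ex: "\<And>z. z \<in> A \<Longrightarrow> \<exists>c. AE x in ref_measure \<beta>. x \<in> U z \<longrightarrow> \<phi> x = c" by blast
  have "\<exists>c. \<forall>z\<in>A. AE x in ref_measure \<beta>. x \<in> U z \<longrightarrow> \<phi> x = c z"
    by (rule bchoice) (use ex in blast)
  then obtain c where c: "\<And>z. z \<in> A \<Longrightarrow> AE x in ref_measure \<beta>. x \<in> U z \<longrightarrow> \<phi> x = c z" by blast
  have eq: "c y = c z" if yz: "y \<in> A" "z \<in> A" "y \<in> U z" for y z
  proof (rule ccontr)
    assume ne: "c y \<noteq> c z"
    have o: "openin (top_of_set orthant) (U y \<inter> U z)" using U(1) yz by (intro openin_Int) auto
    have "AE x in ref_measure \<beta>. x \<notin> U y \<inter> U z"
      using c[OF yz(1)] c[OF yz(2)] by eventually_elim (use ne in auto)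
    moreover have "U y \<inter> U z \<in> sets (ref_measure \<beta>)"
    proof -
      obtain W where "open W" "U y \<inter> U z = orthant \<inter> W" using o by (auto simp: openin_open)
      then show ?thesis by (auto simp: sets_restrict_space_iff)
    qed
    ultimately have "emeasure (ref_measure \<beta>) (U y \<inter> U z) = 0"
      using sets.sets_into_space[of "U y \<inter> U z" "ref_measure \<beta>"]
      by (subst (asm) AE_iff_measurable[where N = "U y \<inter> U z"]) auto
    moreover have "emeasure (ref_measure \<beta>) (U y \<inter> U z) > 0"
      by (rule ref_measure_open_pos[OF o _ assms(3)]) (use U(2) yz in blast)
    ultimately show False by simp
  qed
  have "c constant_on A"
  proof (rule locally_constant_imp_constant[OF A(2)])
    fix z assume z: "z \<in> A"
    have "openin (top_of_set A) (A \<inter> U z)"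
      by (rule openin_subset_trans[OF openin_Int[OF A(1) U(1)[OF z]]]) (use openin_imp_subset[OF A(1)] in auto)
    then show "\<exists>T. openin (top_of_set A) T \<and> z \<in> T \<and> (\<forall>x\<in>T. c x = c z)"
      using U(2)[OF z] by (intro exI[of _ "A \<inter> U z"] conjI ballI eq) (use z in blast)+
  qed
  then obtain k where k: "\<And>z. z \<in> A \<Longrightarrow> c z = k" unfolding constant_on_def by blast
  obtain F where F: "F \<subseteq> U ` A" "countable F" "\<Union>F = \<Union>(U ` A)"
    by (rule Lindelof_openin[of "U ` A" orthant]) (use U in auto)
  have "AE x in ref_measure \<beta>. \<forall>V\<in>F. x \<in> V \<longrightarrow> \<phi> x = k"
    unfolding AE_ball_countable[OF F(2)] using F(1) c k by fastforce
  then have "AE x in ref_measure \<beta>. x \<in> A \<longrightarrow> \<phi> x = k"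
    by eventually_elim (use F(3) U(2) in blast)
  then show ?thesis ..
qed

context weighted_orthant
begin

text \<open>The approximating functions are \<open>C\<^sup>1\<close> up to the boundary, so their oscillation along a line is
  controlled at every point of the line, the atom of \<open>sticky_line \<beta>\<close> at \<open>0\<close> included.\<close>

lemma AE_const_coord:
  fixes z :: "real^'n" and \<delta> c :: real
  defines "I \<equiv> \<lambda>j. {s. 0 \<le> s \<and> \<bar>s - z $ j\<bar> < \<delta>}"
  assumes f: "\<And>k. C1_bounded (f k)" and u: "u \<in> L2 \<mu>"
    and L2: "(\<lambda>k. \<integral>x. (f k x - u x)\<^sup>2 \<partial>\<mu>) \<longlonglongrightarrow> 0" and G0: "(\<lambda>k. G (f k) (f k)) \<longlonglongrightarrow> 0"
    and z: "z \<in> orthant" and d: "0 < \<delta>" and c: "0 < c" "\<And>x. x \<in> box_in I \<Longrightarrow> c \<le> \<rho> x"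
  shows "AE x in m. x \<in> box_in I \<longrightarrow> (AE s in sticky_line \<beta>. s \<in> I i \<longrightarrow> u (upd_coord x i s) = u x)"
proof -
  let ?\<nu> = "sticky_line \<beta>" and ?Q = "box_in I"
  have b0: "0 \<le> \<beta>" using beta_pos by simp
  have z0: "0 \<le> z $ j" for j using z by (simp add: orthant_def)
  have I: "I j \<in> sets (restrict_space borel {0..})" for j
    unfolding I_def by (rule sticky_line_interval(1)[OF z0 d])
  have Ii [measurable]: "I i \<in> sets ?\<nu>" using I by simp
  have Q [measurable]: "?Q \<in> sets orthant_algebra" by (rule box_in_measurable[OF I])
  have um [measurable]: "u \<in> borel_measurable orthant_algebra" using u by (simp add: L2_def)
  have fm [measurable]: "f k \<in> borel_measurable orthant_algebra" for k
    by (rule bounded_meas_measurable[OF C1_bounded_bounded_meas[OF f]])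
  have gm [measurable]: "grad i (f k) \<in> borel_measurable orthant_algebra" for k
    by (rule bounded_meas_measurable[OF C1_bounded_grad[OF f]])
  interpret s: sigma_finite_measure ?\<nu> by (rule sigma_finite_sticky_line)
  define p where "p = enn2real (emeasure ?\<nu> (I i))"
  have p: "emeasure ?\<nu> (I i) = ennreal p" "0 \<le> p"
    using sticky_line_interval(3)[OF z0 d, of \<beta> i] by (auto simp: p_def I_def ennreal_enn2real_if less_top)
  let ?D = "\<lambda>x s. ennreal ((u (upd_coord x i s) - u x)\<^sup>2)"
  let ?inner = "\<lambda>x. \<integral>\<^sup>+s. indicator (I i) s * ?D x s \<partial>?\<nu>"
  \<comment> \<open>The integrated squared increment of u along direction i; the goal is \<Phi> =
    0.\<close>
  define \<Phi> where "\<Phi> = (\<integral>\<^sup>+x. indicator ?Q x * ?inner x \<partial>m)"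
  have mI: "(\<lambda>q. indicator (I i) (snd q) :: ennreal) \<in> borel_measurable (m \<Otimes>\<^sub>M ?\<nu>)"
    by (rule measurable_compose[OF measurable_snd]) simp
  have inner_meas: "?inner \<in> borel_measurable orthant_algebra"
  proof -
    have 1: "(\<lambda>q. u (upd_coord (fst q) i (snd q))) \<in> borel_measurable (m \<Otimes>\<^sub>M ?\<nu>)" by (rule measurable_coord) simp
    have 2: "(\<lambda>q. u (fst q)) \<in> borel_measurable (m \<Otimes>\<^sub>M ?\<nu>)" by (rule measurable_compose[OF measurable_fst]) simp
    have "(\<lambda>(x, s). indicator (I i) s * ?D x s) \<in> borel_measurable (m \<Otimes>\<^sub>M ?\<nu>)"
      unfolding case_prod_beta by (intro borel_measurable_times_ennreal mI measurable_compose[OF _ measurable_ennreal] borel_measurable_power borel_measurable_diff 1 2)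
    from s.borel_measurable_nn_integral[OF this] show ?thesis by simp
  qed
  have line_meas: "(\<lambda>x. \<integral>\<^sup>+s. indicator (I i) s * \<phi> (upd_coord x i s) \<partial>?\<nu>) \<in> borel_measurable orthant_algebra"
    if "\<phi> \<in> borel_measurable orthant_algebra" for \<phi> :: "real^'n \<Rightarrow> ennreal"
  proof -
    have "(\<lambda>(x, s). indicator (I i) s * \<phi> (upd_coord x i s)) \<in> borel_measurable (m \<Otimes>\<^sub>M ?\<nu>)"
      unfolding case_prod_beta by (intro borel_measurable_times_ennreal mI measurable_coord that)
    from s.borel_measurable_nn_integral[OF this] show ?thesis by simp
  qed
  \<comment> \<open>On the box \<rho> \<ge> c, so there m is dominated by \<mu> / c.\<close>
  have on_Q: "(\<integral>\<^sup>+x. indicator ?Q x * \<phi> x \<partial>m) \<le> ennreal (1 / c) * (\<integral>\<^sup>+x. \<phi> x \<partial>\<mu>)"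
    if [measurable]: "\<phi> \<in> borel_measurable orthant_algebra" for \<phi> :: "real^'n \<Rightarrow> ennreal"
  proof -
    have "(\<integral>\<^sup>+x. indicator ?Q x * \<phi> x \<partial>m) \<le> (\<integral>\<^sup>+x. ennreal (1 / c) * (ennreal (\<rho> x) * \<phi> x) \<partial>m)"
    proof (rule nn_integral_mono)
      fix x
      show "indicator ?Q x * \<phi> x \<le> ennreal (1 / c) * (ennreal (\<rho> x) * \<phi> x)"
      proof (cases "x \<in> ?Q")
        case True
        have "1 \<le> 1 / c * \<rho> x" using c(1) c(2)[OF True] by (simp add: field_simps)
        then have "ennreal 1 \<le> ennreal (1 / c * \<rho> x)" by (rule ennreal_leI)
        then have "1 * \<phi> x \<le> ennreal (1 / c * \<rho> x) * \<phi> x" by (intro mult_right_mono) auto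
        moreover have "ennreal (1 / c * \<rho> x) * \<phi> x = ennreal (1 / c) * (ennreal (\<rho> x) * \<phi> x)"
          using c(1) by (subst ennreal_mult') (auto simp: mult.assoc)
        ultimately show ?thesis using True by simp
      qed simp
    qed
    also have "\<dots> = ennreal (1 / c) * (\<integral>\<^sup>+x. ennreal (\<rho> x) * \<phi> x \<partial>m)"
      by (rule nn_integral_cmult) simp
    finally show ?thesis by (simp add: nn_integral_mu)
  qed
  \<comment> \<open>Both terms tend to 0 with k. In the first, 6 is 3 + 3, because the approximation
    error enters at both ends of the increment; in the second it is 3 times the length bound 2
    \<delta>.\<close>
  have le: "\<Phi> \<le> ennreal (6 * p / c * (\<integral>x. (f k x - u x)\<^sup>2 \<partial>\<mu>) + 6 * \<delta> * p * p / c * G (f k) (f k))" for k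
  proof -
    define \<alpha> where "\<alpha> x = ennreal ((f k x - u x)\<^sup>2)" for x
    define \<gamma> where "\<gamma> x = ennreal ((grad i (f k) x)\<^sup>2)" for x
    have \<alpha>m [measurable]: "\<alpha> \<in> borel_measurable orthant_algebra" unfolding \<alpha>_def[abs_def] by measurable
    have \<gamma>m [measurable]: "\<gamma> \<in> borel_measurable orthant_algebra" unfolding \<gamma>_def[abs_def] by measurable
    let ?T = "\<lambda>x. \<integral>\<^sup>+s. indicator (I i) s * \<alpha> (upd_coord x i s) \<partial>?\<nu>"
    let ?K = "\<lambda>x. \<integral>\<^sup>+s. indicator (I i) s * \<gamma> (upd_coord x i s) \<partial>?\<nu>"
    note Tm [measurable] = line_meas[OF \<alpha>m] and Km [measurable] = line_meas[OF \<gamma>m]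
    have osc: "ennreal ((f k (upd_coord x i s) - f k x)\<^sup>2) \<le> ennreal (2 * \<delta>) * ?K x"
      if x: "x \<in> ?Q" and s: "s \<in> I i" for x s
    proof -
      have xo: "x \<in> orthant" and xi: "x $ i \<in> I i" using x by (auto simp: box_in_def)
      have xx: "upd_coord x i (x $ i) = x" by (simp add: vec_eq_iff)
      \<comment> \<open>The endpoints in increasing order, as the line estimate requires; the two
        cases differ by a sign that the square removes.\<close>
      define lo hi where "lo = min s (x $ i)" and "hi = max s (x $ i)"
      have lh: "0 \<le> lo" "lo \<le> hi" "lo \<in> I i" "hi \<in> I i" using s xi by (auto simp: lo_def hi_def I_def)
      have sub: "{lo..hi} \<subseteq> I i" using lh(3,4) by (auto simp: I_def abs_less_iff)
      have len: "hi - lo \<le> 2 * \<delta>" using lh(3,4) by (auto simp: I_def abs_less_iff)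
      have "(f k (upd_coord x i s) - f k x)\<^sup>2 = (f k (upd_coord x i hi) - f k (upd_coord x i lo))\<^sup>2"
        by (cases "s \<le> x $ i") (auto simp: lo_def hi_def min_def max_def xx power2_commute)
      then have "ennreal ((f k (upd_coord x i s) - f k x)\<^sup>2) \<le>
          ennreal (hi - lo) * (\<integral>\<^sup>+r. indicator {lo..hi} r * \<gamma> (upd_coord x i (max 0 r)) \<partial>lborel)"
        unfolding \<gamma>_def using grad_line_power2_le[OF f xo lh(1,2), of k i] by simp
      also have "\<dots> \<le> ennreal (2 * \<delta>) * (\<integral>\<^sup>+r. indicator (I i) r * \<gamma> (upd_coord x i r) * indicator {0..} r \<partial>lborel)"
      proof (rule mult_mono[OF ennreal_leI[OF len] nn_integral_mono])
        fix r show "indicator {lo..hi} r * \<gamma> (upd_coord x i (max 0 r)) \<le> indicator (I i) r * \<gamma> (upd_coord x i r) * indicator {0..} r"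
          using sub lh(1) by (auto simp: indicator_def max_absorb2)
      qed auto
      \<comment> \<open>Adding the atom only increases the integral.\<close>
      also have "\<dots> \<le> ennreal (2 * \<delta>) * ?K x"
      proof (rule mult_left_mono)
        have "(\<lambda>s. indicator (I i) s * \<gamma> (upd_coord x i s)) \<in> borel_measurable ?\<nu>"
          using measurable_upd_line[OF xo] by measurable
        then have "(\<lambda>s. indicator (I i) s * \<gamma> (upd_coord x i s)) \<in> borel_measurable (restrict_space borel {0..})"
          by (simp cong: measurable_cong_sets)
        from nn_integral_sticky_line[OF this, of \<beta>]
        show "(\<integral>\<^sup>+r. indicator (I i) r * \<gamma> (upd_coord x i r) * indicator {0..} r \<partial>lborel) \<le> ?K x" by simp
      qed simp
      finally show ?thesis .
    qed
    have "\<Phi> \<le> (\<integral>\<^sup>+x. indicator ?Q x * (3 * ?T x + ennreal p * (3 * (ennreal (2 * \<delta>) * ?K x) + 3 * \<alpha> x)) \<partial>m)"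
      unfolding \<Phi>_def
    proof (rule nn_integral_mono)
      fix x assume "x \<in> space m"
      then have xo: "x \<in> orthant" by simp
      note [measurable] = measurable_upd_line[OF xo]
      show "indicator ?Q x * ?inner x \<le> indicator ?Q x * (3 * ?T x + ennreal p * (3 * (ennreal (2 * \<delta>) * ?K x) + 3 * \<alpha> x))"
      proof (cases "x \<in> ?Q")
        case True
        have "?inner x \<le> (\<integral>\<^sup>+s. 3 * (indicator (I i) s * \<alpha> (upd_coord x i s)) + (3 * (ennreal (2 * \<delta>) * ?K x) + 3 * \<alpha> x) * indicator (I i) s \<partial>?\<nu>)"
        proof (rule nn_integral_mono)
          fix s
          show "indicator (I i) s * ?D x s \<le> 3 * (indicator (I i) s * \<alpha> (upd_coord x i s)) + (3 * (ennreal (2 * \<delta>) * ?K x) + 3 * \<alpha> x) * indicator (I i) s"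
          proof (cases "s \<in> I i")
            case s: True
            let ?a = "f k (upd_coord x i s) - u (upd_coord x i s)" and ?b = "f k (upd_coord x i s) - f k x" and ?c = "f k x - u x"
            have "(u (upd_coord x i s) - u x)\<^sup>2 = (?b - ?a + ?c)\<^sup>2" by simp
            also have "\<dots> \<le> 3 * ?a\<^sup>2 + (3 * ?b\<^sup>2 + 3 * ?c\<^sup>2)"
            proof -
              \<comment> \<open>Exactly the difference of the two sides of the claimed
                inequality.\<close>
              have "0 \<le> (?a + ?b)\<^sup>2 + (?a + ?c)\<^sup>2 + (?b - ?c)\<^sup>2" by simp
              then show ?thesis by (simp add: power2_eq_square algebra_simps)
            qed
            finally have "?D x s \<le> ennreal (3 * ?a\<^sup>2 + (3 * ?b\<^sup>2 + 3 * ?c\<^sup>2))" by (rule ennreal_leI)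
            also have "\<dots> = 3 * \<alpha> (upd_coord x i s) + (3 * ennreal (?b\<^sup>2) + 3 * \<alpha> x)"
              by (simp add: \<alpha>_def ennreal_plus ennreal_mult)
            also have "\<dots> \<le> 3 * \<alpha> (upd_coord x i s) + (3 * (ennreal (2 * \<delta>) * ?K x) + 3 * \<alpha> x)"
              by (intro add_mono mult_left_mono osc True s) auto
            finally show ?thesis using s by simp
          qed simp
        qed
        also have "\<dots> = 3 * ?T x + (3 * (ennreal (2 * \<delta>) * ?K x) + 3 * \<alpha> x) * emeasure ?\<nu> (I i)"
        proof -
          have m1: "(\<lambda>s. indicator (I i) s * \<alpha> (upd_coord x i s)) \<in> borel_measurable ?\<nu>" by measurable
          have m2: "(\<lambda>s. 3 * (indicator (I i) s * \<alpha> (upd_coord x i s))) \<in> borel_measurable ?\<nu>" using m1 by (rule borel_measurable_times_ennreal[OF borel_measurable_const])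
          have m3: "(\<lambda>s. (3 * (ennreal (2 * \<delta>) * ?K x) + 3 * \<alpha> x) * indicator (I i) s) \<in> borel_measurable ?\<nu>"
            by (rule borel_measurable_times_ennreal[OF borel_measurable_const borel_measurable_indicator[OF Ii]])
          show ?thesis
            unfolding nn_integral_add[OF m2 m3] nn_integral_cmult[OF m1] nn_integral_cmult_indicator[OF Ii] ..
        qed
        finally show ?thesis using True by (simp add: p mult.commute)
      qed simp
    qed
    also have "\<dots> = (\<integral>\<^sup>+x. 3 * (indicator ?Q x * ?T x) + ennreal p * (3 * (ennreal (2 * \<delta>) * (indicator ?Q x * ?K x)) + 3 * (indicator ?Q x * \<alpha> x)) \<partial>m)"
      by (intro nn_integral_cong) (auto simp: indicator_def)
    also have "\<dots> = 3 * (\<integral>\<^sup>+x. indicator ?Q x * ?T x \<partial>m) + ennreal p * (3 * (ennreal (2 * \<delta>) * (\<integral>\<^sup>+x. indicator ?Q x * ?K x \<partial>m)) + 3 * (\<integral>\<^sup>+x. indicator ?Q x * \<alpha> x \<partial>m))"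
      by (simp add: nn_integral_add nn_integral_cmult)
    also have "\<dots> = 3 * (ennreal p * (\<integral>\<^sup>+x. indicator ?Q x * \<alpha> x \<partial>m)) + ennreal p * (3 * (ennreal (2 * \<delta>) * (ennreal p * (\<integral>\<^sup>+x. indicator ?Q x * \<gamma> x \<partial>m))) + 3 * (\<integral>\<^sup>+x. indicator ?Q x * \<alpha> x \<partial>m))"
    proof -
      have e1: "(\<integral>\<^sup>+x. indicator ?Q x * ?T x \<partial>m) = ennreal p * (\<integral>\<^sup>+x. indicator ?Q x * \<alpha> x \<partial>m)"
        unfolding p(1)[symmetric] by (rule nn_integral_box_coord[OF \<alpha>m I b0])
      have e2: "(\<integral>\<^sup>+x. indicator ?Q x * ?K x \<partial>m) = ennreal p * (\<integral>\<^sup>+x. indicator ?Q x * \<gamma> x \<partial>m)"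
        unfolding p(1)[symmetric] by (rule nn_integral_box_coord[OF \<gamma>m I b0])
      show ?thesis unfolding e1 e2 ..
    qed
    also have "\<dots> \<le> 3 * (ennreal p * (ennreal (1 / c) * (\<integral>\<^sup>+x. \<alpha> x \<partial>\<mu>))) + ennreal p * (3 * (ennreal (2 * \<delta>) * (ennreal p * (ennreal (1 / c) * (\<integral>\<^sup>+x. \<gamma> x \<partial>\<mu>)))) + 3 * (ennreal (1 / c) * (\<integral>\<^sup>+x. \<alpha> x \<partial>\<mu>)))"
      by (intro add_mono mult_left_mono on_Q \<alpha>m \<gamma>m) auto
    also have "\<dots> \<le> 3 * (ennreal p * (ennreal (1 / c) * ennreal (\<integral>x. (f k x - u x)\<^sup>2 \<partial>\<mu>))) + ennreal p * (3 * (ennreal (2 * \<delta>) * (ennreal p * (ennreal (1 / c) * ennreal (G (f k) (f k))))) + 3 * (ennreal (1 / c) * ennreal (\<integral>x. (f k x - u x)\<^sup>2 \<partial>\<mu>)))"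
    proof -
      have 1: "(\<integral>\<^sup>+x. \<alpha> x \<partial>\<mu>) = ennreal (\<integral>x. (f k x - u x)\<^sup>2 \<partial>\<mu>)"
        unfolding \<alpha>_def using C1_bounded_bounded_meas[OF f] by (intro nn_integral_eq_integral integrable_diff_square u) auto
      have 2: "(\<integral>\<^sup>+x. \<gamma> x \<partial>\<mu>) \<le> ennreal (G (f k) (f k))"
        unfolding \<gamma>_def nn_integral_square[OF C1_bounded_grad[OF f]] G_self
        by (intro ennreal_leI member_le_sum) (auto simp: integral_nonneg_AE)
      show ?thesis unfolding 1 by (intro add_mono mult_left_mono 2) auto
    qed
    also have "\<dots> = ennreal (3 * (p * (1 / c * (\<integral>x. (f k x - u x)\<^sup>2 \<partial>\<mu>))) + p * (3 * (2 * \<delta> * (p * (1 / c * G (f k) (f k)))) + 3 * (1 / c * (\<integral>x. (f k x - u x)\<^sup>2 \<partial>\<mu>))))"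
    proof -
      have num: "3 * (ennreal p * (ennreal q * ennreal a)) + ennreal p * (3 * (ennreal e * (ennreal p * (ennreal q * ennreal g))) + 3 * (ennreal q * ennreal a))
          = ennreal (3 * (p * (q * a)) + p * (3 * (e * (p * (q * g))) + 3 * (q * a)))"
        if "0 \<le> q" "0 \<le> a" "0 \<le> e" "0 \<le> g" for q a e g
        unfolding ennreal_numeral[symmetric]
        using that p(2) by (simp only: ennreal_mult[symmetric] ennreal_plus[symmetric] mult_nonneg_nonneg add_nonneg_nonneg zero_le_numeral)
      show ?thesis by (rule num) (use c(1) d G_nonneg in \<open>auto simp: integral_nonneg_AE\<close>)
    qed
    also have "3 * (p * (1 / c * (\<integral>x. (f k x - u x)\<^sup>2 \<partial>\<mu>))) + p * (3 * (2 * \<delta> * (p * (1 / c * G (f k) (f k)))) + 3 * (1 / c * (\<integral>x. (f k x - u x)\<^sup>2 \<partial>\<mu>)))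
      = 6 * p / c * (\<integral>x. (f k x - u x)\<^sup>2 \<partial>\<mu>) + 6 * \<delta> * p * p / c * G (f k) (f k)"
      by (simp add: field_simps)
    finally show ?thesis .
  qed
  have "(\<lambda>k. ennreal (6 * p / c * (\<integral>x. (f k x - u x)\<^sup>2 \<partial>\<mu>) + 6 * \<delta> * p * p / c * G (f k) (f k))) \<longlonglongrightarrow> ennreal (6 * p / c * 0 + 6 * \<delta> * p * p / c * 0)"
    by (intro tendsto_intros L2 G0)
  then have "\<Phi> \<le> ennreal (6 * p / c * 0 + 6 * \<delta> * p * p / c * 0)"
    by (rule LIMSEQ_le_const) (use le in blast)
  then have "\<Phi> = 0" by simp
  then have "AE x in m. indicator ?Q x * ?inner x = 0"
    unfolding \<Phi>_def using inner_meas by (subst (asm) nn_integral_0_iff_AE) auto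
  then show ?thesis
  proof (eventually_elim, intro impI)
    fix x assume "indicator ?Q x * ?inner x = 0" "x \<in> ?Q"
    moreover from this have "x \<in> orthant" by (simp add: box_in_def)
    ultimately have x: "x \<in> orthant" and T: "?inner x = 0" by auto
    note [measurable] = measurable_upd_line[OF x]
    have "(\<lambda>s. indicator (I i) s * ?D x s) \<in> borel_measurable ?\<nu>" by measurable
    from T nn_integral_0_iff_AE[OF this] have "AE s in ?\<nu>. indicator (I i) s * ?D x s = 0" by simp
    then show "AE s in ?\<nu>. s \<in> I i \<longrightarrow> u (upd_coord x i s) = u x"
      by eventually_elim (auto simp: indicator_def split: if_splits)
  qed
qed

text \<open>Around each point of A the weight is bounded below on a box; there
  \<open>AE_const_coord\<close> makes u invariant along every direction, so
  \<open>AE_const_box\<close> gives a local constant, and \<open>AE_const_connected\<close> patches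
  these together.\<close>

lemma zero_energy_const:
  assumes u: "u \<in> form_domain \<beta> \<rho>" "form \<beta> \<rho> u u = 0" and u0: "\<And>x. x \<in> orthant \<Longrightarrow> 0 \<le> u x"
    and A: "openin (top_of_set orthant) A" "connected A" "\<And>x. x \<in> A \<Longrightarrow> \<rho> x \<noteq> 0"
  shows "\<exists>c. AE x in \<mu>. x \<in> A \<longrightarrow> u x = c"
proof -
  have b0: "0 \<le> \<beta>" using beta_pos by simp
  obtain f where f: "\<And>k. C1_bounded (f k)" "(\<lambda>k. \<integral>x. (f k x - u x)\<^sup>2 \<partial>\<mu>) \<longlonglongrightarrow> 0" "(\<lambda>k. G (f k) (f k)) \<longlonglongrightarrow> 0"
    by (rule zero_form_approx[OF u]) (rule that)
  have u2: "u \<in> L2 \<mu>" using u by (simp add: form_domain_def)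
  have um [measurable]: "u \<in> borel_measurable orthant_algebra" using u2 by (simp add: L2_def)
  \<comment> \<open>\<open>AE_const_box\<close> averages in \<open>ennreal\<close>; since u is
    nonnegative, nothing is lost in the passage.\<close>
  have "\<exists>c. AE x in m. x \<in> A \<longrightarrow> ennreal (u x) = c"
  proof (rule AE_const_connected[OF A(1,2) b0])
    fix z assume zA: "z \<in> A"
    then have z: "z \<in> orthant" using openin_imp_subset[OF A(1)] by auto
    have rz: "0 < \<rho> z" using A(3)[OF zA] rho_nonneg[OF z] by simp
    let ?V = "orthant \<inter> \<rho> -` {\<rho> z / 2<..}"
    have "openin (top_of_set orthant) ?V" using rho_continuous by (intro continuous_openin_preimage_gen) auto
    moreover have "z \<in> ?V" using z rz by auto
    ultimately obtain \<delta> where d: "0 < \<delta>" and sub: "box_in (\<lambda>i. {s. 0 \<le> s \<and> \<bar>s - z $ i\<bar> < \<delta>}) \<subseteq> ?V"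
      using box_in_nbhd by blast
    let ?I = "\<lambda>i. {s. 0 \<le> s \<and> \<bar>s - z $ i\<bar> < \<delta>}"
    have z0: "0 \<le> z $ j" for j using z by (simp add: orthant_def)
    note Int = sticky_line_interval[OF z0 d]
    have "\<exists>c. AE x in m. x \<in> box_in ?I \<longrightarrow> ennreal (u x) = c"
    proof (rule AE_const_box[OF _ Int(1) b0 Int(2,3)])
      fix i
      have "AE x in m. x \<in> box_in ?I \<longrightarrow> (AE s in sticky_line \<beta>. s \<in> ?I i \<longrightarrow> u (upd_coord x i s) = u x)"
        by (rule AE_const_coord[OF f(1) u2 f(2,3) z d, of "\<rho> z / 2"]) (use rz sub in auto)
      then show "AE x in m. x \<in> box_in ?I \<longrightarrow> (AE s in sticky_line \<beta>. s \<in> ?I i \<longrightarrow> ennreal (u (upd_coord x i s)) = ennreal (u x))"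
        by (rule AE_mp) (auto intro!: AE_I2 elim!: eventually_mono)
    qed measurable
    moreover have "openin (top_of_set orthant) (box_in ?I)"
    proof -
      have "box_in ?I = orthant \<inter> (\<Inter>i. {x. \<bar>x $ i - z $ i\<bar> < \<delta>})" by (auto simp: box_in_def orthant_def)
      moreover have "open (\<Inter>i. {x :: real^'n. \<bar>x $ i - z $ i\<bar> < \<delta>})"
        by (intro open_INT ballI open_Collect_less continuous_intros) auto
      ultimately show ?thesis by (simp add: openin_open_Int)
    qed
    moreover have "z \<in> box_in ?I" using z z0 d by (auto simp: box_in_def)
    ultimately show "\<exists>U. openin (top_of_set orthant) U \<and> z \<in> U \<and> (\<exists>c. AE x in m. x \<in> U \<longrightarrow> ennreal (u x) = c)"
      by blast
  qed
  then obtain c where "AE x in m. x \<in> A \<longrightarrow> ennreal (u x) = c" ..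
  then have "AE x in \<mu>. x \<in> A \<longrightarrow> u x = enn2real c"
    unfolding AE_mu_iff using AE_space by eventually_elim (use u0 in \<open>force simp: enn2real_ennreal\<close>)
  then show ?thesis ..
qed

end

section \<open>Smoothing by sliding averages\<close>

text \<open>One-sided on purpose: from a point of the orthant it looks only at points with larger
  coordinates, which stay in the orthant and have no smaller norm. Iterates are convolutions with
  box splines.\<close>

definition slide_avg :: "real \<Rightarrow> 'n::finite \<Rightarrow> (real^'n \<Rightarrow> real) \<Rightarrow> real^'n \<Rightarrow> real" where
  "slide_avg h j F x = (1 / h) * integral {0..h} (\<lambda>\<tau>. F (x + \<tau> *\<^sub>R axis j 1))"

lemma continuous_line:
  fixes F :: "real^'n::finite \<Rightarrow> real"
  assumes "continuous_on UNIV F" shows "continuous_on S (\<lambda>\<tau>. F (x + \<tau> *\<^sub>R v))"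
  by (rule continuous_on_compose2[OF assms]) (auto intro!: continuous_intros)

lemma continuous_slide_avg:
  fixes F :: "real^'n::finite \<Rightarrow> real"
  assumes F: "continuous_on UNIV F" shows "continuous_on UNIV (slide_avg h j F)"
proof -
  have "continuous_on UNIV (\<lambda>x. integral (cbox 0 h) (\<lambda>\<tau>. F (x + \<tau> *\<^sub>R axis j 1)))"
    by (rule integral_continuous_on_param)
      (auto simp: case_prod_beta intro!: continuous_on_compose2[OF F] continuous_intros)
  from continuous_on_mult[OF continuous_on_const[of _ "1 / h"] this] show ?thesis
    unfolding slide_avg_def[abs_def] by simp
qed

lemma slide_avg_deriv_same:
  fixes F :: "real^'n::finite \<Rightarrow> real"
  assumes F: "continuous_on UNIV F" and h: "0 < h"
  shows "((\<lambda>t. slide_avg h j F (x + t *\<^sub>R axis j 1)) has_real_derivative (F (x + h *\<^sub>R axis j 1) - F x) / h) (at 0)"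
proof -
  define \<phi> where "\<phi> s = F (x + s *\<^sub>R axis j 1)" for s
  have c: "continuous_on S \<phi>" for S unfolding \<phi>_def by (rule continuous_line[OF F])
  \<comment> \<open>The base point -1 makes 0 an interior point, so that \<Phi> has a two-sided
    derivative there.\<close>
  define \<Phi> where "\<Phi> u = integral {-1..u} \<phi>" for u
  have d: "(\<Phi> has_real_derivative \<phi> u) (at u)" if "-1 < u" for u
  proof -
    have "((\<lambda>u. integral {-1..u} \<phi>) has_real_derivative \<phi> u) (at u within {-1..u + 1})"
      by (rule integral_has_real_derivative[OF c]) (use that in auto)
    moreover have "at u within {-1..u + 1} = at u" by (rule at_within_interior) (use that in auto)
    ultimately show ?thesis by (simp add: \<Phi>_def[abs_def])
  qed
  have "((\<lambda>t. \<Phi> (t + h)) has_real_derivative \<phi> h) (at 0)"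
    using DERIV_shift[of \<Phi> "\<phi> h" 0 h] d[of h] h by simp
  then have D: "((\<lambda>t. (\<Phi> (t + h) - \<Phi> t) / h) has_real_derivative (\<phi> h - \<phi> 0) / h) (at 0)"
    by (intro DERIV_cdivide DERIV_diff d) auto
  have eq: "slide_avg h j F (x + t *\<^sub>R axis j 1) = (\<Phi> (t + h) - \<Phi> t) / h" if t: "-1 < t" for t
  proof -
    have "integral {0..h} (\<lambda>\<tau>. F (x + t *\<^sub>R axis j 1 + \<tau> *\<^sub>R axis j 1)) = integral {0..h} (\<lambda>\<tau>. \<phi> (\<tau> + t))"
      by (simp add: \<phi>_def algebra_simps)
    also have "\<dots> = integral {t..t + h} \<phi>"
      using integral_shift_real_ivl[of t t "t + h" \<phi>] by simp
    also have "\<dots> = \<Phi> (t + h) - \<Phi> t"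
      using Henstock_Kurzweil_Integration.integral_combine[of "-1" t "t + h" \<phi>] t h integrable_continuous_real[OF c]
      by (simp add: \<Phi>_def algebra_simps)
    finally show ?thesis by (simp add: slide_avg_def)
  qed
  have "\<forall>\<^sub>F t in nhds 0. (-1::real) < t"
    using eventually_nhds_in_open[of "{-1::real<..}" 0] by simp
  then have "\<forall>\<^sub>F t in nhds 0. slide_avg h j F (x + t *\<^sub>R axis j 1) = (\<Phi> (t + h) - \<Phi> t) / h"
    by eventually_elim (rule eq)
  from DERIV_cong_ev[OF refl this refl] D show ?thesis by (simp add: \<phi>_def)
qed

definition has_partials :: "'n::finite set \<Rightarrow> (real^'n \<Rightarrow> real) \<Rightarrow> bool" where
  "has_partials J F \<longleftrightarrow> continuous_on UNIV F \<and>
     (\<forall>i\<in>J. (\<forall>x. (\<lambda>t. F (x + t *\<^sub>R axis i 1)) differentiable (at 0)) \<and> continuous_on UNIV (partial_deriv i F))"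

lemma has_partialsD:
  assumes "has_partials J F"
  shows "continuous_on UNIV F" "i \<in> J \<Longrightarrow> continuous_on UNIV (partial_deriv i F)"
    "i \<in> J \<Longrightarrow> ((\<lambda>t. F (x + t *\<^sub>R axis i 1)) has_real_derivative partial_deriv i F x) (at 0)"
  using assms unfolding has_partials_def partial_deriv_def by (auto simp: DERIV_deriv_iff_real_differentiable)

lemma slide_avg_deriv_other:
  fixes F :: "real^'n::finite \<Rightarrow> real"
  assumes F: "has_partials J F" and i: "i \<in> J" and h: "0 < h"
  shows "((\<lambda>t. slide_avg h j F (x + t *\<^sub>R axis i 1)) has_real_derivative slide_avg h j (partial_deriv i F) x) (at 0)"
proof -
  let ?f = "\<lambda>t \<tau>. F (x + t *\<^sub>R axis i 1 + \<tau> *\<^sub>R axis j 1)"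
  let ?g = "\<lambda>t \<tau>. partial_deriv i F (x + t *\<^sub>R axis i 1 + \<tau> *\<^sub>R axis j 1)"
  have "((\<lambda>t. integral (cbox 0 h) (?f t)) has_field_derivative integral (cbox 0 h) (?g 0)) (at 0 within UNIV)"
  proof (rule leibniz_rule_field_derivative)
    fix t \<tau> :: real
    have "((\<lambda>u. F (x + t *\<^sub>R axis i 1 + \<tau> *\<^sub>R axis j 1 + u *\<^sub>R axis i 1)) has_real_derivative ?g t \<tau>) (at 0)"
      by (rule has_partialsD(3)[OF F i])
    then have "((\<lambda>u. ?f (u + t) \<tau>) has_real_derivative ?g t \<tau>) (at 0)"
      by (simp add: algebra_simps)
    then show "((\<lambda>t. ?f t \<tau>) has_real_derivative ?g t \<tau>) (at t within UNIV)"
      using DERIV_shift[of "\<lambda>u. ?f u \<tau>" "?g t \<tau>" 0 t] by simp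
  next
    fix t show "?f t integrable_on cbox 0 h"
      by (rule integrable_continuous) (rule continuous_line[OF has_partialsD(1)[OF F]])
  next
    show "continuous_on (UNIV \<times> cbox 0 h) (\<lambda>(t, \<tau>). ?g t \<tau>)"
      by (auto simp: case_prod_beta intro!: continuous_on_compose2[OF has_partialsD(2)[OF F i]] continuous_intros)
  qed auto
  from DERIV_cmult[OF this, of "1 / h"] show ?thesis unfolding slide_avg_def by simp
qed

lemma partial_deriv_slide_avg:
  "has_partials J F \<Longrightarrow> i \<in> J \<Longrightarrow> 0 < h \<Longrightarrow> partial_deriv i (slide_avg h j F) = slide_avg h j (partial_deriv i F)"
  unfolding partial_deriv_def[of i "slide_avg h j F"] using DERIV_imp_deriv[OF slide_avg_deriv_other] by fastforce

lemma has_partials_slide_avg: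
  fixes F :: "real^'n::finite \<Rightarrow> real"
  assumes F: "has_partials J F" and h: "0 < h"
  shows "has_partials (insert j J) (slide_avg h j F)"
  unfolding has_partials_def
proof (intro conjI ballI allI)
  show "continuous_on UNIV (slide_avg h j F)" by (rule continuous_slide_avg[OF has_partialsD(1)[OF F]])
  fix i assume i: "i \<in> insert j J"
  have "(\<forall>x. (\<lambda>t. slide_avg h j F (x + t *\<^sub>R axis i 1)) differentiable at 0) \<and> continuous_on UNIV (partial_deriv i (slide_avg h j F))"
  proof (cases "i \<in> J")
    case True
    then show ?thesis
      using slide_avg_deriv_other[OF F True h] continuous_slide_avg[OF has_partialsD(2)[OF F True], of h j]
      by (auto simp: partial_deriv_slide_avg[OF F True h] simp: real_differentiable_def)
  next
    case False
    then have ij: "i = j" using i by simp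
    note D = slide_avg_deriv_same[OF has_partialsD(1)[OF F] h, of j]
    have "partial_deriv j (slide_avg h j F) x = (F (x + h *\<^sub>R axis j 1) - F x) / h" for x
      unfolding partial_deriv_def by (rule DERIV_imp_deriv[OF D])
    moreover have "continuous_on UNIV (\<lambda>x. (F (x + h *\<^sub>R axis j 1) - F x) / h)"
      using h by (intro continuous_intros continuous_on_compose2[OF has_partialsD(1)[OF F]]) auto
    ultimately show ?thesis using D ij by (auto simp: real_differentiable_def cong: continuous_on_cong)
  qed
  then show "(\<lambda>t. slide_avg h j F (x + t *\<^sub>R axis i 1)) differentiable at 0" "continuous_on UNIV (partial_deriv i (slide_avg h j F))" for x
    by auto
qed

lemma has_partials_foldr:
  assumes "has_partials J F" "0 < h"
  shows "has_partials (set xs \<union> J) (foldr (slide_avg h) xs F)"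
proof (induction xs)
  case (Cons j xs)
  from has_partials_slide_avg[OF this assms(2), of j] show ?case by simp
qed (use assms in simp)

lemma partial_deriv_foldr:
  assumes "has_partials J F" "i \<in> J" "0 < h"
  shows "partial_deriv i (foldr (slide_avg h) xs F) = foldr (slide_avg h) xs (partial_deriv i F)"
proof (induction xs)
  case (Cons j xs)
  then show ?case
    using partial_deriv_slide_avg[OF has_partials_foldr[OF assms(1,3), of xs] _ assms(3), of i j] assms(2) by simp
qed simp

fun smooth_upto :: "nat \<Rightarrow> (real^'n::finite \<Rightarrow> real) \<Rightarrow> bool" where
  "smooth_upto 0 F \<longleftrightarrow> continuous_on UNIV F"
| "smooth_upto (Suc k) F \<longleftrightarrow> has_partials UNIV F \<and> (\<forall>i. smooth_upto k (partial_deriv i F))"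

lemma smooth_upto_continuous: "smooth_upto k F \<Longrightarrow> continuous_on UNIV F"
  by (cases k) (auto simp: has_partials_def)

text \<open>Existing derivatives commute with the averages, so the induction can differentiate
  first; at k = 0 every direction occurs in xs and gains a derivative.\<close>

lemma smooth_upto_foldr:
  assumes "set xs = UNIV" "0 < h"
  shows "smooth_upto k F \<Longrightarrow> smooth_upto (Suc k) (foldr (slide_avg h) xs F)"
proof (induction k arbitrary: F)
  case 0
  then have "has_partials {} F" by (simp add: has_partials_def)
  from has_partials_foldr[OF this assms(2), of xs] show ?case by (auto simp: assms has_partials_def)
next
  case (Suc k)
  then have F: "has_partials UNIV F" by simp
  have "smooth_upto (Suc k) (partial_deriv i (foldr (slide_avg h) xs F))" for i
    unfolding partial_deriv_foldr[OF F UNIV_I assms(2)] by (rule Suc.IH) (use Suc.prems in simp)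
  moreover have "has_partials UNIV (foldr (slide_avg h) xs F)"
    using has_partials_foldr[OF F assms(2), of xs] by simp
  ultimately show ?case by simp
qed

lemma smooth_upto_iter_partial:
  "smooth_upto k F \<Longrightarrow> length is \<le> k \<Longrightarrow> continuous_on UNIV (iter_partial is F) \<and>
    (length is < k \<longrightarrow> (\<forall>i x. (\<lambda>t. iter_partial is F (x + t *\<^sub>R axis i 1)) differentiable (at 0)))"
proof (induction k arbitrary: F "is")
  case 0
  then show ?case by (simp add: iter_partial_def)
next
  case (Suc k)
  show ?case
  \<comment> \<open>\<open>iter_partial\<close> is a \<open>foldr\<close>: the last index of the
    list is differentiated first.\<close>
  proof (cases "is" rule: rev_cases)
    case Nil
    then show ?thesis using Suc.prems by (auto simp: iter_partial_def has_partials_def)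
  next
    case (snoc js j)
    have "smooth_upto k (partial_deriv j F)" using Suc.prems by simp
    from Suc.IH[OF this, of js] Suc.prems(2) snoc show ?thesis by (simp add: iter_partial_def)
  qed
qed

lemma smooth_upto_Ck_orthant:
  assumes "smooth_upto k F" shows "F \<in> Ck_orthant k"
  using smooth_upto_continuous[OF assms] smooth_upto_iter_partial[OF assms]
  by (fastforce simp: Ck_orthant_def Ck_dirs_def extends_continuously_def intro: continuous_on_subset)

text \<open>Anchored at its lower corner, since the averages look only upwards.\<close>

definition cube :: "real^'n::finite \<Rightarrow> real \<Rightarrow> (real^'n) set" where
  "cube x a = {y. \<forall>i. x $ i \<le> y $ i \<and> y $ i \<le> x $ i + a}"

lemma slide_avg_bounds:
  fixes F :: "real^'n::finite \<Rightarrow> real"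
  assumes F: "continuous_on UNIV F" and h: "0 < h"
    and b: "\<And>y. y \<in> cube x (a + h) \<Longrightarrow> lo \<le> F y \<and> F y \<le> hi" and y: "y \<in> cube x a"
  shows "lo \<le> slide_avg h j F y \<and> slide_avg h j F y \<le> hi"
proof -
  have c: "y + \<tau> *\<^sub>R axis j 1 \<in> cube x (a + h)" if "\<tau> \<in> {0..h}" for \<tau>
  proof -
    have "x $ i \<le> y $ i \<and> y $ i \<le> x $ i + a" for i using y by (simp add: cube_def)
    then show ?thesis using that by (auto simp: cube_def axis_def) (smt (verit))+
  qed
  have i: "(\<lambda>\<tau>. F (y + \<tau> *\<^sub>R axis j 1)) integrable_on {0..h}"
    by (intro integrable_continuous_real continuous_line[OF F])
  have "integral {0..h} (\<lambda>_. lo) \<le> integral {0..h} (\<lambda>\<tau>. F (y + \<tau> *\<^sub>R axis j 1))"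
    by (rule integral_le) (use i b[OF c] in auto)
  moreover have "integral {0..h} (\<lambda>\<tau>. F (y + \<tau> *\<^sub>R axis j 1)) \<le> integral {0..h} (\<lambda>_. hi)"
    by (rule integral_le) (use i b[OF c] in auto)
  ultimately show ?thesis using h by (simp add: slide_avg_def field_simps)
qed

lemma continuous_foldr_slide_avg:
  "continuous_on UNIV F \<Longrightarrow> continuous_on UNIV (foldr (slide_avg h) xs F)"
  by (induction xs) (auto intro: continuous_slide_avg)

text \<open>Each average enlarges the region on which F matters by h.\<close>

lemma foldr_slide_avg_bounds:
  fixes F :: "real^'n::finite \<Rightarrow> real"
  assumes F: "continuous_on UNIV F" and h: "0 < h"
  shows "(\<And>y. y \<in> cube x (a + real (length xs) * h) \<Longrightarrow> lo \<le> F y \<and> F y \<le> hi) \<Longrightarrow> y \<in> cube x a \<Longrightarrow>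
    lo \<le> foldr (slide_avg h) xs F y \<and> foldr (slide_avg h) xs F y \<le> hi"
proof (induction xs arbitrary: a y)
  case Nil
  then show ?case by simp
next
  case (Cons j xs)
  have "lo \<le> slide_avg h j (foldr (slide_avg h) xs F) y \<and> slide_avg h j (foldr (slide_avg h) xs F) y \<le> hi"
  proof (rule slide_avg_bounds[OF continuous_foldr_slide_avg[OF F] h _ Cons.prems(2)])
    fix y assume y: "y \<in> cube x (a + h)"
    show "lo \<le> foldr (slide_avg h) xs F y \<and> foldr (slide_avg h) xs F y \<le> hi"
      by (rule Cons.IH[OF _ y]) (use Cons.prems(1) in \<open>simp add: algebra_simps\<close>)
  qed
  then show ?case by simp
qed

lemma slide_avg_translate_diff:
  fixes F :: "real^'n::finite \<Rightarrow> real"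
  assumes F: "continuous_on UNIV F"
  shows "slide_avg h j F (y + v) - slide_avg h j F y = slide_avg h j (\<lambda>y. F (y + v) - F y) y"
proof -
  have "integral {0..h} (\<lambda>\<tau>. F (y + \<tau> *\<^sub>R axis j 1 + v) - F (y + \<tau> *\<^sub>R axis j 1))
    = integral {0..h} (\<lambda>\<tau>. F (y + v + \<tau> *\<^sub>R axis j 1)) - integral {0..h} (\<lambda>\<tau>. F (y + \<tau> *\<^sub>R axis j 1))"
  proof (subst Henstock_Kurzweil_Integration.integral_diff[symmetric])
    show "(\<lambda>\<tau>. F (y + v + \<tau> *\<^sub>R axis j 1)) integrable_on {0..h}" "(\<lambda>\<tau>. F (y + \<tau> *\<^sub>R axis j 1)) integrable_on {0..h}"
      by (intro integrable_continuous_real continuous_line[OF F])+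
  qed (simp add: add_ac)
  then show ?thesis by (simp add: slide_avg_def right_diff_distrib diff_divide_distrib)
qed

lemma foldr_slide_avg_translate_diff:
  fixes F :: "real^'n::finite \<Rightarrow> real"
  assumes F: "continuous_on UNIV F"
  shows "foldr (slide_avg h) xs F (y + v) - foldr (slide_avg h) xs F y = foldr (slide_avg h) xs (\<lambda>y. F (y + v) - F y) y"
proof (induction xs arbitrary: y)
  case (Cons j xs)
  have "foldr (slide_avg h) (j # xs) F (y + v) - foldr (slide_avg h) (j # xs) F y
    = slide_avg h j (\<lambda>y. foldr (slide_avg h) xs F (y + v) - foldr (slide_avg h) xs F y) y"
    by (simp add: slide_avg_translate_diff[OF continuous_foldr_slide_avg[OF F]])
  then show ?case by (simp add: Cons.IH)
qed simp

text \<open>Averages commute with translations, so the difference quotient of the averaged function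
  is the average of the difference quotients, and these are bounded near x. As the derivative D is
  known to exist, steps t > 0 suffice.\<close>

lemma foldr_slide_avg_deriv_bound:
  fixes F :: "real^'n::finite \<Rightarrow> real"
  assumes F: "continuous_on UNIV F" and h: "0 < h" and t0: "0 < t0"
    and L: "\<And>y t. y \<in> cube x (real (length xs) * h) \<Longrightarrow> 0 \<le> t \<Longrightarrow> t \<le> t0 \<Longrightarrow> \<bar>F (y + t *\<^sub>R axis i 1) - F y\<bar> \<le> L * t"
    and D: "((\<lambda>t. foldr (slide_avg h) xs F (x + t *\<^sub>R axis i 1)) has_real_derivative D) (at 0)"
  shows "\<bar>D\<bar> \<le> L"
proof -
  let ?S = "foldr (slide_avg h) xs"
  have x: "x \<in> cube x 0" by (simp add: cube_def)
  have b: "\<bar>(?S F (x + t *\<^sub>R axis i 1) - ?S F x) / t\<bar> \<le> L" if t: "0 < t" "t \<le> t0" for t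
  proof -
    have c: "continuous_on UNIV (\<lambda>y. F (y + t *\<^sub>R axis i 1) - F y)"
      by (intro continuous_intros continuous_on_compose2[OF F]) auto
    have "- (L * t) \<le> ?S (\<lambda>y. F (y + t *\<^sub>R axis i 1) - F y) x \<and> ?S (\<lambda>y. F (y + t *\<^sub>R axis i 1) - F y) x \<le> L * t"
    proof (rule foldr_slide_avg_bounds[OF c h _ x])
      fix y assume "y \<in> cube x (0 + real (length xs) * h)"
      then have "\<bar>F (y + t *\<^sub>R axis i 1) - F y\<bar> \<le> L * t" using t by (intro L) auto
      then show "- (L * t) \<le> F (y + t *\<^sub>R axis i 1) - F y \<and> F (y + t *\<^sub>R axis i 1) - F y \<le> L * t" by linarith
    qed
    then have "\<bar>?S F (x + t *\<^sub>R axis i 1) - ?S F x\<bar> \<le> L * t"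
      by (simp add: foldr_slide_avg_translate_diff[OF F] abs_le_iff)
    then show ?thesis using t by (simp add: field_simps)
  qed
  have "((\<lambda>t. (?S F (x + t *\<^sub>R axis i 1) - ?S F x) / t) \<longlongrightarrow> D) (at 0)"
    using D by (simp add: DERIV_def)
  then have "((\<lambda>t. \<bar>(?S F (x + t *\<^sub>R axis i 1) - ?S F x) / t\<bar>) \<longlongrightarrow> \<bar>D\<bar>) (at_right 0)"
    by (intro tendsto_rabs) (rule tendsto_mono[OF at_le], auto)
  moreover have "\<forall>\<^sub>F t in at_right 0. \<bar>(?S F (x + t *\<^sub>R axis i 1) - ?S F x) / t\<bar> \<le> L"
    unfolding eventually_at_right_field using t0 b by (intro exI[of _ t0]) auto
  ultimately show ?thesis
    by (intro tendsto_upperbound[of "\<lambda>t. \<bar>(?S F (x + t *\<^sub>R axis i 1) - ?S F x) / t\<bar>" _ "at_right 0"]) auto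
qed

section \<open>Elementary bounds for the cut-off\<close>

definition unit_clamp :: "real \<Rightarrow> real" where
  "unit_clamp v = max 0 (min 1 v)"

lemma unit_clamp_bounds [simp]: "0 \<le> unit_clamp v" "unit_clamp v \<le> 1"
  by (auto simp: unit_clamp_def)

lemma unit_clamp_eq: "v \<le> 0 \<Longrightarrow> unit_clamp v = 0" "1 \<le> v \<Longrightarrow> unit_clamp v = 1"
  by (auto simp: unit_clamp_def)

lemma unit_clamp_lipschitz: "\<bar>unit_clamp v - unit_clamp w\<bar> \<le> \<bar>v - w\<bar>"
  by (auto simp: unit_clamp_def max_def min_def)

lemma continuous_unit_clamp [continuous_intros]:
  "continuous_on S f \<Longrightarrow> continuous_on S (\<lambda>x. unit_clamp (f x))"
  unfolding unit_clamp_def by (intro continuous_intros)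

lemma cube_norm_le:
  fixes x :: "real^'n::finite"
  assumes "y \<in> cube x a" shows "norm (y - x) \<le> real CARD('n) * a"
proof -
  have "norm (y - x) \<le> (\<Sum>i\<in>UNIV. \<bar>(y - x) $ i\<bar>)" by (rule norm_le_l1_cart)
  also have "\<dots> \<le> (\<Sum>i\<in>(UNIV::'n set). a)"
  proof (rule sum_mono)
    fix i
    have "x $ i \<le> y $ i \<and> y $ i \<le> x $ i + a" using assms by (simp add: cube_def)
    then show "\<bar>(y - x) $ i\<bar> \<le> a" by simp
  qed
  finally show ?thesis by simp
qed

lemma norm_mono_orthant:
  fixes x y :: "real^'n::finite"
  assumes "x \<in> orthant" "\<And>i. x $ i \<le> y $ i" shows "norm x \<le> norm y"
proof (rule norm_le_componentwise_cart)
  fix i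
  have "0 \<le> x $ i" using assms(1) by (simp add: orthant_def)
  then show "norm (x $ i) \<le> norm (y $ i)" using assms(2)[of i] by simp
qed

section \<open>Cut-off functions of small energy\<close>

text \<open>Ramps at the scales \<open>r k = r0 / 8 ^ (k + 1)\<close> around the zero set of \<open>d\<close> have gradients supported
  in disjoint shells. If the shell at scale \<open>r\<close> has measure \<open>O(r\<^sup>2)\<close>, every ramp has bounded energy,
  so by orthogonality the average of \<open>n\<close> ramps has energy \<open>O(1 / n)\<close>.\<close>

locale cutoff = weighted_orthant \<beta> \<rho> for \<beta> and \<rho> :: "real^'n::finite \<Rightarrow> real" +
  fixes A :: "(real^'n) set" and d :: "real^'n \<Rightarrow> real" and r0 C :: real
  assumes A_sets: "A \<in> sets orthant_algebra"
    and d_lip: "\<bar>d x - d y\<bar> \<le> norm (x - y)" and d_nonneg: "0 \<le> d x"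
    and d_A: "x \<in> orthant \<Longrightarrow> x \<in> A \<longleftrightarrow> 0 < d x"
    and r0: "0 < r0" and C: "0 \<le> C"
    and shell_measure: "0 < s \<Longrightarrow> s < r0 \<Longrightarrow> emeasure \<mu> {x \<in> orthant. 0 < d x \<and> d x < s} \<le> ennreal (C * s\<^sup>2)"
begin

definition r :: "nat \<Rightarrow> real" where "r k = r0 * (1 / 8) ^ Suc k"

lemma r_pos: "0 < r k" using r0 by (simp add: r_def)

lemma r_Suc: "r (Suc k) = r k / 8" by (simp add: r_def)

lemma r_mono: "k \<le> j \<Longrightarrow> r j \<le> r k"
  using r0 by (auto simp: r_def intro!: mult_left_mono power_decreasing)

lemma r_less: "k < j \<Longrightarrow> r j \<le> r k / 8"
  using r_mono[of "Suc k" j] by (simp add: r_Suc)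

lemma r_le: "r k \<le> r0 / 8" using r_mono[of 0 k] by (simp add: r_def)

lemma r_lim: "r \<longlonglongrightarrow> 0"
proof -
  have "(\<lambda>k. r0 * (1 / 8) ^ Suc k) \<longlonglongrightarrow> r0 * 0"
    by (intro tendsto_mult tendsto_const LIMSEQ_Suc LIMSEQ_power_zero) simp
  then show ?thesis by (simp add: r_def[abs_def])
qed

lemma d_continuous: "continuous_on S d"
proof (rule lipschitz_on_continuous_on[of 1])
  show "1-lipschitz_on S d" by (rule lipschitz_onI) (use d_lip in \<open>auto simp: dist_real_def dist_norm\<close>)
qed

definition ramp :: "nat \<Rightarrow> real \<Rightarrow> real" where "ramp k v = unit_clamp (2 * v / r k - 1)"

lemma ramp_0: "v \<le> r k / 2 \<Longrightarrow> ramp k v = 0"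
  unfolding ramp_def by (rule unit_clamp_eq) (use r_pos[of k] in \<open>simp add: field_simps\<close>)

lemma ramp_1: "r k \<le> v \<Longrightarrow> ramp k v = 1"
  unfolding ramp_def by (rule unit_clamp_eq) (use r_pos[of k] in \<open>simp add: field_simps\<close>)

lemma ramp_lip: "\<bar>ramp k v - ramp k w\<bar> \<le> 2 / r k * \<bar>v - w\<bar>"
proof -
  have "\<bar>ramp k v - ramp k w\<bar> \<le> \<bar>(2 * v / r k - 1) - (2 * w / r k - 1)\<bar>"
    unfolding ramp_def by (rule unit_clamp_lipschitz)
  also have "(2 * v / r k - 1) - (2 * w / r k - 1) = 2 / r k * (v - w)"
    by (simp add: diff_divide_distrib right_diff_distrib)
  also have "\<bar>2 / r k * (v - w)\<bar> = 2 / r k * \<bar>v - w\<bar>" unfolding abs_mult using r_pos[of k] by simp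
  finally show ?thesis .
qed

lemma ramp_bounds [simp]: "0 \<le> ramp k v" "ramp k v \<le> 1"
  by (auto simp: ramp_def)

text \<open>Ramp k is non-constant only for r/2 \<le> d \<le> r with r = r k. The margins r/4 on
  both sides leave room for smoothing, and the ratio 8 of successive scales still keeps the shells
  disjoint, because 5/4 * 1/8 < 1/4.\<close>

definition shell :: "nat \<Rightarrow> (real^'n) set" where "shell k = {x. r k / 4 < d x \<and> d x < 5 * r k / 4}"

text \<open>The last factor equals 1 up to norm n + 1 and vanishes from 2 (n + 1) on; it buys
  compact support at the price of a slope 1 / (n + 1).\<close>

definition profile :: "nat \<Rightarrow> real^'n \<Rightarrow> real" where
  "profile n x = (\<Sum>k<Suc n. ramp k (d x)) / real (Suc n) * unit_clamp (2 - norm x / real (Suc n))"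

text \<open>A bound for the Lipschitz constant of \<open>profile n\<close> along coordinate
  directions near x. It survives the smoothing because the shells already contain the
  margin.\<close>

definition slope :: "nat \<Rightarrow> real^'n \<Rightarrow> real" where
  "slope n x = (\<Sum>k<Suc n. 2 / r k * indicator (shell k) x) / real (Suc n) + 1 / real (Suc n)"

lemma slope_nonneg: "0 \<le> slope n x"
  unfolding slope_def using r_pos by (intro add_nonneg_nonneg divide_nonneg_nonneg sum_nonneg mult_nonneg_nonneg) (auto simp: less_imp_le)

lemma profile_continuous: "continuous_on S (profile n)"
  unfolding profile_def[abs_def] ramp_def using r_pos
  by (intro continuous_intros d_continuous) (auto simp: less_imp_neq[symmetric])

lemma average_bounds: "0 \<le> (\<Sum>k<Suc n. ramp k v) / real (Suc n)" "(\<Sum>k<Suc n. ramp k v) / real (Suc n) \<le> 1"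
proof -
  show "0 \<le> (\<Sum>k<Suc n. ramp k v) / real (Suc n)" by (intro divide_nonneg_nonneg sum_nonneg) auto
  have "(\<Sum>k<Suc n. ramp k v) \<le> (\<Sum>k<Suc n. 1)" by (rule sum_mono) simp
  then show "(\<Sum>k<Suc n. ramp k v) / real (Suc n) \<le> 1" by (simp add: divide_le_eq_1)
qed

lemma profile_bounds: "0 \<le> profile n x" "profile n x \<le> 1"
  unfolding profile_def
  by (rule mult_nonneg_nonneg[OF average_bounds(1) unit_clamp_bounds(1)], rule mult_le_one[OF average_bounds(2) unit_clamp_bounds])

text \<open>Off the shell both arguments lie on the same flat piece of the ramp.\<close>

lemma ramp_local_lip:
  assumes v: "\<bar>v - d x\<bar> \<le> r n / 8" and w: "\<bar>w - d x\<bar> \<le> r n / 8" and k: "k \<le> n"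
  shows "\<bar>ramp k v - ramp k w\<bar> \<le> 2 / r k * indicator (shell k) x * \<bar>v - w\<bar>"
proof (cases "x \<in> shell k")
  case True
  then show ?thesis using ramp_lip by simp
next
  case False
  have rk: "r n \<le> r k" using k by (rule r_mono)
  from False consider "d x \<le> r k / 4" | "5 * r k / 4 \<le> d x" by (auto simp: shell_def)
  then have "ramp k v = ramp k w"
  proof cases
    case 1
    have "v \<le> r k / 2" "w \<le> r k / 2" using 1 v w rk r_pos[of k] by linarith+
    then show ?thesis by (simp add: ramp_0)
  next
    case 2
    have "r k \<le> v" "r k \<le> w" using 2 v w rk r_pos[of k] by linarith+
    then show ?thesis by (simp add: ramp_1)
  qed
  then show ?thesis using False by simp
qed

text \<open>The distances r n / 16 of y from x and of the step t add up to the r n / 8 that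
  \<open>ramp_local_lip\<close> tolerates. The smallest scale r n serves all ramps at once.\<close>

lemma profile_local_lip:
  assumes y: "norm (y - x) \<le> r n / 16" and t: "0 \<le> t" "t \<le> r n / 16"
  shows "\<bar>profile n (y + t *\<^sub>R axis i 1) - profile n y\<bar> \<le> slope n x * t"
proof -
  let ?y = "y + t *\<^sub>R axis i 1 :: real^'n"
  let ?P = "\<lambda>z. (\<Sum>k<Suc n. ramp k (d z)) / real (Suc n)" and ?Q = "\<lambda>z :: real^'n. unit_clamp (2 - norm z / real (Suc n))"
  have nt: "norm (?y - y) = t" using t by simp
  have dt: "\<bar>d ?y - d y\<bar> \<le> t" using d_lip[of ?y y] nt by simp
  have 1: "\<bar>d y - d x\<bar> \<le> r n / 16" using d_lip[of y x] y by simp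
  have 2: "\<bar>d ?y - d x\<bar> \<le> r n / 8" using dt 1 t by linarith
  have 3: "\<bar>d y - d x\<bar> \<le> r n / 8" using 1 r_pos[of n] by linarith
  have "\<bar>(\<Sum>k<Suc n. ramp k (d ?y)) - (\<Sum>k<Suc n. ramp k (d y))\<bar> \<le> (\<Sum>k<Suc n. \<bar>ramp k (d ?y) - ramp k (d y)\<bar>)"
    unfolding sum_subtractf[symmetric] by (rule sum_abs)
  also have "\<dots> \<le> (\<Sum>k<Suc n. 2 / r k * indicator (shell k) x * t)"
  proof (rule sum_mono)
    fix k assume "k \<in> {..<Suc n}"
    then have "\<bar>ramp k (d ?y) - ramp k (d y)\<bar> \<le> 2 / r k * indicator (shell k) x * \<bar>d ?y - d y\<bar>"
      by (intro ramp_local_lip[OF 2 3]) simp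
    also have "\<dots> \<le> 2 / r k * indicator (shell k) x * t"
      by (rule mult_left_mono[OF dt]) (use r_pos[of k] in simp)
    finally show "\<bar>ramp k (d ?y) - ramp k (d y)\<bar> \<le> 2 / r k * indicator (shell k) x * t" .
  qed
  also have "\<dots> = (\<Sum>k<Suc n. 2 / r k * indicator (shell k) x) * t" by (rule sum_distrib_right[symmetric])
  finally have "\<bar>(\<Sum>k<Suc n. ramp k (d ?y)) - (\<Sum>k<Suc n. ramp k (d y))\<bar> / real (Suc n) \<le> (\<Sum>k<Suc n. 2 / r k * indicator (shell k) x) * t / real (Suc n)"
    by (rule divide_right_mono) simp
  then have P: "\<bar>?P ?y - ?P y\<bar> \<le> (\<Sum>k<Suc n. 2 / r k * indicator (shell k) x) / real (Suc n) * t"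
    by (simp add: diff_divide_distrib[symmetric] abs_divide del: sum.lessThan_Suc of_nat_Suc)
  have "\<bar>?Q ?y - ?Q y\<bar> \<le> \<bar>(2 - norm ?y / real (Suc n)) - (2 - norm y / real (Suc n))\<bar>" by (rule unit_clamp_lipschitz)
  also have "\<dots> = \<bar>norm ?y - norm y\<bar> / real (Suc n)"
    by (simp add: diff_divide_distrib[symmetric] abs_divide abs_minus_commute del: of_nat_Suc)
  also have "\<dots> \<le> t / real (Suc n)"
    using norm_triangle_ineq3[of ?y y] nt by (intro divide_right_mono) auto
  finally have Q: "\<bar>?Q ?y - ?Q y\<bar> \<le> t / real (Suc n)" .
  have "\<bar>a * b - a' * b'\<bar> \<le> \<bar>a - a'\<bar> + \<bar>b - b'\<bar>" if "0 \<le> b" "b \<le> 1" "0 \<le> a'" "a' \<le> 1" for a b a' b' :: real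
  proof -
    have "a * b - a' * b' = (a - a') * b + a' * (b - b')" by (simp add: algebra_simps)
    then have "\<bar>a * b - a' * b'\<bar> \<le> \<bar>a - a'\<bar> * b + a' * \<bar>b - b'\<bar>"
      using that abs_triangle_ineq[of "(a - a') * b" "a' * (b - b')"] by (simp add: abs_mult)
    also have "\<dots> \<le> \<bar>a - a'\<bar> * 1 + 1 * \<bar>b - b'\<bar>"
      using that by (intro add_mono mult_left_mono mult_right_mono) auto
    finally show ?thesis by simp
  qed
  from this[of "?Q ?y" "?P y" "?P ?y" "?Q y"]
  have "\<bar>profile n ?y - profile n y\<bar> \<le> \<bar>?P ?y - ?P y\<bar> + \<bar>?Q ?y - ?Q y\<bar>"
    unfolding profile_def using average_bounds by simp
  also have "\<dots> \<le> slope n x * t"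
    using P Q by (simp add: slope_def distrib_right del: sum.lessThan_Suc of_nat_Suc)
  finally show ?thesis .
qed

section \<open>The smoothed profile\<close>

definition coords :: "'n list" where "coords = (SOME xs. set xs = UNIV)"

lemma set_coords: "set coords = UNIV"
  unfolding coords_def using finite_list[of "UNIV :: 'n set"] by (rule someI_ex) simp

text \<open>Small enough that all averages together move a point by at most r n / 16; the factor
  CARD('n) pays for the l1 bound on the norm.\<close>

definition step :: "nat \<Rightarrow> real" where
  "step n = r n / (16 * real CARD('n) * real (length (coords @ coords)))"

lemma length_coords: "0 < length (coords @ coords)"
  using set_coords by (cases coords) auto

lemma step_pos: "0 < step n"
  using r_pos[of n] length_coords unfolding step_def by (intro divide_pos_pos mult_pos_pos) (auto simp: zero_less_card_finite)

lemma cube_step: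
  fixes x y :: "real^'n"
  assumes "y \<in> cube x (real (length (coords @ coords)) * step n)"
  shows "norm (y - x) \<le> r n / 16"
proof -
  from cube_norm_le[OF assms] have "norm (y - x) \<le> real CARD('n) * (real (length (coords @ coords)) * step n)" .
  also have "\<dots> = r n / 16"
    using length_coords unfolding step_def by (simp add: field_simps del: length_append)
  finally show ?thesis .
qed

text \<open>Each sliding average gains one derivative in its own direction; going twice through all
  coordinates gives \<open>C\<^sup>2\<close>.\<close>

definition smoothed :: "nat \<Rightarrow> real^'n \<Rightarrow> real" where
  "smoothed n = foldr (slide_avg (step n)) (coords @ coords) (profile n)"

lemma smoothed_bounds:
  assumes "\<And>y. norm (y - x) \<le> r n / 16 \<Longrightarrow> (\<And>i. x $ i \<le> y $ i) \<Longrightarrow> lo \<le> profile n y \<and> profile n y \<le> hi"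
  shows "lo \<le> smoothed n x \<and> smoothed n x \<le> hi"
  unfolding smoothed_def
proof (rule foldr_slide_avg_bounds[OF profile_continuous step_pos])
  show "x \<in> cube x 0" by (simp add: cube_def)
  fix y assume y: "y \<in> cube x (0 + real (length (coords @ coords)) * step n)"
  then have "norm (y - x) \<le> r n / 16" by (intro cube_step) simp
  moreover have "x $ i \<le> y $ i" for i using y by (simp add: cube_def)
  ultimately show "lo \<le> profile n y \<and> profile n y \<le> hi" by (rule assms)
qed

lemma smoothed_smooth: "smooth_upto 2 (smoothed n)"
proof -
  have "smooth_upto 0 (profile n)" by (simp add: profile_continuous)
  from smooth_upto_foldr[OF set_coords step_pos smooth_upto_foldr[OF set_coords step_pos this]]
  show ?thesis by (simp add: smoothed_def numeral_2_eq_2 del: smooth_upto.simps)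
qed

text \<open>From a point of the orthant the averages look only at points of no smaller norm, so
  beyond radius 2 (n + 1) they see the value 0 alone.\<close>

lemma smoothed_Cc2: "smoothed n \<in> Cc2_orthant"
proof -
  have "{x \<in> orthant. smoothed n x \<noteq> 0} \<subseteq> cball 0 (2 * real (Suc n))"
  proof (rule subsetI, rule ccontr)
    fix x :: "real^'n" assume x: "x \<in> {x \<in> orthant. smoothed n x \<noteq> 0}" and "x \<notin> cball 0 (2 * real (Suc n))"
    then have nx: "2 * real (Suc n) < norm x" and xo: "x \<in> orthant" by (auto simp: dist_norm)
    have "0 \<le> smoothed n x \<and> smoothed n x \<le> 0"
    proof (rule smoothed_bounds)
      fix y :: "real^'n" assume "\<And>i. x $ i \<le> y $ i"
      then have "2 * real (Suc n) < norm y" using norm_mono_orthant[OF xo, of y] nx by simp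
      then have "2 - norm y / real (Suc n) \<le> 0" by (simp add: field_simps del: of_nat_Suc)
      then have "unit_clamp (2 - norm y / real (Suc n)) = 0" by (rule unit_clamp_eq)
      then show "0 \<le> profile n y \<and> profile n y \<le> 0" by (simp add: profile_def)
    qed
    then show False using x by simp
  qed
  then have "compact (closure {x \<in> orthant. smoothed n x \<noteq> 0})"
    unfolding compact_closure using bounded_subset[OF bounded_cball] by blast
  then show ?thesis using smooth_upto_Ck_orthant[OF smoothed_smooth] by (simp add: Cc2_orthant_def)
qed

lemma smoothed_grad: "\<bar>grad i (smoothed n) x\<bar> \<le> slope n x"
proof -
  have "has_partials UNIV (smoothed n)" using smoothed_smooth[of n] by (simp add: numeral_2_eq_2)
  from has_partialsD(3)[OF this UNIV_I]
  have D: "((\<lambda>t. foldr (slide_avg (step n)) (coords @ coords) (profile n) (x + t *\<^sub>R axis i 1)) has_real_derivative partial_deriv i (smoothed n) x) (at 0)"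
    by (simp add: smoothed_def)
  have "\<bar>partial_deriv i (smoothed n) x\<bar> \<le> slope n x"
    by (rule foldr_slide_avg_deriv_bound[OF profile_continuous step_pos _ _ D, of "r n / 16"])
      (use r_pos[of n] in \<open>auto intro!: profile_local_lip cube_step simp del: length_append\<close>)
  then show ?thesis using slope_nonneg[of n x] by (simp add: grad_def indicator_def)
qed

section \<open>Energy and limit of the smoothed profile\<close>

lemma shell_sets [measurable]: "shell k \<inter> orthant \<in> sets orthant_algebra"
proof -
  have "open (shell k)"
    unfolding shell_def by (intro open_Collect_conj open_Collect_less d_continuous continuous_intros)
  then show ?thesis by (auto simp: sets_restrict_space_iff)
qed

lemma shell_bound: "measure \<mu> (shell k \<inter> orthant) \<le> C * (5 * r k / 4)\<^sup>2"
proof -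
  have "emeasure \<mu> (shell k \<inter> orthant) \<le> emeasure \<mu> {x \<in> orthant. 0 < d x \<and> d x < 5 * r k / 4}"
  proof (rule emeasure_mono)
    show "shell k \<inter> orthant \<subseteq> {x \<in> orthant. 0 < d x \<and> d x < 5 * r k / 4}"
      using r_pos[of k] by (auto simp: shell_def)
    have "open {x. 0 < d x \<and> d x < 5 * r k / 4}"
      by (intro open_Collect_conj open_Collect_less d_continuous continuous_intros)
    then have "{x. 0 < d x \<and> d x < 5 * r k / 4} \<inter> orthant \<in> sets orthant_algebra" by (auto simp: sets_restrict_space_iff)
    moreover have "{x. 0 < d x \<and> d x < 5 * r k / 4} \<inter> orthant = {x \<in> orthant. 0 < d x \<and> d x < 5 * r k / 4}" by auto
    ultimately show "{x \<in> orthant. 0 < d x \<and> d x < 5 * r k / 4} \<in> sets \<mu>" by simp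
  qed
  \<comment> \<open>The hypothesis on small scales applies, since 5/4 * r k \<le> 5/32 * r0 <
    r0.\<close>
  also have "\<dots> \<le> ennreal (C * (5 * r k / 4)\<^sup>2)"
    using r_pos[of k] r_le[of k] r0 by (intro shell_measure) auto
  finally show ?thesis using C by (simp add: emeasure_eq_measure)
qed

lemma shell_disjoint: "x \<in> shell k \<Longrightarrow> x \<in> shell j \<Longrightarrow> k = j"
  using r_less[of k j] r_less[of j k] r_pos[of k] r_pos[of j] by (cases k j rule: linorder_cases) (auto simp: shell_def)

text \<open>By disjointness at most one term is nonzero; this is the orthogonality of the
  ramps.\<close>

lemma shell_sum_square:
  "(\<Sum>k<n. a k * indicator (shell k) x)\<^sup>2 = (\<Sum>k<n. (a k)\<^sup>2 * indicator (shell k) x)" for a :: "nat \<Rightarrow> real"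
proof (cases "\<exists>k<n. x \<in> shell k")
  case True
  then obtain j where j: "j < n" "x \<in> shell j" by blast
  have "(\<Sum>k<n. b k * indicator (shell k) x) = b j" for b :: "nat \<Rightarrow> real"
  proof -
    have "(\<Sum>k<n. b k * indicator (shell k) x) = (\<Sum>k<n. if k = j then b j else 0)"
    proof (rule sum.cong[OF refl])
      fix k
      show "b k * indicator (shell k) x = (if k = j then b j else 0)"
      proof (cases "k = j")
        case False
        then have "x \<notin> shell k" using shell_disjoint[OF j(2)] by blast
        then show ?thesis using False by simp
      qed (simp add: j)
    qed
    then show ?thesis using j by simp
  qed
  then show ?thesis by simp
next
  case False
  then have "(\<Sum>k<n. b k * indicator (shell k) x) = 0" for b :: "nat \<Rightarrow> real"
    by (intro sum.neutral) auto
  then show ?thesis by simp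
qed

text \<open>Shell k contributes at most (2/r)^2 * C * (5r/4)^2 = 25 C, multiplied by 1/4 * 1 through
  the simplification of the powers to 25/4 * C, whatever k is. There are n + 1 shells against the
  factor 1 / (n + 1)^2 of the average, and (a + b)^2 \<le> 2 a^2 + 2 b^2 doubles the
  constant.\<close>

lemma smoothed_energy: "G (smoothed n) (smoothed n) \<le> real CARD('n) * ((25 / 2 * C + 2 * measure \<mu> orthant) / real (Suc n))"
proof -
  let ?K = "real (Suc n)"
  have K: "1 \<le> ?K" by simp
  let ?B = "\<lambda>x. 2 / ?K\<^sup>2 * (\<Sum>k<Suc n. (2 / r k)\<^sup>2 * indicator (shell k \<inter> orthant) x) + 2 / ?K\<^sup>2 :: real"
  have ind: "integrable \<mu> (\<lambda>x. indicator (shell k \<inter> orthant) x :: real)" for k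
    by (intro integrable_bounded_meas) (simp add: bounded_meas_indicator)
  have iB: "integrable \<mu> ?B"
    by (intro Bochner_Integration.integrable_add integrable_mult_right Bochner_Integration.integrable_sum ind integrable_const)
  have "(\<integral>x. (grad i (smoothed n) x)\<^sup>2 \<partial>\<mu>) \<le> (25 / 2 * C + 2 * measure \<mu> orthant) / ?K" for i
  proof -
    have g: "bounded_meas orthant_algebra (grad i (smoothed n))" by (rule C1_bounded_grad[OF Cc2_C1_bounded[OF smoothed_Cc2]])
    have "(\<integral>x. (grad i (smoothed n) x)\<^sup>2 \<partial>\<mu>) \<le> (\<integral>x. ?B x \<partial>\<mu>)"
    proof (rule integral_mono[OF _ iB])
      show "integrable \<mu> (\<lambda>x. (grad i (smoothed n) x)\<^sup>2)"
        unfolding power2_eq_square by (intro integrable_bounded_meas) (simp add: bounded_meas_mult g)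
      fix x assume "x \<in> space \<mu>"
      then have x: "x \<in> orthant" by simp
      let ?S = "\<Sum>k<Suc n. 2 / r k * indicator (shell k) x"
      have "(grad i (smoothed n) x)\<^sup>2 \<le> (slope n x)\<^sup>2"
        using power_mono[OF smoothed_grad[of i n x], of 2] by simp
      also have "\<dots> \<le> 2 * (?S / ?K)\<^sup>2 + 2 * (1 / ?K)\<^sup>2"
      proof -
        have "0 \<le> (?S / ?K - 1 / ?K)\<^sup>2" by simp
        then show ?thesis unfolding slope_def by (simp add: power2_sum power2_diff del: sum.lessThan_Suc of_nat_Suc)
      qed
      also have "\<dots> = 2 / ?K\<^sup>2 * ?S\<^sup>2 + 2 / ?K\<^sup>2"
        by (simp add: power_divide del: sum.lessThan_Suc of_nat_Suc)
      also have "?S\<^sup>2 = (\<Sum>k<Suc n. (2 / r k)\<^sup>2 * indicator (shell k) x)"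
        by (rule shell_sum_square)
      also have "\<dots> = (\<Sum>k<Suc n. (2 / r k)\<^sup>2 * indicator (shell k \<inter> orthant) x)"
        using x by (intro sum.cong) (auto simp: indicator_def)
      finally show "(grad i (smoothed n) x)\<^sup>2 \<le> ?B x" .
    qed
    also have "\<dots> = 2 / ?K\<^sup>2 * (\<Sum>k<Suc n. (2 / r k)\<^sup>2 * measure \<mu> (shell k \<inter> orthant)) + 2 / ?K\<^sup>2 * measure \<mu> orthant"
    proof -
      have "(\<integral>x. ?B x \<partial>\<mu>) = (\<integral>x. 2 / ?K\<^sup>2 * (\<Sum>k<Suc n. (2 / r k)\<^sup>2 * indicator (shell k \<inter> orthant) x) \<partial>\<mu>) + (\<integral>x. 2 / ?K\<^sup>2 \<partial>\<mu>)"
        by (intro Bochner_Integration.integral_add integrable_mult_right Bochner_Integration.integrable_sum ind integrable_const)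
      also have "(\<integral>x. 2 / ?K\<^sup>2 * (\<Sum>k<Suc n. (2 / r k)\<^sup>2 * indicator (shell k \<inter> orthant) x) \<partial>\<mu>)
          = 2 / ?K\<^sup>2 * (\<integral>x. (\<Sum>k<Suc n. (2 / r k)\<^sup>2 * indicator (shell k \<inter> orthant) x) \<partial>\<mu>)"
        by (rule integral_mult_right_zero)
      also have "(\<integral>x. (\<Sum>k<Suc n. (2 / r k)\<^sup>2 * indicator (shell k \<inter> orthant) x) \<partial>\<mu>)
          = (\<Sum>k<Suc n. \<integral>x. (2 / r k)\<^sup>2 * indicator (shell k \<inter> orthant) x \<partial>\<mu>)"
        by (intro Bochner_Integration.integral_sum integrable_mult_right ind)
      also have "\<dots> = (\<Sum>k<Suc n. (2 / r k)\<^sup>2 * measure \<mu> (shell k \<inter> orthant))"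
        by (intro sum.cong refl) (simp add: Int_absorb2)
      finally show ?thesis by (simp del: sum.lessThan_Suc of_nat_Suc)
    qed
    also have "\<dots> \<le> 2 / ?K\<^sup>2 * (\<Sum>k<Suc n. 25 / 4 * C) + 2 / ?K\<^sup>2 * measure \<mu> orthant"
    proof (intro add_mono mult_left_mono sum_mono order_refl)
      fix k
      have "(2 / r k)\<^sup>2 * measure \<mu> (shell k \<inter> orthant) \<le> (2 / r k)\<^sup>2 * (C * (5 * r k / 4)\<^sup>2)"
        by (rule mult_left_mono[OF shell_bound]) simp
      also have "\<dots> = 25 / 4 * C" using r_pos[of k] by (simp add: power2_eq_square field_simps)
      finally show "(2 / r k)\<^sup>2 * measure \<mu> (shell k \<inter> orthant) \<le> 25 / 4 * C" .
    qed auto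
    also have "\<dots> = 25 / 2 * C / ?K + 2 * measure \<mu> orthant / ?K\<^sup>2"
      by (simp add: power2_eq_square field_simps del: of_nat_Suc)
    also have "\<dots> \<le> 25 / 2 * C / ?K + 2 * measure \<mu> orthant / ?K"
      using K self_le_power[of ?K 2] by (intro add_mono order_refl divide_left_mono) (auto simp del: of_nat_Suc)
    finally show ?thesis by (simp add: add_divide_distrib del: of_nat_Suc)
  qed
  then have "G (smoothed n) (smoothed n) \<le> (\<Sum>i\<in>(UNIV::'n set). (25 / 2 * C + 2 * measure \<mu> orthant) / ?K)"
    unfolding G_self by (intro sum_mono)
  then show ?thesis by (simp del: of_nat_Suc)
qed

lemma smoothed_lim:
  assumes x: "x \<in> orthant" shows "(\<lambda>n. smoothed n x) \<longlonglongrightarrow> indicator A x"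
proof (cases "0 < d x")
  case False
  then have dx: "d x = 0" using d_nonneg[of x] by simp
  have "smoothed n x = 0" for n
  proof -
    have "0 \<le> smoothed n x \<and> smoothed n x \<le> 0"
    proof (rule smoothed_bounds)
      fix y :: "real^'n" assume y: "norm (y - x) \<le> r n / 16"
      \<comment> \<open>Within r n / 16 of a zero of d every ramp is still in its flat part at
        0.\<close>
      have "ramp k (d y) = 0" if "k < Suc n" for k
      proof (rule ramp_0)
        have "d y \<le> r n / 16" using d_lip[of y x] y dx by linarith
        then show "d y \<le> r k / 2" using r_mono[of k n] r_pos[of k] that by simp
      qed
      then have "(\<Sum>k<Suc n. ramp k (d y)) = 0" by (intro sum.neutral) auto
      then show "0 \<le> profile n y \<and> profile n y \<le> 0" by (simp add: profile_def del: sum.lessThan_Suc)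
    qed
    then show ?thesis by simp
  qed
  then show ?thesis using False d_A[OF x] by simp
next
  case True
  have "\<forall>\<^sub>F k in sequentially. r k < d x / 2" using r_lim True by (intro order_tendstoD(2)) auto
  then obtain k0 where k0: "\<And>k. k \<ge> k0 \<Longrightarrow> r k < d x / 2" by (auto simp: eventually_sequentially)
  obtain n0 where n0: "norm x + r0 \<le> real n0" using real_arch_simple by blast
  \<comment> \<open>Near x only the first k0 ramps can differ from 1, and n \<ge> n0 keeps the
    spatial cut-off equal to 1.\<close>
  have b: "1 - real k0 / real (Suc n) \<le> smoothed n x \<and> smoothed n x \<le> 1" if n: "n \<ge> max k0 n0" for n
  proof (rule smoothed_bounds)
    fix y :: "real^'n" assume y: "norm (y - x) \<le> r n / 16"
    have rn: "r n < d x / 2" using k0 n by simp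
    have dy: "d x / 2 \<le> d y" using d_lip[of x y] y rn r_pos[of n] by (simp add: norm_minus_commute abs_le_iff)
    have "norm y \<le> norm x + norm (y - x)" using norm_triangle_sub[of y x] by simp
    also have "\<dots> \<le> real (Suc n)" using y r_le[of n] r0 n0 n by simp
    finally have "1 \<le> 2 - norm y / real (Suc n)" by (simp add: divide_le_eq_1 del: of_nat_Suc)
    then have Q: "unit_clamp (2 - norm y / real (Suc n)) = 1" by (rule unit_clamp_eq)
    have "real (Suc n) - real k0 = (\<Sum>k\<in>{k0..<Suc n}. 1)" using n by simp
    also have "\<dots> = (\<Sum>k\<in>{k0..<Suc n}. ramp k (d y))"
    proof (rule sum.cong[OF refl])
      fix k assume "k \<in> {k0..<Suc n}"
      then have "r k \<le> d y" using k0[of k] dy by simp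
      then show "1 = ramp k (d y)" by (simp add: ramp_1)
    qed
    also have "\<dots> \<le> (\<Sum>k<Suc n. ramp k (d y))" by (rule sum_mono2) auto
    finally have "(real (Suc n) - real k0) / real (Suc n) \<le> (\<Sum>k<Suc n. ramp k (d y)) / real (Suc n)"
      by (rule divide_right_mono) simp
    then show "1 - real k0 / real (Suc n) \<le> profile n y \<and> profile n y \<le> 1"
      using profile_bounds(2)[of n y] by (simp add: profile_def Q diff_divide_distrib del: sum.lessThan_Suc of_nat_Suc)
  qed
  have "(\<lambda>n. 1 - real k0 / real (Suc n)) \<longlonglongrightarrow> 1 - 0"
    by (intro tendsto_diff tendsto_const LIMSEQ_Suc[OF lim_const_over_n])
  then have lim: "(\<lambda>n. 1 - real k0 / real (Suc n)) \<longlonglongrightarrow> 1" by simp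
  have "(\<lambda>n. smoothed n x) \<longlonglongrightarrow> 1"
  proof (rule real_tendsto_sandwich[OF _ _ lim tendsto_const])
    show "\<forall>\<^sub>F n in sequentially. 1 - real k0 / real (Suc n) \<le> smoothed n x"
      using b by (intro eventually_sequentiallyI[of "max k0 n0"]) blast
    show "\<forall>\<^sub>F n in sequentially. smoothed n x \<le> 1"
      using b by (intro eventually_sequentiallyI[of "max k0 n0"]) blast
  qed
  then show ?thesis using True d_A[OF x] by simp
qed

lemma indicator_zero_energy:
  shows "indicator A \<in> form_domain \<beta> \<rho>" "\<And>v. v \<in> form_domain \<beta> \<rho> \<Longrightarrow> form \<beta> \<rho> (indicator A) v = 0"
proof -
  have bA: "bounded_meas orthant_algebra (indicator A)" by (rule bounded_meas_indicator[OF A_sets])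
  have A2: "indicator A \<in> L2 \<mu>"
    using bA A_sets integrable_bounded_meas[of "\<lambda>x. indicator A x * indicator A x"] bounded_meas_mult[OF bA bA]
    by (simp add: L2_def power2_eq_square bounded_meas_measurable)
  have L2: "(\<lambda>n. \<integral>x. (smoothed n x - indicator A x)\<^sup>2 \<partial>\<mu>) \<longlonglongrightarrow> (\<integral>x. 0 \<partial>\<mu>)"
  proof (rule integral_dominated_convergence[where w = "\<lambda>_. 1"])
    show "(\<lambda>x. (smoothed n x - indicator A x)\<^sup>2) \<in> borel_measurable \<mu>" for n
      using bounded_meas_measurable[OF C1_bounded_bounded_meas[OF Cc2_C1_bounded[OF smoothed_Cc2]]] bounded_meas_measurable[OF bA] by simp
    show "AE x in \<mu>. (\<lambda>n. (smoothed n x - indicator A x)\<^sup>2) \<longlonglongrightarrow> 0"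
    proof (rule AE_I2)
      fix x assume "x \<in> space \<mu>"
      then have "(\<lambda>n. smoothed n x) \<longlonglongrightarrow> indicator A x" by (intro smoothed_lim) simp
      then have "(\<lambda>n. (smoothed n x - indicator A x)\<^sup>2) \<longlonglongrightarrow> (indicator A x - indicator A x)\<^sup>2" by (intro tendsto_intros)
      then show "(\<lambda>n. (smoothed n x - indicator A x)\<^sup>2) \<longlonglongrightarrow> 0" by simp
    qed
    show "AE x in \<mu>. norm ((smoothed n x - indicator A x)\<^sup>2) \<le> 1" for n
    proof (rule AE_I2)
      fix x
      have "0 \<le> smoothed n x \<and> smoothed n x \<le> 1" by (rule smoothed_bounds) (simp add: profile_bounds)
      then have "\<bar>smoothed n x - indicator A x\<bar> \<le> 1" by (auto simp: indicator_def)
      from power_mono[OF this, of 2] show "norm ((smoothed n x - indicator A x)\<^sup>2) \<le> 1" by simp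
    qed
  qed auto
  have "(\<lambda>n. real CARD('n) * ((25 / 2 * C + 2 * measure \<mu> orthant) / real (Suc n))) \<longlonglongrightarrow> real CARD('n) * 0"
    by (intro tendsto_mult tendsto_const LIMSEQ_Suc[OF lim_const_over_n])
  then have lim: "(\<lambda>n. real CARD('n) * ((25 / 2 * C + 2 * measure \<mu> orthant) / real (Suc n))) \<longlonglongrightarrow> 0" by simp
  have E: "(\<lambda>n. G (smoothed n) (smoothed n)) \<longlonglongrightarrow> 0"
    by (rule real_tendsto_sandwich[OF _ _ tendsto_const lim]) (intro always_eventually allI G_nonneg smoothed_energy)+
  note Z = zero_energy_approx[OF A2 smoothed_Cc2 _ E]
  show "indicator A \<in> form_domain \<beta> \<rho>" "\<And>v. v \<in> form_domain \<beta> \<rho> \<Longrightarrow> form \<beta> \<rho> (indicator A) v = 0"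
    using Z L2 by simp_all
qed

end

section \<open>The Markov property for path events\<close>

context conservative_diffusion
begin

abbreviation "\<Omega> \<equiv> space \<F>"
abbreviation "SB \<equiv> restrict_space borel S"

lemma space_filtration: "0 \<le> t \<Longrightarrow> space (\<F>t t) = \<Omega>"
  using filtration_sub[of t] by (simp add: subalgebra_def)

lemma sets_filtration: "0 \<le> t \<Longrightarrow> A \<in> sets (\<F>t t) \<Longrightarrow> A \<in> sets \<F>"
  using filtration_sub[of t] by (auto simp: subalgebra_def)

lemma filtration_mono_sets: "0 \<le> s \<Longrightarrow> s \<le> t \<Longrightarrow> A \<in> sets (\<F>t s) \<Longrightarrow> A \<in> sets (\<F>t t)"
  using filtration_mono[of s t] by (auto simp: subalgebra_def)

lemma X_measurable: "0 \<le> t \<Longrightarrow> X t \<in> \<F> \<rightarrow>\<^sub>M SB"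
  using measurable_from_subalg[OF filtration_sub adapted] .

lemma space_SB [simp]: "space SB = S" by (simp add: space_restrict_space)

lemma X_in_S: "0 \<le> t \<Longrightarrow> \<omega> \<in> \<Omega> \<Longrightarrow> X t \<omega> \<in> S"
  using measurable_space[OF X_measurable] by simp

lemma space_P: "x \<in> S \<Longrightarrow> space (P x) = \<Omega>"
  using sets_eq_imp_space_eq[OF sets_P] .

lemma X_measurable_P: "x \<in> S \<Longrightarrow> 0 \<le> t \<Longrightarrow> X t \<in> P x \<rightarrow>\<^sub>M SB"
  using X_measurable measurable_cong_sets[OF sets_P refl] by blast

lemma X_event: "0 \<le> t \<Longrightarrow> \<Gamma> \<in> sets SB \<Longrightarrow> {\<omega> \<in> \<Omega>. X t \<omega> \<in> \<Gamma>} \<in> sets \<F>"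
  using measurable_sets[OF X_measurable, of t \<Gamma>] by (simp add: vimage_def Int_def conj_commute)

lemma X_event_filtration: "0 \<le> t \<Longrightarrow> \<Gamma> \<in> sets SB \<Longrightarrow> {\<omega> \<in> \<Omega>. X t \<omega> \<in> \<Gamma>} \<in> sets (\<F>t t)"
  using measurable_sets[OF adapted, of t \<Gamma>] by (simp add: vimage_def Int_def conj_commute space_filtration)

lemma emeasure_P_space: "x \<in> S \<Longrightarrow> emeasure (P x) \<Omega> = 1"
  using prob_space.emeasure_space_1[OF prob] space_P by metis

text \<open>From events, which \<open>kernel\<close> covers, to nonnegative functions.\<close>

lemma kernel_nn_integral:
  assumes t: "0 \<le> t" and \<phi>: "\<phi> \<in> borel_measurable SB"
  shows "(\<lambda>x. \<integral>\<^sup>+\<omega>. \<phi> (X t \<omega>) \<partial>P x) \<in> borel_measurable SB"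
  using \<phi>
proof (induction rule: borel_measurable_induct)
  case (cong f g)
  have "(\<integral>\<^sup>+\<omega>. f (X t \<omega>) \<partial>P x) = (\<integral>\<^sup>+\<omega>. g (X t \<omega>) \<partial>P x)" if "x \<in> S" for x
    by (rule nn_integral_cong) (use cong(3) X_in_S[OF t] space_P[OF that] in auto)
  then show ?case by (intro measurable_cong[THEN iffD2, OF _ cong(4)]) simp
next
  case (set \<Gamma>)
  have eq: "(\<integral>\<^sup>+\<omega>. indicator \<Gamma> (X t \<omega>) \<partial>P x) = ennreal (measure (P x) {\<omega> \<in> \<Omega>. X t \<omega> \<in> \<Gamma>})" if x: "x \<in> S" for x
  proof -
    interpret prob_space "P x" by (rule prob[OF x])
    have "(\<integral>\<^sup>+\<omega>. indicator \<Gamma> (X t \<omega>) \<partial>P x) = (\<integral>\<^sup>+\<omega>. indicator {\<omega> \<in> \<Omega>. X t \<omega> \<in> \<Gamma>} \<omega> \<partial>P x)"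
      by (rule nn_integral_cong) (auto simp: indicator_def space_P[OF x])
    also have "\<dots> = emeasure (P x) {\<omega> \<in> \<Omega>. X t \<omega> \<in> \<Gamma>}"
      using X_event[OF t set] sets_P[OF x] by simp
    finally show ?thesis by (simp add: emeasure_eq_measure)
  qed
  have "(\<lambda>x. ennreal (measure (P x) {\<omega> \<in> \<Omega>. X t \<omega> \<in> \<Gamma>})) \<in> borel_measurable SB"
    using kernel[OF t set] by measurable
  then show ?case by (subst measurable_cong[OF eq]) auto
next
  case (mult u c)
  have "(\<integral>\<^sup>+\<omega>. c * u (X t \<omega>) \<partial>P x) = c * (\<integral>\<^sup>+\<omega>. u (X t \<omega>) \<partial>P x)" if "x \<in> S" for x
    by (rule nn_integral_cmult) (rule measurable_compose[OF X_measurable_P[OF that t] mult(2)])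
  then show ?case using mult(4) by (subst measurable_cong[where g = "\<lambda>x. c * (\<integral>\<^sup>+\<omega>. u (X t \<omega>) \<partial>P x)"]) auto
next
  case (add u v)
  have "(\<integral>\<^sup>+\<omega>. v (X t \<omega>) + u (X t \<omega>) \<partial>P x) = (\<integral>\<^sup>+\<omega>. v (X t \<omega>) \<partial>P x) + (\<integral>\<^sup>+\<omega>. u (X t \<omega>) \<partial>P x)" if "x \<in> S" for x
    by (rule nn_integral_add) (rule measurable_compose[OF X_measurable_P[OF that t]], fact add)+
  then show ?case using add by (subst measurable_cong[where g = "\<lambda>x. (\<integral>\<^sup>+\<omega>. v (X t \<omega>) \<partial>P x) + (\<integral>\<^sup>+\<omega>. u (X t \<omega>) \<partial>P x)"]) auto
next
  case (seq U)
  have "(\<integral>\<^sup>+\<omega>. (SUP i. U i) (X t \<omega>) \<partial>P x) = (SUP i. \<integral>\<^sup>+\<omega>. U i (X t \<omega>) \<partial>P x)" if "x \<in> S" for x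
  proof -
    have "(\<integral>\<^sup>+\<omega>. (SUP i. U i (X t \<omega>)) \<partial>P x) = (SUP i. \<integral>\<^sup>+\<omega>. U i (X t \<omega>) \<partial>P x)"
    proof (rule nn_integral_monotone_convergence_SUP)
      show "incseq (\<lambda>i \<omega>. U i (X t \<omega>))" using seq(3) by (auto simp: incseq_def le_fun_def)
      show "(\<lambda>\<omega>. U i (X t \<omega>)) \<in> borel_measurable (P x)" for i
        by (rule measurable_compose[OF X_measurable_P[OF that t] seq(1)])
    qed
    then show ?thesis by (simp add: SUP_apply image_image)
  qed
  then show ?case using seq(5) by (subst measurable_cong[where g = "\<lambda>x. SUP i. \<integral>\<^sup>+\<omega>. U i (X t \<omega>) \<partial>P x"]) auto
qed

text \<open>The strong Markov property at the constant time t.\<close>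

lemma simple_markov_event:
  assumes x: "x \<in> S" and t: "0 \<le> t" and s: "0 \<le> s" and A: "A \<in> sets (\<F>t t)" and \<Gamma>: "\<Gamma> \<in> sets SB"
  shows "emeasure (P x) (A \<inter> {\<omega> \<in> \<Omega>. X (t + s) \<omega> \<in> \<Gamma>})
    = (\<integral>\<^sup>+\<omega>. indicator A \<omega> * emeasure (P (X t \<omega>)) {\<omega>' \<in> \<Omega>. X s \<omega>' \<in> \<Gamma>} \<partial>P x)"
proof -
  have AF: "A \<in> sets \<F>" by (rule sets_filtration[OF t A])
  then have AO: "A \<subseteq> \<Omega>" by (rule sets.sets_into_space)
  \<comment> \<open>The event that a constant is at most u is either \<Omega> or empty.\<close>
  have 1: "{\<omega> \<in> \<Omega>. ennreal t \<le> ennreal u} \<in> sets (\<F>t u)" if "0 \<le> u" for u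
    using sets.top[of "\<F>t u"] space_filtration[OF that] by (cases "ennreal t \<le> ennreal u") auto
  have 2: "{\<omega> \<in> A. ennreal t \<le> ennreal u} \<in> sets (\<F>t u)" if "0 \<le> u" for u
    using filtration_mono_sets[OF t _ A, of u] that by (cases "ennreal t \<le> ennreal u") auto
  from strong_markov[OF x, of "\<lambda>_. ennreal t" A s \<Gamma>, OF 1 AF 2 s \<Gamma>]
  have "emeasure (P x) {\<omega> \<in> A. X (t + s) \<omega> \<in> \<Gamma>} = (\<integral>\<^sup>+\<omega>. indicator A \<omega> * emeasure (P (X t \<omega>)) {\<omega>' \<in> \<Omega>. X s \<omega>' \<in> \<Gamma>} \<partial>P x)"
    using t by simp
  moreover have "{\<omega> \<in> A. X (t + s) \<omega> \<in> \<Gamma>} = A \<inter> {\<omega> \<in> \<Omega>. X (t + s) \<omega> \<in> \<Gamma>}" using AO by auto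
  ultimately show ?thesis by simp
qed

text \<open>Keeping the factor A from the past is what allows the iteration in
  \<open>emeasure_cyl_markov\<close>.\<close>

lemma simple_markov:
  assumes x: "x \<in> S" and t: "0 \<le> t" and s: "0 \<le> s" and A: "A \<in> sets (\<F>t t)" and \<phi>: "\<phi> \<in> borel_measurable SB"
  shows "(\<integral>\<^sup>+\<omega>. indicator A \<omega> * \<phi> (X (t + s) \<omega>) \<partial>P x)
    = (\<integral>\<^sup>+\<omega>. indicator A \<omega> * (\<integral>\<^sup>+\<omega>'. \<phi> (X s \<omega>') \<partial>P (X t \<omega>)) \<partial>P x)"
  using \<phi>
proof (induction rule: borel_measurable_induct)
  case (cong f g)
  have "(\<integral>\<^sup>+\<omega>. indicator A \<omega> * f (X (t + s) \<omega>) \<partial>P x) = (\<integral>\<^sup>+\<omega>. indicator A \<omega> * g (X (t + s) \<omega>) \<partial>P x)"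
    by (rule nn_integral_cong) (use cong(3) X_in_S[of "t + s"] t s space_P[OF x] in auto)
  moreover have "(\<integral>\<^sup>+\<omega>'. f (X s \<omega>') \<partial>P (X t \<omega>)) = (\<integral>\<^sup>+\<omega>'. g (X s \<omega>') \<partial>P (X t \<omega>))" if "\<omega> \<in> \<Omega>" for \<omega>
    by (rule nn_integral_cong) (use cong(3) X_in_S[OF s] space_P[OF X_in_S[OF t that]] in auto)
  then have "(\<integral>\<^sup>+\<omega>. indicator A \<omega> * (\<integral>\<^sup>+\<omega>'. f (X s \<omega>') \<partial>P (X t \<omega>)) \<partial>P x) = (\<integral>\<^sup>+\<omega>. indicator A \<omega> * (\<integral>\<^sup>+\<omega>'. g (X s \<omega>') \<partial>P (X t \<omega>)) \<partial>P x)"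
    by (intro nn_integral_cong) (simp add: space_P[OF x])
  ultimately show ?case using cong(4) by simp
next
  case (set \<Gamma>)
  have AF: "A \<in> sets \<F>" by (rule sets_filtration[OF t A])
  then have AO: "A \<subseteq> \<Omega>" by (rule sets.sets_into_space)
  have ev: "{\<omega> \<in> \<Omega>. X (t + s) \<omega> \<in> \<Gamma>} \<in> sets \<F>" using X_event[OF _ set, of "t + s"] t s by simp
  have "(\<integral>\<^sup>+\<omega>. indicator A \<omega> * indicator \<Gamma> (X (t + s) \<omega>) \<partial>P x) = (\<integral>\<^sup>+\<omega>. indicator (A \<inter> {\<omega> \<in> \<Omega>. X (t + s) \<omega> \<in> \<Gamma>}) \<omega> \<partial>P x)"
    by (rule nn_integral_cong) (auto simp: indicator_def space_P[OF x])
  also have "\<dots> = emeasure (P x) (A \<inter> {\<omega> \<in> \<Omega>. X (t + s) \<omega> \<in> \<Gamma>})"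
    using AF ev sets_P[OF x] by (intro nn_integral_indicator) auto
  also have "\<dots> = (\<integral>\<^sup>+\<omega>. indicator A \<omega> * emeasure (P (X t \<omega>)) {\<omega>' \<in> \<Omega>. X s \<omega>' \<in> \<Gamma>} \<partial>P x)"
    by (rule simple_markov_event[OF x t s A set])
  also have "\<dots> = (\<integral>\<^sup>+\<omega>. indicator A \<omega> * (\<integral>\<^sup>+\<omega>'. indicator \<Gamma> (X s \<omega>') \<partial>P (X t \<omega>)) \<partial>P x)"
  proof (rule nn_integral_cong)
    fix \<omega> assume "\<omega> \<in> space (P x)"
    then have y: "X t \<omega> \<in> S" using X_in_S[OF t] space_P[OF x] by simp
    have "(\<integral>\<^sup>+\<omega>'. indicator \<Gamma> (X s \<omega>') \<partial>P (X t \<omega>)) = (\<integral>\<^sup>+\<omega>'. indicator {\<omega>' \<in> \<Omega>. X s \<omega>' \<in> \<Gamma>} \<omega>' \<partial>P (X t \<omega>))"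
      by (rule nn_integral_cong) (auto simp: indicator_def space_P[OF y])
    also have "\<dots> = emeasure (P (X t \<omega>)) {\<omega>' \<in> \<Omega>. X s \<omega>' \<in> \<Gamma>}"
      using X_event[OF s set] sets_P[OF y] by simp
    finally show "indicator A \<omega> * emeasure (P (X t \<omega>)) {\<omega>' \<in> \<Omega>. X s \<omega>' \<in> \<Gamma>} = indicator A \<omega> * (\<integral>\<^sup>+\<omega>'. indicator \<Gamma> (X s \<omega>') \<partial>P (X t \<omega>))"
      by simp
  qed
  finally show ?case .
next
  case (mult u c)
  have Am [measurable]: "A \<in> sets (P x)" using sets_filtration[OF t A] sets_P[OF x] by simp
  have um [measurable]: "(\<lambda>\<omega>. u (X (t + s) \<omega>)) \<in> borel_measurable (P x)"
    using measurable_compose[OF X_measurable_P[OF x, of "t + s"] mult(2)] t s by simp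
  have km [measurable]: "(\<lambda>\<omega>. \<integral>\<^sup>+\<omega>'. u (X s \<omega>') \<partial>P (X t \<omega>)) \<in> borel_measurable (P x)"
    by (rule measurable_compose[OF X_measurable_P[OF x t] kernel_nn_integral[OF s mult(2)]])
  have "(\<integral>\<^sup>+\<omega>. indicator A \<omega> * (c * u (X (t + s) \<omega>)) \<partial>P x) = c * (\<integral>\<^sup>+\<omega>. indicator A \<omega> * u (X (t + s) \<omega>) \<partial>P x)"
    by (subst nn_integral_cmult[symmetric]) (auto simp: mult.left_commute)
  also have "\<dots> = c * (\<integral>\<^sup>+\<omega>. indicator A \<omega> * (\<integral>\<^sup>+\<omega>'. u (X s \<omega>') \<partial>P (X t \<omega>)) \<partial>P x)" by (simp add: mult(4))
  also have "\<dots> = (\<integral>\<^sup>+\<omega>. indicator A \<omega> * (c * (\<integral>\<^sup>+\<omega>'. u (X s \<omega>') \<partial>P (X t \<omega>))) \<partial>P x)"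
    by (subst nn_integral_cmult[symmetric]) (auto simp: mult.left_commute)
  also have "\<dots> = (\<integral>\<^sup>+\<omega>. indicator A \<omega> * (\<integral>\<^sup>+\<omega>'. c * u (X s \<omega>') \<partial>P (X t \<omega>)) \<partial>P x)"
  proof (rule nn_integral_cong)
    fix \<omega> assume "\<omega> \<in> space (P x)"
    then have y: "X t \<omega> \<in> S" using X_in_S[OF t] space_P[OF x] by simp
    have "(\<integral>\<^sup>+\<omega>'. c * u (X s \<omega>') \<partial>P (X t \<omega>)) = c * (\<integral>\<^sup>+\<omega>'. u (X s \<omega>') \<partial>P (X t \<omega>))"
      by (rule nn_integral_cmult) (rule measurable_compose[OF X_measurable_P[OF y s] mult(2)])
    then show "indicator A \<omega> * (c * (\<integral>\<^sup>+\<omega>'. u (X s \<omega>') \<partial>P (X t \<omega>))) = indicator A \<omega> * (\<integral>\<^sup>+\<omega>'. c * u (X s \<omega>') \<partial>P (X t \<omega>))" by simp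
  qed
  finally show ?case .
next
  case (add u v)
  have Am [measurable]: "A \<in> sets (P x)" using sets_filtration[OF t A] sets_P[OF x] by simp
  have m [measurable]: "(\<lambda>\<omega>. w (X (t + s) \<omega>)) \<in> borel_measurable (P x)" if "w \<in> borel_measurable SB" for w :: "_ \<Rightarrow> ennreal"
    using measurable_compose[OF X_measurable_P[OF x, of "t + s"] that] t s by simp
  have k [measurable]: "(\<lambda>\<omega>. \<integral>\<^sup>+\<omega>'. w (X s \<omega>') \<partial>P (X t \<omega>)) \<in> borel_measurable (P x)" if "w \<in> borel_measurable SB" for w
    by (rule measurable_compose[OF X_measurable_P[OF x t] kernel_nn_integral[OF s that]])
  note mm = m[OF add(1)] m[OF add(3)] k[OF add(1)] k[OF add(3)]
  have "(\<integral>\<^sup>+\<omega>. indicator A \<omega> * (v (X (t + s) \<omega>) + u (X (t + s) \<omega>)) \<partial>P x)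
    = (\<integral>\<^sup>+\<omega>. indicator A \<omega> * v (X (t + s) \<omega>) \<partial>P x) + (\<integral>\<^sup>+\<omega>. indicator A \<omega> * u (X (t + s) \<omega>) \<partial>P x)"
    using mm by (subst nn_integral_add[symmetric]) (auto simp: distrib_left)
  also have "\<dots> = (\<integral>\<^sup>+\<omega>. indicator A \<omega> * (\<integral>\<^sup>+\<omega>'. v (X s \<omega>') \<partial>P (X t \<omega>)) \<partial>P x) + (\<integral>\<^sup>+\<omega>. indicator A \<omega> * (\<integral>\<^sup>+\<omega>'. u (X s \<omega>') \<partial>P (X t \<omega>)) \<partial>P x)"
    using add by simp
  also have "\<dots> = (\<integral>\<^sup>+\<omega>. indicator A \<omega> * ((\<integral>\<^sup>+\<omega>'. v (X s \<omega>') \<partial>P (X t \<omega>)) + (\<integral>\<^sup>+\<omega>'. u (X s \<omega>') \<partial>P (X t \<omega>))) \<partial>P x)"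
    using mm by (subst nn_integral_add[symmetric]) (auto simp: distrib_left)
  also have "\<dots> = (\<integral>\<^sup>+\<omega>. indicator A \<omega> * (\<integral>\<^sup>+\<omega>'. v (X s \<omega>') + u (X s \<omega>') \<partial>P (X t \<omega>)) \<partial>P x)"
  proof (rule nn_integral_cong)
    fix \<omega> assume "\<omega> \<in> space (P x)"
    then have y: "X t \<omega> \<in> S" using X_in_S[OF t] space_P[OF x] by simp
    have "(\<integral>\<^sup>+\<omega>'. v (X s \<omega>') + u (X s \<omega>') \<partial>P (X t \<omega>)) = (\<integral>\<^sup>+\<omega>'. v (X s \<omega>') \<partial>P (X t \<omega>)) + (\<integral>\<^sup>+\<omega>'. u (X s \<omega>') \<partial>P (X t \<omega>))"
      by (rule nn_integral_add) (rule measurable_compose[OF X_measurable_P[OF y s]], fact add)+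
    then show "indicator A \<omega> * ((\<integral>\<^sup>+\<omega>'. v (X s \<omega>') \<partial>P (X t \<omega>)) + (\<integral>\<^sup>+\<omega>'. u (X s \<omega>') \<partial>P (X t \<omega>))) = indicator A \<omega> * (\<integral>\<^sup>+\<omega>'. v (X s \<omega>') + u (X s \<omega>') \<partial>P (X t \<omega>))" by simp
  qed
  finally show ?case .
next
  case (seq U)
  have Am [measurable]: "A \<in> sets (P x)" using sets_filtration[OF t A] sets_P[OF x] by simp
  have m [measurable]: "(\<lambda>\<omega>. U i (X (t + s) \<omega>)) \<in> borel_measurable (P x)" for i
    using measurable_compose[OF X_measurable_P[OF x, of "t + s"] seq(1)] t s by simp
  have k [measurable]: "(\<lambda>\<omega>. \<integral>\<^sup>+\<omega>'. U i (X s \<omega>') \<partial>P (X t \<omega>)) \<in> borel_measurable (P x)" for i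
    by (rule measurable_compose[OF X_measurable_P[OF x t] kernel_nn_integral[OF s seq(1)]])
  have mono: "i \<le> j \<Longrightarrow> U i y \<le> U j y" for i j y using seq(3) by (auto simp: incseq_def le_fun_def)
  have "(\<integral>\<^sup>+\<omega>. indicator A \<omega> * (SUP i. U i (X (t + s) \<omega>)) \<partial>P x) = (\<integral>\<^sup>+\<omega>. (SUP i. indicator A \<omega> * U i (X (t + s) \<omega>)) \<partial>P x)"
    by (simp add: SUP_mult_left_ennreal)
  also have "\<dots> = (SUP i. \<integral>\<^sup>+\<omega>. indicator A \<omega> * U i (X (t + s) \<omega>) \<partial>P x)"
    by (rule nn_integral_monotone_convergence_SUP) (auto simp: incseq_def le_fun_def intro!: mult_left_mono mono)
  also have "\<dots> = (SUP i. \<integral>\<^sup>+\<omega>. indicator A \<omega> * (\<integral>\<^sup>+\<omega>'. U i (X s \<omega>') \<partial>P (X t \<omega>)) \<partial>P x)"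
    using seq(5) by simp
  also have "\<dots> = (\<integral>\<^sup>+\<omega>. (SUP i. indicator A \<omega> * (\<integral>\<^sup>+\<omega>'. U i (X s \<omega>') \<partial>P (X t \<omega>))) \<partial>P x)"
    by (rule nn_integral_monotone_convergence_SUP[symmetric]) (auto simp: incseq_def le_fun_def intro!: mult_left_mono nn_integral_mono mono)
  also have "\<dots> = (\<integral>\<^sup>+\<omega>. indicator A \<omega> * (\<integral>\<^sup>+\<omega>'. (SUP i. U i (X s \<omega>')) \<partial>P (X t \<omega>)) \<partial>P x)"
  proof (rule nn_integral_cong)
    fix \<omega> assume "\<omega> \<in> space (P x)"
    then have y: "X t \<omega> \<in> S" using X_in_S[OF t] space_P[OF x] by simp
    have "(\<integral>\<^sup>+\<omega>'. (SUP i. U i (X s \<omega>')) \<partial>P (X t \<omega>)) = (SUP i. \<integral>\<^sup>+\<omega>'. U i (X s \<omega>') \<partial>P (X t \<omega>))"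
      by (rule nn_integral_monotone_convergence_SUP)
        (auto simp: incseq_def le_fun_def intro!: mono measurable_compose[OF X_measurable_P[OF y s] seq(1)])
    then show "(SUP i. indicator A \<omega> * (\<integral>\<^sup>+\<omega>'. U i (X s \<omega>') \<partial>P (X t \<omega>))) = indicator A \<omega> * (\<integral>\<^sup>+\<omega>'. (SUP i. U i (X s \<omega>')) \<partial>P (X t \<omega>))"
      by (simp add: SUP_mult_left_ennreal)
  qed
  finally show ?case by (simp add: SUP_apply image_image)
qed

text \<open>In \<open>cyl\<close> and \<open>cyl_prob\<close> the list entries carry time increments, in \<open>fin_dim\<close> absolute times.\<close>

fun cyl :: "real \<Rightarrow> (real \<times> 'a set) list \<Rightarrow> 'w set" where
  "cyl t [] = \<Omega>"
| "cyl t ((d, \<Gamma>) # l) = {\<omega> \<in> \<Omega>. X (t + d) \<omega> \<in> \<Gamma>} \<inter> cyl (t + d) l"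

fun cyl_prob :: "(real \<times> 'a set) list \<Rightarrow> 'a \<Rightarrow> ennreal" where
  "cyl_prob [] y = 1"
| "cyl_prob ((d, \<Gamma>) # l) y = (\<integral>\<^sup>+\<omega>. indicator \<Gamma> (X d \<omega>) * cyl_prob l (X d \<omega>) \<partial>P y)"

definition valid :: "(real \<times> 'a set) list \<Rightarrow> bool" where
  "valid l \<longleftrightarrow> (\<forall>(d, \<Gamma>)\<in>set l. 0 \<le> d \<and> \<Gamma> \<in> sets SB)"

lemma valid_Cons [simp]: "valid ((d, \<Gamma>) # l) \<longleftrightarrow> 0 \<le> d \<and> \<Gamma> \<in> sets SB \<and> valid l"
  by (auto simp: valid_def)

lemma cyl_prob_measurable: "valid l \<Longrightarrow> cyl_prob l \<in> borel_measurable SB"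
proof (induction l)
  case (Cons p l)
  obtain d \<Gamma> where p: "p = (d, \<Gamma>)" by (cases p)
  have [measurable]: "cyl_prob l \<in> borel_measurable SB" "\<Gamma> \<in> sets SB" using Cons p by auto
  have "(\<lambda>y. indicator \<Gamma> y * cyl_prob l y) \<in> borel_measurable SB" by measurable
  from kernel_nn_integral[OF _ this, of d] show ?case using Cons.prems p by simp
next
  case Nil
  have "cyl_prob [] = (\<lambda>_. 1)" by auto
  then show ?case by simp
qed

text \<open>The first event of the list is absorbed into A, which thereby moves from
  \<open>\<F>t t\<close> to \<open>\<F>t (t + d)\<close>.\<close>

lemma emeasure_cyl_markov:
  assumes x: "x \<in> S"
  shows "valid l \<Longrightarrow> 0 \<le> t \<Longrightarrow> A \<in> sets (\<F>t t) \<Longrightarrow>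
    emeasure (P x) (A \<inter> cyl t l) = (\<integral>\<^sup>+\<omega>. indicator A \<omega> * cyl_prob l (X t \<omega>) \<partial>P x)"
proof (induction l arbitrary: t A)
  case Nil
  have AF: "A \<in> sets \<F>" by (rule sets_filtration[OF Nil(2,3)])
  then have "A \<inter> \<Omega> = A" using sets.sets_into_space by blast
  then show ?case using AF sets_P[OF x] by simp
next
  case (Cons p l)
  obtain d \<Gamma> where p: "p = (d, \<Gamma>)" by (cases p)
  have d: "0 \<le> d" and \<Gamma> [measurable]: "\<Gamma> \<in> sets SB" and l: "valid l" using Cons.prems(1) p by auto
  have td: "0 \<le> t + d" using Cons.prems(2) d by simp
  let ?A = "A \<inter> {\<omega> \<in> \<Omega>. X (t + d) \<omega> \<in> \<Gamma>}"
  have A': "?A \<in> sets (\<F>t (t + d))"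
    using filtration_mono_sets[OF Cons.prems(2) _ Cons.prems(3), of "t + d"] X_event_filtration[OF td \<Gamma>] d by auto
  have [measurable]: "cyl_prob l \<in> borel_measurable SB" by (rule cyl_prob_measurable[OF l])
  have m: "(\<lambda>y. indicator \<Gamma> y * cyl_prob l y) \<in> borel_measurable SB" by measurable
  have "emeasure (P x) (A \<inter> cyl t (p # l)) = emeasure (P x) (?A \<inter> cyl (t + d) l)"
    by (simp add: p Int_assoc)
  also have "\<dots> = (\<integral>\<^sup>+\<omega>. indicator ?A \<omega> * cyl_prob l (X (t + d) \<omega>) \<partial>P x)"
    by (rule Cons.IH[OF l td A'])
  also have "\<dots> = (\<integral>\<^sup>+\<omega>. indicator A \<omega> * (indicator \<Gamma> (X (t + d) \<omega>) * cyl_prob l (X (t + d) \<omega>)) \<partial>P x)"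
    by (rule nn_integral_cong) (auto simp: indicator_def space_P[OF x])
  also have "\<dots> = (\<integral>\<^sup>+\<omega>. indicator A \<omega> * cyl_prob (p # l) (X t \<omega>) \<partial>P x)"
    using simple_markov[OF x Cons.prems(2) d Cons.prems(3) m] by (simp add: p)
  finally show ?case .
qed

text \<open>The case t = 0 and A = \<Omega>; the start at y makes the integrand constant.\<close>

lemma cyl_prob_eq: "valid l \<Longrightarrow> y \<in> S \<Longrightarrow> cyl_prob l y = emeasure (P y) (cyl 0 l)"
proof -
  assume l: "valid l" and y: "y \<in> S"
  interpret prob_space "P y" by (rule prob[OF y])
  have O: "\<Omega> \<in> sets (\<F>t 0)" using sets.top[of "\<F>t 0"] space_filtration[of 0] by simp
  have c: "cyl t l \<subseteq> \<Omega>" for t l by (induction t l rule: cyl.induct) auto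
  have "emeasure (P y) (cyl 0 l) = emeasure (P y) (\<Omega> \<inter> cyl 0 l)" using c by (simp add: Int_absorb1)
  also have "\<dots> = (\<integral>\<^sup>+\<omega>. indicator \<Omega> \<omega> * cyl_prob l (X 0 \<omega>) \<partial>P y)"
    by (rule emeasure_cyl_markov[OF y l _ O]) simp
  also have "\<dots> = (\<integral>\<^sup>+\<omega>. cyl_prob l y \<partial>P y)"
    by (rule nn_integral_cong_AE) (use start[OF y] AE_space in \<open>eventually_elim, auto simp: space_P[OF y]\<close>)
  also have "\<dots> = cyl_prob l y" by (simp add: emeasure_space_1)
  finally show ?thesis by simp
qed

definition fin_dim :: "(real \<times> 'a set) list \<Rightarrow> 'w set" where
  "fin_dim l = {\<omega> \<in> \<Omega>. \<forall>(t, \<Gamma>)\<in>set l. X t \<omega> \<in> \<Gamma>}"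

fun increments :: "real \<Rightarrow> (real \<times> 'a set) list \<Rightarrow> (real \<times> 'a set) list" where
  "increments t0 [] = []"
| "increments t0 ((t, \<Gamma>) # l) = (t - t0, \<Gamma>) # increments t l"

lemma cyl_increments:
  "sorted (t0 # map fst l) \<Longrightarrow> (\<forall>(t, \<Gamma>)\<in>set l. \<Gamma> \<in> sets SB) \<Longrightarrow> cyl t0 (increments t0 l) = fin_dim l \<and> valid (increments t0 l)"
proof (induction l arbitrary: t0)
  case Nil
  then show ?case by (simp add: fin_dim_def valid_def)
next
  case (Cons p l)
  obtain t \<Gamma> where p: "p = (t, \<Gamma>)" by (cases p)
  have "cyl t (increments t l) = fin_dim l \<and> valid (increments t l)"
    by (rule Cons.IH) (use Cons.prems p in auto)
  then show ?case using Cons.prems p by (auto simp: fin_dim_def)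
qed

text \<open>Sorting by time turns the differences into nonnegative increments; repeated times give
  increment 0.\<close>

lemma fin_dim_eq_cyl: "valid l \<Longrightarrow> \<exists>l'. valid l' \<and> fin_dim l = cyl 0 l'"
proof -
  assume l: "valid l"
  let ?s = "sort_key fst l"
  have "sorted (0 # map fst ?s)" using l by (auto simp: valid_def sorted_sort_key)
  moreover have "\<forall>(t, \<Gamma>)\<in>set ?s. \<Gamma> \<in> sets SB" using l by (auto simp: valid_def)
  ultimately have "cyl 0 (increments 0 ?s) = fin_dim ?s \<and> valid (increments 0 ?s)" by (rule cyl_increments)
  moreover have "fin_dim ?s = fin_dim l" by (simp add: fin_dim_def)
  ultimately show ?thesis by metis
qed

lemma cyl_shift: "0 \<le> t \<Longrightarrow> 0 \<le> s \<Longrightarrow> valid l \<Longrightarrow> {\<omega> \<in> \<Omega>. \<Theta> t \<omega> \<in> cyl s l} = cyl (t + s) l"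
proof (induction l arbitrary: s)
  case Nil
  then show ?case using shift_into by auto
next
  case (Cons p l)
  obtain d \<Gamma> where p: "p = (d, \<Gamma>)" by (cases p)
  have "{\<omega> \<in> \<Omega>. \<Theta> t \<omega> \<in> cyl (s + d) l} = cyl (t + (s + d)) l" by (rule Cons.IH) (use Cons.prems p in auto)
  moreover have "X (s + d) (\<Theta> t \<omega>) = X (t + s + d) \<omega>" if "\<omega> \<in> \<Omega>" for \<omega>
    using shift[of "s + d" t \<omega>] that Cons.prems p by (simp add: ac_simps)
  ultimately show ?case using shift_into Cons.prems(1) by (auto simp: p ac_simps)
qed

text \<open>The full \<open>\<F>\<close> need not be generated by \<open>X\<close>, and \<open>\<Theta> t\<close> need not be measurable for it.\<close>

definition path_events :: "'w measure" where
  "path_events = sigma \<Omega> (fin_dim ` {l. valid l})"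

lemma fin_dim_Pow: "fin_dim ` {l. valid l} \<subseteq> Pow \<Omega>"
  by (auto simp: fin_dim_def)

lemma space_path_events [simp]: "space path_events = \<Omega>"
  by (simp add: path_events_def space_measure_of[OF fin_dim_Pow])

lemma sets_path_events: "sets path_events = sigma_sets \<Omega> (fin_dim ` {l. valid l})"
  by (simp add: path_events_def sets_measure_of[OF fin_dim_Pow])

lemma fin_dim_Int_stable: "Int_stable (fin_dim ` {l. valid l})"
proof (rule Int_stableI)
  fix a b assume "a \<in> fin_dim ` {l. valid l}" "b \<in> fin_dim ` {l. valid l}"
  then obtain k l where "valid k" "valid l" "a = fin_dim k" "b = fin_dim l" by auto
  then have "a \<inter> b = fin_dim (k @ l)" "valid (k @ l)" by (auto simp: fin_dim_def valid_def)
  then show "a \<inter> b \<in> fin_dim ` {l. valid l}" by blast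
qed

lemma cyl_sets: "valid l \<Longrightarrow> 0 \<le> t \<Longrightarrow> cyl t l \<in> sets \<F>"
proof (induction l arbitrary: t)
  case (Cons p l)
  then show ?case by (cases p) (auto intro!: X_event)
qed simp

text \<open>Dynkin's theorem. The claims go through the induction together, because the steps for
  complements and unions use the measurability of \<open>emeasure (P x) D\<close> in x and that of
  the shifted event.\<close>

lemma path_event_markov:
  assumes "D \<in> sets path_events"
  shows "D \<in> sets \<F> \<and> (\<lambda>x. emeasure (P x) D) \<in> borel_measurable SB \<and>
    (\<forall>t\<ge>0. {\<omega> \<in> \<Omega>. \<Theta> t \<omega> \<in> D} \<in> sets \<F> \<and>
      (\<forall>x\<in>S. \<forall>A\<in>sets (\<F>t t). emeasure (P x) (A \<inter> {\<omega> \<in> \<Omega>. \<Theta> t \<omega> \<in> D})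
         = (\<integral>\<^sup>+\<omega>. indicator A \<omega> * emeasure (P (X t \<omega>)) D \<partial>P x)))"
  using assms unfolding sets_path_events
proof (induction rule: sigma_sets_induct_disjoint[OF fin_dim_Int_stable fin_dim_Pow, consumes 1, case_names basic empty compl union])
  case (basic D)
  then obtain l where l: "valid l" "D = cyl 0 l" using fin_dim_eq_cyl by auto
  have s: "{\<omega> \<in> \<Omega>. \<Theta> t \<omega> \<in> D} = cyl t l" if "0 \<le> t" for t
    using cyl_shift[OF that _ l(1), of 0] by (simp add: l(2))
  have "(\<lambda>x. emeasure (P x) D) \<in> borel_measurable SB"
    using cyl_prob_measurable[OF l(1)] cyl_prob_eq[OF l(1)] by (subst measurable_cong[where g = "cyl_prob l"]) (auto simp: l(2))
  moreover have "emeasure (P x) (A \<inter> {\<omega> \<in> \<Omega>. \<Theta> t \<omega> \<in> D}) = (\<integral>\<^sup>+\<omega>. indicator A \<omega> * emeasure (P (X t \<omega>)) D \<partial>P x)"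
    if "0 \<le> t" "x \<in> S" "A \<in> sets (\<F>t t)" for t x A
    unfolding s[OF that(1)] emeasure_cyl_markov[OF that(2) l(1) that(1,3)]
    by (rule nn_integral_cong) (use cyl_prob_eq[OF l(1)] X_in_S[OF that(1)] space_P[OF that(2)] l(2) in auto)
  ultimately show ?case using cyl_sets[OF l(1)] s by (auto simp: l(2))
next
  case empty
  then show ?case by simp
next
  case (compl D)
  then have DF: "D \<in> sets \<F>" and Dm [measurable]: "(\<lambda>x. emeasure (P x) D) \<in> borel_measurable SB"
    and DT: "\<And>t. 0 \<le> t \<Longrightarrow> {\<omega> \<in> \<Omega>. \<Theta> t \<omega> \<in> D} \<in> sets \<F>"
    and mk: "\<And>t x A. 0 \<le> t \<Longrightarrow> x \<in> S \<Longrightarrow> A \<in> sets (\<F>t t) \<Longrightarrow> emeasure (P x) (A \<inter> {\<omega> \<in> \<Omega>. \<Theta> t \<omega> \<in> D}) = (\<integral>\<^sup>+\<omega>. indicator A \<omega> * emeasure (P (X t \<omega>)) D \<partial>P x)"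
    by auto
  have c: "emeasure (P x) (\<Omega> - D) = 1 - emeasure (P x) D" if x: "x \<in> S" for x
  proof -
    interpret prob_space "P x" by (rule prob[OF x])
    have "emeasure (P x) (space (P x) - D) = emeasure (P x) (space (P x)) - emeasure (P x) D"
      by (rule emeasure_compl) (use DF sets_P[OF x] in auto)
    then show ?thesis by (simp add: space_P[OF x] emeasure_P_space[OF x])
  qed
  have s: "{\<omega> \<in> \<Omega>. \<Theta> t \<omega> \<in> \<Omega> - D} = \<Omega> - {\<omega> \<in> \<Omega>. \<Theta> t \<omega> \<in> D}" if "0 \<le> t" for t
    using shift_into[OF that] by auto
  have "(\<lambda>x. emeasure (P x) (\<Omega> - D)) \<in> borel_measurable SB"
    by (subst measurable_cong[where g = "\<lambda>x. 1 - emeasure (P x) D"]) (auto simp: c)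
  moreover have "emeasure (P x) (A \<inter> {\<omega> \<in> \<Omega>. \<Theta> t \<omega> \<in> \<Omega> - D}) = (\<integral>\<^sup>+\<omega>. indicator A \<omega> * emeasure (P (X t \<omega>)) (\<Omega> - D) \<partial>P x)"
    if t: "0 \<le> t" and x: "x \<in> S" and A: "A \<in> sets (\<F>t t)" for t x A
  proof -
    interpret prob_space "P x" by (rule prob[OF x])
    have AF: "A \<in> sets (P x)" using sets_filtration[OF t A] sets_P[OF x] by simp
    have AO: "A \<subseteq> \<Omega>" using sets.sets_into_space[OF sets_filtration[OF t A]] .
    have m: "(\<lambda>\<omega>. indicator A \<omega> * emeasure (P (X t \<omega>)) D) \<in> borel_measurable (P x)"
      using AF measurable_compose[OF X_measurable_P[OF x t] Dm] by simp
    have "A \<inter> {\<omega> \<in> \<Omega>. \<Theta> t \<omega> \<in> \<Omega> - D} = A - A \<inter> {\<omega> \<in> \<Omega>. \<Theta> t \<omega> \<in> D}"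
      using AO s[OF t] by auto
    then have "emeasure (P x) (A \<inter> {\<omega> \<in> \<Omega>. \<Theta> t \<omega> \<in> \<Omega> - D}) = emeasure (P x) A - emeasure (P x) (A \<inter> {\<omega> \<in> \<Omega>. \<Theta> t \<omega> \<in> D})"
      using AF DT[OF t] sets_P[OF x] by (simp add: emeasure_Diff)
    also have "\<dots> = (\<integral>\<^sup>+\<omega>. indicator A \<omega> \<partial>P x) - (\<integral>\<^sup>+\<omega>. indicator A \<omega> * emeasure (P (X t \<omega>)) D \<partial>P x)"
      using AF mk[OF t x A] by simp
    also have "\<dots> = (\<integral>\<^sup>+\<omega>. indicator A \<omega> - indicator A \<omega> * emeasure (P (X t \<omega>)) D \<partial>P x)"
    proof (rule nn_integral_diff[symmetric])
      show "(\<integral>\<^sup>+\<omega>. indicator A \<omega> * emeasure (P (X t \<omega>)) D \<partial>P x) \<noteq> \<infinity>"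
        unfolding mk[OF t x A, symmetric] using emeasure_finite by simp
      show "AE \<omega> in P x. indicator A \<omega> * emeasure (P (X t \<omega>)) D \<le> indicator A \<omega>"
      proof (rule AE_I2)
        fix \<omega> assume "\<omega> \<in> space (P x)"
        then have y: "X t \<omega> \<in> S" using X_in_S[OF t] space_P[OF x] by simp
        show "indicator A \<omega> * emeasure (P (X t \<omega>)) D \<le> indicator A \<omega>"
          using subprob_space.subprob_emeasure_le_1[OF prob_space_imp_subprob_space[OF prob[OF y]], of D]
          by (cases "\<omega> \<in> A") auto
      qed
    qed (use AF m in auto)
    also have "\<dots> = (\<integral>\<^sup>+\<omega>. indicator A \<omega> * emeasure (P (X t \<omega>)) (\<Omega> - D) \<partial>P x)"
      by (rule nn_integral_cong) (use c X_in_S[OF t] space_P[OF x] in \<open>simp split: split_indicator\<close>)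
    finally show ?thesis .
  qed
  ultimately show ?case using DF DT s by auto
next
  case (union D)
  then have DF: "\<And>i. D i \<in> sets \<F>" and Dm [measurable]: "\<And>i. (\<lambda>x. emeasure (P x) (D i)) \<in> borel_measurable SB"
    and DT: "\<And>t i. 0 \<le> t \<Longrightarrow> {\<omega> \<in> \<Omega>. \<Theta> t \<omega> \<in> D i} \<in> sets \<F>"
    and mk: "\<And>t x A i. 0 \<le> t \<Longrightarrow> x \<in> S \<Longrightarrow> A \<in> sets (\<F>t t) \<Longrightarrow> emeasure (P x) (A \<inter> {\<omega> \<in> \<Omega>. \<Theta> t \<omega> \<in> D i}) = (\<integral>\<^sup>+\<omega>. indicator A \<omega> * emeasure (P (X t \<omega>)) (D i) \<partial>P x)"
    by auto
  have c: "emeasure (P x) (\<Union>i. D i) = (\<Sum>i. emeasure (P x) (D i))" if x: "x \<in> S" for x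
    by (rule suminf_emeasure[symmetric]) (use DF union(1) sets_P[OF x] in auto)
  have s: "{\<omega> \<in> \<Omega>. \<Theta> t \<omega> \<in> (\<Union>i. D i)} = (\<Union>i. {\<omega> \<in> \<Omega>. \<Theta> t \<omega> \<in> D i})" for t by auto
  have "(\<lambda>x. emeasure (P x) (\<Union>i. D i)) \<in> borel_measurable SB"
    by (subst measurable_cong[where g = "\<lambda>x. \<Sum>i. emeasure (P x) (D i)"]) (auto simp: c)
  moreover have "emeasure (P x) (A \<inter> {\<omega> \<in> \<Omega>. \<Theta> t \<omega> \<in> (\<Union>i. D i)}) = (\<integral>\<^sup>+\<omega>. indicator A \<omega> * emeasure (P (X t \<omega>)) (\<Union>i. D i) \<partial>P x)"
    if t: "0 \<le> t" and x: "x \<in> S" and A: "A \<in> sets (\<F>t t)" for t x A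
  proof -
    have AF: "A \<in> sets (P x)" using sets_filtration[OF t A] sets_P[OF x] by simp
    have m: "(\<lambda>\<omega>. indicator A \<omega> * emeasure (P (X t \<omega>)) (D i)) \<in> borel_measurable (P x)" for i
      using AF measurable_compose[OF X_measurable_P[OF x t] Dm] by simp
    have e: "A \<inter> {\<omega> \<in> \<Omega>. \<Theta> t \<omega> \<in> (\<Union>i. D i)} = (\<Union>i. A \<inter> {\<omega> \<in> \<Omega>. \<Theta> t \<omega> \<in> D i})" by auto
    have "emeasure (P x) (A \<inter> {\<omega> \<in> \<Omega>. \<Theta> t \<omega> \<in> (\<Union>i. D i)}) = (\<Sum>i. emeasure (P x) (A \<inter> {\<omega> \<in> \<Omega>. \<Theta> t \<omega> \<in> D i}))"
      using AF DT[OF t] union(1) sets_P[OF x]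
      unfolding e by (intro suminf_emeasure[symmetric]) (auto simp: disjoint_family_on_def)
    also have "\<dots> = (\<Sum>i. \<integral>\<^sup>+\<omega>. indicator A \<omega> * emeasure (P (X t \<omega>)) (D i) \<partial>P x)"
      using mk[OF t x A] by simp
    also have "\<dots> = (\<integral>\<^sup>+\<omega>. (\<Sum>i. indicator A \<omega> * emeasure (P (X t \<omega>)) (D i)) \<partial>P x)"
      by (rule nn_integral_suminf[symmetric]) (rule m)
    also have "\<dots> = (\<integral>\<^sup>+\<omega>. indicator A \<omega> * emeasure (P (X t \<omega>)) (\<Union>i. D i) \<partial>P x)"
      by (rule nn_integral_cong) (use c X_in_S[OF t] space_P[OF x] in simp)
    finally show ?thesis .
  qed
  ultimately show ?case using DF DT by (auto simp: s)
qed

end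

section \<open>The ergodic theorem\<close>

text \<open>Garsia's argument: on the set where some partial sum is positive, \<open>g\<close> dominates \<open>M - M \<circ> \<theta>\<close>
  with \<open>M\<close> the maximum of finitely many partial sums.\<close>

lemma (in finite_measure) maximal_ergodic:
  fixes g :: "'a \<Rightarrow> real"
  assumes \<theta> [measurable]: "\<theta> \<in> M \<rightarrow>\<^sub>M M" and inv: "distr M M \<theta> = M"
    and g [measurable]: "g \<in> borel_measurable M" and gb: "\<And>\<omega>. \<omega> \<in> space M \<Longrightarrow> \<bar>g \<omega>\<bar> \<le> c"
    and D [measurable]: "D \<in> sets M" and DD: "\<And>\<omega>. \<omega> \<in> space M \<Longrightarrow> \<theta> \<omega> \<in> D \<longleftrightarrow> \<omega> \<in> D"
    and pos: "\<And>\<omega>. \<omega> \<in> D \<Longrightarrow> \<exists>n. 0 < (\<Sum>k<n. g ((\<theta> ^^ k) \<omega>))"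
  shows "0 \<le> (\<integral>\<omega>. indicator D \<omega> * g \<omega> \<partial>M)"
proof -
  have \<theta>s: "\<theta> \<omega> \<in> space M" if "\<omega> \<in> space M" for \<omega> using measurable_space[OF \<theta> that] .
  have \<theta>k [measurable]: "(\<theta> ^^ k) \<in> M \<rightarrow>\<^sub>M M" for k
  proof (induction k)
    case (Suc k)
    then show ?case using measurable_comp[OF Suc \<theta>] by simp
  qed (simp add: id_def)
  define S where "S n \<omega> = (\<Sum>k<n. g ((\<theta> ^^ k) \<omega>))" for n \<omega>
  have S_Suc: "S (Suc n) \<omega> = g \<omega> + S n (\<theta> \<omega>)" for n \<omega>
    by (simp add: S_def sum.lessThan_Suc_shift funpow_swap1 del: sum.lessThan_Suc)
  have Sm [measurable]: "S n \<in> borel_measurable M" for n unfolding S_def[abs_def] by measurable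
  have Sb: "\<bar>S n \<omega>\<bar> \<le> real n * c" if "\<omega> \<in> space M" for n \<omega>
  proof -
    have "\<bar>S n \<omega>\<bar> \<le> (\<Sum>k<n. \<bar>g ((\<theta> ^^ k) \<omega>)\<bar>)" unfolding S_def by (rule sum_abs)
    also have "\<dots> \<le> (\<Sum>k<n. c)" by (rule sum_mono) (rule gb, rule measurable_space[OF \<theta>k that])
    finally show ?thesis by simp
  qed
  \<comment> \<open>Nonnegative, because n = 0 contributes the empty sum.\<close>
  define X where "X N \<omega> = Max ((\<lambda>n. S n \<omega>) ` {..N})" for N \<omega>
  have Xm [measurable]: "X N \<in> borel_measurable M" for N unfolding X_def[abs_def] by measurable
  have X_ge: "n \<le> N \<Longrightarrow> S n \<omega> \<le> X N \<omega>" for n N \<omega> unfolding X_def by (rule Max_ge) auto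
  have X0: "0 \<le> X N \<omega>" for N \<omega> using X_ge[of 0 N \<omega>] by (simp add: S_def)
  have X_in: "\<exists>n\<le>N. X N \<omega> = S n \<omega>" for N \<omega>
  proof -
    have "X N \<omega> \<in> (\<lambda>n. S n \<omega>) ` {..N}" unfolding X_def by (rule Max_in) auto
    then show ?thesis by auto
  qed
  have c0: "0 \<le> c" if "\<omega> \<in> space M" for \<omega> using gb[OF that] by linarith
  have Xb: "\<bar>X N \<omega>\<bar> \<le> real N * c" if "\<omega> \<in> space M" for N \<omega>
  proof -
    obtain n where "n \<le> N" "X N \<omega> = S n \<omega>" using X_in by blast
    moreover have "real n * c \<le> real N * c" using \<open>n \<le> N\<close> c0[OF that] by (intro mult_right_mono) auto
    ultimately show ?thesis using Sb[OF that, of n] by linarith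
  qed
  have int: "integrable M (\<lambda>\<omega>. h \<omega>)" if "h \<in> borel_measurable M" "\<And>\<omega>. \<omega> \<in> space M \<Longrightarrow> \<bar>h \<omega>\<bar> \<le> b" for h :: "'a \<Rightarrow> real" and b
    using that by (intro integrable_const_bound[where B = b]) auto
  let ?E = "\<lambda>N. {\<omega> \<in> space M. 0 < X N \<omega>}"
  have [measurable]: "?E N \<in> sets M" for N by measurable
  have step: "0 \<le> (\<integral>\<omega>. indicator (D \<inter> ?E N) \<omega> * g \<omega> \<partial>M)" for N
  proof -
    have iX: "integrable M (\<lambda>\<omega>. indicator D \<omega> * X N \<omega>)"
      by (rule int[where b = "real N * c"]) (use Xb c0 in \<open>auto simp: indicator_def\<close>)
    have iX\<theta>: "integrable M (\<lambda>\<omega>. indicator D \<omega> * X N (\<theta> \<omega>))"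
      by (rule int[where b = "real N * c"]) (use Xb \<theta>s c0 in \<open>auto simp: indicator_def\<close>)
    \<comment> \<open>Invariance of D lets the indicator move along with \<theta>, and invariance of
      the measure then removes \<theta>.\<close>
    have "(\<integral>\<omega>. indicator D \<omega> * X N (\<theta> \<omega>) \<partial>M) = (\<integral>\<omega>. indicator D (\<theta> \<omega>) * X N (\<theta> \<omega>) \<partial>M)"
      by (rule Bochner_Integration.integral_cong[OF refl]) (simp add: indicator_def DD)
    also have "\<dots> = (\<integral>\<omega>. indicator D \<omega> * X N \<omega> \<partial>distr M M \<theta>)"
      by (rule integral_distr[symmetric]) measurable
    finally have "(\<integral>\<omega>. indicator D \<omega> * X N (\<theta> \<omega>) \<partial>M) = (\<integral>\<omega>. indicator D \<omega> * X N \<omega> \<partial>M)" by (simp add: inv)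
    then have "0 = (\<integral>\<omega>. indicator D \<omega> * X N \<omega> - indicator D \<omega> * X N (\<theta> \<omega>) \<partial>M)"
      using iX iX\<theta> by simp
    also have "\<dots> \<le> (\<integral>\<omega>. indicator (D \<inter> ?E N) \<omega> * g \<omega> \<partial>M)"
    proof (rule integral_mono)
      show "integrable M (\<lambda>\<omega>. indicator D \<omega> * X N \<omega> - indicator D \<omega> * X N (\<theta> \<omega>))" using iX iX\<theta> by simp
      show "integrable M (\<lambda>\<omega>. indicator (D \<inter> ?E N) \<omega> * g \<omega>)"
        by (rule int[where b = c]) (use gb c0 in \<open>auto simp: indicator_def\<close>)
      fix \<omega> assume w: "\<omega> \<in> space M"
      show "indicator D \<omega> * X N \<omega> - indicator D \<omega> * X N (\<theta> \<omega>) \<le> indicator (D \<inter> ?E N) \<omega> * g \<omega>"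
      proof (cases "\<omega> \<in> D \<and> 0 < X N \<omega>")
        case True
        obtain n where n: "n \<le> N" "X N \<omega> = S n \<omega>" using X_in by blast
        \<comment> \<open>The sum for n = 0 is 0, so a positive maximum is attained at a successor,
          where \<open>S_Suc\<close> splits off g.\<close>
        with True obtain k where k: "n = Suc k" by (cases n) (auto simp: S_def)
        have "X N \<omega> = g \<omega> + S k (\<theta> \<omega>)" using n k S_Suc by simp
        also have "\<dots> \<le> g \<omega> + X N (\<theta> \<omega>)" using X_ge[of k N "\<theta> \<omega>"] n k by simp
        finally show ?thesis using True w by simp
      next
        case False
        then show ?thesis using X0[of N \<omega>] X0[of N "\<theta> \<omega>"] by (auto simp: indicator_def)
      qed
    qed
    finally show ?thesis .
  qed
  \<comment> \<open>The sets where X N is positive exhaust D, since every point of D has a positive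
    partial sum.\<close>
  have "(\<lambda>N. \<integral>\<omega>. indicator (D \<inter> ?E N) \<omega> * g \<omega> \<partial>M) \<longlonglongrightarrow> (\<integral>\<omega>. indicator D \<omega> * g \<omega> \<partial>M)"
  proof (rule integral_dominated_convergence[where w = "\<lambda>_. \<bar>c\<bar>"])
    show "AE \<omega> in M. (\<lambda>N. indicator (D \<inter> ?E N) \<omega> * g \<omega>) \<longlonglongrightarrow> indicator D \<omega> * g \<omega>"
    proof (rule AE_I2)
      fix \<omega> assume w: "\<omega> \<in> space M"
      show "(\<lambda>N. indicator (D \<inter> ?E N) \<omega> * g \<omega>) \<longlonglongrightarrow> indicator D \<omega> * g \<omega>"
      proof (cases "\<omega> \<in> D")
        case True
        then obtain n where "0 < S n \<omega>" using pos unfolding S_def by blast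
        then have "0 < X N \<omega>" if "n \<le> N" for N using X_ge[OF that, of \<omega>] by simp
        then have "\<forall>\<^sub>F N in sequentially. indicator (D \<inter> ?E N) \<omega> * g \<omega> = indicator D \<omega> * g \<omega>"
          using True w by (intro eventually_sequentiallyI[of n]) simp
        then show ?thesis by (rule tendsto_eventually)
      qed simp
    qed
    show "AE \<omega> in M. norm (indicator (D \<inter> ?E N) \<omega> * g \<omega>) \<le> \<bar>c\<bar>" for N
      by (rule AE_I2) (use gb in \<open>fastforce simp: indicator_def\<close>)
  qed (auto intro!: measurable)
  then show ?thesis by (rule LIMSEQ_le_const) (use step in blast)
qed

section \<open>Path functionals and invariant events\<close>

locale borel_diffusion = conservative_diffusion S \<F> \<F>t X \<Theta> P
  for S :: "'a::euclidean_space set" and \<F> :: "'w measure" and \<F>t X \<Theta> and P :: "'a \<Rightarrow> 'w measure" +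
  assumes S_borel: "S \<in> sets borel" and S_nonempty: "S \<noteq> {}"
begin

lemma X_path_measurable: "0 \<le> t \<Longrightarrow> X t \<in> path_events \<rightarrow>\<^sub>M SB"
proof (rule measurableI)
  fix \<Gamma> assume t: "0 \<le> t" and \<Gamma>: "\<Gamma> \<in> sets SB"
  have "X t -` \<Gamma> \<inter> space path_events = fin_dim [(t, \<Gamma>)]" by (auto simp: fin_dim_def)
  moreover have "valid [(t, \<Gamma>)]" using t \<Gamma> by (simp add: valid_def)
  ultimately show "X t -` \<Gamma> \<inter> space path_events \<in> sets path_events"
    unfolding sets_path_events by (auto intro!: sigma_sets.Basic)
qed (simp add: X_in_S)

text \<open>On the generators the shift just adds t to all times.\<close>

lemma shift_measurable: "0 \<le> t \<Longrightarrow> \<Theta> t \<in> path_events \<rightarrow>\<^sub>M path_events"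
proof (rule measurable_sigma_sets[OF sets_path_events fin_dim_Pow])
  assume t: "0 \<le> t"
  show "\<Theta> t \<in> space path_events \<rightarrow> \<Omega>" using shift_into[OF t] by auto
  fix D assume "D \<in> fin_dim ` {l. valid l}"
  then obtain l where l: "valid l" "D = fin_dim l" by auto
  have "\<Theta> t -` D \<inter> space path_events = fin_dim (map (\<lambda>(s, \<Gamma>). (s + t, \<Gamma>)) l)"
    using l shift[OF _ t] shift_into[OF t] by (fastforce simp: fin_dim_def valid_def)
  moreover have "valid (map (\<lambda>(s, \<Gamma>). (s + t, \<Gamma>)) l)" using l t by (auto simp: valid_def)
  ultimately show "\<Theta> t -` D \<inter> space path_events \<in> sets path_events"
    unfolding sets_path_events by (auto intro!: sigma_sets.Basic)
qed

text \<open>By continuity of paths the evaluation is the limit of the values at the last grid point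
  of mesh 1 / (n + 1) before the given time, and each of these approximations involves countably
  many times only.\<close>

lemma path_eval_measurable: "(\<lambda>p. X (max 0 (fst p)) (snd p)) \<in> borel \<Otimes>\<^sub>M path_events \<rightarrow>\<^sub>M SB"
proof (rule measurable_restrict_space2)
  show "(\<lambda>p. X (max 0 (fst p)) (snd p)) \<in> space (borel \<Otimes>\<^sub>M path_events) \<rightarrow> S"
    using X_in_S by (auto simp: space_pair_measure)
  let ?k = "\<lambda>n s. nat \<lfloor>max 0 s * real (Suc n)\<rfloor>"
  show "(\<lambda>p. X (max 0 (fst p)) (snd p)) \<in> borel_measurable (borel \<Otimes>\<^sub>M path_events)"
  proof (rule borel_measurable_LIMSEQ_metric)
    fix n
    show "(\<lambda>p. X (real (?k n (fst p)) / real (Suc n)) (snd p)) \<in> borel_measurable (borel \<Otimes>\<^sub>M path_events)"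
    proof (rule measurable_compose_countable[where f = "\<lambda>k p. X (real k / real (Suc n)) (snd p)"])
      fix k
      have "X (real k / real (Suc n)) \<in> borel_measurable path_events"
        using measurable_restrict_space2_iff[of "X (real k / real (Suc n))" path_events borel S] X_path_measurable[of "real k / real (Suc n)"] by simp
      then show "(\<lambda>p. X (real k / real (Suc n)) (snd p)) \<in> borel_measurable (borel \<Otimes>\<^sub>M path_events)"
        by (rule measurable_compose[OF measurable_snd])
    qed measurable
  next
    fix p :: "real \<times> 'w" assume "p \<in> space (borel \<Otimes>\<^sub>M path_events)"
    then have w: "snd p \<in> \<Omega>" by (auto simp: space_pair_measure)
    define s where "s = max 0 (fst p)"
    have s: "0 \<le> s" by (simp add: s_def)
    have le: "real (nat \<lfloor>s * real (Suc n)\<rfloor>) / real (Suc n) \<le> s" "s - 1 / real (Suc n) \<le> real (nat \<lfloor>s * real (Suc n)\<rfloor>) / real (Suc n)" for n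
    proof -
      have "0 \<le> s * real (Suc n)" using s by simp
      then have 1: "real (nat \<lfloor>s * real (Suc n)\<rfloor>) = of_int \<lfloor>s * real (Suc n)\<rfloor>" by simp
      show "real (nat \<lfloor>s * real (Suc n)\<rfloor>) / real (Suc n) \<le> s"
        unfolding 1 by (simp add: divide_le_eq of_int_floor_le del: of_nat_Suc)
      have "s * real (Suc n) - 1 \<le> of_int \<lfloor>s * real (Suc n)\<rfloor>" by linarith
      then have "(s * real (Suc n) - 1) / real (Suc n) \<le> of_int \<lfloor>s * real (Suc n)\<rfloor> / real (Suc n)"
        by (rule divide_right_mono) simp
      then show "s - 1 / real (Suc n) \<le> real (nat \<lfloor>s * real (Suc n)\<rfloor>) / real (Suc n)"
        unfolding 1 by (simp add: diff_divide_distrib del: of_nat_Suc)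
    qed
    have "(\<lambda>n. s - 1 / real (Suc n)) \<longlonglongrightarrow> s - 0"
      by (intro tendsto_diff tendsto_const LIMSEQ_Suc[OF lim_const_over_n])
    then have lim: "(\<lambda>n. s - 1 / real (Suc n)) \<longlonglongrightarrow> s" by simp
    have "(\<lambda>n. real (nat \<lfloor>s * real (Suc n)\<rfloor>) / real (Suc n)) \<longlonglongrightarrow> s"
      by (rule real_tendsto_sandwich[OF _ _ lim tendsto_const]) (intro always_eventually allI le)+
    then have "(\<lambda>n. X (real (nat \<lfloor>s * real (Suc n)\<rfloor>) / real (Suc n)) (snd p)) \<longlonglongrightarrow> X s (snd p)"
      by (rule continuous_on_tendsto_compose[OF continuous_paths[OF w]]) (use s in auto)
    then show "(\<lambda>n. X (real (?k n (fst p)) / real (Suc n)) (snd p)) \<longlonglongrightarrow> X (max 0 (fst p)) (snd p)"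
      by (simp add: s_def)
  qed
qed

lemma path_function_measurable:
  assumes "f \<in> borel_measurable SB"
  shows "(\<lambda>p. f (X (max 0 (fst p)) (snd p)) :: real) \<in> borel_measurable (borel \<Otimes>\<^sub>M path_events)"
  by (rule measurable_compose[OF path_eval_measurable assms])

lemma path_line_measurable:
  assumes "f \<in> borel_measurable SB" "\<omega> \<in> \<Omega>"
  shows "(\<lambda>s. f (X (max 0 s) \<omega>) :: real) \<in> borel_measurable borel"
proof -
  have "(\<lambda>s. (s, \<omega>)) \<in> borel \<rightarrow>\<^sub>M borel \<Otimes>\<^sub>M path_events" using assms(2) by simp
  from measurable_compose[OF this path_function_measurable[OF assms(1)]] show ?thesis by simp
qed

text \<open>\<open>max 0\<close> only makes the integrand a total Borel function of s; for a \<ge> 0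
  it changes nothing.\<close>

definition occ :: "('a \<Rightarrow> real) \<Rightarrow> real \<Rightarrow> real \<Rightarrow> 'w \<Rightarrow> real" where
  "occ f a b \<omega> = (\<integral>s. indicator {a..b} s * f (X (max 0 s) \<omega>) \<partial>lborel)"

context
  fixes f :: "'a \<Rightarrow> real" and c :: real
  assumes f: "f \<in> borel_measurable SB" and fb: "\<And>x. x \<in> S \<Longrightarrow> \<bar>f x\<bar> \<le> c"
begin

lemma occ_integrable:
  assumes "\<omega> \<in> \<Omega>" shows "integrable lborel (\<lambda>s. indicator {a..b} s * f (X (max 0 s) \<omega>))"
proof (rule Bochner_Integration.integrable_bound)
  show "integrable lborel (\<lambda>s. indicator {a..b} s * c)"
    by (intro integrable_mult_left integrable_real_indicator) (auto simp: emeasure_lborel_Icc_eq)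
  show "(\<lambda>s. indicator {a..b} s * f (X (max 0 s) \<omega>)) \<in> borel_measurable lborel"
    using path_line_measurable[OF f assms] by simp
  have "\<bar>f (X (max 0 s) \<omega>)\<bar> \<le> c" for s by (rule fb) (rule X_in_S, use assms in auto)
  then show "AE s in lborel. norm (indicator {a..b} s * f (X (max 0 s) \<omega>)) \<le> norm (indicator {a..b} s * c)"
    by (auto simp: indicator_def intro: order_trans[OF _ abs_ge_self])
qed

lemma occ_bound:
  assumes "\<omega> \<in> \<Omega>" "a \<le> b" shows "\<bar>occ f a b \<omega>\<bar> \<le> c * (b - a)"
proof -
  have "\<bar>occ f a b \<omega>\<bar> \<le> (\<integral>s. \<bar>indicator {a..b} s * f (X (max 0 s) \<omega>)\<bar> \<partial>lborel)"
    unfolding occ_def by (rule integral_abs_bound)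
  also have "\<dots> \<le> (\<integral>s. indicator {a..b} s * c \<partial>lborel)"
  proof (rule integral_mono)
    show "integrable lborel (\<lambda>s. \<bar>indicator {a..b} s * f (X (max 0 s) \<omega>)\<bar>)"
      using occ_integrable[OF assms(1)] by simp
    show "integrable lborel (\<lambda>s. indicator {a..b} s * c)"
      by (intro integrable_mult_left integrable_real_indicator) (auto simp: emeasure_lborel_Icc_eq)
    fix s
    have "\<bar>f (X (max 0 s) \<omega>)\<bar> \<le> c" by (rule fb) (rule X_in_S, use assms in auto)
    then show "\<bar>indicator {a..b} s * f (X (max 0 s) \<omega>)\<bar> \<le> indicator {a..b} s * c" by (simp add: indicator_def)
  qed
  also have "\<dots> = c * (b - a)" using assms(2) by simp
  finally show ?thesis .
qed

lemma occ_add: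
  assumes "\<omega> \<in> \<Omega>" "a \<le> b" "b \<le> d" shows "occ f a d \<omega> = occ f a b \<omega> + occ f b d \<omega>"
proof -
  have "occ f a d \<omega> = (\<integral>s. indicator {a..b} s * f (X (max 0 s) \<omega>) + indicator {b..d} s * f (X (max 0 s) \<omega>) \<partial>lborel)"
    unfolding occ_def
  proof (rule integral_cong_AE)
    show "AE s in lborel. indicator {a..d} s * f (X (max 0 s) \<omega>) = indicator {a..b} s * f (X (max 0 s) \<omega>) + indicator {b..d} s * f (X (max 0 s) \<omega>)"
      using AE_lborel_singleton[of b] by eventually_elim (use assms in \<open>auto simp: indicator_def\<close>)
  qed (use path_line_measurable[OF f assms(1)] in auto)
  also have "\<dots> = occ f a b \<omega> + occ f b d \<omega>"
    unfolding occ_def by (rule Bochner_Integration.integral_add) (rule occ_integrable[OF assms(1)])+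
  finally show ?thesis .
qed

lemma occ_shift:
  assumes w: "\<omega> \<in> \<Omega>" and u: "0 \<le> u" and a: "0 \<le> a" shows "occ f a b (\<Theta> u \<omega>) = occ f (a + u) (b + u) \<omega>"
proof -
  have "occ f (a + u) (b + u) \<omega> = (\<integral>s. indicator {a + u..b + u} (u + 1 * s) * f (X (max 0 (u + 1 * s)) \<omega>) \<partial>lborel)"
    unfolding occ_def by (subst lborel_integral_real_affine[where c = 1 and t = u]) auto
  also have "\<dots> = occ f a b (\<Theta> u \<omega>)"
    unfolding occ_def
  proof (rule Bochner_Integration.integral_cong[OF refl])
    fix s
    show "indicator {a + u..b + u} (u + 1 * s) * f (X (max 0 (u + 1 * s)) \<omega>) = indicator {a..b} s * f (X (max 0 s) (\<Theta> u \<omega>))"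
    proof (cases "s \<in> {a..b}")
      case True
      then have "X (max 0 s) (\<Theta> u \<omega>) = X (max 0 (u + 1 * s)) \<omega>"
        using shift[of s u \<omega>] a u w by (simp add: max_absorb2 add.commute)
      then show ?thesis using True by simp
    qed simp
  qed
  finally show ?thesis by simp
qed

lemma occ_measurable: "occ f a b \<in> borel_measurable path_events"
proof -
  have "(\<lambda>p. indicator {a..b} (snd p) * f (X (max 0 (snd p)) (fst p))) \<in> borel_measurable (path_events \<Otimes>\<^sub>M lborel)"
  proof (rule borel_measurable_times)
    show "(\<lambda>p. indicator {a..b} (snd p) :: real) \<in> borel_measurable (path_events \<Otimes>\<^sub>M lborel)"
      by (rule measurable_compose[OF measurable_snd]) simp
    have "(\<lambda>p. (snd p, fst p)) \<in> path_events \<Otimes>\<^sub>M lborel \<rightarrow>\<^sub>M borel \<Otimes>\<^sub>M path_events"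
      by (intro measurable_Pair measurable_fst) (rule measurable_compose[OF measurable_snd], simp)
    from measurable_compose[OF this path_function_measurable[OF f]]
    show "(\<lambda>p. f (X (max 0 (snd p)) (fst p))) \<in> borel_measurable (path_events \<Otimes>\<^sub>M lborel)" by simp
  qed
  then show ?thesis
    unfolding occ_def[abs_def] by (intro lborel.borel_measurable_lebesgue_integral) (simp add: case_prod_beta)
qed

lemma shift_pow: "\<omega> \<in> \<Omega> \<Longrightarrow> (\<Theta> 1 ^^ k) \<omega> \<in> \<Omega>"
  by (induction k) (auto intro: shift_into)

lemma occ_shift_pow:
  assumes "\<omega> \<in> \<Omega>" shows "0 \<le> a \<Longrightarrow> occ f a b ((\<Theta> 1 ^^ k) \<omega>) = occ f (a + real k) (b + real k) \<omega>"
proof (induction k arbitrary: a b)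
  case (Suc k)
  have "occ f a b ((\<Theta> 1 ^^ Suc k) \<omega>) = occ f (a + 1) (b + 1) ((\<Theta> 1 ^^ k) \<omega>)"
    using occ_shift[OF shift_pow[OF assms] _ Suc.prems, of 1 b k] by simp
  then show ?case using Suc.IH[of "a + 1" "b + 1"] Suc.prems by (simp add: add_ac)
qed simp

text \<open>The continuous time integral becomes a Birkhoff sum for the time-one shift, to which
  \<open>maximal_ergodic\<close> applies.\<close>

lemma occ_sum:
  assumes "\<omega> \<in> \<Omega>" shows "(\<Sum>k<n. occ f 0 1 ((\<Theta> 1 ^^ k) \<omega>)) = occ f 0 (real n) \<omega>"
proof (induction n)
  case 0
  have "AE s in lborel. indicator {0..0} s * f (X (max 0 s) \<omega>) = 0"
    using AE_lborel_singleton[of "0::real"] by eventually_elim (auto simp: indicator_def)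
  then have "occ f 0 0 \<omega> = 0" unfolding occ_def by (rule integral_eq_zero_AE)
  then show ?case by simp
next
  case (Suc n)
  then show ?case
    using occ_add[OF assms, of 0 "real n" "real (Suc n)"] occ_shift_pow[OF assms, of 0 1 n] by (simp add: add_ac)
qed

end

text \<open>Invariance at every path and every time, not just up to null sets, so that
  \<open>invariant_event_harmonic\<close> holds at every x.\<close>

definition invariant_event :: "'w set \<Rightarrow> bool" where
  "invariant_event D \<longleftrightarrow> D \<in> sets path_events \<and> (\<forall>t\<ge>0. \<forall>\<omega>\<in>\<Omega>. \<Theta> t \<omega> \<in> D \<longleftrightarrow> \<omega> \<in> D)"

lemma path_eventD:
  assumes "D \<in> sets path_events"
  shows "D \<in> sets \<F>" "D \<subseteq> \<Omega>" "(\<lambda>x. emeasure (P x) D) \<in> borel_measurable SB"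
    "0 \<le> t \<Longrightarrow> {\<omega> \<in> \<Omega>. \<Theta> t \<omega> \<in> D} \<in> sets \<F>"
    "0 \<le> t \<Longrightarrow> x \<in> S \<Longrightarrow> A \<in> sets (\<F>t t) \<Longrightarrow> emeasure (P x) (A \<inter> {\<omega> \<in> \<Omega>. \<Theta> t \<omega> \<in> D})
         = (\<integral>\<^sup>+\<omega>. indicator A \<omega> * emeasure (P (X t \<omega>)) D \<partial>P x)"
  using path_event_markov[OF assms] sets.sets_into_space[OF assms] by auto

lemma invariant_event_vimage:
  "invariant_event D \<Longrightarrow> 0 \<le> t \<Longrightarrow> {\<omega> \<in> \<Omega>. \<Theta> t \<omega> \<in> D} = D"
  unfolding invariant_event_def using path_eventD(2) by auto

text \<open>The Markov property at time t, with the shifted event replaced by D itself. It serves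
  twice: for ergodicity and for the passage to quasi every starting point.\<close>

lemma invariant_event_harmonic:
  assumes D: "invariant_event D" and t: "0 \<le> t" and x: "x \<in> S"
  shows "emeasure (P x) D = (\<integral>\<^sup>+\<omega>. emeasure (P (X t \<omega>)) D \<partial>P x)"
proof -
  have Dp: "D \<in> sets path_events" using D by (simp add: invariant_event_def)
  have O: "\<Omega> \<in> sets (\<F>t t)" using sets.top[of "\<F>t t"] space_filtration[OF t] by simp
  have "emeasure (P x) D = emeasure (P x) (\<Omega> \<inter> {\<omega> \<in> \<Omega>. \<Theta> t \<omega> \<in> D})"
    using invariant_event_vimage[OF D t] path_eventD(2)[OF Dp] by (simp add: Int_absorb1)
  also have "\<dots> = (\<integral>\<^sup>+\<omega>. indicator \<Omega> \<omega> * emeasure (P (X t \<omega>)) D \<partial>P x)"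
    by (rule path_eventD(5)[OF Dp t x O])
  also have "\<dots> = (\<integral>\<^sup>+\<omega>. emeasure (P (X t \<omega>)) D \<partial>P x)"
    by (rule nn_integral_cong) (simp add: space_P[OF x])
  finally show ?thesis .
qed

lemma invariant_event_harmonic_real:
  assumes D: "invariant_event D" and t: "0 \<le> t" and x: "x \<in> S"
  shows "(\<integral>\<omega>. measure (P (X t \<omega>)) D \<partial>P x) = measure (P x) D"
proof -
  interpret prob_space "P x" by (rule prob[OF x])
  have Dp: "D \<in> sets path_events" using D by (simp add: invariant_event_def)
  have m: "(\<lambda>\<omega>. emeasure (P (X t \<omega>)) D) \<in> borel_measurable (P x)"
    by (rule measurable_compose[OF X_measurable_P[OF x t] path_eventD(3)[OF Dp]])
  have "(\<integral>\<omega>. measure (P (X t \<omega>)) D \<partial>P x) = enn2real (\<integral>\<^sup>+\<omega>. ennreal (measure (P (X t \<omega>)) D) \<partial>P x)"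
    using m by (intro integral_eq_nn_integral) (auto simp: measure_def)
  also have "(\<integral>\<^sup>+\<omega>. ennreal (measure (P (X t \<omega>)) D) \<partial>P x) = (\<integral>\<^sup>+\<omega>. emeasure (P (X t \<omega>)) D \<partial>P x)"
  proof (rule nn_integral_cong)
    fix \<omega> assume "\<omega> \<in> space (P x)"
    then have "X t \<omega> \<in> S" using X_in_S[OF t] space_P[OF x] by simp
    then interpret y: prob_space "P (X t \<omega>)" by (rule prob)
    show "ennreal (measure (P (X t \<omega>)) D) = emeasure (P (X t \<omega>)) D" by (simp add: y.emeasure_eq_measure)
  qed
  also have "\<dots> = emeasure (P x) D" by (rule invariant_event_harmonic[OF D t x, symmetric])
  finally show ?thesis by (simp add: measure_def)
qed

lemma measure_P_measurable:
  "D \<in> sets path_events \<Longrightarrow> (\<lambda>x. measure (P x) D) \<in> borel_measurable SB"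
  unfolding measure_def using path_eventD(3) by measurable

text \<open>Restricted to path events, where measurability in x is available.\<close>

definition path_kernel :: "'a \<Rightarrow> 'w measure" where
  "path_kernel x = distr (P x) path_events (\<lambda>\<omega>. \<omega>)"

lemma id_path_events: "x \<in> S \<Longrightarrow> (\<lambda>\<omega>. \<omega>) \<in> P x \<rightarrow>\<^sub>M path_events"
  using path_eventD(1,2) sets_P space_P by (intro measurableI) (auto simp: Int_absorb2)

lemma emeasure_path_kernel:
  "x \<in> S \<Longrightarrow> D \<in> sets path_events \<Longrightarrow> emeasure (path_kernel x) D = emeasure (P x) D"
  unfolding path_kernel_def using path_eventD(2)[of D] space_P
  by (subst emeasure_distr[OF id_path_events]) (auto simp: Int_absorb2)

lemma nn_integral_path_kernel:
  "x \<in> S \<Longrightarrow> g \<in> borel_measurable path_events \<Longrightarrow> (\<integral>\<^sup>+\<omega>. g \<omega> \<partial>path_kernel x) = (\<integral>\<^sup>+\<omega>. g \<omega> \<partial>P x)"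
  unfolding path_kernel_def by (subst nn_integral_distr[OF id_path_events]) auto

end

text \<open>The assumption \<open>harmonic_const\<close> expresses ergodicity of the stationary measure \<open>\<nu>\<close>.\<close>

locale ergodic_diffusion = borel_diffusion S \<F> \<F>t X \<Theta> P + finite_measure \<nu>
  for S :: "'a::euclidean_space set" and \<F> :: "'w measure" and \<F>t X \<Theta> and P :: "'a \<Rightarrow> 'w measure"
    and \<nu> :: "'a measure" +
  assumes sets_nu: "sets \<nu> = sets SB"
    and stationary: "0 \<le> t \<Longrightarrow> \<Gamma> \<in> sets SB \<Longrightarrow> (\<integral>\<^sup>+x. emeasure (P x) {\<omega> \<in> \<Omega>. X t \<omega> \<in> \<Gamma>} \<partial>\<nu>) = emeasure \<nu> \<Gamma>"
    and harmonic_const: "h \<in> borel_measurable SB \<Longrightarrow> (\<And>x. x \<in> S \<Longrightarrow> 0 \<le> h x \<and> h x \<le> 1) \<Longrightarrow>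
      (\<And>t x. 0 \<le> t \<Longrightarrow> x \<in> S \<Longrightarrow> (\<integral>\<omega>. h (X t \<omega>) \<partial>P x) = h x) \<Longrightarrow> \<exists>\<kappa>::real. AE x in \<nu>. h x = \<kappa>"
begin

section \<open>The stationary path measure and its time averages\<close>

lemma space_nu: "space \<nu> = S"
  using sets_eq_imp_space_eq[OF sets_nu] by simp

lemma measurable_nu: "f \<in> \<nu> \<rightarrow>\<^sub>M N \<longleftrightarrow> f \<in> SB \<rightarrow>\<^sub>M N"
  using measurable_cong_sets[OF sets_nu refl] by blast

definition P_nu :: "'w measure" where "P_nu = \<nu> \<bind> path_kernel"

lemma path_kernel_measurable: "path_kernel \<in> \<nu> \<rightarrow>\<^sub>M subprob_algebra path_events"
proof (rule measurable_subprob_algebra)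
  fix x assume "x \<in> space \<nu>"
  then have x: "x \<in> S" by (simp add: space_nu)
  show "subprob_space (path_kernel x)"
    unfolding path_kernel_def by (intro prob_space_imp_subprob_space prob_space.prob_space_distr prob[OF x] id_path_events[OF x])
  show "sets (path_kernel x) = sets path_events" by (simp add: path_kernel_def)
next
  fix D assume D: "D \<in> sets path_events"
  show "(\<lambda>x. emeasure (path_kernel x) D) \<in> borel_measurable \<nu>"
    unfolding measurable_nu
    by (rule measurable_cong[THEN iffD2, OF _ path_eventD(3)[OF D]]) (simp add: emeasure_path_kernel D)
qed

lemma sets_P_nu [measurable_cong, simp]: "sets P_nu = sets path_events"
  unfolding P_nu_def by (rule sets_bind) (use S_nonempty in \<open>auto simp: space_nu path_kernel_def\<close>)

lemma space_P_nu [simp]: "space P_nu = \<Omega>"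
  using sets_eq_imp_space_eq[OF sets_P_nu] by simp

lemma emeasure_P_nu:
  assumes D: "D \<in> sets path_events" shows "emeasure P_nu D = (\<integral>\<^sup>+x. emeasure (P x) D \<partial>\<nu>)"
proof -
  have "emeasure P_nu D = (\<integral>\<^sup>+x. emeasure (path_kernel x) D \<partial>\<nu>)"
    unfolding P_nu_def by (rule emeasure_bind[OF _ path_kernel_measurable D]) (use S_nonempty in \<open>simp add: space_nu\<close>)
  also have "\<dots> = (\<integral>\<^sup>+x. emeasure (P x) D \<partial>\<nu>)"
    by (rule nn_integral_cong) (simp add: space_nu emeasure_path_kernel D)
  finally show ?thesis .
qed

sublocale path: finite_measure P_nu
proof
  have O: "\<Omega> \<in> sets path_events" using sets.top[of path_events] by simp
  have "emeasure P_nu \<Omega> = (\<integral>\<^sup>+x. 1 \<partial>\<nu>)"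
    unfolding emeasure_P_nu[OF O] by (rule nn_integral_cong) (simp add: space_nu emeasure_P_space)
  then show "emeasure P_nu (space P_nu) \<noteq> \<infinity>" by (simp add: emeasure_finite)
qed

lemma nn_integral_P_nu:
  assumes g: "g \<in> borel_measurable path_events"
  shows "(\<integral>\<^sup>+\<omega>. g \<omega> \<partial>P_nu) = (\<integral>\<^sup>+x. (\<integral>\<^sup>+\<omega>. g \<omega> \<partial>P x) \<partial>\<nu>)"
proof -
  have "(\<integral>\<^sup>+\<omega>. g \<omega> \<partial>P_nu) = (\<integral>\<^sup>+x. (\<integral>\<^sup>+\<omega>. g \<omega> \<partial>path_kernel x) \<partial>\<nu>)"
    unfolding P_nu_def by (rule nn_integral_bind[OF g path_kernel_measurable])
  also have "\<dots> = (\<integral>\<^sup>+x. (\<integral>\<^sup>+\<omega>. g \<omega> \<partial>P x) \<partial>\<nu>)"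
    by (rule nn_integral_cong) (simp add: space_nu nn_integral_path_kernel g)
  finally show ?thesis .
qed

lemma distr_X:
  assumes t: "0 \<le> t" shows "distr P_nu SB (X t) = \<nu>"
proof (rule measure_eqI)
  note X = X_path_measurable[OF t]
  have Xm: "X t \<in> P_nu \<rightarrow>\<^sub>M SB" using X measurable_cong_sets[OF sets_P_nu refl] by blast
  fix \<Gamma> assume "\<Gamma> \<in> sets (distr P_nu SB (X t))"
  then have \<Gamma>: "\<Gamma> \<in> sets SB" by simp
  have e: "X t -` \<Gamma> \<inter> \<Omega> = {\<omega> \<in> \<Omega>. X t \<omega> \<in> \<Gamma>}" by auto
  have "{\<omega> \<in> \<Omega>. X t \<omega> \<in> \<Gamma>} \<in> sets path_events" using measurable_sets[OF Xm \<Gamma>] e by simp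
  then show "emeasure (distr P_nu SB (X t)) \<Gamma> = emeasure \<nu> \<Gamma>"
    using stationary[OF t \<Gamma>] by (simp add: emeasure_distr[OF Xm \<Gamma>] e emeasure_P_nu)
qed (simp add: sets_nu)

lemma stationary_nn_integral:
  assumes t: "0 \<le> t" and \<phi>: "\<phi> \<in> borel_measurable SB"
  shows "(\<integral>\<^sup>+x. (\<integral>\<^sup>+\<omega>. \<phi> (X t \<omega>) \<partial>P x) \<partial>\<nu>) = (\<integral>\<^sup>+x. \<phi> x \<partial>\<nu>)"
proof -
  have Xm: "X t \<in> P_nu \<rightarrow>\<^sub>M SB" using X_path_measurable[OF t] measurable_cong_sets[OF sets_P_nu refl] by blast
  have "(\<integral>\<^sup>+x. \<phi> x \<partial>\<nu>) = (\<integral>\<^sup>+x. \<phi> x \<partial>distr P_nu SB (X t))" by (simp add: distr_X[OF t])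
  also have "\<dots> = (\<integral>\<^sup>+\<omega>. \<phi> (X t \<omega>) \<partial>P_nu)" by (rule nn_integral_distr[OF Xm]) (simp add: \<phi>)
  also have "\<dots> = (\<integral>\<^sup>+x. (\<integral>\<^sup>+\<omega>. \<phi> (X t \<omega>) \<partial>P x) \<partial>\<nu>)"
    by (rule nn_integral_P_nu) (rule measurable_compose[OF X_path_measurable[OF t] \<phi>])
  finally show ?thesis by simp
qed

text \<open>The Markov property expresses the probability of a shifted event by the state at time t,
  whose law is again \<nu>.\<close>

lemma distr_shift:
  assumes t: "0 \<le> t" shows "distr P_nu P_nu (\<Theta> t) = P_nu"
proof (rule measure_eqI)
  have Tm: "\<Theta> t \<in> P_nu \<rightarrow>\<^sub>M P_nu"
    using shift_measurable[OF t] measurable_cong_sets[OF sets_P_nu sets_P_nu] by blast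
  fix D assume "D \<in> sets (distr P_nu P_nu (\<Theta> t))"
  then have D: "D \<in> sets path_events" by simp
  have e: "\<Theta> t -` D \<inter> \<Omega> = {\<omega> \<in> \<Omega>. \<Theta> t \<omega> \<in> D}" by auto
  have D': "{\<omega> \<in> \<Omega>. \<Theta> t \<omega> \<in> D} \<in> sets path_events" using measurable_sets[OF Tm, of D] D e by simp
  have O: "\<Omega> \<in> sets (\<F>t t)" using sets.top[of "\<F>t t"] space_filtration[OF t] by simp
  have "emeasure (distr P_nu P_nu (\<Theta> t)) D = (\<integral>\<^sup>+x. emeasure (P x) {\<omega> \<in> \<Omega>. \<Theta> t \<omega> \<in> D} \<partial>\<nu>)"
    using D by (subst emeasure_distr[OF Tm]) (auto simp: e emeasure_P_nu[OF D'])
  also have "\<dots> = (\<integral>\<^sup>+x. (\<integral>\<^sup>+\<omega>. emeasure (P (X t \<omega>)) D \<partial>P x) \<partial>\<nu>)"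
  proof (rule nn_integral_cong)
    fix x assume "x \<in> space \<nu>"
    then have x: "x \<in> S" by (simp add: space_nu)
    have "emeasure (P x) {\<omega> \<in> \<Omega>. \<Theta> t \<omega> \<in> D} = emeasure (P x) (\<Omega> \<inter> {\<omega> \<in> \<Omega>. \<Theta> t \<omega> \<in> D})" by (rule arg_cong[where f = "emeasure (P x)"]) auto
    also have "\<dots> = (\<integral>\<^sup>+\<omega>. indicator \<Omega> \<omega> * emeasure (P (X t \<omega>)) D \<partial>P x)" by (rule path_eventD(5)[OF D t x O])
    also have "\<dots> = (\<integral>\<^sup>+\<omega>. emeasure (P (X t \<omega>)) D \<partial>P x)" by (rule nn_integral_cong) (simp add: space_P[OF x])
    finally show "emeasure (P x) {\<omega> \<in> \<Omega>. \<Theta> t \<omega> \<in> D} = (\<integral>\<^sup>+\<omega>. emeasure (P (X t \<omega>)) D \<partial>P x)" .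
  qed
  also have "\<dots> = (\<integral>\<^sup>+x. emeasure (P x) D \<partial>\<nu>)" by (rule stationary_nn_integral[OF t path_eventD(3)[OF D]])
  finally show "emeasure (distr P_nu P_nu (\<Theta> t)) D = emeasure P_nu D" by (simp add: emeasure_P_nu[OF D])
qed simp

text \<open>By invariance D may be read as an event of the path after time s, so the Markov property
  turns its probability at X s into a density; stationarity removes s.\<close>

lemma distr_X_invariant:
  assumes D: "invariant_event D" and s: "0 \<le> s"
  shows "distr (density P_nu (indicator D)) SB (X s) = density \<nu> (\<lambda>x. emeasure (P x) D)"
proof (rule measure_eqI)
  have Dp: "D \<in> sets path_events" using D by (simp add: invariant_event_def)
  have hm: "(\<lambda>x. emeasure (P x) D) \<in> borel_measurable \<nu>" unfolding measurable_nu by (rule path_eventD(3)[OF Dp])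
  have Xm: "X s \<in> density P_nu (indicator D) \<rightarrow>\<^sub>M SB"
    using X_path_measurable[OF s] measurable_cong_sets[OF sets_P_nu refl] by (simp cong: measurable_cong_sets)
  fix \<Gamma> assume "\<Gamma> \<in> sets (distr (density P_nu (indicator D)) SB (X s))"
  then have \<Gamma>: "\<Gamma> \<in> sets SB" by simp
  let ?E = "{\<omega> \<in> \<Omega>. X s \<omega> \<in> \<Gamma>}"
  have E: "?E \<in> sets path_events" using measurable_sets[OF X_path_measurable[OF s] \<Gamma>] by (simp add: vimage_def Int_def conj_commute)
  have "emeasure (distr (density P_nu (indicator D)) SB (X s)) \<Gamma> = emeasure (density P_nu (indicator D)) ?E"
    by (subst emeasure_distr[OF Xm \<Gamma>]) (simp add: vimage_def Int_def conj_commute)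
  also have "\<dots> = emeasure P_nu (?E \<inter> D)"
  proof -
    have "emeasure (density P_nu (indicator D)) ?E = (\<integral>\<^sup>+\<omega>. indicator D \<omega> * indicator ?E \<omega> \<partial>P_nu)"
      by (rule emeasure_density) (use Dp E in auto)
    also have "\<dots> = (\<integral>\<^sup>+\<omega>. indicator (?E \<inter> D) \<omega> \<partial>P_nu)" by (intro nn_integral_cong) (auto simp: indicator_def)
    also have "\<dots> = emeasure P_nu (?E \<inter> D)" by (rule nn_integral_indicator) (use Dp E in auto)
    finally show ?thesis .
  qed
  also have "\<dots> = (\<integral>\<^sup>+x. emeasure (P x) (?E \<inter> D) \<partial>\<nu>)" by (rule emeasure_P_nu) (use Dp E in auto)
  also have "\<dots> = (\<integral>\<^sup>+x. (\<integral>\<^sup>+\<omega>. indicator \<Gamma> (X s \<omega>) * emeasure (P (X s \<omega>)) D \<partial>P x) \<partial>\<nu>)"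
  proof (rule nn_integral_cong)
    fix x assume "x \<in> space \<nu>"
    then have x: "x \<in> S" by (simp add: space_nu)
    have "emeasure (P x) (?E \<inter> D) = emeasure (P x) (?E \<inter> {\<omega> \<in> \<Omega>. \<Theta> s \<omega> \<in> D})" by (simp add: invariant_event_vimage[OF D s])
    also have "\<dots> = (\<integral>\<^sup>+\<omega>. indicator ?E \<omega> * emeasure (P (X s \<omega>)) D \<partial>P x)"
      by (rule path_eventD(5)[OF Dp s x X_event_filtration[OF s \<Gamma>]])
    also have "\<dots> = (\<integral>\<^sup>+\<omega>. indicator \<Gamma> (X s \<omega>) * emeasure (P (X s \<omega>)) D \<partial>P x)"
      by (rule nn_integral_cong) (simp add: space_P[OF x] indicator_def)
    finally show "emeasure (P x) (?E \<inter> D) = (\<integral>\<^sup>+\<omega>. indicator \<Gamma> (X s \<omega>) * emeasure (P (X s \<omega>)) D \<partial>P x)" .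
  qed
  also have "\<dots> = (\<integral>\<^sup>+x. indicator \<Gamma> x * emeasure (P x) D \<partial>\<nu>)"
    by (rule stationary_nn_integral[OF s, of "\<lambda>x. indicator \<Gamma> x * emeasure (P x) D"]) (use \<Gamma> path_eventD(3)[OF Dp] in measurable)
  also have "\<dots> = emeasure (density \<nu> (\<lambda>x. emeasure (P x) D)) \<Gamma>"
    using \<Gamma> by (subst emeasure_density[OF hm]) (auto simp: sets_nu mult.commute)
  finally show "emeasure (distr (density P_nu (indicator D)) SB (X s)) \<Gamma> = emeasure (density \<nu> (\<lambda>x. emeasure (P x) D)) \<Gamma>" .
qed (simp add: sets_nu)

text \<open>The density in \<open>distr_X_invariant\<close> is a harmonic function, hence constant
  almost everywhere, so f keeps mean zero on every invariant event.\<close>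

lemma integral_invariant:
  assumes D: "invariant_event D" and s: "0 \<le> s" and f: "f \<in> borel_measurable SB" and f0: "(\<integral>x. f x \<partial>\<nu>) = (0::real)"
  shows "(\<integral>\<omega>. indicator D \<omega> * f (X s \<omega>) \<partial>P_nu) = 0"
proof -
  have Dp: "D \<in> sets path_events" using D by (simp add: invariant_event_def)
  have hm: "(\<lambda>x. measure (P x) D) \<in> borel_measurable SB" by (rule measure_P_measurable[OF Dp])
  have h1: "0 \<le> measure (P x) D \<and> measure (P x) D \<le> 1" if "x \<in> S" for x
    using prob_space.prob_le_1[OF prob[OF that]] by simp
  obtain \<kappa> where \<kappa>: "AE x in \<nu>. measure (P x) D = \<kappa>"
    using harmonic_const[OF hm h1 invariant_event_harmonic_real[OF D]] by blast
  have "(\<integral>\<omega>. indicator D \<omega> * f (X s \<omega>) \<partial>P_nu) = (\<integral>\<omega>. f (X s \<omega>) \<partial>density P_nu (\<lambda>\<omega>. ennreal (indicator D \<omega>)))"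
    using Dp measurable_compose[OF X_path_measurable[OF s] f]
    by (subst integral_density) (auto cong: measurable_cong_sets)
  also have "\<dots> = (\<integral>\<omega>. f (X s \<omega>) \<partial>density P_nu (indicator D))" by (simp add: ennreal_indicator)
  also have "\<dots> = (\<integral>x. f x \<partial>distr (density P_nu (indicator D)) SB (X s))"
    using X_path_measurable[OF s] f by (subst integral_distr) (auto cong: measurable_cong_sets)
  also have "\<dots> = (\<integral>x. f x \<partial>density \<nu> (\<lambda>x. emeasure (P x) D))" by (simp add: distr_X_invariant[OF D s])
  also have "\<dots> = (\<integral>x. f x \<partial>density \<nu> (\<lambda>x. ennreal (measure (P x) D)))"
  proof -
    have "density \<nu> (\<lambda>x. emeasure (P x) D) = density \<nu> (\<lambda>x. ennreal (measure (P x) D))"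
    proof (rule density_cong)
      show "AE x in \<nu>. emeasure (P x) D = ennreal (measure (P x) D)"
      proof (rule AE_I2)
        fix x assume "x \<in> space \<nu>"
        then interpret prob_space "P x" using prob by (simp add: space_nu)
        show "emeasure (P x) D = ennreal (measure (P x) D)" by (rule emeasure_eq_measure)
      qed
    qed (use path_eventD(3)[OF Dp] hm in \<open>auto simp: measurable_nu\<close>)
    then show ?thesis by simp
  qed
  also have "\<dots> = (\<integral>x. measure (P x) D * f x \<partial>\<nu>)"
    using hm f by (subst integral_density) (auto simp: measurable_nu)
  also have "\<dots> = (\<integral>x. \<kappa> * f x \<partial>\<nu>)"
    using \<kappa> hm f by (intro integral_cong_AE) (auto simp: measurable_nu elim!: AE_mp)
  also have "\<dots> = 0" by (simp add: f0)
  finally show ?thesis .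
qed

text \<open>The limsup of \<open>occ f 0 N / N\<close> exceeds \<open>\<epsilon>\<close>; the margin \<open>1 / Suc j\<close> makes the event insensitive to
  bounded perturbations of \<open>occ\<close>, hence shift invariant.\<close>

definition exceed :: "('a \<Rightarrow> real) \<Rightarrow> real \<Rightarrow> 'w set" where
  "exceed f \<epsilon> = {\<omega> \<in> \<Omega>. \<exists>j::nat. \<forall>n::nat. \<exists>N\<ge>n. (\<epsilon> + 1 / real (Suc j)) * real N < occ f 0 (real N) \<omega>}"

text \<open>Passing from j to j + 1 frees a gap \<delta> * N, which absorbs the bounded perturbation
  once N \<ge> K / \<delta>.\<close>

lemma exceed_perturb:
  fixes a b :: "nat \<Rightarrow> real"
  assumes "\<exists>j::nat. \<forall>n::nat. \<exists>N\<ge>n. (\<epsilon> + 1 / real (Suc j)) * real N < a N" and K: "\<And>N. \<bar>a N - b N\<bar> \<le> K"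
  shows "\<exists>j::nat. \<forall>n::nat. \<exists>N\<ge>n. (\<epsilon> + 1 / real (Suc j)) * real N < b N"
proof -
  obtain j :: nat where j: "\<And>n. \<exists>N\<ge>n. (\<epsilon> + 1 / real (Suc j)) * real N < a N" using assms(1) by blast
  define \<delta> where "\<delta> = 1 / real (Suc j) - 1 / real (Suc (Suc j))"
  have "1 / real (Suc (Suc j)) < 1 / real (Suc j)" by (rule divide_strict_left_mono) auto
  then have \<delta>: "0 < \<delta>" by (simp add: \<delta>_def)
  obtain n0 where n0: "K / \<delta> \<le> real n0" using real_arch_simple by blast
  have "\<exists>N\<ge>n. (\<epsilon> + 1 / real (Suc (Suc j))) * real N < b N" for n
  proof -
    obtain N where N: "max n n0 \<le> N" "(\<epsilon> + 1 / real (Suc j)) * real N < a N" using j by blast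
    have "K / \<delta> \<le> real N" using n0 N(1) by linarith
    then have "K \<le> \<delta> * real N" using \<delta> by (simp add: field_simps)
    moreover have "(\<epsilon> + 1 / real (Suc j)) * real N = (\<epsilon> + 1 / real (Suc (Suc j))) * real N + \<delta> * real N"
      by (simp add: \<delta>_def algebra_simps)
    ultimately have "(\<epsilon> + 1 / real (Suc (Suc j))) * real N < b N" using N(2) K[of N] by linarith
    then show ?thesis using N(1) by auto
  qed
  then show ?thesis by blast
qed

context
  fixes f :: "'a \<Rightarrow> real" and c :: real
  assumes f: "f \<in> borel_measurable SB" and fb: "\<And>x. x \<in> S \<Longrightarrow> \<bar>f x\<bar> \<le> c"
begin

lemma c_nonneg: "0 \<le> c"
  using S_nonempty fb by (metis abs_ge_zero all_not_in_conv order_trans)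

text \<open>Only the two end pieces of length t differ.\<close>

lemma occ_shift_diff:
  assumes w: "\<omega> \<in> \<Omega>" and t: "0 \<le> t" and N: "0 \<le> N"
  shows "\<bar>occ f 0 N (\<Theta> t \<omega>) - occ f 0 N \<omega>\<bar> \<le> 2 * c * t"
proof -
  have "occ f 0 t \<omega> + occ f t (N + t) \<omega> = occ f 0 N \<omega> + occ f N (N + t) \<omega>"
    using occ_add[OF f fb w, of 0 t "N + t"] occ_add[OF f fb w, of 0 N "N + t"] t N by simp
  moreover have "\<bar>occ f 0 t \<omega>\<bar> \<le> c * t" "\<bar>occ f N (N + t) \<omega>\<bar> \<le> c * t"
    using occ_bound[OF f fb w, of 0 t] occ_bound[OF f fb w, of N "N + t"] t by auto
  moreover have "occ f 0 N (\<Theta> t \<omega>) = occ f t (N + t) \<omega>"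
    using occ_shift[OF f fb w t, of 0 N] by simp
  ultimately show ?thesis by linarith
qed

text \<open>A shift changes \<open>occ\<close> by at most 2 * c * t, a bound independent of N, so
  \<open>exceed_perturb\<close> applies in both directions.\<close>

lemma exceed_invariant: "invariant_event (exceed f \<epsilon>)"
  unfolding invariant_event_def
proof (intro conjI allI impI ballI)
  note [measurable] = occ_measurable[OF f fb]
  have "exceed f \<epsilon> = {\<omega> \<in> space path_events. \<exists>j::nat. \<forall>n::nat. \<exists>N\<in>{n..}. (\<epsilon> + 1 / real (Suc j)) * real N < occ f 0 (real N) \<omega>}"
    unfolding exceed_def by (simp add: Bex_def)
  also have "\<dots> \<in> sets path_events" by measurable
  finally show "exceed f \<epsilon> \<in> sets path_events" .
  fix t :: real and \<omega> assume t: "0 \<le> t" and w: "\<omega> \<in> \<Omega>"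
  have K: "\<bar>occ f 0 (real N) (\<Theta> t \<omega>) - occ f 0 (real N) \<omega>\<bar> \<le> 2 * c * t" for N
    by (rule occ_shift_diff[OF w t]) simp
  have K': "\<bar>occ f 0 (real N) \<omega> - occ f 0 (real N) (\<Theta> t \<omega>)\<bar> \<le> 2 * c * t" for N
    using K[of N] by (simp add: abs_minus_commute)
  have "\<Theta> t \<omega> \<in> \<Omega>" by (rule shift_into[OF t w])
  then show "\<Theta> t \<omega> \<in> exceed f \<epsilon> \<longleftrightarrow> \<omega> \<in> exceed f \<epsilon>"
    using exceed_perturb[where a = "\<lambda>N. occ f 0 (real N) (\<Theta> t \<omega>)" and b = "\<lambda>N. occ f 0 (real N) \<omega>", OF _ K, of \<epsilon>]
      exceed_perturb[where b = "\<lambda>N. occ f 0 (real N) (\<Theta> t \<omega>)" and a = "\<lambda>N. occ f 0 (real N) \<omega>", OF _ K', of \<epsilon>] w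
    unfolding exceed_def by blast
qed

text \<open>Fubini in the time variable, with \<open>integral_invariant\<close> at each time
  s.\<close>

lemma integral_occ_invariant:
  assumes D: "invariant_event D" and f0: "(\<integral>x. f x \<partial>\<nu>) = 0"
  shows "(\<integral>\<omega>. indicator D \<omega> * occ f 0 1 \<omega> \<partial>P_nu) = 0"
proof -
  let ?L = "restrict_space lborel {0..1::real}"
  have Dp: "D \<in> sets path_events" using D by (simp add: invariant_event_def)
  have L: "finite_measure ?L"
    by (rule finite_measureI) (simp add: emeasure_restrict_space space_restrict_space)
  interpret L: finite_measure ?L by (rule L)
  interpret PL: pair_sigma_finite P_nu ?L
    by (intro pair_sigma_finite.intro path.sigma_finite_measure_axioms L.sigma_finite_measure_axioms)
  interpret PF: finite_measure "P_nu \<Otimes>\<^sub>M ?L"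
    by (intro finite_measure_pair_measure path.finite_measure_axioms L)
  let ?F = "\<lambda>\<omega> s. indicator D \<omega> * f (X (max 0 s) \<omega>)"
  have m: "case_prod ?F \<in> borel_measurable (P_nu \<Otimes>\<^sub>M ?L)"
    unfolding case_prod_beta
  proof (rule borel_measurable_times)
    show "(\<lambda>p. indicator D (fst p) :: real) \<in> borel_measurable (P_nu \<Otimes>\<^sub>M ?L)"
      by (rule measurable_compose[OF measurable_fst]) (use Dp in simp)
    have 1: "(\<lambda>p. snd p) \<in> P_nu \<Otimes>\<^sub>M ?L \<rightarrow>\<^sub>M borel"
      by (rule measurable_compose[OF measurable_snd]) (auto intro: measurable_restrict_space1)
    have "(\<lambda>\<omega>. \<omega>) \<in> P_nu \<rightarrow>\<^sub>M path_events"
      by (rule measurable_ident_sets) simp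
    from measurable_Pair[OF 1 measurable_compose[OF measurable_fst this]]
    have "(\<lambda>p. (snd p, fst p)) \<in> P_nu \<Otimes>\<^sub>M ?L \<rightarrow>\<^sub>M borel \<Otimes>\<^sub>M path_events" .
    from measurable_compose[OF this path_function_measurable[OF f]]
    show "(\<lambda>p. f (X (max 0 (snd p)) (fst p))) \<in> borel_measurable (P_nu \<Otimes>\<^sub>M ?L)" by simp
  qed
  have int: "integrable (P_nu \<Otimes>\<^sub>M ?L) (case_prod ?F)"
  proof (rule PF.integrable_const_bound[OF _ m, of c])
    show "AE p in P_nu \<Otimes>\<^sub>M ?L. norm (case_prod ?F p) \<le> c"
    proof (rule AE_I2)
      fix p assume "p \<in> space (P_nu \<Otimes>\<^sub>M ?L)"
      then have "fst p \<in> \<Omega>" by (auto simp: space_pair_measure)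
      then have "\<bar>f (X (max 0 (snd p)) (fst p))\<bar> \<le> c" by (intro fb X_in_S) auto
      then show "norm (case_prod ?F p) \<le> c" using c_nonneg by (simp add: case_prod_beta indicator_def)
    qed
  qed
  have "(\<integral>\<omega>. indicator D \<omega> * occ f 0 1 \<omega> \<partial>P_nu) = (\<integral>\<omega>. (\<integral>s. ?F \<omega> s \<partial>?L) \<partial>P_nu)"
  proof (rule Bochner_Integration.integral_cong[OF refl])
    fix \<omega>
    have "occ f 0 1 \<omega> = (\<integral>s. f (X (max 0 s) \<omega>) \<partial>?L)"
      by (subst integral_restrict_space) (auto simp: occ_def)
    then show "indicator D \<omega> * occ f 0 1 \<omega> = (\<integral>s. ?F \<omega> s \<partial>?L)" by simp
  qed
  also have "\<dots> = (\<integral>s. (\<integral>\<omega>. ?F \<omega> s \<partial>P_nu) \<partial>?L)" by (rule PL.Fubini_integral[OF int, symmetric])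
  also have "\<dots> = (\<integral>s. 0 \<partial>?L)"
    by (rule Bochner_Integration.integral_cong[OF refl]) (rule integral_invariant[OF D _ f f0], simp)
  finally show ?thesis by simp
qed

text \<open>On this event some partial sum of \<open>occ f 0 1 \<omega> - \<epsilon>\<close> is
  positive, so the maximal inequality makes the integral of that function over the event
  nonnegative. By \<open>integral_occ_invariant\<close> the same integral is -\<epsilon> times the
  probability.\<close>

lemma exceed_null:
  assumes f0: "(\<integral>x. f x \<partial>\<nu>) = 0" and \<epsilon>: "0 < \<epsilon>"
  shows "emeasure P_nu (exceed f \<epsilon>) = 0"
proof -
  let ?D = "exceed f \<epsilon>"
  note D = exceed_invariant[of \<epsilon>]
  have Dp: "?D \<in> sets path_events" using D by (simp add: invariant_event_def)
  have om: "occ f 0 1 \<in> borel_measurable P_nu" using occ_measurable[OF f fb] measurable_cong_sets[OF sets_P_nu refl] by blast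
  have ob: "\<bar>occ f 0 1 \<omega>\<bar> \<le> c" if "\<omega> \<in> \<Omega>" for \<omega> using occ_bound[OF f fb that, of 0 1] by simp
  have "0 \<le> (\<integral>\<omega>. indicator ?D \<omega> * (occ f 0 1 \<omega> - \<epsilon>) \<partial>P_nu)"
  proof (rule path.maximal_ergodic[of "\<Theta> 1" "\<lambda>\<omega>. occ f 0 1 \<omega> - \<epsilon>" "c + \<epsilon>" ?D])
    show "\<Theta> 1 \<in> P_nu \<rightarrow>\<^sub>M P_nu"
      using shift_measurable[of 1] measurable_cong_sets[OF sets_P_nu sets_P_nu] by simp
    show "distr P_nu P_nu (\<Theta> 1) = P_nu" by (rule distr_shift) simp
    show "(\<lambda>\<omega>. occ f 0 1 \<omega> - \<epsilon>) \<in> borel_measurable P_nu" using om by simp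
    show "\<bar>occ f 0 1 \<omega> - \<epsilon>\<bar> \<le> c + \<epsilon>" if "\<omega> \<in> space P_nu" for \<omega> using ob[of \<omega>] that \<epsilon> by auto
    show "?D \<in> sets P_nu" using Dp by simp
    show "\<Theta> 1 \<omega> \<in> ?D \<longleftrightarrow> \<omega> \<in> ?D" if "\<omega> \<in> space P_nu" for \<omega>
      using D that by (simp add: invariant_event_def)
    fix \<omega> assume w: "\<omega> \<in> ?D"
    then have wO: "\<omega> \<in> \<Omega>" by (simp add: exceed_def)
    obtain j N :: nat where N: "(\<epsilon> + 1 / real (Suc j)) * real N < occ f 0 (real N) \<omega>" using w unfolding exceed_def by blast
    have "(\<Sum>k<N. occ f 0 1 ((\<Theta> 1 ^^ k) \<omega>) - \<epsilon>) = occ f 0 (real N) \<omega> - real N * \<epsilon>"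
      using occ_sum[OF f fb wO, of N] by (simp add: sum_subtractf)
    moreover have "0 \<le> 1 / real (Suc j) * real N" by simp
    moreover have "\<epsilon> * real N + 1 / real (Suc j) * real N < occ f 0 (real N) \<omega>" using N by (simp only: distrib_right)
    ultimately have "0 < (\<Sum>k<N. occ f 0 1 ((\<Theta> 1 ^^ k) \<omega>) - \<epsilon>)" by (simp only: mult.commute[of "real N" \<epsilon>])
    then show "\<exists>n. 0 < (\<Sum>k<n. occ f 0 1 ((\<Theta> 1 ^^ k) \<omega>) - \<epsilon>)" by blast
  qed
  also have "(\<integral>\<omega>. indicator ?D \<omega> * (occ f 0 1 \<omega> - \<epsilon>) \<partial>P_nu) = (\<integral>\<omega>. indicator ?D \<omega> * occ f 0 1 \<omega> - \<epsilon> * indicator ?D \<omega> \<partial>P_nu)"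
    by (intro Bochner_Integration.integral_cong refl) (simp add: algebra_simps)
  also have "\<dots> = (\<integral>\<omega>. indicator ?D \<omega> * occ f 0 1 \<omega> \<partial>P_nu) - (\<integral>\<omega>. \<epsilon> * indicator ?D \<omega> \<partial>P_nu)"
  proof (rule Bochner_Integration.integral_diff)
    show "integrable P_nu (\<lambda>\<omega>. indicator ?D \<omega> * occ f 0 1 \<omega>)"
      by (rule path.integrable_const_bound[where B = c])
        (use om Dp ob c_nonneg in \<open>auto simp: indicator_def intro!: AE_I2\<close>)
    show "integrable P_nu (\<lambda>\<omega>. \<epsilon> * indicator ?D \<omega>)"
      using Dp by (intro integrable_mult_right integrable_real_indicator) (auto simp: path.emeasure_eq_measure)
  qed
  also have "(\<integral>\<omega>. indicator ?D \<omega> * occ f 0 1 \<omega> \<partial>P_nu) = 0" by (rule integral_occ_invariant[OF D f0])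
  finally have "\<epsilon> * measure P_nu ?D \<le> 0" using Dp path_eventD(2)[OF Dp] by (simp add: Int_absorb2)
  then have "measure P_nu ?D \<le> 0" using \<epsilon> by (simp add: mult_le_0_iff)
  then show ?thesis by (simp add: path.emeasure_eq_measure measure_le_0_iff)
qed

end

lemma occ_uminus: "occ (\<lambda>x. - f x) a b \<omega> = - occ f a b \<omega>"
  by (simp add: occ_def)

text \<open>Lower deviations are upper deviations of -f, and countably many levels 1 / (m + 1)
  suffice. Between integer times \<open>occ\<close> moves by at most c, which the division by t
  removes.\<close>

lemma time_average_tendsto_0:
  assumes f: "f \<in> borel_measurable SB" and fb: "\<And>x. x \<in> S \<Longrightarrow> \<bar>f x\<bar> \<le> c" and f0: "(\<integral>x. f x \<partial>\<nu>) = (0::real)"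
  shows "\<exists>N. invariant_event N \<and> (AE x in \<nu>. measure (P x) N = 0) \<and>
    (\<forall>\<omega>\<in>\<Omega> - N. ((\<lambda>t. occ f 0 t \<omega> / t) \<longlongrightarrow> 0) at_top)"
proof -
  let ?g = "\<lambda>x. - f x"
  have g: "?g \<in> borel_measurable SB" using f by simp
  have gb: "\<bar>?g x\<bar> \<le> c" if "x \<in> S" for x using fb[OF that] by simp
  have g0: "(\<integral>x. ?g x \<partial>\<nu>) = 0" using f0 by simp
  define N where "N = (\<Union>m::nat. exceed f (1 / real (Suc m)) \<union> exceed ?g (1 / real (Suc m)))"
  have inv: "invariant_event N"
    using exceed_invariant[OF f fb] exceed_invariant[OF g gb]
    unfolding N_def invariant_event_def by (intro conjI allI impI ballI sets.countable_UN) auto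
  then have Np: "N \<in> sets path_events" by (simp add: invariant_event_def)
  have "emeasure P_nu N = 0"
  proof -
    have "exceed f (1 / real (Suc m)) \<union> exceed ?g (1 / real (Suc m)) \<in> null_sets P_nu" for m
      using exceed_null[OF f fb f0, of "1 / real (Suc m)"] exceed_null[OF g gb g0, of "1 / real (Suc m)"]
        exceed_invariant[OF f fb] exceed_invariant[OF g gb]
      by (intro null_sets.Un) (auto simp: null_sets_def invariant_event_def)
    then have "N \<in> null_sets P_nu" unfolding N_def by (intro null_sets_UN)
    then show ?thesis by (rule null_setsD1)
  qed
  then have "(\<integral>\<^sup>+x. emeasure (P x) N \<partial>\<nu>) = 0" by (simp add: emeasure_P_nu[OF Np])
  then have "AE x in \<nu>. emeasure (P x) N = 0"
    using path_eventD(3)[OF Np] by (subst (asm) nn_integral_0_iff_AE) (auto simp: measurable_nu)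
  then have ae: "AE x in \<nu>. measure (P x) N = 0" by eventually_elim (simp add: measure_def)
  have "((\<lambda>t. occ f 0 t \<omega> / t) \<longlongrightarrow> 0) at_top" if w: "\<omega> \<in> \<Omega> - N" for \<omega>
  proof (rule tendstoI)
    fix e :: real assume e: "0 < e"
    have wO: "\<omega> \<in> \<Omega>" using w by simp
    have c0: "0 \<le> c" by (rule c_nonneg[OF f fb])
    \<comment> \<open>Level and margin will both be 1 / (m + 1); their sum 2 / (m + 1) must stay
      below e / 2.\<close>
    obtain m :: nat where m: "4 / e < real m" using reals_Archimedean2 by blast
    have m2: "2 / real (Suc m) < e / 2"
    proof -
      have "4 / e < real (Suc m)" using m by simp
      then show ?thesis using e by (simp add: field_simps del: of_nat_Suc)
    qed
    have "\<exists>n. \<forall>N\<ge>n. u N \<le> 2 / real (Suc m) * real N"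
      if "\<not> (\<exists>j::nat. \<forall>n::nat. \<exists>N\<ge>n. (1 / real (Suc m) + 1 / real (Suc j)) * real N < u N)" for u :: "nat \<Rightarrow> real"
    proof -
      have "\<exists>n. \<forall>N\<ge>n. u N \<le> (1 / real (Suc m) + 1 / real (Suc m)) * real N" using that by (meson not_le_imp_less)
      then show ?thesis by (simp del: of_nat_Suc)
    qed
    note bound = this
    have "\<omega> \<notin> exceed f (1 / real (Suc m))" "\<omega> \<notin> exceed ?g (1 / real (Suc m))" using w by (auto simp: N_def)
    then have "\<exists>n. \<forall>N\<ge>n. occ f 0 (real N) \<omega> \<le> 2 / real (Suc m) * real N" "\<exists>n. \<forall>N\<ge>n. occ ?g 0 (real N) \<omega> \<le> 2 / real (Suc m) * real N"
      using wO unfolding exceed_def by (intro bound; blast)+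
    then obtain n1 n2 where n: "\<And>N. N \<ge> n1 \<Longrightarrow> occ f 0 (real N) \<omega> \<le> 2 / real (Suc m) * real N"
      "\<And>N. N \<ge> n2 \<Longrightarrow> - occ f 0 (real N) \<omega> \<le> 2 / real (Suc m) * real N"
      unfolding occ_uminus by blast
    \<comment> \<open>Large enough for both integer bounds, for c < e * t / 2, and for t >
      0.\<close>
    define T where "T = real (max n1 n2) + 2 * c / e + 1"
    have "dist (occ f 0 t \<omega> / t) 0 < e" if t: "t > T" for t
    proof -
      have T1: "1 \<le> T" using c0 e by (simp add: T_def)
      then have t0: "0 < t" using t by simp
      define N where "N = nat \<lfloor>t\<rfloor>"
      have N: "real N \<le> t" "t \<le> real N + 1" using t0 by (auto simp: N_def)
      have "real (max n1 n2) \<le> t" using t c0 e by (simp add: T_def) (smt (verit) divide_nonneg_pos mult_nonneg_nonneg)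
      then have "max n1 n2 \<le> N" unfolding N_def by (rule le_nat_floor)
      then have "\<bar>occ f 0 (real N) \<omega>\<bar> \<le> 2 / real (Suc m) * real N" using n[of N] by (simp add: abs_le_iff)
      also have "\<dots> \<le> 2 / real (Suc m) * t" by (rule mult_left_mono[OF N(1)]) simp
      finally have 1: "\<bar>occ f 0 (real N) \<omega>\<bar> \<le> 2 / real (Suc m) * t" .
      have "\<bar>occ f (real N) t \<omega>\<bar> \<le> c * (t - real N)" by (rule occ_bound[OF f fb wO N(1)])
      also have "\<dots> \<le> c * 1" by (rule mult_left_mono) (use N c0 in auto)
      finally have 2: "\<bar>occ f (real N) t \<omega>\<bar> \<le> c" by simp
      have "occ f 0 t \<omega> = occ f 0 (real N) \<omega> + occ f (real N) t \<omega>" by (rule occ_add[OF f fb wO]) (use N in auto)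
      with 1 2 have "\<bar>occ f 0 t \<omega>\<bar> \<le> 2 / real (Suc m) * t + c" by linarith
      also have "\<dots> < e / 2 * t + e / 2 * t"
      proof (rule add_strict_mono)
        show "2 / real (Suc m) * t < e / 2 * t" using m2 t0 by (rule mult_strict_right_mono)
        have "2 * c / e < t" using t by (simp add: T_def)
        then show "c < e / 2 * t" using e by (simp add: field_simps)
      qed
      finally show ?thesis using t0 by (simp add: field_simps abs_divide)
    qed
    then show "\<forall>\<^sub>F t in at_top. dist (occ f 0 t \<omega> / t) 0 < e"
      unfolding eventually_at_top_dense by blast
  qed
  with inv ae show ?thesis by blast
qed

end

section \<open>Quasi-everywhere statements and the semigroup\<close>

text \<open>Off an open set U' of small capacity q is continuous, so there the points with q
  \<noteq> 0 are the trace of an open set W. Adding A \<inter> W enlarges U' by a null set only, and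
  \<open>capacity_open\<close> does not see null sets because its test functions are constrained
  almost everywhere.\<close>

lemma quasi_every_zero:
  fixes M :: "'a::topological_space measure"
  assumes A: "openin (top_of_set (space M)) A" and q: "quasi_continuous M D Q q"
    and ae: "AE x in M. x \<in> A \<longrightarrow> q x = 0"
  shows "quasi_every M D Q A (\<lambda>x. q x = (0::real))"
proof -
  define N where "N = {x \<in> A. q x \<noteq> 0}"
  have less: "capacity M D Q N < \<epsilon>" if e: "0 < \<epsilon>" for \<epsilon>
  proof -
    obtain U where U: "capacity M D Q U < \<epsilon>" "continuous_on (space M - U) q"
      using q e unfolding quasi_continuous_def by blast
    then obtain U' where U': "openin (top_of_set (space M)) U'" "U \<subseteq> U'" "capacity_open M D Q U' < \<epsilon>"
      unfolding capacity_def INF_less_iff by blast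
    have "continuous_on (space M - U') q" by (rule continuous_on_subset[OF U(2)]) (use U'(2) in auto)
    then have "openin (top_of_set (space M - U')) ((space M - U') \<inter> q -` (- {0}))"
      by (rule continuous_openin_preimage_gen) auto
    then obtain W where W: "open W" "(space M - U') \<inter> q -` (- {0}) = (space M - U') \<inter> W"
      by (auto simp: openin_open)
    let ?V = "U' \<union> (A \<inter> W)"
    have As: "A \<subseteq> space M" using openin_imp_subset[OF A] .
    have V: "openin (top_of_set (space M)) ?V"
      using U'(1) A W(1) by (intro openin_Un) (auto intro: openin_Int_open)
    have NV: "N \<subseteq> ?V"
      using W(2) As by (auto simp: N_def)
    have "AE x in M. x \<in> ?V \<longrightarrow> x \<in> U'"
      using ae by eventually_elim (use W(2) As in blast)
    then have "capacity_open M D Q ?V \<le> capacity_open M D Q U'"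
      unfolding capacity_open_def by (intro INF_superset_mono) (auto elim!: eventually_elim2)
    moreover have "capacity M D Q N \<le> capacity_open M D Q ?V"
      unfolding capacity_def by (rule INF_lower) (use V NV in auto)
    ultimately show ?thesis using U'(3) by simp
  qed
  have "capacity M D Q N = 0"
    using less[of "capacity M D Q N"] by (auto simp: zero_less_iff_neq_zero)
  then show ?thesis
    unfolding quasi_every_def using openin_imp_subset[OF A] by (intro exI[of _ N]) (auto simp: N_def)
qed

lemma quasi_every_mono:
  "quasi_every M D Q A R \<Longrightarrow> (\<And>x. x \<in> A \<Longrightarrow> R x \<Longrightarrow> R' x) \<Longrightarrow> quasi_every M D Q A R'"
  unfolding quasi_every_def by blast

section \<open>Square-integrable functions\<close>

lemma L2_mult_integrable:
  assumes f: "f \<in> L2 M" and g: "g \<in> L2 M" shows "integrable M (\<lambda>x. f x * g x)"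
proof (rule Bochner_Integration.integrable_bound)
  show "integrable M (\<lambda>x. (f x)\<^sup>2 + (g x)\<^sup>2)" using f g by (simp add: L2_def)
  show "(\<lambda>x. f x * g x) \<in> borel_measurable M" using f g by (auto simp: L2_def intro!: borel_measurable_times)
  have "\<bar>a * b\<bar> \<le> a\<^sup>2 + b\<^sup>2" for a b :: real
  proof -
    have "0 \<le> (a + b)\<^sup>2 + a\<^sup>2 + b\<^sup>2" "0 \<le> (a - b)\<^sup>2 + a\<^sup>2 + b\<^sup>2" by simp_all
    then show ?thesis by (simp add: power2_eq_square algebra_simps abs_le_iff)
  qed
  then show "AE x in M. norm (f x * g x) \<le> norm ((f x)\<^sup>2 + (g x)\<^sup>2)" by simp
qed

lemma L2_lincomb:
  assumes f: "f \<in> L2 M" and g: "g \<in> L2 M"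
  shows "(\<lambda>x. a * f x + b * g x) \<in> L2 M"
    and "(\<integral>x. (a * f x + b * g x)\<^sup>2 \<partial>M) = a\<^sup>2 * (\<integral>x. (f x)\<^sup>2 \<partial>M) + 2 * a * b * (\<integral>x. f x * g x \<partial>M) + b\<^sup>2 * (\<integral>x. (g x)\<^sup>2 \<partial>M)"
proof -
  note i = L2_mult_integrable[OF f g]
  have f2: "integrable M (\<lambda>x. (f x)\<^sup>2)" and g2: "integrable M (\<lambda>x. (g x)\<^sup>2)" using f g by (auto simp: L2_def)
  have e: "(\<lambda>x. (a * f x + b * g x)\<^sup>2) = (\<lambda>x. a\<^sup>2 * (f x)\<^sup>2 + 2 * a * b * (f x * g x) + b\<^sup>2 * (g x)\<^sup>2)"
    by (simp add: power2_eq_square algebra_simps)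
  show "(\<lambda>x. a * f x + b * g x) \<in> L2 M"
    using f g i f2 g2 unfolding L2_def mem_Collect_eq e by simp
  show "(\<integral>x. (a * f x + b * g x)\<^sup>2 \<partial>M) = a\<^sup>2 * (\<integral>x. (f x)\<^sup>2 \<partial>M) + 2 * a * b * (\<integral>x. f x * g x \<partial>M) + b\<^sup>2 * (\<integral>x. (g x)\<^sup>2 \<partial>M)"
    unfolding e using i f2 g2 by simp
qed

lemma L2_norm_eq: "L2_norm M f = sqrt (\<integral>x. (f x)\<^sup>2 \<partial>M)"
  by (simp add: L2_norm_def L2_inner_def power2_eq_square)

lemma L2_norm_nonneg: "0 \<le> L2_norm M f"
  by (simp add: L2_norm_eq integral_nonneg_AE)

lemma L2_norm_cong: "f \<in> borel_measurable M \<Longrightarrow> g \<in> borel_measurable M \<Longrightarrow> AE x in M. f x = g x \<Longrightarrow> L2_norm M f = L2_norm M g"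
  unfolding L2_norm_eq by (intro arg_cong[of _ _ sqrt] integral_cong_AE) (auto elim!: AE_mp)

lemma L2_norm_triangle:
  assumes f: "f \<in> L2 M" and g: "g \<in> L2 M"
  shows "L2_norm M (\<lambda>x. f x + g x) \<le> L2_norm M f + L2_norm M g"
proof -
  let ?p = "\<integral>x. (f x)\<^sup>2 \<partial>M" and ?q = "\<integral>x. f x * g x \<partial>M" and ?r = "\<integral>x. (g x)\<^sup>2 \<partial>M"
  have "?q\<^sup>2 \<le> ?p * ?r"
  proof (rule quadratic_nonneg_imp)
    fix t
    have "0 \<le> (\<integral>x. (1 * f x + t * g x)\<^sup>2 \<partial>M)" by (simp add: integral_nonneg_AE)
    then show "0 \<le> ?p + 2 * t * ?q + t\<^sup>2 * ?r" unfolding L2_lincomb(2)[OF f g] by simp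
  qed (simp add: integral_nonneg_AE)
  then have q: "?q \<le> sqrt ?p * sqrt ?r"
    by (simp add: real_sqrt_mult[symmetric] real_le_rsqrt)
  have "(\<integral>x. (f x + g x)\<^sup>2 \<partial>M) = ?p + 2 * ?q + ?r" using L2_lincomb(2)[OF f g, of 1 1] by simp
  also have "\<dots> \<le> (sqrt ?p)\<^sup>2 + 2 * (sqrt ?p * sqrt ?r) + (sqrt ?r)\<^sup>2"
    using q by (simp add: integral_nonneg_AE)
  also have "\<dots> = (sqrt ?p + sqrt ?r)\<^sup>2" by (simp add: power2_sum)
  finally show ?thesis unfolding L2_norm_eq by (intro real_le_lsqrt) (auto simp: integral_nonneg_AE)
qed

section \<open>Fixed points of the semigroup\<close>

context
  fixes M :: "'a measure" and D :: "('a \<Rightarrow> real) set" and Q and T :: "real \<Rightarrow> ('a \<Rightarrow> real) \<Rightarrow> 'a \<Rightarrow> real"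
  assumes sg: "is_L2_semigroup M D Q T"
begin

lemmas semigroup_def = sg[unfolded is_L2_semigroup_def]

lemma semigroup_L2: "0 < t \<Longrightarrow> f \<in> L2 M \<Longrightarrow> T t f \<in> L2 M"
  and semigroup_contraction: "0 < t \<Longrightarrow> f \<in> L2 M \<Longrightarrow> L2_norm M (T t f) \<le> L2_norm M f"
  using semigroup_def[THEN conjunct1] by blast+

lemma semigroup_linear: "0 < t \<Longrightarrow> f \<in> L2 M \<Longrightarrow> g \<in> L2 M \<Longrightarrow>
    AE x in M. T t (\<lambda>y. a * f y + b * g y) x = a * T t f x + b * T t g x"
  by (rule semigroup_def[THEN conjunct2, THEN conjunct2, THEN conjunct1, rule_format])

lemma semigroup_add: "0 < s \<Longrightarrow> 0 < t \<Longrightarrow> f \<in> L2 M \<Longrightarrow> AE x in M. T (s + t) f x = T s (T t f) x"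
  by (rule semigroup_def[THEN conjunct2, THEN conjunct2, THEN conjunct2, THEN conjunct1, rule_format])

lemma semigroup_generator: "u \<in> L2 M \<Longrightarrow> w \<in> L2 M \<Longrightarrow>
    ((\<lambda>t. L2_norm M (\<lambda>x. (T t u x - u x) / t - w x)) \<longlongrightarrow> 0) (at_right 0) \<longleftrightarrow>
    u \<in> D \<and> (\<forall>v\<in>D. Q u v = - L2_inner M w v)"
  by (rule semigroup_def[THEN conjunct2, THEN conjunct2, THEN conjunct2, THEN conjunct2, THEN conjunct2, THEN bspec, THEN bspec])

lemma zero_L2: "(\<lambda>_. 0) \<in> L2 M"
  by (simp add: L2_def)

text \<open>The difference quotients vanish almost everywhere, so u lies in the kernel of the
  generator.\<close>

lemma semigroup_fixed_imp_form_zero: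
  assumes u: "u \<in> L2 M" and fix_u: "\<And>t. 0 < t \<Longrightarrow> AE x in M. T t u x = u x"
  shows "u \<in> D" "v \<in> D \<Longrightarrow> Q u v = 0"
proof -
  have "L2_norm M (\<lambda>x. (T t u x - u x) / t - 0) = 0" if t: "0 < t" for t
  proof -
    have "L2_norm M (\<lambda>x. (T t u x - u x) / t - 0) = L2_norm M (\<lambda>x. 0)"
      using semigroup_L2[OF t u] u by (intro L2_norm_cong) (auto simp: L2_def intro: eventually_mono[OF fix_u[OF t]])
    then show ?thesis by (simp add: L2_norm_eq)
  qed
  then have "\<forall>\<^sub>F t in at_right 0. L2_norm M (\<lambda>x. (T t u x - u x) / t - 0) = 0"
    unfolding eventually_at_right_field by (intro exI[of _ 1]) auto
  then have "((\<lambda>t. L2_norm M (\<lambda>x. (T t u x - u x) / t - 0)) \<longlongrightarrow> 0) (at_right 0)"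
    by (rule tendsto_eventually)
  with semigroup_generator[OF u zero_L2] show "u \<in> D" "v \<in> D \<Longrightarrow> Q u v = 0"
    by (auto simp: L2_inner_def)
qed

text \<open>With \<open>N t = \<parallel>T\<^sub>t u - u\<parallel>\<close> one has \<open>N t \<le> m N (t / m)\<close>, and \<open>N s / s \<rightarrow> 0\<close>.\<close>

lemma form_zero_imp_semigroup_fixed:
  assumes u: "u \<in> D" "u \<in> L2 M" and z: "\<And>v. v \<in> D \<Longrightarrow> Q u v = 0" and t: "0 < t"
  shows "AE x in M. T t u x = u x"
proof -
  define N where "N s = L2_norm M (\<lambda>x. T s u x - u x)" for s
  have dL2: "(\<lambda>x. T s u x - u x) \<in> L2 M" if "0 < s" for s
    using L2_lincomb(1)[OF semigroup_L2[OF that u(2)] u(2), of 1 "-1"] by simp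
  \<comment> \<open>T_(s+r) u - u = T_s (T_r u - u) + (T_s u - u), and T_s is a linear
    contraction.\<close>
  have add: "N (s + r) \<le> N s + N r" if s: "0 < s" and r: "0 < r" for s r
  proof -
    have TT: "T s (T r u) \<in> L2 M" by (intro semigroup_L2 s r u)
    have Tr: "T r u \<in> L2 M" by (intro semigroup_L2 r u)
    have 1: "(\<lambda>x. T s (\<lambda>y. 1 * T r u y + (-1) * u y) x) \<in> L2 M" by (intro semigroup_L2 s L2_lincomb Tr u)
    have "N (s + r) = L2_norm M (\<lambda>x. T s (\<lambda>y. 1 * T r u y + (-1) * u y) x + (T s u x - u x))"
      unfolding N_def
    proof (rule L2_norm_cong)
      show "AE x in M. T (s + r) u x - u x = T s (\<lambda>y. 1 * T r u y + (-1) * u y) x + (T s u x - u x)"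
        using semigroup_add[OF s r u(2)] semigroup_linear[OF s Tr u(2), of 1 "-1"] by eventually_elim simp
    qed (use semigroup_L2[of "s + r" u] dL2[OF s] 1 s r u in \<open>auto simp: L2_def\<close>)
    also have "\<dots> \<le> L2_norm M (T s (\<lambda>y. 1 * T r u y + (-1) * u y)) + N s"
      unfolding N_def by (rule L2_norm_triangle[OF 1 dL2[OF s]])
    also have "L2_norm M (T s (\<lambda>y. 1 * T r u y + (-1) * u y)) \<le> N r"
      using semigroup_contraction[OF s L2_lincomb(1)[OF Tr u(2), of 1 "-1"]] by (simp add: N_def)
    finally show ?thesis by simp
  qed
  have mult: "N (real (Suc m) * s) \<le> real (Suc m) * N s" if s: "0 < s" for s m
  proof (induction m)
    case (Suc m)
    have "N (real (Suc (Suc m)) * s) = N (real (Suc m) * s + s)" by (simp add: algebra_simps)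
    also have "\<dots> \<le> N (real (Suc m) * s) + N s" by (rule add) (use s in auto)
    finally show ?case using Suc by (simp add: algebra_simps)
  qed simp
  have "((\<lambda>s. L2_norm M (\<lambda>x. (T s u x - u x) / s - 0)) \<longlongrightarrow> 0) (at_right 0)"
    using semigroup_generator[OF u(2) zero_L2] u(1) z by (auto simp: L2_inner_def)
  moreover have "\<forall>\<^sub>F s in at_right 0. L2_norm M (\<lambda>x. (T s u x - u x) / s - 0) = N s / s"
    unfolding eventually_at_right_field
    by (intro exI[of _ 1]) (auto simp: N_def L2_norm_eq power_divide real_sqrt_divide)
  ultimately have lim: "((\<lambda>s. N s / s) \<longlongrightarrow> 0) (at_right 0)"
    by (rule Lim_transform_eventually)
  have "filterlim (\<lambda>m. t / real (Suc m)) (at_right 0) sequentially"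
    unfolding filterlim_at
    by (intro conjI always_eventually allI LIMSEQ_Suc[OF lim_const_over_n]) (use t in auto)
  from filterlim_compose[OF lim this]
  have "(\<lambda>m. N (t / real (Suc m)) / (t / real (Suc m))) \<longlonglongrightarrow> 0" .
  \<comment> \<open>The quotient of t by t / (m + 1) is the factor m + 1 in the bound
    \<open>mult\<close>.\<close>
  then have "(\<lambda>m. t * (N (t / real (Suc m)) / (t / real (Suc m)))) \<longlonglongrightarrow> t * 0" by (intro tendsto_intros)
  moreover have "N t \<le> t * (N (t / real (Suc m)) / (t / real (Suc m)))" for m
    using mult[of "t / real (Suc m)" m] t by (simp add: field_simps del: of_nat_Suc)
  ultimately have "N t \<le> t * 0" by (intro LIMSEQ_le_const) auto
  then have "N t = 0" using L2_norm_nonneg[of M "\<lambda>x. T t u x - u x"] by (simp add: N_def)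
  then have "(\<integral>x. (T t u x - u x)\<^sup>2 \<partial>M) = 0" by (simp add: N_def L2_norm_eq)
  then have "AE x in M. (T t u x - u x)\<^sup>2 = 0"
    using dL2[OF t] by (subst (asm) integral_nonneg_eq_0_iff_AE) (auto simp: L2_def)
  then show ?thesis by eventually_elim simp
qed

text \<open>For small \<epsilon> of the sign of a the linear term would dominate; a / (b + 1) is
  small enough, and the added 1 keeps the divisor positive.\<close>

lemma linear_le_quadratic_imp_zero:
  fixes a b :: real
  assumes le: "\<And>\<epsilon>. 2 * \<epsilon> * a \<le> \<epsilon>\<^sup>2 * b" shows "a = 0"
proof (rule ccontr)
  assume a: "a \<noteq> 0"
  \<comment> \<open>The two signs of \<epsilon> together give 0 \<le> 2 * b.\<close>
  have "0 \<le> b" using le[of 1] le[of "-1"] by simp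
  then have b: "0 < b + 1" by simp
  have "2 * (a / (b + 1)) * a \<le> (a / (b + 1))\<^sup>2 * b" by (rule le)
  also have "\<dots> \<le> (a / (b + 1))\<^sup>2 * (b + 1)" by (rule mult_left_mono) auto
  also have "\<dots> = a\<^sup>2 / (b + 1)" using b by (simp add: power2_eq_square)
  also have "2 * (a / (b + 1)) * a = 2 * (a\<^sup>2 / (b + 1))" by (simp add: power2_eq_square)
  finally have "a\<^sup>2 / (b + 1) \<le> 0" by simp
  moreover have "0 < a\<^sup>2 / (b + 1)" using a b by simp
  ultimately show False by simp
qed

text \<open>Expand \<open>\<parallel>T\<^sub>t(u + \<epsilon> f)\<parallel>\<^sup>2 \<le> \<parallel>u + \<epsilon> f\<parallel>\<^sup>2\<close> and let \<open>\<epsilon> \<rightarrow> 0\<close> with either sign.\<close>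

lemma semigroup_fixed_adjoint:
  assumes u: "u \<in> L2 M" and fix_u: "AE x in M. T t u x = u x" and f: "f \<in> L2 M" and t: "0 < t"
  shows "(\<integral>x. u x * T t f x \<partial>M) = (\<integral>x. u x * f x \<partial>M)"
proof -
  let ?a = "(\<integral>x. u x * T t f x \<partial>M) - (\<integral>x. u x * f x \<partial>M)"
  let ?b = "(\<integral>x. (f x)\<^sup>2 \<partial>M) - (\<integral>x. (T t f x)\<^sup>2 \<partial>M)"
  have Tf: "T t f \<in> L2 M" by (rule semigroup_L2[OF t f])
  have le: "2 * \<epsilon> * ?a \<le> \<epsilon>\<^sup>2 * ?b" for \<epsilon>
  proof -
    have c: "(\<lambda>y. 1 * u y + \<epsilon> * f y) \<in> L2 M" by (rule L2_lincomb[OF u f])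
    have "L2_norm M (\<lambda>x. 1 * u x + \<epsilon> * T t f x) = L2_norm M (T t (\<lambda>y. 1 * u y + \<epsilon> * f y))"
    proof (rule L2_norm_cong)
      show "AE x in M. 1 * u x + \<epsilon> * T t f x = T t (\<lambda>y. 1 * u y + \<epsilon> * f y) x"
        using semigroup_linear[OF t u f, of 1 \<epsilon>] fix_u by eventually_elim simp
    qed (use semigroup_L2[OF t c] L2_lincomb(1)[OF u Tf, of 1 \<epsilon>] in \<open>auto simp: L2_def\<close>)
    also have "\<dots> \<le> L2_norm M (\<lambda>y. 1 * u y + \<epsilon> * f y)" by (rule semigroup_contraction[OF t c])
    finally have "(\<integral>x. (1 * u x + \<epsilon> * T t f x)\<^sup>2 \<partial>M) \<le> (\<integral>x. (1 * u x + \<epsilon> * f x)\<^sup>2 \<partial>M)"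
      by (simp add: L2_norm_eq)
    then show ?thesis
      unfolding L2_lincomb(2)[OF u Tf] L2_lincomb(2)[OF u f] by (simp add: algebra_simps)
  qed
  have "?a = 0" by (rule linear_le_quadratic_imp_zero[OF le])
  then show ?thesis by simp
qed

end

context weighted_orthant
begin

section \<open>Components of the positivity set\<close>

abbreviation "zeros \<equiv> {x \<in> orthant. \<rho> x = 0}"

lemma open_positive: "openin (top_of_set orthant) (orthant - zeros)"
proof -
  have "openin (top_of_set orthant) (orthant \<inter> \<rho> -` (- {0}))"
    using rho_continuous by (intro continuous_openin_preimage_gen) auto
  moreover have "orthant \<inter> \<rho> -` (- {0}) = orthant - zeros" by auto
  ultimately show ?thesis by simp
qed

lemma convex_orthant: "convex (orthant :: (real^'n) set)"
  by (auto simp: convex_def orthant_def intro!: add_nonneg_nonneg)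

text \<open>A convex set is locally connected, hence so is its relatively open subset, and there
  components are open.\<close>

lemma component_open:
  assumes "A \<in> components (orthant - zeros)" shows "openin (top_of_set orthant) A"
proof -
  have "locally connected (orthant :: (real^'n) set)"
    by (rule convex_imp_locally_connected[OF convex_orthant])
  then have "locally connected (orthant - zeros)" by (rule locally_open_subset[OF _ open_positive])
  from openin_components_locally_connected[OF this assms] show ?thesis
    using open_positive by (rule openin_trans)
qed

lemma openin_orthant_sets: "openin (top_of_set orthant) U \<Longrightarrow> U \<in> sets (orthant_algebra :: (real^'n) measure)"
  by (auto simp: openin_open sets_restrict_space_iff)

text \<open>Let d be the distance to the rest of the orthant. A point of A close to that rest is
  close to a zero of \<rho>: the segment to the nearest point stays in the convex orthant and leaves
  A, so it meets the zero set. Thus the sets bounded in \<open>cutoff\<close> lie in the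
  neighbourhoods of the hypothesis.\<close>

lemma component_indicator_zero_energy:
  assumes A: "A \<in> components (orthant - zeros)"
    and C: "\<forall>\<^sub>F r in at_right 0. emeasure \<mu> (nbhd r zeros) \<le> ennreal (C * r\<^sup>2)"
  shows "indicator A \<in> form_domain \<beta> \<rho>" "\<And>v. v \<in> form_domain \<beta> \<rho> \<Longrightarrow> form \<beta> \<rho> (indicator A) v = 0"
proof -
  note oA = component_open[OF A]
  have As: "A \<subseteq> orthant" by (rule openin_imp_subset[OF oA])
  \<comment> \<open>\<open>infdist\<close> to the empty set is 0, the wrong value if A is the whole
    orthant.\<close>
  define d where "d x = (if orthant - A = {} then 1 else infdist x (orthant - A))" for x
  have cl: "closed (orthant - A)"
  proof -
    have "closedin (top_of_set orthant) (orthant - A)" by (rule closedin_diff[OF _ oA]) simp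
    then show ?thesis by (rule closedin_closed_trans[OF _ closed_orthant])
  qed
  obtain r1 where r1: "0 < r1" "\<And>r. 0 < r \<Longrightarrow> r < r1 \<Longrightarrow> emeasure \<mu> (nbhd r zeros) \<le> ennreal (C * r\<^sup>2)"
    using C unfolding eventually_at_right_field by blast
  \<comment> \<open>For s \<le> 1 the default value 1 of d contributes no point.\<close>
  have sub: "{x \<in> orthant. 0 < d x \<and> d x < s} \<subseteq> nbhd s zeros" if s: "s \<le> 1" for s
  proof
    fix x assume x: "x \<in> {x \<in> orthant. 0 < d x \<and> d x < s}"
    then have ne: "orthant - A \<noteq> {}" and ds: "0 < infdist x (orthant - A)" "infdist x (orthant - A) < s" and xo: "x \<in> orthant"
      using s by (auto simp: d_def split: if_splits)
    have xA: "x \<in> A" using ds(1) xo in_closed_iff_infdist_zero[OF cl ne, of x] by auto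
    obtain y where y: "y \<in> orthant - A" "infdist x (orthant - A) = dist x y"
      using infdist_attains_inf[OF cl ne] by blast
    have seg: "closed_segment x y \<subseteq> orthant" using convex_orthant xo y(1) by (intro closed_segment_subset) auto
    have "\<exists>z\<in>closed_segment x y. z \<in> zeros"
    proof (rule ccontr)
      assume "\<not> (\<exists>z\<in>closed_segment x y. z \<in> zeros)"
      then have "closed_segment x y \<subseteq> orthant - zeros" using seg by blast
      then have "closed_segment x y \<subseteq> A"
      proof (rule components_maximal[OF A connected_segment(1)])
        have "x \<in> A \<inter> closed_segment x y" using xA by simp
        then show "A \<inter> closed_segment x y \<noteq> {}" by blast
      qed
      then show False using y(1) by auto
    qed
    then obtain z where z: "z \<in> closed_segment x y" "z \<in> zeros" by blast
    have "dist x z \<le> dist x y" using segment_bound(1)[OF z(1)] by (simp add: dist_norm norm_minus_commute)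
    then have "dist x z < s" using y(2) ds(2) by linarith
    then show "x \<in> nbhd s zeros" using z(2) xo unfolding nbhd_def by blast
  qed
  have nbhd_sets: "nbhd s zeros \<in> sets \<mu>" for s
  proof -
    have "nbhd s zeros = orthant \<inter> (\<Union>y\<in>zeros. ball y s)" by (auto simp: nbhd_def dist_commute)
    moreover have "open (\<Union>y\<in>zeros. ball y s)" by (intro open_UN ballI open_ball)
    ultimately show ?thesis by (simp add: openin_orthant_sets openin_open_Int)
  qed
  \<comment> \<open>The bound 1 on the scales respects the default value of d, and
    \<open>max C 0\<close> copes with a negative C.\<close>
  interpret cutoff \<beta> \<rho> A d "min r1 1" "max C 0"
  proof
    show "A \<in> sets orthant_algebra" by (rule openin_orthant_sets[OF oA])
    show "\<bar>d x - d y\<bar> \<le> norm (x - y)" for x y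
      using infdist_triangle_abs[of x "orthant - A" y] by (simp add: d_def dist_norm)
    show "0 \<le> d x" for x by (simp add: d_def infdist_nonneg)
    show "x \<in> A \<longleftrightarrow> 0 < d x" if "x \<in> orthant" for x
      using that in_closed_iff_infdist_zero[OF cl, of x] infdist_nonneg[of x "orthant - A"] by (auto simp: d_def less_le)
    show "0 < min r1 1" "0 \<le> max C 0" using r1 by auto
    fix s assume s: "0 < s" "s < min r1 1"
    have "emeasure \<mu> {x \<in> orthant. 0 < d x \<and> d x < s} \<le> emeasure \<mu> (nbhd s zeros)"
      by (rule emeasure_mono[OF sub nbhd_sets]) (use s in simp)
    also have "\<dots> \<le> ennreal (C * s\<^sup>2)" using r1(2) s by simp
    also have "\<dots> \<le> ennreal (max C 0 * s\<^sup>2)" by (intro ennreal_leI mult_right_mono) auto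
    finally show "emeasure \<mu> {x \<in> orthant. 0 < d x \<and> d x < s} \<le> ennreal (max C 0 * s\<^sup>2)" .
  qed
  show "indicator A \<in> form_domain \<beta> \<rho>" "\<And>v. v \<in> form_domain \<beta> \<rho> \<Longrightarrow> form \<beta> \<rho> (indicator A) v = 0"
    by (rule indicator_zero_energy)+
qed

lemma bounded_meas_L2:
  assumes "bounded_meas orthant_algebra f" shows "f \<in> L2 \<mu>"
  using assms integrable_bounded_meas[of "\<lambda>x. f x * f x"] bounded_meas_mult[OF assms assms]
  by (simp add: L2_def power2_eq_square bounded_meas_measurable)

text \<open>Full support of the reference measure; it makes the quotient in the limit
  meaningful.\<close>

lemma component_measure_pos:
  assumes A: "A \<in> components (orthant - zeros)" shows "0 < measure \<mu> A"
proof -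
  note oA = component_open[OF A]
  have "A \<noteq> {}" using A in_components_nonempty by blast
  then have m: "0 < emeasure m A" using oA beta_pos by (intro ref_measure_open_pos) auto
  have "emeasure \<mu> A \<noteq> 0"
  proof
    assume "emeasure \<mu> A = 0"
    then have "AE x in \<mu>. x \<notin> A" using openin_orthant_sets[OF oA] by (intro AE_not_in) (auto simp: null_sets_def)
    then have "AE x in m. x \<notin> A" by (simp add: AE_mu_iff)
    then have "emeasure m A = 0"
      using openin_orthant_sets[OF oA] openin_imp_subset[OF oA] by (subst (asm) AE_iff_measurable[where N = A]) auto
    with m show False by simp
  qed
  then show ?thesis by (simp add: emeasure_eq_measure zero_less_measure_iff)
qed

end

section \<open>Time averages on a component\<close>

locale weighted_diffusion = weighted_orthant \<beta> \<rho> + conservative_diffusion orthant \<F> \<F>t X \<Theta> P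
  for \<beta> and \<rho> :: "real^'n::finite \<Rightarrow> real" and \<F> :: "'w measure" and \<F>t X \<Theta>
    and P :: "real^'n \<Rightarrow> 'w measure" +
  fixes T :: "real \<Rightarrow> (real^'n \<Rightarrow> real) \<Rightarrow> real^'n \<Rightarrow> real" and A :: "(real^'n) set" and C :: real
  assumes sg: "is_L2_semigroup (weighted_measure \<beta> \<rho>) (form_domain \<beta> \<rho>) (form \<beta> \<rho>) T"
    and assoc: "associated (weighted_measure \<beta> \<rho>) (form_domain \<beta> \<rho>) (form \<beta> \<rho>) T X P"
    and C: "\<forall>\<^sub>F r in at_right 0. emeasure (weighted_measure \<beta> \<rho>) (nbhd r {x \<in> orthant. \<rho> x = 0}) \<le> ennreal (C * r\<^sup>2)"
    and A: "A \<in> components (orthant - {x \<in> orthant. \<rho> x = 0})"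
begin

lemma associatedD:
  assumes "f \<in> L2 \<mu>" "0 < t"
  shows "quasi_continuous \<mu> (form_domain \<beta> \<rho>) (form \<beta> \<rho>) (\<lambda>x. \<integral>\<omega>. f (X t \<omega>) \<partial>P x)"
    and "AE x in \<mu>. (\<integral>\<omega>. f (X t \<omega>) \<partial>P x) = T t f x"
  using assoc assms unfolding associated_def by blast+

lemma A_open: "openin (top_of_set orthant) A"
  by (rule component_open[OF A])

lemma A_sets: "A \<in> sets orthant_algebra"
  by (rule openin_orthant_sets[OF A_open])

definition mu_A :: "(real^'n) measure" where "mu_A = density \<mu> (indicator A)"

lemma sets_mu_A: "sets mu_A = sets orthant_algebra" by (simp add: mu_A_def)

lemma indicator_A_L2: "indicator A \<in> L2 \<mu>"
  by (rule bounded_meas_L2[OF bounded_meas_indicator[OF A_sets]])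

text \<open>The indicator of A is fixed by the contraction T t, hence also by its adjoint.\<close>

lemma A_invariant:
  assumes t: "0 < t" and f: "f \<in> L2 \<mu>"
  shows "(\<integral>x. indicator A x * T t f x \<partial>\<mu>) = (\<integral>x. indicator A x * f x \<partial>\<mu>)"
proof (rule semigroup_fixed_adjoint[OF sg indicator_A_L2 _ f t])
  have "form \<beta> \<rho> (indicator A) v = 0" if "v \<in> form_domain \<beta> \<rho>" for v
    using that by (rule component_indicator_zero_energy(2)[OF A C])
  then show "AE x in \<mu>. T t (indicator A) x = indicator A x"
    using component_indicator_zero_energy(1)[OF A C] indicator_A_L2 t
    by (intro form_zero_imp_semigroup_fixed[OF sg])
qed

lemma AE_mu_A: "(AE x in mu_A. Q x) \<longleftrightarrow> (AE x in \<mu>. x \<in> A \<longrightarrow> Q x)"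
proof -
  have "(AE x in mu_A. Q x) \<longleftrightarrow> (AE x in \<mu>. 0 < (indicator A x :: ennreal) \<longrightarrow> Q x)"
    unfolding mu_A_def using A_sets by (subst AE_density) auto
  also have "\<dots> \<longleftrightarrow> (AE x in \<mu>. x \<in> A \<longrightarrow> Q x)" by (intro AE_cong) (auto simp: indicator_def)
  finally show ?thesis .
qed

lemma emeasure_mu_A: "\<Gamma> \<in> sets orthant_algebra \<Longrightarrow> emeasure mu_A \<Gamma> = emeasure \<mu> (A \<inter> \<Gamma>)"
  unfolding mu_A_def using A_sets by (intro emeasure_density_indicator) auto

lemma finite_mu_A: "finite_measure mu_A"
proof
  have "orthant \<in> sets (orthant_algebra :: (real^'n) measure)" by (simp add: sets_restrict_space_iff)
  then show "emeasure mu_A (space mu_A) \<noteq> \<infinity>"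
    using emeasure_mu_A[of orthant] by (simp add: mu_A_def emeasure_finite)
qed

lemma nn_integral_mu_A: "f \<in> borel_measurable orthant_algebra \<Longrightarrow> (\<integral>\<^sup>+x. f x \<partial>mu_A) = (\<integral>\<^sup>+x. indicator A x * f x \<partial>\<mu>)"
  unfolding mu_A_def using A_sets by (subst nn_integral_density) auto

text \<open>\<open>A_invariant\<close> read through the association of process and semigroup. The
  case t = 0 is separate, because association and semigroup speak of t > 0 only; there the start at
  x decides.\<close>

lemma stationary_mu_A:
  assumes t: "0 \<le> t" and \<Gamma>: "\<Gamma> \<in> sets orthant_algebra"
  shows "(\<integral>\<^sup>+x. emeasure (P x) {\<omega> \<in> space \<F>. X t \<omega> \<in> \<Gamma>} \<partial>mu_A) = emeasure mu_A \<Gamma>"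
proof (cases "t = 0")
  case True
  have "(\<integral>\<^sup>+x. emeasure (P x) {\<omega> \<in> space \<F>. X t \<omega> \<in> \<Gamma>} \<partial>mu_A) = (\<integral>\<^sup>+x. indicator \<Gamma> x \<partial>mu_A)"
  proof (rule nn_integral_cong)
    fix x assume "x \<in> space mu_A"
    then have x: "x \<in> orthant" by (simp add: mu_A_def)
    interpret prob_space "P x" by (rule prob[OF x])
    have "emeasure (P x) {\<omega> \<in> space \<F>. X t \<omega> \<in> \<Gamma>} = emeasure (P x) (if x \<in> \<Gamma> then space (P x) else {})"
    proof (rule emeasure_eq_AE)
      show "AE \<omega> in P x. \<omega> \<in> {\<omega> \<in> space \<F>. X t \<omega> \<in> \<Gamma>} \<longleftrightarrow> \<omega> \<in> (if x \<in> \<Gamma> then space (P x) else {})"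
        using start[OF x] AE_space by eventually_elim (use True space_P[OF x] in auto)
    qed (use X_event[OF t \<Gamma>] sets_P[OF x] in auto)
    then show "emeasure (P x) {\<omega> \<in> space \<F>. X t \<omega> \<in> \<Gamma>} = indicator \<Gamma> x" by (simp add: emeasure_space_1)
  qed
  then show ?thesis using \<Gamma> by (simp add: sets_mu_A)
next
  case False
  then have t0: "0 < t" using t by simp
  let ?f = "indicator \<Gamma> :: _ \<Rightarrow> real"
  have f: "bounded_meas orthant_algebra ?f" by (rule bounded_meas_indicator[OF \<Gamma>])
  have f2: "?f \<in> L2 \<mu>" by (rule bounded_meas_L2[OF f])
  let ?p = "\<lambda>x. measure (P x) {\<omega> \<in> space \<F>. X t \<omega> \<in> \<Gamma>}"
  have pm [measurable]: "?p \<in> borel_measurable orthant_algebra" by (rule kernel[OF t \<Gamma>])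
  have p1: "?p x \<le> 1" if "x \<in> orthant" for x using prob_space.prob_le_1[OF prob[OF that]] .
  have pf: "(\<integral>\<omega>. ?f (X t \<omega>) \<partial>P x) = ?p x" if x: "x \<in> orthant" for x
  proof -
    have "(\<integral>\<omega>. ?f (X t \<omega>) \<partial>P x) = (\<integral>\<omega>. indicator {\<omega> \<in> space \<F>. X t \<omega> \<in> \<Gamma>} \<omega> \<partial>P x)"
      by (rule Bochner_Integration.integral_cong[OF refl]) (simp add: indicator_def space_P[OF x])
    then show ?thesis using X_event[OF t \<Gamma>] sets_P[OF x] space_P[OF x] by (simp add: Int_absorb2)
  qed
  have AEp: "AE x in \<mu>. ?p x = T t ?f x"
    using associatedD(2)[OF f2 t0] AE_space by eventually_elim (auto simp: pf)
  have bp: "bounded_meas orthant_algebra (\<lambda>x. indicator A x * ?p x)"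
    by (rule bounded_measI[where c = 1]) (use A_sets p1 in \<open>auto simp: indicator_def space_restrict_space\<close>)
  have "(\<integral>\<^sup>+x. emeasure (P x) {\<omega> \<in> space \<F>. X t \<omega> \<in> \<Gamma>} \<partial>mu_A) = (\<integral>\<^sup>+x. ennreal (?p x) \<partial>mu_A)"
  proof (rule nn_integral_cong)
    fix x assume "x \<in> space mu_A"
    then interpret prob_space "P x" using prob by (simp add: mu_A_def)
    show "emeasure (P x) {\<omega> \<in> space \<F>. X t \<omega> \<in> \<Gamma>} = ennreal (?p x)" by (rule emeasure_eq_measure)
  qed
  also have "\<dots> = (\<integral>\<^sup>+x. ennreal (indicator A x * ?p x) \<partial>\<mu>)"
    by (subst nn_integral_mu_A) (auto intro!: nn_integral_cong simp: indicator_def)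
  also have "\<dots> = ennreal (\<integral>x. indicator A x * ?p x \<partial>\<mu>)"
    by (rule nn_integral_eq_integral) (use bp in \<open>auto intro!: integrable_bounded_meas\<close>)
  also have "(\<integral>x. indicator A x * ?p x \<partial>\<mu>) = (\<integral>x. indicator A x * T t ?f x \<partial>\<mu>)"
  proof (rule integral_cong_AE)
    show "(\<lambda>x. indicator A x * T t ?f x) \<in> borel_measurable \<mu>"
      using semigroup_L2[OF sg t0 f2] A_sets by (auto simp: L2_def intro!: borel_measurable_times)
    show "(\<lambda>x. indicator A x * ?p x) \<in> borel_measurable \<mu>" using bp by (simp add: bounded_meas_measurable)
    show "AE x in \<mu>. indicator A x * ?p x = indicator A x * T t ?f x" using AEp by eventually_elim simp
  qed
  also have "\<dots> = (\<integral>x. indicator A x * ?f x \<partial>\<mu>)" by (rule A_invariant[OF t0 f2])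
  also have "\<dots> = (\<integral>x. indicator (A \<inter> \<Gamma>) x \<partial>\<mu>)" by (simp add: indicator_inter_arith)
  also have "\<dots> = measure \<mu> (A \<inter> \<Gamma>)" using sets.sets_into_space[OF \<Gamma>] by (simp add: space_restrict_space Int_absorb2 le_infI2)
  finally show ?thesis using emeasure_mu_A[OF \<Gamma>] by (simp add: emeasure_eq_measure)
qed

text \<open>A harmonic function is fixed by the semigroup, so it has zero energy and
  \<open>zero_energy_const\<close> applies on A.\<close>

lemma harmonic_const_mu_A:
  fixes h :: "real^'n \<Rightarrow> real"
  assumes h: "h \<in> borel_measurable orthant_algebra" and h01: "\<And>x. x \<in> orthant \<Longrightarrow> 0 \<le> h x \<and> h x \<le> 1"
    and inv: "\<And>t x. 0 \<le> t \<Longrightarrow> x \<in> orthant \<Longrightarrow> (\<integral>\<omega>. h (X t \<omega>) \<partial>P x) = h x"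
  shows "\<exists>\<kappa>. AE x in mu_A. h x = \<kappa>"
proof -
  have hb: "bounded_meas orthant_algebra h"
    by (rule bounded_measI[OF h, where c = 1]) (use h01 in \<open>auto simp: space_restrict_space abs_le_iff intro: order_trans[of _ 0]\<close>)
  have h2: "h \<in> L2 \<mu>" by (rule bounded_meas_L2[OF hb])
  have fix_h: "AE x in \<mu>. T t h x = h x" if t: "0 < t" for t
  proof -
    show ?thesis using associatedD(2)[OF h2 t] AE_space by eventually_elim (use inv t in auto)
  qed
  have D: "h \<in> form_domain \<beta> \<rho>" by (rule semigroup_fixed_imp_form_zero(1)[OF sg h2 fix_h])
  have "form \<beta> \<rho> h h = 0" by (rule semigroup_fixed_imp_form_zero(2)[OF sg h2 fix_h D])
  then have "\<exists>c. AE x in \<mu>. x \<in> A \<longrightarrow> h x = c"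
    using h01 A_open in_components_connected[OF A] in_components_subset[OF A] by (intro zero_energy_const[OF D]) auto
  then show ?thesis by (simp add: AE_mu_A)
qed

sublocale ergodic_diffusion orthant \<F> \<F>t X \<Theta> P mu_A
proof (intro ergodic_diffusion.intro borel_diffusion.intro borel_diffusion_axioms.intro ergodic_diffusion_axioms.intro)
  show "conservative_diffusion orthant \<F> \<F>t X \<Theta> P" ..
  show "(orthant :: (real^'n) set) \<noteq> {}" by (auto simp: orthant_def intro!: exI[of _ 0])
  show "finite_measure mu_A" by (rule finite_mu_A)
  show "\<exists>\<kappa>. AE x in mu_A. h x = \<kappa>"
    if "h \<in> borel_measurable orthant_algebra" "\<And>x. x \<in> orthant \<Longrightarrow> 0 \<le> h x \<and> h x \<le> 1"
      "\<And>t x. 0 \<le> t \<Longrightarrow> x \<in> orthant \<Longrightarrow> (\<integral>\<omega>. h (X t \<omega>) \<partial>P x) = h x" for h :: "real^'n \<Rightarrow> real"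
    using that by (rule harmonic_const_mu_A)
qed (auto simp: sets_mu_A stationary_mu_A)

lemma time_average:
  assumes \<Gamma>: "\<Gamma> \<in> sets borel"
  shows "quasi_every \<mu> (form_domain \<beta> \<rho>) (form \<beta> \<rho>) A (\<lambda>x. AE \<omega> in P x.
        ((\<lambda>t. (1 / t) * (LBINT s:{0..t}. indicator \<Gamma> (X s \<omega>)))
           \<longlongrightarrow> measure \<mu> (\<Gamma> \<inter> A) / measure \<mu> A) at_top)"
proof -
  define \<kappa> where "\<kappa> = measure \<mu> (\<Gamma> \<inter> A) / measure \<mu> A"
  \<comment> \<open>The indicator of \<Gamma>, cut down to the state space and centred to have mean
    zero under \<open>mu_A\<close>.\<close>
  define f where "f x = indicator (\<Gamma> \<inter> orthant) x - \<kappa>" for x :: "real^'n"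
  have \<Gamma>o: "\<Gamma> \<inter> orthant \<in> sets orthant_algebra" using \<Gamma> by (auto simp: sets_restrict_space_iff)
  have fm: "f \<in> borel_measurable orthant_algebra" unfolding f_def[abs_def] using \<Gamma>o by measurable
  have fb: "\<bar>f x\<bar> \<le> 1 + \<bar>\<kappa>\<bar>" for x by (auto simp: f_def indicator_def)
  have Ao: "A \<subseteq> orthant" using openin_imp_subset[OF A_open] .
  have f0: "(\<integral>x. f x \<partial>mu_A) = 0"
  proof -
    have m1: "measure mu_A (\<Gamma> \<inter> orthant) = measure \<mu> (\<Gamma> \<inter> A)"
      using emeasure_mu_A[OF \<Gamma>o] Ao by (simp add: measure_def) (metis Int_absorb1 Int_assoc Int_commute)
    have "orthant \<in> sets (orthant_algebra :: (real^'n) measure)" by (simp add: sets_restrict_space_iff)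
    from emeasure_mu_A[OF this] have m2: "measure mu_A (space mu_A) = measure \<mu> A"
      using Ao by (simp add: measure_def mu_A_def Int_absorb2)
    have "(\<integral>x. f x \<partial>mu_A) = (\<integral>x. indicator (\<Gamma> \<inter> orthant) x \<partial>mu_A) - (\<integral>x. \<kappa> \<partial>mu_A)"
      unfolding f_def by (rule Bochner_Integration.integral_diff) (use \<Gamma>o in \<open>auto simp: sets_mu_A finite_measure.emeasure_eq_measure[OF finite_mu_A]\<close>)
    also have "\<dots> = measure \<mu> (\<Gamma> \<inter> A) - \<kappa> * measure \<mu> A"
      using m1 m2 by (simp add: mu_A_def Int_absorb2 Int_assoc)
    also have "\<dots> = 0" using component_measure_pos[OF A] by (simp add: \<kappa>_def)
    finally show ?thesis .
  qed
  obtain N where N: "invariant_event N" "AE x in mu_A. measure (P x) N = 0"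
    "\<And>\<omega>. \<omega> \<in> space \<F> - N \<Longrightarrow> ((\<lambda>t. occ f 0 t \<omega> / t) \<longlongrightarrow> 0) at_top"
    using time_average_tendsto_0[OF fm fb f0] by blast
  have Np: "N \<in> sets path_events" using N(1) by (simp add: invariant_event_def)
  let ?h = "\<lambda>x. measure (P x) N"
  have hb: "bounded_meas orthant_algebra ?h"
    by (rule bounded_measI[OF measure_P_measurable[OF Np], where c = 1])
      (use prob_space.prob_le_1[OF prob] in \<open>auto simp: space_restrict_space\<close>)
  let ?q = "\<lambda>x. \<integral>\<omega>. ?h (X 1 \<omega>) \<partial>P x"
  have qh: "?q x = ?h x" if "x \<in> orthant" for x by (rule invariant_event_harmonic_real[OF N(1) _ that]) simp
  have "quasi_every \<mu> (form_domain \<beta> \<rho>) (form \<beta> \<rho>) A (\<lambda>x. ?q x = 0)"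
  proof (rule quasi_every_zero)
    show "openin (top_of_set (space \<mu>)) A" using A_open by simp
    show "quasi_continuous \<mu> (form_domain \<beta> \<rho>) (form \<beta> \<rho>) ?q"
      by (rule associatedD(1)[OF bounded_meas_L2[OF hb]]) simp
    show "AE x in \<mu>. x \<in> A \<longrightarrow> ?q x = 0"
      using N(2) unfolding AE_mu_A by eventually_elim (use qh Ao in auto)
  qed
  then show ?thesis
  proof (rule quasi_every_mono)
    fix x assume xA: "x \<in> A" and "?q x = 0"
    then have x: "x \<in> orthant" and hx: "?h x = 0" using qh Ao by auto
    interpret prob_space "P x" by (rule prob[OF x])
    have "N \<in> null_sets (P x)"
      using hx path_eventD(1)[OF Np] sets_P[OF x] by (auto simp: null_sets_def emeasure_eq_measure)
    then have "AE \<omega> in P x. \<omega> \<notin> N" by (rule AE_not_in)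
    then show "AE \<omega> in P x. ((\<lambda>t. (1 / t) * (LBINT s:{0..t}. indicator \<Gamma> (X s \<omega>))) \<longlongrightarrow> measure \<mu> (\<Gamma> \<inter> A) / measure \<mu> A) at_top"
      using AE_space
    proof eventually_elim
      fix \<omega> assume "\<omega> \<notin> N" "\<omega> \<in> space (P x)"
      then have w: "\<omega> \<in> space \<F>" and lim: "((\<lambda>t. occ f 0 t \<omega> / t) \<longlongrightarrow> 0) at_top" using N(3) space_P[OF x] by auto
      have eq: "(1 / t) * (LBINT s:{0..t}. indicator \<Gamma> (X s \<omega>)) = occ f 0 t \<omega> / t + \<kappa>" if t: "0 < t" for t
      proof -
        let ?g = "indicator (\<Gamma> \<inter> orthant) :: _ \<Rightarrow> real"
        have gm: "?g \<in> borel_measurable orthant_algebra" using \<Gamma>o by measurable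
        have gb: "\<bar>?g x\<bar> \<le> 1" for x by (simp add: indicator_def)
        have i1: "integrable lborel (\<lambda>s. indicator {0..t} s * ?g (X (max 0 s) \<omega>))" by (rule occ_integrable[OF gm gb w])
        have i2: "integrable lborel (\<lambda>s. indicator {0..t} s * \<kappa>)"
          by (intro integrable_mult_left integrable_real_indicator) (auto simp: emeasure_lborel_Icc_eq)
        have "occ f 0 t \<omega> = (\<integral>s. indicator {0..t} s * ?g (X (max 0 s) \<omega>) - indicator {0..t} s * \<kappa> \<partial>lborel)"
          unfolding occ_def f_def by (simp add: right_diff_distrib)
        also have "\<dots> = (\<integral>s. indicator {0..t} s * ?g (X (max 0 s) \<omega>) \<partial>lborel) - (\<integral>s. indicator {0..t} s * \<kappa> \<partial>lborel)"
          by (rule Bochner_Integration.integral_diff[OF i1 i2])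
        also have "(\<integral>s. indicator {0..t} s * \<kappa> \<partial>lborel) = t * \<kappa>" using t by simp
        also have "(\<integral>s. indicator {0..t} s * ?g (X (max 0 s) \<omega>) \<partial>lborel) = (LBINT s:{0..t}. indicator \<Gamma> (X s \<omega>))"
          unfolding set_lebesgue_integral_def
          by (rule Bochner_Integration.integral_cong[OF refl]) (use X_in_S[OF _ w] in \<open>auto simp: indicator_def max_absorb2\<close>)
        finally show ?thesis using t by (simp add: field_simps)
      qed
      have "((\<lambda>t. occ f 0 t \<omega> / t + \<kappa>) \<longlongrightarrow> 0 + \<kappa>) at_top" by (intro tendsto_intros lim)
      then have "((\<lambda>t. occ f 0 t \<omega> / t + \<kappa>) \<longlongrightarrow> measure \<mu> (\<Gamma> \<inter> A) / measure \<mu> A) at_top" by (simp add: \<kappa>_def)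
      moreover have "\<forall>\<^sub>F t in at_top. occ f 0 t \<omega> / t + \<kappa> = (1 / t) * (LBINT s:{0..t}. indicator \<Gamma> (X s \<omega>))"
        using eventually_gt_at_top[of "0::real"] by eventually_elim (simp only: eq)
      ultimately show "((\<lambda>t. (1 / t) * (LBINT s:{0..t}. indicator \<Gamma> (X s \<omega>))) \<longlongrightarrow> measure \<mu> (\<Gamma> \<inter> A) / measure \<mu> A) at_top"
        by (rule Lim_transform_eventually)
    qed
  qed
qed

end

text \<open>Half of the limit is a rate that is eventually exceeded; T0 \<ge> 1 permits multiplying
  by t.\<close>

lemma average_tendsto_pos_imp_linear_bound:
  fixes I :: "real \<Rightarrow> real"
  assumes lim: "((\<lambda>t. (1 / t) * I t) \<longlongrightarrow> \<kappa>) at_top" and \<kappa>: "0 < \<kappa>"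
  shows "\<exists>T0\<ge>0. \<exists>c>0. \<forall>t\<ge>T0. t * c \<le> I t"
proof -
  have "\<forall>\<^sub>F t in at_top. \<kappa> / 2 < (1 / t) * I t" using \<kappa> by (intro order_tendstoD(1)[OF lim]) simp
  then obtain T1 where T1: "\<And>t. t \<ge> T1 \<Longrightarrow> \<kappa> / 2 < (1 / t) * I t" unfolding eventually_at_top_linorder by blast
  have "t * (\<kappa> / 2) \<le> I t" if "t \<ge> max T1 1" for t
    using T1[of t] that by (simp add: field_simps)
  then show ?thesis using \<kappa> by (intro exI[of _ "max T1 1"] conjI exI[of _ "\<kappa> / 2"]) auto
qed

theorem corollary5p7:
  fixes \<beta> :: real
    and \<rho> :: "real^'n::finite \<Rightarrow> real"
    and C :: real
    and T :: "real \<Rightarrow> (real^'n \<Rightarrow> real) \<Rightarrow> real^'n \<Rightarrow> real"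
    and \<F> :: "'w measure"
    and \<F>t :: "real \<Rightarrow> 'w measure"
    and X :: "real \<Rightarrow> 'w \<Rightarrow> real^'n"
    and \<Theta> :: "real \<Rightarrow> 'w \<Rightarrow> 'w"
    and P :: "real^'n \<Rightarrow> 'w measure"
  defines "\<mu> \<equiv> weighted_measure \<beta> \<rho>"
    and "\<A> \<equiv> components (orthant - {x \<in> orthant. \<rho> x = 0})"
    and "D \<equiv> form_domain \<beta> \<rho>"
    and "\<E> \<equiv> form \<beta> \<rho>"
  assumes "0 < \<beta>"
    and "AE x in ref_measure \<beta>. 0 < \<rho> x"
    and "\<rho> \<in> Ck_orthant 1"
    and "\<And>B. B \<noteq> {} \<Longrightarrow> (\<lambda>x. sqrt (\<rho> x)) \<in> sobolev_H12 B"
    and "finite \<A>"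
    and "\<And>A. A \<in> \<A> \<Longrightarrow> convex A"
    and "\<forall>\<^sub>F r in at_right 0. emeasure \<mu> (nbhd r {x \<in> orthant. \<rho> x = 0}) \<le> ennreal (C * r\<^sup>2)"
    and "is_L2_semigroup \<mu> D \<E> T"
    and "conservative_diffusion orthant \<F> \<F>t X \<Theta> P"
    and "associated \<mu> D \<E> T X P"
  shows "\<forall>\<Gamma>\<in>sets borel. \<Gamma> \<subseteq> orthant_boundary \<longrightarrow> (\<forall>A\<in>\<A>.
      quasi_every \<mu> D \<E> A (\<lambda>x. AE \<omega> in P x.
        ((\<lambda>t. (1 / t) * (LBINT s:{0..t}. indicator \<Gamma> (X s \<omega>)))
           \<longlongrightarrow> measure \<mu> (\<Gamma> \<inter> A) / measure \<mu> A) at_top) \<and>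
      (0 < measure \<mu> (\<Gamma> \<inter> A) \<longrightarrow>
        quasi_every \<mu> D \<E> A (\<lambda>x. AE \<omega> in P x.
          \<exists>T0\<ge>0. \<exists>c>0. \<forall>t\<ge>T0. (LBINT s:{0..t}. indicator \<Gamma> (X s \<omega>)) \<ge> t * c)))"
proof (intro ballI impI)
  fix \<Gamma> :: "(real^'n) set" and A
  assume \<Gamma>: "\<Gamma> \<in> sets borel" and A: "A \<in> \<A>"
  have cont: "continuous_on orthant \<rho>" using assms(7) by (simp add: Ck_orthant_def)
  \<comment> \<open>This is where the Sobolev hypothesis on the square root of \<rho>
    enters.\<close>
  have "finite_measure (weighted_measure \<beta> \<rho>)"
    by (rule finite_weighted_measure[OF continuous_on_orthant_measurable[OF cont] assms(8)])
  then interpret weighted_diffusion \<beta> \<rho> \<F> \<F>t X \<Theta> P T A C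
    using assms A cont
    by (intro weighted_diffusion.intro weighted_orthant.intro weighted_diffusion_axioms.intro) (simp_all add: \<mu>_def \<A>_def D_def \<E>_def)
  have avg: "quasi_every \<mu> D \<E> A (\<lambda>x. AE \<omega> in P x.
        ((\<lambda>t. (1 / t) * (LBINT s:{0..t}. indicator \<Gamma> (X s \<omega>)))
           \<longlongrightarrow> measure \<mu> (\<Gamma> \<inter> A) / measure \<mu> A) at_top)"
    using time_average[OF \<Gamma>] by (simp add: \<mu>_def D_def \<E>_def)
  moreover have "quasi_every \<mu> D \<E> A (\<lambda>x. AE \<omega> in P x.
          \<exists>T0\<ge>0. \<exists>c>0. \<forall>t\<ge>T0. (LBINT s:{0..t}. indicator \<Gamma> (X s \<omega>)) \<ge> t * c)"
    if pos: "0 < measure \<mu> (\<Gamma> \<inter> A)"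
    using avg
  proof (rule quasi_every_mono)
    have "0 < measure \<mu> A" using component_measure_pos A by (simp add: \<mu>_def \<A>_def)
    with pos have \<kappa>: "0 < measure \<mu> (\<Gamma> \<inter> A) / measure \<mu> A" by simp
    fix x assume "AE \<omega> in P x. ((\<lambda>t. (1 / t) * (LBINT s:{0..t}. indicator \<Gamma> (X s \<omega>))) \<longlongrightarrow> measure \<mu> (\<Gamma> \<inter> A) / measure \<mu> A) at_top"
    then show "AE \<omega> in P x. \<exists>T0\<ge>0. \<exists>c>0. \<forall>t\<ge>T0. (LBINT s:{0..t}. indicator \<Gamma> (X s \<omega>)) \<ge> t * c"
      by eventually_elim (rule average_tendsto_pos_imp_linear_bound[OF _ \<kappa>])
  qed
  ultimately show "quasi_every \<mu> D \<E> A (\<lambda>x. AE \<omega> in P x.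
        ((\<lambda>t. (1 / t) * (LBINT s:{0..t}. indicator \<Gamma> (X s \<omega>)))
           \<longlongrightarrow> measure \<mu> (\<Gamma> \<inter> A) / measure \<mu> A) at_top) \<and>
      (0 < measure \<mu> (\<Gamma> \<inter> A) \<longrightarrow>
        quasi_every \<mu> D \<E> A (\<lambda>x. AE \<omega> in P x.
          \<exists>T0\<ge>0. \<exists>c>0. \<forall>t\<ge>T0. (LBINT s:{0..t}. indicator \<Gamma> (X s \<omega>)) \<ge> t * c))"
    by blast
qed

end
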